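(* Let $V$ be a finite-dimensional real or complex vector space, let $\mu$ be a probability measure on $\mathrm{GL}(V)$ with finite first moment and let $W$ be a $\mu$-invariant subspace of $V$. Let $\overline{\nu}$ be a $\mu$-stationary ergodic probability measure on $P(V/W)$ with $\alpha(\overline{\nu})>\lambda_1(W)$, and let $\nu$ be its unique $\mu$-stationary lift on $P(V)\setminus P(W)$. For $x\in P(V)\setminus P(W)$ let $\overline{x}$ denote its projection to $P(V/W)$. Let $X_1,X_2,\dots$ be iid random variables with law $\mu$. (1) For any $x\in P(V)\setminus P(W)$, the Cesàro means $\frac1n\sum_{i=1}^n\mu^{*i}*\delta_x$ converge weakly to $\nu$ if and only if $\frac1n\sum_{i=1}^n\mu^{*i}*\delta_{\overline{x}}$ converges weakly to $\overline{\nu}$. (2) For any $x\in P(V)\setminus P(W)$, the sequence $\frac1n\sum_{i=1}^n\delta_{X_i\cdots X_1\cdot x}$ converges (weakly) to $\nu$ almost surely if and only if $\frac1n\sum_{i=1}^n\delta_{X_i\cdots X_1\cdot\overline{x}}$ converges (weakly) to $\overline{\nu}$ almost surely.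
   Context: $P(V)$ is the projective space of lines of $V$; measures are Borel. Fix any norm on $V$. A probability measure $\mu$ on $\mathrm{GL}(V)$ has finite first moment if $\int \log\max\{\|g\|,\|g^{-1}\|\}\,d\mu(g)<\infty$. $\Gamma_\mu$ is the semigroup generated by the support of $\mu$; $W$ is $\mu$-invariant if it is $\Gamma_\mu$-invariant. In that case $\mu$ induces probability measures on $\mathrm{GL}(W)$ and $\mathrm{GL}(V/W)$. The top Lyapunov exponent $\lambda_1$ of $\mu$ is the almost sure limit of $\frac1n\log\|X_n\cdots X_1\|$; $\lambda_1(W)$ is the top Lyapunov exponent of the measure induced on $\mathrm{GL}(W)$ (with $\lambda_1(\{0\})=-\infty$). A probability measure $\nu$ is $\mu$-stationary if $\mu*\nu=\nu$, where $\int f\,d(\mu*\nu)=\iint f(gx)\,d\mu(g)\,d\nu(x)$; it is ergodic if it is extremal among $\mu$-stationary probability measures. The cocycle average of a $\mu$-stationary $\overline\nu$ on $P(V/W)$ is $\alpha(\overline\nu)=\iint\log\frac{\|gv\|}{\|v\|}\,d\mu(g)\,d\overline\nu([v])$ (independent of the norm). A $\mu$-stationary lift of $\overline\nu$ is a $\mu$-stationary probability measure on $P(V)\setminus P(W)$ whose push-forward under the map $P(V)\setminus P(W)\to P(V/W)$ induced by $V\to V/W$ is $\overline\nu$. Under the condition $\alpha(\overline\nu)>\lambda_1(W)$ such a lift exists and is unique. $\mu^{*i}$ is the $i$-th convolution power (the law of $X_i\cdots X_1$). *)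

theory Defs
  imports "HOL-Probability.Probability"
begin

section \<open>The vector space and its general linear group\<close>

text \<open>
  The scalars range over a type of class \<open>real_normed_field\<close> and \<open>euclidean_space\<close>, i.e. (up to
  isomorphism) over the reals or the complex numbers. The type \<open>'v\<close> carries the fixed norm on \<open>V\<close>,
  which is taken to be a Euclidean (Hermitian) one; \<open>scl\<close> is the scalar multiplication.
\<close>

locale normed_space_over = vector_space scl
  for scl :: "'k::{real_normed_field,euclidean_space} \<Rightarrow> 'v::euclidean_space \<Rightarrow> 'v" +
  assumes scale_of_real: "scl (of_real r) v = r *\<^sub>R v"
    and norm_scale: "norm (scl c v) = norm c * norm v"

text \<open>Bounded real-linear maps carry the operator norm; since \<open>'v\<close> is finite-dimensional, every
  linear map is bounded, and the norm topology restricts to the usual topology of \<open>GL(V)\<close>.\<close>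

definition GL :: "('k::{real_normed_field,euclidean_space} \<Rightarrow> 'v::euclidean_space \<Rightarrow> 'v)
    \<Rightarrow> ('v \<Rightarrow>\<^sub>L 'v) set" where
  "GL scl = {g. Vector_Spaces.linear scl scl (blinfun_apply g) \<and> bij (blinfun_apply g)}"

definition GL_borel :: "('k::{real_normed_field,euclidean_space} \<Rightarrow> 'v::euclidean_space \<Rightarrow> 'v)
    \<Rightarrow> ('v \<Rightarrow>\<^sub>L 'v) measure" where
  "GL_borel scl = restrict_space borel (GL scl)"

definition finite_first_moment :: "('v::euclidean_space \<Rightarrow>\<^sub>L 'v) measure \<Rightarrow> bool" where
  "finite_first_moment \<mu> \<longleftrightarrow>
     integrable \<mu> (\<lambda>g. ln (max (norm g) (onorm (inv (blinfun_apply g)))))"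

definition msupport :: "'a::topological_space measure \<Rightarrow> 'a set" where
  "msupport \<mu> = {g \<in> space \<mu>. \<forall>U. open U \<longrightarrow> g \<in> U \<longrightarrow> emeasure \<mu> (U \<inter> space \<mu>) > 0}"

inductive_set Gamma :: "('v::euclidean_space \<Rightarrow>\<^sub>L 'v) measure \<Rightarrow> ('v \<Rightarrow>\<^sub>L 'v) set"
  for \<mu> where
  gen: "g \<in> msupport \<mu> \<Longrightarrow> g \<in> Gamma \<mu>"
| mult: "g \<in> Gamma \<mu> \<Longrightarrow> h \<in> Gamma \<mu> \<Longrightarrow> g o\<^sub>L h \<in> Gamma \<mu>"

definition invariant_subspace :: "('k::{real_normed_field,euclidean_space} \<Rightarrow> 'v::euclidean_space \<Rightarrow> 'v)
    \<Rightarrow> ('v \<Rightarrow>\<^sub>L 'v) measure \<Rightarrow> 'v set \<Rightarrow> bool" where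
  "invariant_subspace scl \<mu> W \<longleftrightarrow>
     module.subspace scl W \<and> (\<forall>g \<in> Gamma \<mu>. blinfun_apply g ` W \<subseteq> W)"

text \<open>If \<open>W\<close> is \<open>\<mu>\<close>-invariant then \<open>\<mu>\<close> is carried by the stabilizer of \<open>W\<close>, the closed subgroup
  of those \<open>g\<close> that act on \<open>W\<close> and on \<open>V/W\<close>. The measures induced by \<open>\<mu>\<close> on \<open>GL(W)\<close> and
  \<open>GL(V/W)\<close> are used through these actions of the restriction of \<open>\<mu>\<close> to the stabilizer.\<close>

definition stabilizer :: "('k::{real_normed_field,euclidean_space} \<Rightarrow> 'v::euclidean_space \<Rightarrow> 'v)
    \<Rightarrow> 'v set \<Rightarrow> ('v \<Rightarrow>\<^sub>L 'v) set" where
  "stabilizer scl W = {g \<in> GL scl. blinfun_apply g ` W = W}"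

primrec conv_power :: "('v::euclidean_space \<Rightarrow>\<^sub>L 'v) measure \<Rightarrow> nat \<Rightarrow> ('v \<Rightarrow>\<^sub>L 'v) measure" where
  "conv_power \<mu> 0 = return \<mu> id_blinfun"
| "conv_power \<mu> (Suc i) = distr (\<mu> \<Otimes>\<^sub>M conv_power \<mu> i) \<mu> (\<lambda>(g, h). g o\<^sub>L h)"


section \<open>Random walk and top Lyapunov exponent\<close>

text \<open>\<open>walk X n\<close> is the product \<open>X\<^sub>n \<cdots> X\<^sub>1\<close>; the index \<open>0\<close> of \<open>X\<close> is not used.\<close>

primrec walk :: "(nat \<Rightarrow> 'v::euclidean_space \<Rightarrow>\<^sub>L 'v) \<Rightarrow> nat \<Rightarrow> 'v \<Rightarrow>\<^sub>L 'v" where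
  "walk X 0 = id_blinfun"
| "walk X (Suc n) = X (Suc n) o\<^sub>L walk X n"

definition norm_on :: "'v::euclidean_space set \<Rightarrow> ('v \<Rightarrow>\<^sub>L 'v) \<Rightarrow> real" where
  "norm_on W g = (SUP w \<in> W - {0}. norm (blinfun_apply g w) / norm w)"

text \<open>The exponent \<open>\<lambda>\<^sub>1(W)\<close> of the measure induced on \<open>GL(W)\<close>: \<open>norm_on W\<close> is the operator norm of
  the restriction to \<open>W\<close>. On the product space the coordinates are iid with law \<open>\<mu>\<close>.\<close>

definition top_lyapunov :: "'v::euclidean_space set \<Rightarrow> ('v \<Rightarrow>\<^sub>L 'v) measure \<Rightarrow> ereal" where
  "top_lyapunov W \<mu> =
     (if W = {0} then -\<infinity>
      else THE l. AE \<omega> in (\<Pi>\<^sub>M i \<in> {1::nat..}. \<mu>).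
             (\<lambda>n. ereal (ln (norm_on W (walk \<omega> n)) / real n)) \<longlonglongrightarrow> l)"


section \<open>Projective spaces\<close>

definition quotient_topology :: "'a topology \<Rightarrow> ('a \<Rightarrow> 'b) \<Rightarrow> 'b topology" where
  "quotient_topology T q =
     topology (\<lambda>U. U \<subseteq> q ` topspace T \<and> openin T {x \<in> topspace T. q x \<in> U})"

lemma openin_quotient_topology:
  "openin (quotient_topology T q) U \<longleftrightarrow>
     U \<subseteq> q ` topspace T \<and> openin T {x \<in> topspace T. q x \<in> U}"
proof -
  have "istopology (\<lambda>U. U \<subseteq> q ` topspace T \<and> openin T {x \<in> topspace T. q x \<in> U})"
    unfolding istopology_def
  proof (intro conjI allI impI)
    fix A B
    assume A: "A \<subseteq> q ` topspace T \<and> openin T {x \<in> topspace T. q x \<in> A}"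
      and B: "B \<subseteq> q ` topspace T \<and> openin T {x \<in> topspace T. q x \<in> B}"
    have "{x \<in> topspace T. q x \<in> A \<inter> B} =
        {x \<in> topspace T. q x \<in> A} \<inter> {x \<in> topspace T. q x \<in> B}" by auto
    then show "openin T {x \<in> topspace T. q x \<in> A \<inter> B}" using A B by auto
    show "A \<inter> B \<subseteq> q ` topspace T" using A by blast
  next
    fix K
    assume K: "\<forall>A\<in>K. A \<subseteq> q ` topspace T \<and> openin T {x \<in> topspace T. q x \<in> A}"
    have "{x \<in> topspace T. q x \<in> \<Union>K} = (\<Union>A\<in>K. {x \<in> topspace T. q x \<in> A})" by auto
    then show "openin T {x \<in> topspace T. q x \<in> \<Union>K}" using K by auto
    show "\<Union>K \<subseteq> q ` topspace T" using K by blast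
  qed
  then show ?thesis unfolding quotient_topology_def by (simp add: topology_inverse')
qed

lemma topspace_quotient_topology: "topspace (quotient_topology T q) = q ` topspace T"
proof
  show "topspace (quotient_topology T q) \<subseteq> q ` topspace T"
    using openin_quotient_topology[of T q] openin_topspace by blast
  have "{x \<in> topspace T. q x \<in> q ` topspace T} = topspace T" by auto
  then have "openin (quotient_topology T q) (q ` topspace T)"
    by (simp add: openin_quotient_topology)
  then show "q ` topspace T \<subseteq> topspace (quotient_topology T q)" by (rule openin_subset)
qed

definition borel_of :: "'a topology \<Rightarrow> 'a measure" where
  "borel_of T = sigma (topspace T) {U. openin T U}"

definition line :: "('k \<Rightarrow> 'v \<Rightarrow> 'v) \<Rightarrow> 'v \<Rightarrow> 'v set" where
  "line scl v = range (\<lambda>c. scl c v)"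

definition proj_space :: "('k \<Rightarrow> 'v \<Rightarrow> 'v::zero) \<Rightarrow> 'v set \<Rightarrow> 'v set set" where
  "proj_space scl S = line scl ` (S - {0})"

definition proj_topology :: "('k \<Rightarrow> 'v \<Rightarrow> 'v::euclidean_space) \<Rightarrow> 'v set topology" where
  "proj_topology scl = quotient_topology (top_of_set (- {0})) (line scl)"

definition proj_minus_topology :: "('k \<Rightarrow> 'v \<Rightarrow> 'v::euclidean_space) \<Rightarrow> 'v set \<Rightarrow> 'v set topology" where
  "proj_minus_topology scl W =
     subtopology (proj_topology scl) (proj_space scl UNIV - proj_space scl W)"

text \<open>Elements of \<open>V/W\<close> are the cosets \<open>v + W\<close>, and points of \<open>P(V/W)\<close> are lines of \<open>V/W\<close>, i.e. sets of
  cosets. In \<open>qline\<close> the line spanned by \<open>v + W\<close> is \<open>{c v + W | c}\<close>.\<close>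

definition coset :: "'v::ab_group_add set \<Rightarrow> 'v \<Rightarrow> 'v set" where
  "coset W v = (\<lambda>w. v + w) ` W"

definition qline :: "('k \<Rightarrow> 'v \<Rightarrow> 'v::ab_group_add) \<Rightarrow> 'v set \<Rightarrow> 'v \<Rightarrow> 'v set set" where
  "qline scl W v = range (\<lambda>c. coset W (scl c v))"

text \<open>The topology of \<open>P(V/W)\<close> is the quotient topology for the composition
  \<open>V \<setminus> W \<rightarrow> (V/W) \<setminus> {0} \<rightarrow> P(V/W)\<close> of quotient maps.\<close>

definition qproj_topology :: "('k \<Rightarrow> 'v \<Rightarrow> 'v::euclidean_space) \<Rightarrow> 'v set \<Rightarrow> 'v set set topology" where
  "qproj_topology scl W = quotient_topology (top_of_set (- W)) (qline scl W)"

text \<open>The map \<open>P(V) \<setminus> P(W) \<rightarrow> P(V/W)\<close> sends a line \<open>L\<close> to \<open>{v + W | v \<in> L}\<close>.\<close>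

definition proj_map :: "'v::ab_group_add set \<Rightarrow> 'v set \<Rightarrow> 'v set set" where
  "proj_map W L = coset W ` L"

text \<open>An element of \<open>GL(V)\<close> acts on lines of \<open>V\<close>, on cosets and on lines of \<open>V/W\<close> by taking images.\<close>

definition act :: "('v::euclidean_space \<Rightarrow>\<^sub>L 'v) \<Rightarrow> 'v set \<Rightarrow> 'v set" where
  "act g L = blinfun_apply g ` L"

definition qact :: "('v::euclidean_space \<Rightarrow>\<^sub>L 'v) \<Rightarrow> 'v set set \<Rightarrow> 'v set set" where
  "qact g Q = (\<lambda>C. blinfun_apply g ` C) ` Q"


section \<open>Stationary measures\<close>

text \<open>\<open>act_conv scl W a \<mu> \<eta>\<close> is \<open>\<mu> * \<eta>\<close> for a measure \<open>\<eta>\<close> on a space on which the stabilizer of \<open>W\<close>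
  acts through \<open>a\<close>.\<close>

definition act_conv :: "('k::{real_normed_field,euclidean_space} \<Rightarrow> 'v::euclidean_space \<Rightarrow> 'v)
    \<Rightarrow> 'v set \<Rightarrow> (('v \<Rightarrow>\<^sub>L 'v) \<Rightarrow> 'x \<Rightarrow> 'x) \<Rightarrow> ('v \<Rightarrow>\<^sub>L 'v) measure \<Rightarrow> 'x measure \<Rightarrow> 'x measure" where
  "act_conv scl W a \<mu> \<eta> =
     distr (restrict_space \<mu> (stabilizer scl W) \<Otimes>\<^sub>M \<eta>) \<eta> (\<lambda>(g, x). a g x)"

definition stationary :: "('k::{real_normed_field,euclidean_space} \<Rightarrow> 'v::euclidean_space \<Rightarrow> 'v)
    \<Rightarrow> 'v set \<Rightarrow> (('v \<Rightarrow>\<^sub>L 'v) \<Rightarrow> 'x \<Rightarrow> 'x) \<Rightarrow> ('v \<Rightarrow>\<^sub>L 'v) measure \<Rightarrow> 'x topology \<Rightarrow> 'x measure \<Rightarrow> bool"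
  where
  "stationary scl W a \<mu> T \<eta> \<longleftrightarrow>
     prob_space \<eta> \<and> sets \<eta> = sets (borel_of T) \<and> act_conv scl W a \<mu> \<eta> = \<eta>"

definition ergodic :: "('k::{real_normed_field,euclidean_space} \<Rightarrow> 'v::euclidean_space \<Rightarrow> 'v)
    \<Rightarrow> 'v set \<Rightarrow> (('v \<Rightarrow>\<^sub>L 'v) \<Rightarrow> 'x \<Rightarrow> 'x) \<Rightarrow> ('v \<Rightarrow>\<^sub>L 'v) measure \<Rightarrow> 'x topology \<Rightarrow> 'x measure \<Rightarrow> bool"
  where
  "ergodic scl W a \<mu> T \<eta> \<longleftrightarrow>
     stationary scl W a \<mu> T \<eta> \<and>
     (\<forall>\<eta>1 \<eta>2 t. stationary scl W a \<mu> T \<eta>1 \<longrightarrow> stationary scl W a \<mu> T \<eta>2 \<longrightarrow> 0 < t \<longrightarrow> t < 1 \<longrightarrow>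
        (\<forall>A \<in> sets \<eta>. measure \<eta> A = t * measure \<eta>1 A + (1 - t) * measure \<eta>2 A) \<longrightarrow>
        \<eta>1 = \<eta> \<and> \<eta>2 = \<eta>)"

text \<open>On cosets \<open>v + W\<close> this is the quotient norm of \<open>V/W\<close>, the distance from \<open>v\<close> to \<open>W\<close>.\<close>

definition coset_norm :: "'v::euclidean_space set \<Rightarrow> real" where
  "coset_norm C = (INF v \<in> C. norm v)"

text \<open>\<open>log (\<parallel>g v\<parallel> / \<parallel>v\<parallel>)\<close> for a nonzero \<open>v\<close> on the line \<open>Q\<close> of \<open>V/W\<close>, whose zero vector is the coset \<open>W\<close>;
  for \<open>g\<close> in the stabilizer of \<open>W\<close> the value does not depend on the choice.\<close>

definition log_cocycle :: "'v::euclidean_space set \<Rightarrow> ('v \<Rightarrow>\<^sub>L 'v) \<Rightarrow> 'v set set \<Rightarrow> real" where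
  "log_cocycle W g Q =
     (let C = (SOME C. C \<in> Q \<and> C \<noteq> W) in ln (coset_norm (blinfun_apply g ` C) / coset_norm C))"

definition cocycle_average :: "('k::{real_normed_field,euclidean_space} \<Rightarrow> 'v::euclidean_space \<Rightarrow> 'v)
    \<Rightarrow> 'v set \<Rightarrow> ('v \<Rightarrow>\<^sub>L 'v) measure \<Rightarrow> 'v set set measure \<Rightarrow> real" where
  "cocycle_average scl W \<mu> \<eta> =
     (\<integral>Q. (\<integral>g. log_cocycle W g Q \<partial>restrict_space \<mu> (stabilizer scl W)) \<partial>\<eta>)"

definition stationary_lift :: "('k::{real_normed_field,euclidean_space} \<Rightarrow> 'v::euclidean_space \<Rightarrow> 'v)
    \<Rightarrow> 'v set \<Rightarrow> ('v \<Rightarrow>\<^sub>L 'v) measure \<Rightarrow> 'v set set measure \<Rightarrow> 'v set measure \<Rightarrow> bool" where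
  "stationary_lift scl W \<mu> \<nu>' \<nu> \<longleftrightarrow>
     stationary scl W act \<mu> (proj_minus_topology scl W) \<nu> \<and>
     distr \<nu> (borel_of (qproj_topology scl W)) (proj_map W) = \<nu>'"


section \<open>Weak convergence and averages\<close>

definition weakly_converges :: "'x topology \<Rightarrow> (nat \<Rightarrow> 'x measure) \<Rightarrow> 'x measure \<Rightarrow> bool" where
  "weakly_converges T N \<eta> \<longleftrightarrow>
     (\<forall>f. continuous_map T euclideanreal f \<longrightarrow> bounded (f ` topspace T) \<longrightarrow>
        (\<lambda>n. \<integral>x. f x \<partial>N n) \<longlonglongrightarrow> (\<integral>x. f x \<partial>\<eta>))"

text \<open>The measure \<open>(N 1 + \<dots> + N n) / n\<close> (for \<open>n > 0\<close>), as a mixture.\<close>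

definition average :: "(nat \<Rightarrow> 'x measure) \<Rightarrow> nat \<Rightarrow> 'x measure" where
  "average N n = Giry_Monad.bind (uniform_count_measure {1..n}) N"

end

theory Submission imports Defs begin

text \<open>
  Let \<open>F\<close> be a test function on \<open>P(V) - P(W)\<close> that is regular along the fibres over \<open>P(V/W)\<close>. Since
  \<open>\<alpha>(\<eta>) > \<lambda>\<^sub>1(W)\<close>, Birkhoff's theorem for the cocycle on \<open>P(V/W)\<close> and Kingman's theorem for the norms on
  \<open>W\<close> show that a long block \<open>g\<close> of the walk contracts the fibres, except on a set of small measure, so
  \<open>F(g x)\<close> is close to \<open>F(g s(x))\<close> for the section \<open>s [v] = [perp v]\<close>. The latter depends only on the
  projection of \<open>x\<close> to \<open>P(V/W)\<close>. Hence equidistribution in \<open>P(V/W)\<close> determines the averages of \<open>F\<close> along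
  the walk, provided that the walk does not approach \<open>P(W)\<close>, and this is excluded by a drift inequality
  for the logarithm of \<open>\<parallel>v\<parallel> / d(v, W)\<close>. For the almost sure statement, a law of large numbers for
  block-martingale differences replaces \<open>F(g x)\<close> by its conditional expectation.
\<close>

section \<open>Ergodic theorems\<close>

text \<open>The space P(V) - P(W) is not compact, so convergence in P(V/W) alone could let mass
  escape to P(W). Only a first moment is available, so the error made on a bad block cannot be
  bounded by the probability of the block: it is cut at a level \<open>m\<close> per step, and the
  part above \<open>m\<close> is averaged separately as \<open>excess\<close>. The starting point is
  arbitrary, and all that is known of its orbit is how it distributes in P(V/W). Contraction is
  therefore used only through bounded functions such as \<open>min 1 (c * contr g v)\<close>, which
  depend continuously on the point of P(V/W). The limit is not found by compactness: the comparison
  of \<open>F\<close> with its values on the section is also made under \<open>\<nu>\<close>, where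
  stationarity keeps the integral of \<open>F\<close> fixed, so that both quantities are close to
  the same integral over P(V/W). Birkhoff's and Kingman's theorems are applied to the skew product
  of \<open>\<eta>\<close> with the Bernoulli shift, whose ergodicity is derived from the
  extremality of \<open>\<eta>\<close>.\<close>

locale measure_preserving = prob_space P for P :: "'a measure" +
  fixes T :: "'a \<Rightarrow> 'a"
  assumes T_measurable [measurable]: "T \<in> P \<rightarrow>\<^sub>M P" and distr_T: "distr P P T = P"
begin

lemma funpow_T_measurable [measurable]: "(T ^^ n) \<in> P \<rightarrow>\<^sub>M P"
  by (induct n) auto

lemma funpow_T_space: "x \<in> space P \<Longrightarrow> (T ^^ n) x \<in> space P"
  by (rule measurable_space[OF funpow_T_measurable])

lemma distr_funpow_T: "distr P P (T ^^ n) = P"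
proof (induct n)
  case 0
  have e: "T ^^ 0 = (\<lambda>x. x)" by (simp add: fun_eq_iff)
  show ?case unfolding e by (rule distr_id2) (rule refl)
next
  case (Suc n)
  have "distr (distr P P (T ^^ n)) P T = distr P P (T \<circ> T ^^ n)"
    by (rule distr_distr[OF T_measurable funpow_T_measurable])
  moreover have "distr (distr P P (T ^^ n)) P T = P" unfolding Suc by (rule distr_T)
  moreover have "T ^^ Suc n = T \<circ> T ^^ n" by simp
  ultimately show ?case by (simp only:)
qed

lemma integral_funpow_T:
  fixes f :: "'a \<Rightarrow> real"
  assumes [measurable]: "f \<in> borel_measurable P"
  shows "(\<integral>x. f ((T ^^ n) x) \<partial>P) = (\<integral>x. f x \<partial>P)"
  by (subst (2) distr_funpow_T[of n, symmetric], subst integral_distr) auto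

lemma integrable_funpow_T:
  fixes f :: "'a \<Rightarrow> real"
  assumes "integrable P f"
  shows "integrable P (\<lambda>x. f ((T ^^ n) x))"
proof -
  have [measurable]: "f \<in> borel_measurable P" using assms by auto
  have "integrable (distr P P (T ^^ n)) f" using assms by (simp add: distr_funpow_T)
  then show ?thesis by (subst (asm) integrable_distr_eq) auto
qed

lemma AE_funpow_T:
  assumes "AE x in P. Q x"
  shows "AE x in P. Q ((T ^^ n) x)"
proof (rule AE_distrD[OF funpow_T_measurable[of n]])
  show "AE x in distr P P (T ^^ n). Q x" unfolding distr_funpow_T by (rule assms)
qed

end

text \<open>One integrable function \<open>L\<close> controls both signs: the upper bound by its
  Birkhoff sums follows from subadditivity, the lower one is assumed and keeps the growth rate
  finite. In the applications \<open>L\<close> is the modulus of an integrable function or the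
  logarithm of the size of the first step.\<close>

locale subadditive_cocycle = measure_preserving +
  fixes a :: "nat \<Rightarrow> 'a \<Rightarrow> real" and L :: "'a \<Rightarrow> real"
  assumes subadd: "x \<in> space P \<Longrightarrow> a (n + m) x \<le> a n x + a m ((T ^^ n) x)"
    and a_0: "x \<in> space P \<Longrightarrow> a 0 x = 0"
    and a_measurable [measurable]: "\<And>n. a n \<in> borel_measurable P"
    and L_integrable: "integrable P L"
    and abs_a_1_le: "x \<in> space P \<Longrightarrow> \<bar>a 1 x\<bar> \<le> L x"
    and a_ge: "x \<in> space P \<Longrightarrow> - (\<Sum>i<n. L ((T ^^ i) x)) \<le> a n x"
begin

lemma L_nonneg: "x \<in> space P \<Longrightarrow> 0 \<le> L x"
  using abs_a_1_le[of x] by linarith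

lemma L_measurable [measurable]: "L \<in> borel_measurable P"
  using L_integrable by auto

lemma a_le: "x \<in> space P \<Longrightarrow> a n x \<le> (\<Sum>i<n. L ((T ^^ i) x))"
proof (induct n arbitrary: x)
  case (Suc n)
  have "a (Suc n) x \<le> a n x + a 1 ((T ^^ n) x)" using subadd[of x n 1] Suc(2) by simp
  also have "\<dots> \<le> (\<Sum>i<n. L ((T ^^ i) x)) + L ((T ^^ n) x)"
    using Suc(1)[OF Suc(2)] abs_a_1_le[OF funpow_T_space[OF Suc(2)], of n] by linarith
  finally show ?case by simp
qed (simp add: a_0)

lemma sum_L_integrable: "integrable P (\<lambda>x. \<Sum>i<n. L ((T ^^ i) x))"
  by (intro Bochner_Integration.integrable_sum integrable_funpow_T L_integrable)

lemma a_integrable: "integrable P (a n)"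
proof (rule Bochner_Integration.integrable_bound[OF sum_L_integrable[of n]])
  show "AE x in P. norm (a n x) \<le> norm (\<Sum>i<n. L ((T ^^ i) x))"
    using a_le[of _ n] a_ge[of _ n] by (intro AE_I2) (force simp: abs_le_iff)
qed simp

text \<open>The covering argument of Katznelson and Weiss: along an orbit, jump by some \<open>m \<le> K\<close> with
  \<open>a m \<le> m c\<close> whenever there is one, and by \<open>1\<close> otherwise.\<close>

lemma covering_bound:
  fixes c :: real and K r :: nat
  defines "B \<equiv> {x. \<forall>n\<in>{1..K}. real n * c < a n x}" and "L' \<equiv> \<lambda>x. L x + \<bar>c\<bar>"
  assumes x: "x \<in> space P"
  shows "a r x \<le> real r * c + (\<Sum>p<r. indicator B ((T ^^ p) x) * L' ((T ^^ p) x))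
     + (\<Sum>p\<in>{r - K..<r}. L' ((T ^^ p) x))"
  using x
proof (induct r arbitrary: x rule: less_induct)
  case (less r)
  define F where "F = (\<lambda>x p. indicator B ((T ^^ p) x) * L' ((T ^^ p) x))"
  define H where "H = (\<lambda>x p. L' ((T ^^ p) x))"
  have pos: "0 \<le> F x p" "0 \<le> H x p" for p
    using L_nonneg[OF funpow_T_space[OF less(2)], of p] by (auto simp: F_def H_def L'_def)
  have cs: "c \<le> L' x - L x" "- c \<le> L' x - L x" by (auto simp: L'_def)
  \<comment> \<open>One jump of length \<open>m\<close>, followed by the induction hypothesis at the
    landing point. The surplus \<open>e\<close> of the jump has to be paid from the positions that
    the boundary sum of the remaining orbit leaves free.\<close>
  have step: "a r x \<le> real r * c + sum (F x) {..<r} + sum (H x) {r - K..<r}"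
    if m: "1 \<le> m" "m \<le> r" and am: "a m x \<le> real m * c + sum (F x) {..<m} + e"
      and e: "e + sum (H x) {(r - m - K) + m..<r} \<le> sum (H x) {r - K..<r}" for m e
  proof -
    have y: "(T ^^ m) x \<in> space P" by (rule funpow_T_space[OF less(2)])
    have sh: "F ((T ^^ m) x) p = F x (p + m)" "H ((T ^^ m) x) p = H x (p + m)" for p
      by (auto simp: F_def H_def funpow_add)
    have "a r x \<le> a m x + a (r - m) ((T ^^ m) x)"
      using subadd[OF less(2), of m "r - m"] m by simp
    also have "a (r - m) ((T ^^ m) x) \<le> real (r - m) * c + sum (F ((T ^^ m) x)) {..<r - m}
        + sum (H ((T ^^ m) x)) {r - m - K..<r - m}"
      using less(1)[of "r - m", OF _ y] m unfolding F_def H_def by simp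
    also have "sum (F ((T ^^ m) x)) {..<r - m} = sum (F x) {m..<r}"
      using sum.shift_bounds_nat_ivl[of "F x" 0 m "r - m"] m by (simp add: sh lessThan_atLeast0)
    also have "sum (H ((T ^^ m) x)) {r - m - K..<r - m} = sum (H x) {(r - m - K) + m..<r}"
      using sum.shift_bounds_nat_ivl[of "H x" "r - m - K" m "r - m"] m by (simp add: sh)
    finally have "a r x \<le> real m * c + real (r - m) * c + (sum (F x) {..<m} + sum (F x) {m..<r})
        + (e + sum (H x) {(r - m - K) + m..<r})"
      using am by linarith
    also have "sum (F x) {..<m} + sum (F x) {m..<r} = sum (F x) {..<r}"
      using sum.atLeastLessThan_concat[of 0 m r "F x"] m by (simp add: lessThan_atLeast0)
    also have "real m * c + real (r - m) * c = real r * c"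
      using m by (simp add: of_nat_diff algebra_simps)
    finally show ?thesis using e by linarith
  qed
  have "a r x \<le> real r * c + sum (F x) {..<r} + sum (H x) {r - K..<r}"
  proof (cases "r = 0")
    case True
    then show "a r x \<le> real r * c + sum (F x) {..<r} + sum (H x) {r - K..<r}"
      using a_0[OF less(2)] by simp
  next
    case r: False
    show "a r x \<le> real r * c + sum (F x) {..<r} + sum (H x) {r - K..<r}"
    \<comment> \<open>Near the end a jump of length up to \<open>K\<close> could overshoot, so
      single steps are made there and charged to the boundary sum.\<close>
    proof (cases "r \<le> K")
      case True
      have "{r - K..<r} = insert 0 {1..<r}" using True r by auto
      then have "sum (H x) {r - K..<r} = H x 0 + sum (H x) {1..<r}" by simp
      then show ?thesis
        using True r cs abs_a_1_le[OF less(2)] pos(1)[of 0]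
        by (intro step[of 1 "L' x"]) (auto simp: H_def)
    next
      case rK: False
      show ?thesis
      proof (cases "x \<in> B")
        case True
        have eq: "r - 1 - K + 1 = r - K" using rK by auto
        show ?thesis
        proof (rule step[of 1 0])
          show "a 1 x \<le> real 1 * c + sum (F x) {..<1} + 0"
            using True cs abs_a_1_le[OF less(2)] by (simp add: F_def)
        qed (use r eq in simp_all)
      next
        case False
        then obtain m where m: "1 \<le> m" "m \<le> K" "a m x \<le> real m * c" by (force simp: B_def)
        have "r - m - K + m \<ge> r - K" by auto
        then have "sum (H x) {(r - m - K) + m..<r} \<le> sum (H x) {r - K..<r}"
          by (intro sum_mono2) (auto simp: pos)
        moreover have "0 \<le> sum (F x) {..<m}" by (simp add: pos sum_nonneg)
        ultimately show ?thesis
          using m rK by (intro step[of m 0]) simp_all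
      qed
    qed
  qed
  then show ?case by (simp add: F_def H_def)
qed

text \<open>Integrate \<open>covering_bound\<close>. The exceptional sets \<open>B K\<close>
  decrease to a null set, so by dominated convergence their contribution per step is below
  \<open>\<epsilon>\<close> for a large \<open>K\<close>, and the last \<open>K\<close> positions
  cost a constant.\<close>

lemma integral_le_of_AE_ex_le:
  assumes ae: "AE x in P. \<exists>n\<ge>1. a n x \<le> real n * c" and "0 < \<epsilon>"
  shows "\<exists>C. \<forall>n. (\<integral>x. a n x \<partial>P) \<le> real n * (c + \<epsilon>) + C"
proof -
  define B where "B = (\<lambda>K. {x. \<forall>n\<in>{1..K}. real n * c < a n x})"
  define L' where "L' = (\<lambda>x. L x + \<bar>c\<bar>)"
  have [measurable]: "Measurable.pred P (\<lambda>x. x \<in> B K)" for K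
    unfolding B_def mem_Collect_eq by measurable
  have L'int: "integrable P L'" unfolding L'_def using L_integrable by auto
  have [measurable]: "L' \<in> borel_measurable P" using L'int by auto
  have L'pos: "x \<in> space P \<Longrightarrow> 0 \<le> L' x" for x using L_nonneg[of x] by (simp add: L'_def)
  have indint: "integrable P (\<lambda>x. indicator (B K) x * L' x)" for K
    by (rule Bochner_Integration.integrable_bound[OF L'int])
       (auto simp: indicator_def)
  have "(\<lambda>K. \<integral>x. indicator (B K) x * L' x \<partial>P) \<longlonglongrightarrow> (\<integral>x. 0 \<partial>P)"
  proof (rule integral_dominated_convergence[where w=L'])
    show "AE x in P. (\<lambda>K. indicator (B K) x * L' x) \<longlonglongrightarrow> 0"
      using ae
    proof eventually_elim
      case (elim x)
      then obtain n where n: "n \<ge> 1" "a n x \<le> real n * c" by auto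
      have "\<forall>\<^sub>F K in sequentially. indicator (B K) x * L' x = 0"
        using eventually_ge_at_top[of n]
      proof eventually_elim
        case (elim K)
        then have "x \<notin> B K" using n unfolding B_def by (auto simp: not_less intro!: bexI[of _ n])
        then show ?case by simp
      qed
      then show ?case by (simp add: tendsto_eventually)
    qed
    show "AE x in P. norm (indicator (B K) x * L' x) \<le> L' x" for K
      using L'pos by (intro AE_I2) (auto simp: indicator_def)
  qed (use L'int in auto)
  then have "\<forall>\<^sub>F K in sequentially. (\<integral>x. indicator (B K) x * L' x \<partial>P) < \<epsilon>"
    using \<open>0 < \<epsilon>\<close> by (intro order_tendstoD(2)) auto
  then obtain K where K: "(\<integral>x. indicator (B K) x * L' x \<partial>P) < \<epsilon>"
    unfolding eventually_sequentially by blast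
  have "(\<integral>x. a n x \<partial>P) \<le> real n * (c + \<epsilon>) + real K * (\<integral>x. L' x \<partial>P)" for n
  proof -
    let ?S = "\<lambda>x. real n * c + (\<Sum>p<n. indicator (B K) ((T ^^ p) x) * L' ((T ^^ p) x))
        + (\<Sum>p\<in>{n - K..<n}. L' ((T ^^ p) x))"
    note ii = integrable_funpow_T[OF indint] integrable_funpow_T[OF L'int]
    have "(\<integral>x. a n x \<partial>P) \<le> (\<integral>x. ?S x \<partial>P)"
    proof (rule integral_mono[OF a_integrable])
      show "integrable P ?S"
        by (intro Bochner_Integration.integrable_add Bochner_Integration.integrable_sum ii) auto
      show "a n x \<le> ?S x" if "x \<in> space P" for x
        using covering_bound[OF that, of n c K] unfolding B_def L'_def .
    qed
    also have "\<dots> = real n * c + (\<Sum>p<n. \<integral>x. indicator (B K) ((T ^^ p) x) * L' ((T ^^ p) x) \<partial>P)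
        + (\<Sum>p\<in>{n - K..<n}. \<integral>x. L' ((T ^^ p) x) \<partial>P)"
    proof -
      have i1: "integrable P (\<lambda>x. \<Sum>p<n. indicator (B K) ((T ^^ p) x) * L' ((T ^^ p) x))"
        by (rule Bochner_Integration.integrable_sum) (rule ii)
      have i2: "integrable P (\<lambda>x. \<Sum>p\<in>{n - K..<n}. L' ((T ^^ p) x))"
        by (rule Bochner_Integration.integrable_sum) (rule ii)
      have i0: "integrable P (\<lambda>x. real n * c)" by simp
      show ?thesis
        unfolding Bochner_Integration.integral_add[OF Bochner_Integration.integrable_add[OF i0 i1] i2]
          Bochner_Integration.integral_add[OF i0 i1] Bochner_Integration.integral_sum[OF ii(1)]
          Bochner_Integration.integral_sum[OF ii(2)]
        by (simp add: prob_space)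
    qed
    also have "\<dots> = real n * c + real n * (\<integral>x. indicator (B K) x * L' x \<partial>P)
        + real (n - (n - K)) * (\<integral>x. L' x \<partial>P)"
    proof -
      have 1: "(\<integral>x. indicator (B K) ((T ^^ p) x) * L' ((T ^^ p) x) \<partial>P) =
          (\<integral>x. indicator (B K) x * L' x \<partial>P)" for p
        by (rule integral_funpow_T[of "\<lambda>x. indicator (B K) x * L' x" p]) simp
      have 2: "(\<integral>x. L' ((T ^^ p) x) \<partial>P) = (\<integral>x. L' x \<partial>P)" for p
        by (rule integral_funpow_T[of L' p]) simp
      show ?thesis unfolding 1 2 by simp
    qed
    also have "\<dots> \<le> real n * c + real n * \<epsilon> + real K * (\<integral>x. L' x \<partial>P)"
    proof -
      have "0 \<le> (\<integral>x. L' x \<partial>P)" by (rule Bochner_Integration.integral_nonneg) (rule L'pos)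
      then have "real (n - (n - K)) * (\<integral>x. L' x \<partial>P) \<le> real K * (\<integral>x. L' x \<partial>P)"
        by (intro mult_right_mono) auto
      moreover have "real n * (\<integral>x. indicator (B K) x * L' x \<partial>P) \<le> real n * \<epsilon>"
        using K by (intro mult_left_mono) auto
      ultimately show ?thesis by linarith
    qed
    finally show ?thesis by (simp add: algebra_simps)
  qed
  then show ?thesis by blast
qed

end

section \<open>Ergodic systems and growth bounds from below\<close>

locale ergodic_system = measure_preserving +
  assumes invariant_01: "\<And>E. E \<in> sets P \<Longrightarrow> AE x in P. T x \<in> E \<longleftrightarrow> x \<in> E \<Longrightarrow>
    prob E = 0 \<or> prob E = 1"
begin

text \<open>The preimage of \<open>E\<close> contains \<open>E\<close> and has the same measure, so
  the two differ by a null set and \<open>E\<close> is almost invariant.\<close>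

lemma subinvariant_01:
  assumes E [measurable]: "E \<in> sets P" and sub: "\<And>x. x \<in> E \<Longrightarrow> T x \<in> E"
  shows "prob E = 0 \<or> prob E = 1"
proof (rule invariant_01[OF E])
  let ?F = "T -` E \<inter> space P"
  have "E \<subseteq> ?F" using sub sets.sets_into_space[OF E] by auto
  have "prob ?F = measure (distr P P T) E" by (simp add: measure_distr)
  then have "prob ?F = prob E" by (simp add: distr_T)
  moreover have "prob (?F - E) = prob ?F - prob E"
    using \<open>E \<subseteq> ?F\<close> by (intro finite_measure_Diff) auto
  ultimately have "prob (?F - E) = 0" by simp
  then have "AE x in P. x \<notin> ?F - E"
    by (intro AE_not_in) (auto simp: null_sets_def emeasure_eq_measure)
  with AE_space show "AE x in P. T x \<in> E \<longleftrightarrow> x \<in> E"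
    by eventually_elim (use sub in auto)
qed

end

locale ergodic_subadditive_cocycle = ergodic_system + subadditive_cocycle
begin

text \<open>Were almost every orbit to meet \<open>a n x \<le> real n * c1\<close> for some
  \<open>n \<ge> 1\<close>, \<open>integral_le_of_AE_ex_le\<close> would push the means below
  \<open>real n * \<gamma>\<close>. So \<open>F\<close> has positive measure; it lies in
  \<open>G\<close>, the event that the lower limit of \<open>a n x / real n\<close> is at least
  \<open>c1\<close>. This event is forward invariant, since one step costs only \<open>L x\<close>,
  and hence it has full measure.\<close>

lemma eventually_ge:
  assumes g: "\<And>n. real n * \<gamma> \<le> (\<integral>x. a n x \<partial>P)" and "c < \<gamma>"
  shows "AE x in P. \<forall>\<^sub>F n in sequentially. real n * c \<le> a n x"
proof -
  obtain c1 where c1: "c < c1" "c1 < \<gamma>" using \<open>c < \<gamma>\<close> dense by blast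
  define F where "F = {x\<in>space P. \<forall>n\<ge>1. real n * c1 < a n x}"
  define G where "G = {x\<in>space P. \<forall>j. \<exists>N. \<forall>n\<ge>N. real n * (c1 - 1 / real (Suc j)) \<le> a n x}"
  have [measurable]: "F \<in> sets P" "G \<in> sets P" unfolding F_def G_def by measurable
  have "prob F \<noteq> 0"
  proof
    assume "prob F = 0"
    then have "AE x in P. x \<notin> F"
      by (intro AE_not_in) (auto simp: null_sets_def emeasure_eq_measure)
    with AE_space have "AE x in P. \<exists>n\<ge>1. a n x \<le> real n * c1"
      by eventually_elim (auto simp: F_def not_less)
    then obtain C where C: "\<And>n. (\<integral>x. a n x \<partial>P) \<le> real n * (c1 + (\<gamma> - c1) / 2) + C"
      using integral_le_of_AE_ex_le[of c1 "(\<gamma> - c1) / 2"] c1 by auto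
    obtain n where n: "real n * ((\<gamma> - c1) / 2) > C"
      using c1 reals_Archimedean3[of "(\<gamma> - c1) / 2"] by auto
    have "real n * \<gamma> = real n * (c1 + (\<gamma> - c1) / 2) + real n * ((\<gamma> - c1) / 2)"
      by (simp add: field_simps)
    with g[of n] C[of n] n show False by linarith
  qed
  moreover have "F \<subseteq> G"
  proof
    fix x assume x: "x \<in> F"
    have "real n * (c1 - 1 / real (Suc j)) \<le> a n x" if "n \<ge> 1" for j n
    proof -
      have "real n * (c1 - 1 / real (Suc j)) \<le> real n * c1" by (intro mult_left_mono) auto
      moreover have "real n * c1 < a n x" using x that unfolding F_def by simp
      ultimately show ?thesis by linarith
    qed
    then show "x \<in> G" using x unfolding F_def G_def by auto
  qed
  ultimately have "prob G \<noteq> 0"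
    using finite_measure_mono[of F G] measure_nonneg[of P F] by fastforce
  moreover have "T x \<in> G" if "x \<in> G" for x
  proof -
    have xs: "x \<in> space P" and ev: "\<exists>N. \<forall>n\<ge>N. real n * (c1 - 1 / real (Suc j)) \<le> a n x" for j
      using that by (auto simp: G_def)
    have "\<exists>N. \<forall>n\<ge>N. real n * (c1 - 1 / real (Suc j)) \<le> a n (T x)" for j
    proof -
      \<comment> \<open>Half of the slack \<open>1 / real (Suc j)\<close> is used at
        \<open>x\<close>; the other half pays for \<open>L x\<close> and for the lost time step when
        passing to \<open>T x\<close>.\<close>
      obtain N where N: "\<And>n. n \<ge> N \<Longrightarrow> real n * (c1 - 1 / real (Suc (2 * j + 1))) \<le> a n x"
        using ev[of "2 * j + 1"] by auto
      define d where "d = c1 - 1 / real (Suc (2 * j + 1))"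
      define h where "h = 1 / (2 * real (Suc j))"
      have "real (Suc (2 * j + 1)) = 2 * real (Suc j)" by simp
      then have "d = c1 - h" unfolding d_def h_def by (simp only:)
      moreover have "1 / s = 1 / (2 * s) + 1 / (2 * s)" if "0 < s" for s :: real
        using that by (simp add: field_simps)
      then have "1 / real (Suc j) = h + h" unfolding h_def by (metis of_nat_0_less_iff zero_less_Suc)
      ultimately have dh: "c1 - 1 / real (Suc j) = d - h" "0 < h" by (auto simp: h_def)
      obtain N1 where N1: "real N1 * h > L x - d"
        using dh reals_Archimedean3 by blast
      show ?thesis unfolding dh(1)
      proof (intro exI[of _ "max N N1"] allI impI)
        fix n assume n: "max N N1 \<le> n"
        have "real (Suc n) * d \<le> a (Suc n) x" using N[of "Suc n"] n unfolding d_def by auto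
        also have "\<dots> \<le> L x + a n (T x)"
          using subadd[OF xs, of 1 n] abs_a_1_le[OF xs] by simp
        finally have "real n * d + d - L x \<le> a n (T x)" by (simp add: algebra_simps)
        moreover have "real N1 * h \<le> real n * h" using n dh by (intro mult_right_mono) auto
        ultimately show "real n * (d - h) \<le> a n (T x)" using N1 by (simp add: algebra_simps)
      qed
    qed
    then show ?thesis using measurable_space[OF T_measurable xs] by (auto simp: G_def)
  qed
  ultimately have "prob G = 1" using subinvariant_01[of G] by auto
  then have "AE x in P. x \<in> G" by (simp add: prob_eq_1)
  then show ?thesis
  proof eventually_elim
    case (elim x)
    obtain j where j: "1 / real (Suc j) < c1 - c"
      using c1 nat_approx_posE[of "c1 - c"] by (auto simp: field_simps)
    then obtain N where N: "\<And>n. n \<ge> N \<Longrightarrow> real n * (c1 - 1 / real (Suc j)) \<le> a n x"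
      using elim unfolding G_def by auto
    have "real n * c \<le> a n x" if "n \<ge> N" for n
    proof -
      have "real n * c \<le> real n * (c1 - 1 / real (Suc j))" using j by (intro mult_left_mono) auto
      then show ?thesis using N[OF that] by linarith
    qed
    then show ?case by (auto simp: eventually_sequentially)
  qed
qed

end

section \<open>Birkhoff's theorem\<close>

context ergodic_system
begin

text \<open>Birkhoff sums form an additive cocycle dominated by the modulus of \<open>f\<close>, so
  \<open>eventually_ge\<close> applies with the integral as growth rate. Using this for
  \<open>f\<close> and for its negative gives the limit.\<close>

lemma birkhoff_eventually_ge:
  fixes f :: "'a \<Rightarrow> real"
  assumes f: "integrable P f" and "c < (\<integral>x. f x \<partial>P)"
  shows "AE x in P. \<forall>\<^sub>F n in sequentially. real n * c \<le> (\<Sum>i<n. f ((T ^^ i) x))"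
proof -
  have [measurable]: "f \<in> borel_measurable P" using f by auto
  interpret ergodic_subadditive_cocycle P T "\<lambda>n x. \<Sum>i<n. f ((T ^^ i) x)" "\<lambda>x. \<bar>f x\<bar>"
  proof (unfold_locales)
    fix n m x
    have "(\<Sum>i<n + m. f ((T ^^ i) x)) =
        (\<Sum>i<n. f ((T ^^ i) x)) + (\<Sum>i\<in>{n..<n + m}. f ((T ^^ i) x))"
      by (simp add: lessThan_atLeast0 sum.atLeastLessThan_concat)
    also have "(\<Sum>i\<in>{n..<n + m}. f ((T ^^ i) x)) = (\<Sum>i<m. f ((T ^^ i) ((T ^^ n) x)))"
      using sum.shift_bounds_nat_ivl[of "\<lambda>i. f ((T ^^ i) x)" 0 n m]
      by (simp add: lessThan_atLeast0 funpow_add add.commute)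
    finally show "(\<Sum>i<n + m. f ((T ^^ i) x)) \<le>
        (\<Sum>i<n. f ((T ^^ i) x)) + (\<Sum>i<m. f ((T ^^ i) ((T ^^ n) x)))" by simp
    show "- (\<Sum>i<n. \<bar>f ((T ^^ i) x)\<bar>) \<le> (\<Sum>i<n. f ((T ^^ i) x))"
      unfolding sum_negf[symmetric] by (intro sum_mono) auto
  qed (use f in auto)
  show ?thesis
  proof (rule eventually_ge[OF _ assms(2)])
    show "real n * (\<integral>x. f x \<partial>P) \<le> (\<integral>x. (\<Sum>i<n. f ((T ^^ i) x)) \<partial>P)" for n
      by (subst Bochner_Integration.integral_sum)
         (auto intro!: integrable_funpow_T f simp: integral_funpow_T)
  qed
qed

lemma birkhoff:
  fixes f :: "'a \<Rightarrow> real"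
  assumes f: "integrable P f"
  shows "AE x in P. (\<lambda>n. (\<Sum>i<n. f ((T ^^ i) x)) / real n) \<longlonglongrightarrow> (\<integral>x. f x \<partial>P)"
proof -
  let ?I = "\<integral>x. f x \<partial>P"
  have "AE x in P. \<forall>j. \<forall>\<^sub>F n in sequentially.
      real n * (?I - 1 / real (Suc j)) \<le> (\<Sum>i<n. f ((T ^^ i) x))"
    by (subst AE_all_countable, intro allI birkhoff_eventually_ge[OF f]) auto
  moreover have "AE x in P. \<forall>j. \<forall>\<^sub>F n in sequentially.
      real n * (- ?I - 1 / real (Suc j)) \<le> (\<Sum>i<n. - f ((T ^^ i) x))"
    by (subst AE_all_countable, intro allI birkhoff_eventually_ge[of "\<lambda>x. - f x"]) (use f in auto)
  ultimately show ?thesis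
  proof eventually_elim
    case (elim x)
    show ?case
    proof (rule tendstoI)
      fix e :: real assume "0 < e"
      then obtain j where j: "1 / real (Suc j) < e" using nat_approx_posE by blast
      show "\<forall>\<^sub>F n in sequentially. dist ((\<Sum>i<n. f ((T ^^ i) x)) / real n) ?I < e"
        using elim(1)[rule_format, of j] elim(2)[rule_format, of j] eventually_gt_at_top[of 0]
      proof eventually_elim
        case (elim n)
        then have "?I - 1 / real (Suc j) \<le> (\<Sum>i<n. f ((T ^^ i) x)) / real n"
          "(\<Sum>i<n. f ((T ^^ i) x)) / real n \<le> ?I + 1 / real (Suc j)"
          by (auto simp: field_simps sum_negf)
        then show ?case using j by (simp add: dist_real_def abs_less_iff)
      qed
    qed
  qed
qed

end

section \<open>Growth bounds from above and Kingman's theorem\<close>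

context ergodic_subadditive_cocycle
begin

lemma block_bound:
  assumes "x \<in> space P" "0 < k"
  shows "a n x \<le> (\<Sum>i\<in>{i. i + k \<le> n \<and> k dvd i}. a k ((T ^^ i) x))
    + (\<Sum>i\<in>{n - k..<n}. L ((T ^^ i) x))"
  using assms(1)
proof (induct n arbitrary: x rule: less_induct)
  case (less n)
  show ?case
  proof (cases "n < k")
    case True
    then have e: "{i. i + k \<le> n \<and> k dvd i} = {}" "{n - k..<n} = {..<n}" by auto
    show ?thesis unfolding e using a_le[OF less(2)] by simp
  next
    case False
    let ?y = "(T ^^ k) x"
    have y: "?y \<in> space P" by (rule funpow_T_space[OF less(2)])
    have "a n x \<le> a k x + a (n - k) ?y" using subadd[OF less(2), of k "n - k"] False by simp
    also have "\<dots> \<le> a k x + ((\<Sum>i\<in>{i. i + k \<le> n - k \<and> k dvd i}. a k ((T ^^ i) ?y))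
        + (\<Sum>i\<in>{n - k - k..<n - k}. L ((T ^^ i) ?y)))"
      using less(1)[of "n - k", OF _ y] False \<open>0 < k\<close> by simp
    also have "(\<Sum>i\<in>{i. i + k \<le> n - k \<and> k dvd i}. a k ((T ^^ i) ?y)) =
        (\<Sum>i\<in>(\<lambda>i. i + k) ` {i. i + k \<le> n - k \<and> k dvd i}. a k ((T ^^ i) x))"
      by (subst sum.reindex) (auto simp: funpow_add)
    also have "(\<lambda>i. i + k) ` {i. i + k \<le> n - k \<and> k dvd i} = {i. i + k \<le> n \<and> k dvd i} - {0}"
    proof -
      have "i \<in> (\<lambda>i. i + k) ` {i. i + k \<le> n - k \<and> k dvd i}" if "i + k \<le> n" "k dvd i" "0 < i" for i
      proof -
        have "k \<le> i" using that dvd_imp_le by blast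
        then show ?thesis using that by (intro image_eqI[of _ _ "i - k"]) auto
      qed
      then show ?thesis using \<open>0 < k\<close> False by auto
    qed
    also have "a k x + ((\<Sum>i\<in>{i. i + k \<le> n \<and> k dvd i} - {0}. a k ((T ^^ i) x))
        + (\<Sum>i\<in>{n - k - k..<n - k}. L ((T ^^ i) ?y))) =
        (\<Sum>i\<in>{i. i + k \<le> n \<and> k dvd i}. a k ((T ^^ i) x)) + (\<Sum>i\<in>{n - k - k..<n - k}. L ((T ^^ i) ?y))"
    proof -
      have "finite {i. i + k \<le> n \<and> k dvd i}" by (rule finite_subset[of _ "{..n}"]) auto
      then show ?thesis using False by (subst (2) sum.remove[of _ 0]) auto
    qed
    also have "(\<Sum>i\<in>{n - k - k..<n - k}. L ((T ^^ i) ?y)) = (\<Sum>i\<in>{n - k - k + k..<n - k + k}. L ((T ^^ i) x))"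
      by (subst sum.shift_bounds_nat_ivl) (simp add: funpow_add)
    also have "\<dots> \<le> (\<Sum>i\<in>{n - k..<n}. L ((T ^^ i) x))"
      using False by (intro sum_mono2) (auto intro!: L_nonneg funpow_T_space less(2))
    finally show ?thesis by simp
  qed
qed

text \<open>Averaging over the \<open>k\<close> possible offsets replaces the sum over multiples of
  \<open>k\<close> by a sum over all positions, a Birkhoff sum for \<open>T\<close> itself. Working
  with \<open>T ^^ k\<close> would require the ergodicity of this power, which may fail.\<close>

lemma averaged_block_bound:
  assumes x: "x \<in> space P" and "0 < k" "k \<le> n"
  shows "real k * a n x \<le> (\<Sum>i<n + 1 - k. a k ((T ^^ i) x))
    + real k * ((\<Sum>i<k. L ((T ^^ i) x)) + (\<Sum>i\<in>{n - k..<n}. L ((T ^^ i) x)))"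
proof -
  let ?A = "\<lambda>r. {i. i + k \<le> n \<and> i mod k = r}"
  let ?E = "(\<Sum>i<k. L ((T ^^ i) x)) + (\<Sum>i\<in>{n - k..<n}. L ((T ^^ i) x))"
  have r: "a n x \<le> (\<Sum>i\<in>?A r. a k ((T ^^ i) x)) + ?E" if "r < k" for r
  proof -
    let ?y = "(T ^^ r) x"
    have "a n x \<le> a r x + a (n - r) ?y" using subadd[OF x, of r "n - r"] that assms by simp
    also have "a (n - r) ?y \<le> (\<Sum>i\<in>{i. i + k \<le> n - r \<and> k dvd i}. a k ((T ^^ i) ?y))
        + (\<Sum>i\<in>{n - r - k..<n - r}. L ((T ^^ i) ?y))"
      by (rule block_bound[OF funpow_T_space[OF x] \<open>0 < k\<close>])
    also have "(\<Sum>i\<in>{i. i + k \<le> n - r \<and> k dvd i}. a k ((T ^^ i) ?y)) =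
        (\<Sum>i\<in>(\<lambda>i. i + r) ` {i. i + k \<le> n - r \<and> k dvd i}. a k ((T ^^ i) x))"
      by (subst sum.reindex) (auto simp: funpow_add)
    also have "(\<lambda>i. i + r) ` {i. i + k \<le> n - r \<and> k dvd i} = ?A r"
    proof -
      have "i \<in> (\<lambda>i. i + r) ` {i. i + k \<le> n - r \<and> k dvd i}" if "i + k \<le> n" "i mod k = r" for i
      proof -
        have "r \<le> i" using that by auto
        then show ?thesis using that
          by (intro image_eqI[of _ _ "i - r"]) (auto simp: minus_mod_eq_mult_div)
      qed
      then show ?thesis using \<open>r < k\<close> by (auto simp: mod_add_left_eq dvd_eq_mod_eq_0)
    qed
    also have "(\<Sum>i\<in>{n - r - k..<n - r}. L ((T ^^ i) ?y)) =
        (\<Sum>i\<in>{n - r - k + r..<n - r + r}. L ((T ^^ i) x))"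
      by (subst sum.shift_bounds_nat_ivl) (simp add: funpow_add)
    also have "\<dots> \<le> (\<Sum>i\<in>{n - k..<n}. L ((T ^^ i) x))"
      using that assms by (intro sum_mono2) (auto intro!: L_nonneg funpow_T_space x)
    also have "a r x \<le> (\<Sum>i<k. L ((T ^^ i) x))"
      using a_le[OF x, of r]
      by (rule order_trans) (use that in \<open>auto intro!: sum_mono2 L_nonneg funpow_T_space x\<close>)
    finally show ?thesis by simp
  qed
  have "real k * a n x = (\<Sum>r<k. a n x)" by simp
  also have "\<dots> \<le> (\<Sum>r<k. (\<Sum>i\<in>?A r. a k ((T ^^ i) x)) + ?E)" by (intro sum_mono r) auto
  also have "\<dots> = (\<Sum>r<k. (\<Sum>i\<in>{i\<in>{..<n + 1 - k}. i mod k = r}. a k ((T ^^ i) x))) + real k * ?E"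
  proof -
    have "?A r = {i\<in>{..<n + 1 - k}. i mod k = r}" for r using assms by auto
    then show ?thesis by (simp add: sum.distrib)
  qed
  also have "(\<Sum>r<k. (\<Sum>i\<in>{i\<in>{..<n + 1 - k}. i mod k = r}. a k ((T ^^ i) x))) =
      (\<Sum>i<n + 1 - k. a k ((T ^^ i) x))"
    by (rule sum.group) (use \<open>0 < k\<close> in auto)
  finally show ?thesis .
qed

lemma eventually_le:
  assumes "0 < k" and "(\<integral>x. a k x \<partial>P) < real k * c"
  shows "AE x in P. \<forall>\<^sub>F n in sequentially. a n x \<le> real n * c"
  using birkhoff[OF a_integrable[of k]] birkhoff[OF L_integrable] AE_space
proof eventually_elim
  case (elim x)
  let ?s = "\<lambda>n. (\<Sum>i<n. a k ((T ^^ i) x)) / real n" and ?l = "\<lambda>n. (\<Sum>i<n. L ((T ^^ i) x)) / real n"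
  let ?I = "\<integral>x. a k x \<partial>P" and ?J = "\<integral>x. L x \<partial>P"
  let ?C = "\<Sum>i<k. L ((T ^^ i) x)"
  have r: "(\<lambda>n. real (n + j) / real (n + k)) \<longlonglongrightarrow> 1" for j by real_asymp
  \<comment> \<open>The last \<open>k\<close> values of \<open>L\<close> add up to a difference of
    two Birkhoff sums, which is of order o(n). The index is shifted by \<open>k\<close> to keep
    subtraction of natural numbers out of the limit.\<close>
  have "(\<lambda>n. ?s (n + 1) * (real (n + 1) / real (n + k)) + real k * (?C / real (n + k)
      + (?l (n + k) - ?l n * (real (n + 0) / real (n + k))))) \<longlonglongrightarrow> ?I * 1 + real k * (0 + (?J - ?J * 1))"
    by (intro tendsto_add tendsto_mult tendsto_diff tendsto_const r
        LIMSEQ_ignore_initial_segment[OF elim(1)] LIMSEQ_ignore_initial_segment[OF elim(2)] elim(2)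
        LIMSEQ_ignore_initial_segment[where f="\<lambda>n. ?C / real n"] lim_const_over_n)
  then have "\<forall>\<^sub>F n in sequentially. ?s (n + 1) * (real (n + 1) / real (n + k)) + real k * (?C / real (n + k)
      + (?l (n + k) - ?l n * (real (n + 0) / real (n + k)))) < real k * c"
    using assms by (intro order_tendstoD(2)) auto
  then have "\<forall>\<^sub>F n in sequentially. a (n + k) x \<le> real (n + k) * c"
    using eventually_gt_at_top[of 0]
  proof eventually_elim
    case (elim n)
    have nk: "real (n + k) > 0" using \<open>0 < k\<close> by simp
    have "real k * a (n + k) x \<le> (\<Sum>i<n + 1. a k ((T ^^ i) x))
        + real k * (?C + (\<Sum>i\<in>{n..<n + k}. L ((T ^^ i) x)))"
      using averaged_block_bound[OF \<open>x \<in> space P\<close> \<open>0 < k\<close>, of "n + k"] by simp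
    also have "(\<Sum>i\<in>{n..<n + k}. L ((T ^^ i) x)) =
        (\<Sum>i<n + k. L ((T ^^ i) x)) - (\<Sum>i<n. L ((T ^^ i) x))"
      using sum.atLeastLessThan_concat[of 0 n "n + k" "\<lambda>i. L ((T ^^ i) x)"]
      by (simp add: lessThan_atLeast0)
    also have "(\<Sum>i<n + 1. a k ((T ^^ i) x)) + real k * (?C + ((\<Sum>i<n + k. L ((T ^^ i) x))
        - (\<Sum>i<n. L ((T ^^ i) x)))) \<le> real k * c * real (n + k)"
    proof -
      have c: "u / p * (p / q) = u / q" if "p > 0" for u p q :: real using that by simp
      have e: "u + v * (x + (y - z)) \<le> w * q" if "u / q + v * (x / q + (y / q - z / q)) < w" "q > 0"
        for u v w x y z q :: real
      proof -
        have "u / q + v * (x / q + (y / q - z / q)) = (u + v * (x + (y - z))) / q"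
          by (simp add: add_divide_distrib diff_divide_distrib distrib_left right_diff_distrib)
        then show ?thesis using that by (simp add: field_simps)
      qed
      have n1: "real (n + 1) > 0" "real n > 0" using elim(2) by auto
      show ?thesis
        using elim(1) unfolding c[OF n1(1)] add_0_right c[OF n1(2)] by (rule e[OF _ nk])
    qed
    finally show ?case using \<open>0 < k\<close> by (simp add: mult.assoc mult.commute mult.left_commute)
  qed
  then show ?case
    using eventually_sequentially_seg[of "\<lambda>n. a n x \<le> real n * c" k] by simp
qed

text \<open>The constant is the infimum of the normalised means: \<open>eventually_ge\<close> gives
  every smaller rate from below, and a single good block length \<open>k\<close> in
  \<open>eventually_le\<close> gives every larger rate from above. The lower bound by
  \<open>L\<close> makes the infimum finite.\<close>

lemma kingman:
  obtains \<gamma> where "AE x in P. (\<lambda>n. a n x / real n) \<longlonglongrightarrow> \<gamma>"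
proof -
  define \<gamma> where "\<gamma> = (INF n\<in>{1..}. (\<integral>x. a n x \<partial>P) / real n)"
  let ?J = "\<integral>x. L x \<partial>P"
  have "- ?J \<le> (\<integral>x. a n x \<partial>P) / real n" if "n \<ge> 1" for n
  proof -
    have "(\<integral>x. - (\<Sum>i<n. L ((T ^^ i) x)) \<partial>P) \<le> (\<integral>x. a n x \<partial>P)"
      by (rule integral_mono) (use sum_L_integrable a_integrable a_ge in auto)
    also have "(\<integral>x. - (\<Sum>i<n. L ((T ^^ i) x)) \<partial>P) = - real n * ?J"
      by (simp add: Bochner_Integration.integral_sum integrable_funpow_T[OF L_integrable]
          integral_funpow_T)
    finally show ?thesis using that by (simp add: field_simps)
  qed
  then have bdd: "bdd_below ((\<lambda>n. (\<integral>x. a n x \<partial>P) / real n) ` {1..})"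
    by (intro bdd_belowI2[of _ "- ?J"]) auto
  have low: "real n * \<gamma> \<le> (\<integral>x. a n x \<partial>P)" for n
  proof (cases "n = 0")
    case True
    have "(\<integral>x. a 0 x \<partial>P) = (\<integral>x. 0 \<partial>P)" by (rule Bochner_Integration.integral_cong) (auto simp: a_0)
    then show ?thesis using True by simp
  next
    case False
    then have "\<gamma> \<le> (\<integral>x. a n x \<partial>P) / real n" unfolding \<gamma>_def by (intro cINF_lower[OF bdd]) auto
    then show ?thesis using False by (simp add: field_simps)
  qed
  have up: "AE x in P. \<forall>\<^sub>F n in sequentially. a n x \<le> real n * c" if "\<gamma> < c" for c
  proof -
    obtain k :: nat where "k \<ge> 1" "(\<integral>x. a k x \<partial>P) / real k < c"
    proof -
      have "(\<lambda>n. (\<integral>x. a n x \<partial>P) / real n) ` {1..} \<noteq> {}" by simp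
      from cInf_lessD[OF this \<open>\<gamma> < c\<close>[unfolded \<gamma>_def]] show thesis using that by auto
    qed
    then show ?thesis using eventually_le[of k c] by (simp add: field_simps)
  qed
  have "AE x in P. \<forall>j. \<forall>\<^sub>F n in sequentially. real n * (\<gamma> - 1 / real (Suc j)) \<le> a n x"
    by (subst AE_all_countable, intro allI eventually_ge[OF low]) auto
  moreover have "AE x in P. \<forall>j. \<forall>\<^sub>F n in sequentially. a n x \<le> real n * (\<gamma> + 1 / real (Suc j))"
    by (subst AE_all_countable, intro allI up) auto
  ultimately have "AE x in P. (\<lambda>n. a n x / real n) \<longlonglongrightarrow> \<gamma>"
  proof eventually_elim
    case (elim x)
    show ?case
    proof (rule tendstoI)
      fix e :: real assume "0 < e"
      then obtain j where j: "1 / real (Suc j) < e" using nat_approx_posE by blast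
      show "\<forall>\<^sub>F n in sequentially. dist (a n x / real n) \<gamma> < e"
        using elim(1)[rule_format, of j] elim(2)[rule_format, of j] eventually_gt_at_top[of 0]
      proof eventually_elim
        case (elim n)
        then have "\<gamma> - 1 / real (Suc j) \<le> a n x / real n" "a n x / real n \<le> \<gamma> + 1 / real (Suc j)"
          by (auto simp: field_simps)
        then show ?case using j by (simp add: dist_real_def abs_less_iff)
      qed
    qed
  qed
  then show ?thesis by (rule that)
qed

end

section \<open>Skew products over a Bernoulli shift\<close>

definition shift :: "(nat \<Rightarrow> 'g) \<Rightarrow> nat \<Rightarrow> 'g" where
  "shift \<omega> = (\<lambda>n. \<omega> (Suc n))"

lemma shift_case_nat [simp]: "shift (case_nat g \<omega>) = \<omega>"
  by (simp add: shift_def)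

lemma funpow_shift: "(shift ^^ n) \<omega> = (\<lambda>k. \<omega> (n + k))"
  by (induct n arbitrary: \<omega>) (simp_all add: shift_def)

lemma measurable_shift [measurable]: "shift \<in> (\<Pi>\<^sub>M i\<in>UNIV::nat set. M) \<rightarrow>\<^sub>M (\<Pi>\<^sub>M i\<in>UNIV. M)"
  unfolding shift_def by (rule measurable_PiM_single') (auto simp: space_PiM PiE_iff)

context sequence_space
begin

lemma nn_integral_case_nat:
  assumes [measurable]: "F \<in> borel_measurable S"
  shows "(\<integral>\<^sup>+\<omega>. F \<omega> \<partial>S) = (\<integral>\<^sup>+g. \<integral>\<^sup>+\<omega>. F (case_nat g \<omega>) \<partial>S \<partial>M)"
proof -
  have "(\<integral>\<^sup>+\<omega>. F \<omega> \<partial>S) = (\<integral>\<^sup>+\<omega>. F \<omega> \<partial>distr (M \<Otimes>\<^sub>M S) S (\<lambda>(s, \<omega>). case_nat s \<omega>))"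
    by (simp only: PiM_iter)
  also have "\<dots> = (\<integral>\<^sup>+z. F (case z of (s, \<omega>) \<Rightarrow> case_nat s \<omega>) \<partial>(M \<Otimes>\<^sub>M S))"
    by (rule nn_integral_distr) measurable
  also have "\<dots> = (\<integral>\<^sup>+g. \<integral>\<^sup>+\<omega>. F (case_nat g \<omega>) \<partial>S \<partial>M)"
    by (subst P.nn_integral_fst[symmetric]) measurable
  finally show ?thesis .
qed

lemma emeasure_cons_cylinder:
  assumes [measurable]: "A \<in> sets M" "C \<in> sets S"
  shows "emeasure S {\<omega>\<in>space S. \<omega> 0 \<in> A \<and> shift \<omega> \<in> C} = emeasure M A * emeasure S C"
proof -
  let ?X = "{\<omega>\<in>space S. \<omega> 0 \<in> A \<and> shift \<omega> \<in> C}"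
  have "emeasure S ?X = (\<integral>\<^sup>+\<omega>. indicator ?X \<omega> \<partial>S)"
    by (rule nn_integral_indicator[symmetric]) measurable
  also have "\<dots> = (\<integral>\<^sup>+\<omega>. indicator A (\<omega> 0) * indicator C (shift \<omega>) \<partial>S)"
    by (rule nn_integral_cong) (simp add: indicator_def)
  also have "\<dots> = (\<integral>\<^sup>+g. \<integral>\<^sup>+\<omega>. indicator A g * indicator C \<omega> \<partial>S \<partial>M)"
    by (subst nn_integral_case_nat) simp_all
  also have "\<dots> = (\<integral>\<^sup>+g. indicator A g * emeasure S C \<partial>M)"
    by (simp add: nn_integral_cmult)
  finally show ?thesis by (simp add: nn_integral_multc)
qed

end

section \<open>The skew product of a stationary measure\<close>

locale stationary_action = sequence_space M + Y: prob_space \<eta>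
  for M :: "'g measure" and \<eta> :: "'y measure" +
  fixes act :: "'g \<Rightarrow> 'y \<Rightarrow> 'y"
  assumes act_measurable: "(\<lambda>(g, y). act g y) \<in> M \<Otimes>\<^sub>M \<eta> \<rightarrow>\<^sub>M \<eta>"
    and distr_act: "distr (M \<Otimes>\<^sub>M \<eta>) \<eta> (\<lambda>(g, y). act g y) = \<eta>"
begin

sublocale Z: pair_prob_space \<eta> S ..
sublocale ZM: pair_prob_space \<eta> "M" ..

lemma measurable_act [measurable (raw)]:
  "f \<in> N \<rightarrow>\<^sub>M M \<Longrightarrow> h \<in> N \<rightarrow>\<^sub>M \<eta> \<Longrightarrow> (\<lambda>x. act (f x) (h x)) \<in> N \<rightarrow>\<^sub>M \<eta>"
  using measurable_compose[OF measurable_Pair act_measurable, of f N h] by simp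

lemma nn_integral_act:
  assumes [measurable]: "F \<in> borel_measurable \<eta>"
  shows "(\<integral>\<^sup>+y. \<integral>\<^sup>+g. F (act g y) \<partial>M \<partial>\<eta>) = (\<integral>\<^sup>+y. F y \<partial>\<eta>)"
proof -
  have "(\<integral>\<^sup>+y. F y \<partial>\<eta>) = (\<integral>\<^sup>+y. F y \<partial>distr (M \<Otimes>\<^sub>M \<eta>) \<eta> (\<lambda>(g, y). act g y))"
    by (simp only: distr_act)
  also have "\<dots> = (\<integral>\<^sup>+z. F (case z of (g, y) \<Rightarrow> act g y) \<partial>(M \<Otimes>\<^sub>M \<eta>))"
    by (rule nn_integral_distr) measurable
  also have "\<dots> = (\<integral>\<^sup>+g. \<integral>\<^sup>+y. F (act g y) \<partial>\<eta> \<partial>M)"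
    by (subst Y.nn_integral_fst[symmetric]) measurable
  also have "\<dots> = (\<integral>\<^sup>+y. \<integral>\<^sup>+g. F (act g y) \<partial>M \<partial>\<eta>)"
    by (rule ZM.Fubini') measurable
  finally show ?thesis ..
qed

lemma AE_act:
  assumes [measurable]: "Measurable.pred \<eta> Q" and "AE y in \<eta>. Q y"
  shows "AE y in \<eta>. AE g in M. Q (act g y)"
proof -
  have "AE y in distr (M \<Otimes>\<^sub>M \<eta>) \<eta> (\<lambda>(g, y). act g y). Q y" by (simp only: distr_act assms)
  then have "AE z in M \<Otimes>\<^sub>M \<eta>. Q (act (fst z) (snd z))"
    by (subst (asm) AE_distr_iff) (auto simp: case_prod_beta)
  then have "AE g in M. AE y in \<eta>. Q (act g y)"
    by (subst pair_sigma_finite.AE_pair_iff) (auto intro: pair_sigma_finite.intro Y.sigma_finite_measure_axioms M.sigma_finite_measure)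
  then show ?thesis
    by (subst pair_sigma_finite.AE_commute) (auto intro: pair_sigma_finite.intro Y.sigma_finite_measure_axioms M.sigma_finite_measure)
qed

text \<open>Since \<open>act g y\<close> and \<open>y\<close> almost surely lie in \<open>H\<close>
  together, normalising \<open>\<eta>\<close> on \<open>H\<close> keeps it stationary. This links
  the extremality of \<open>\<eta>\<close> to the 0-1 law in \<open>ergodic_action\<close>.\<close>

lemma distr_act_uniform_measure:
  assumes H [measurable]: "H \<in> sets \<eta>" and pos: "Y.prob H \<noteq> 0"
    and inv: "AE y in \<eta>. AE g in M. act g y \<in> H \<longleftrightarrow> y \<in> H"
  shows "distr (M \<Otimes>\<^sub>M uniform_measure \<eta> H) (uniform_measure \<eta> H) (\<lambda>(g, y). act g y) =
    uniform_measure \<eta> H"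
proof (rule measure_eqI)
  let ?U = "uniform_measure \<eta> H"
  have "emeasure \<eta> H \<noteq> 0" "emeasure \<eta> H \<noteq> \<infinity>"
    using pos by (auto simp: Y.emeasure_eq_measure)
  then interpret U: prob_space ?U by (rule prob_space_uniform_measure)
  interpret MU: pair_prob_space M ?U ..
  fix A assume "A \<in> sets (distr (M \<Otimes>\<^sub>M ?U) ?U (\<lambda>(g, y). act g y))"
  then have A [measurable]: "A \<in> sets \<eta>" by simp
  have act [measurable]: "(\<lambda>(g, y). act g y) \<in> M \<Otimes>\<^sub>M ?U \<rightarrow>\<^sub>M \<eta>"
    using act_measurable by (simp cong: measurable_cong_sets sets_pair_measure_cong)
  have "emeasure (distr (M \<Otimes>\<^sub>M ?U) ?U (\<lambda>(g, y). act g y)) A =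
      emeasure (distr (M \<Otimes>\<^sub>M ?U) \<eta> (\<lambda>(g, y). act g y)) A"
    by (simp cong: distr_cong)
  also have "\<dots> = (\<integral>\<^sup>+z. indicator A (case z of (g, y) \<Rightarrow> act g y) \<partial>(M \<Otimes>\<^sub>M ?U))"
    by (subst nn_integral_indicator[symmetric], simp, subst nn_integral_distr) auto
  also have "\<dots> = (\<integral>\<^sup>+y. \<integral>\<^sup>+g. indicator A (act g y) \<partial>M \<partial>?U)"
    by (subst MU.nn_integral_snd[symmetric]) auto
  also have "\<dots> = (\<integral>\<^sup>+y. (\<integral>\<^sup>+g. indicator A (act g y) \<partial>M) * indicator H y \<partial>\<eta>) / emeasure \<eta> H"
    by (rule nn_integral_uniform_measure) measurable
  also have "(\<integral>\<^sup>+y. (\<integral>\<^sup>+g. indicator A (act g y) \<partial>M) * indicator H y \<partial>\<eta>) =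
      (\<integral>\<^sup>+y. \<integral>\<^sup>+g. indicator (A \<inter> H) (act g y) \<partial>M \<partial>\<eta>)"
  proof (rule nn_integral_cong_AE)
    show "AE y in \<eta>. (\<integral>\<^sup>+g. indicator A (act g y) \<partial>M) * indicator H y =
        (\<integral>\<^sup>+g. indicator (A \<inter> H) (act g y) \<partial>M)"
      using inv AE_space
    proof eventually_elim
      case (elim y)
      note [measurable] = elim(2)
      have "(\<integral>\<^sup>+g. indicator A (act g y) \<partial>M) * indicator H y =
          (\<integral>\<^sup>+g. indicator A (act g y) * indicator H y \<partial>M)"
        by (subst nn_integral_multc) auto
      also have "\<dots> = (\<integral>\<^sup>+g. indicator (A \<inter> H) (act g y) \<partial>M)"
        by (rule nn_integral_cong_AE, use elim(1) in eventually_elim) (auto simp: indicator_def)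
      finally show ?case .
    qed
  qed
  also have "\<dots> = (\<integral>\<^sup>+y. indicator (A \<inter> H) y \<partial>\<eta>)" by (rule nn_integral_act) measurable
  also have "\<dots> / emeasure \<eta> H = emeasure ?U A"
    by (simp add: Int_commute)
  finally show "emeasure (distr (M \<Otimes>\<^sub>M ?U) ?U (\<lambda>(g, y). act g y)) A = emeasure ?U A" .
qed simp

definition skew :: "'y \<times> (nat \<Rightarrow> 'g) \<Rightarrow> 'y \<times> (nat \<Rightarrow> 'g)" where
  "skew = (\<lambda>(y, \<omega>). (act (\<omega> 0) y, shift \<omega>))"

lemma measurable_skew [measurable]: "skew \<in> \<eta> \<Otimes>\<^sub>M S \<rightarrow>\<^sub>M \<eta> \<Otimes>\<^sub>M S"
  unfolding skew_def by measurable

text \<open>The first letter is independent of the others, which form a sequence of the same law;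
  integrating it out reduces the claim to the stationarity of \<open>\<eta>\<close>.\<close>

lemma nn_integral_skew:
  assumes [measurable]: "F \<in> borel_measurable (\<eta> \<Otimes>\<^sub>M S)"
  shows "(\<integral>\<^sup>+z. F (skew z) \<partial>(\<eta> \<Otimes>\<^sub>M S)) = (\<integral>\<^sup>+z. F z \<partial>(\<eta> \<Otimes>\<^sub>M S))"
proof -
  have "(\<integral>\<^sup>+z. F (skew z) \<partial>(\<eta> \<Otimes>\<^sub>M S)) = (\<integral>\<^sup>+y. \<integral>\<^sup>+\<omega>. F (act (\<omega> 0) y, shift \<omega>) \<partial>S \<partial>\<eta>)"
    by (subst P.nn_integral_fst[symmetric]) (auto simp: skew_def)
  also have "\<dots> = (\<integral>\<^sup>+y. \<integral>\<^sup>+g. \<integral>\<^sup>+\<omega>. F (act g y, \<omega>) \<partial>S \<partial>M \<partial>\<eta>)"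
    by (intro nn_integral_cong, subst nn_integral_case_nat) auto
  also have "\<dots> = (\<integral>\<^sup>+y. \<integral>\<^sup>+\<omega>. F (y, \<omega>) \<partial>S \<partial>\<eta>)"
    by (rule nn_integral_act[of "\<lambda>y. \<integral>\<^sup>+\<omega>. F (y, \<omega>) \<partial>S"]) measurable
  also have "\<dots> = (\<integral>\<^sup>+z. F z \<partial>(\<eta> \<Otimes>\<^sub>M S))"
    by (rule P.nn_integral_fst) measurable
  finally show ?thesis .
qed

sublocale skew: measure_preserving "\<eta> \<Otimes>\<^sub>M S" skew
proof
  show "distr (\<eta> \<Otimes>\<^sub>M S) (\<eta> \<Otimes>\<^sub>M S) skew = \<eta> \<Otimes>\<^sub>M S"
  proof (rule measure_eqI)
    fix A assume "A \<in> sets (distr (\<eta> \<Otimes>\<^sub>M S) (\<eta> \<Otimes>\<^sub>M S) skew)"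
    then have [measurable]: "A \<in> sets (\<eta> \<Otimes>\<^sub>M S)" by simp
    have "emeasure (distr (\<eta> \<Otimes>\<^sub>M S) (\<eta> \<Otimes>\<^sub>M S) skew) A = (\<integral>\<^sup>+z. indicator A (skew z) \<partial>(\<eta> \<Otimes>\<^sub>M S))"
      by (subst nn_integral_indicator[symmetric], simp, subst nn_integral_distr) auto
    then show "emeasure (distr (\<eta> \<Otimes>\<^sub>M S) (\<eta> \<Otimes>\<^sub>M S) skew) A = emeasure (\<eta> \<Otimes>\<^sub>M S) A"
      by (simp add: nn_integral_skew)
  qed simp
qed measurable

end

section \<open>Ergodicity of the skew product\<close>

locale ergodic_action = stationary_action +
  assumes invariant_01: "H \<in> sets \<eta> \<Longrightarrow> AE y in \<eta>. AE g in M. act g y \<in> H \<longleftrightarrow> y \<in> H \<Longrightarrow>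
    Y.prob H = 0 \<or> Y.prob H = 1"
begin

context
  fixes E assumes E [measurable]: "E \<in> sets (\<eta> \<Otimes>\<^sub>M S)"
    and inv: "AE z in \<eta> \<Otimes>\<^sub>M S. skew z \<in> E \<longleftrightarrow> z \<in> E"
begin

text \<open>The measure of the part in \<open>C\<close> of the fibre of \<open>E\<close> over
  \<open>y\<close>. The aim is to show that it factorises as \<open>height y\<close> times the
  measure of \<open>C\<close>, which means that \<open>E\<close> does not depend on the
  sequence.\<close>

definition sec :: "'b \<Rightarrow> (nat \<Rightarrow> 'a) set \<Rightarrow> ennreal" where
  "sec y C = (\<integral>\<^sup>+\<omega>. indicator E (y, \<omega>) * indicator C \<omega> \<partial>S)"

lemma sec_measurable [measurable]:
  assumes [measurable]: "C \<in> sets S"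
  shows "(\<lambda>y. sec y C) \<in> borel_measurable \<eta>"
  unfolding sec_def by measurable

lemma sec_le: "C \<in> sets S \<Longrightarrow> sec y C \<le> 1"
proof -
  have "sec y C \<le> (\<integral>\<^sup>+\<omega>. 1 \<partial>S)" unfolding sec_def by (intro nn_integral_mono) (auto simp: indicator_def)
  then show ?thesis by (simp add: P.emeasure_space_1)
qed

text \<open>By invariance the fibre of \<open>E\<close> over \<open>y\<close> consists, up to a null
  set, of the sequences whose shift lies in the fibre over the point to which the first letter moves
  \<open>y\<close>.\<close>

lemma sec_cons:
  assumes [measurable]: "A \<in> sets M" "C \<in> sets S"
  shows "AE y in \<eta>. sec y {\<omega>\<in>space S. \<omega> 0 \<in> A \<and> shift \<omega> \<in> C} =
    (\<integral>\<^sup>+g. indicator A g * sec (act g y) C \<partial>M)"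
  using Z.AE_pair[OF inv] AE_space
proof eventually_elim
  case (elim y)
  note [measurable] = elim(2)
  let ?C = "{\<omega>\<in>space S. \<omega> 0 \<in> A \<and> shift \<omega> \<in> C}"
  have "sec y ?C = (\<integral>\<^sup>+\<omega>. indicator E (act (\<omega> 0) y, shift \<omega>) * (indicator A (\<omega> 0) * indicator C (shift \<omega>)) \<partial>S)"
    unfolding sec_def
    by (rule nn_integral_cong_AE, use elim(1) AE_space in eventually_elim) (auto simp: indicator_def skew_def)
  also have "\<dots> = (\<integral>\<^sup>+g. \<integral>\<^sup>+\<omega>. indicator A g * (indicator E (act g y, \<omega>) * indicator C \<omega>) \<partial>S \<partial>M)"
    by (subst nn_integral_case_nat) (auto simp: ac_simps)
  also have "\<dots> = (\<integral>\<^sup>+g. indicator A g * sec (act g y) C \<partial>M)"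
    unfolding sec_def by (rule nn_integral_cong) (subst nn_integral_cmult, auto)
  finally show ?case .
qed

definition height :: "'b \<Rightarrow> real" where
  "height y = enn2real (sec y (space S))"

lemma height_measurable [measurable]: "height \<in> borel_measurable \<eta>"
  unfolding height_def by measurable

lemma ennreal_height: "ennreal (height y) = sec y (space S)"
  unfolding height_def
  by (rule ennreal_enn2real, rule order.strict_trans1[OF sec_le ennreal_one_less_top]) simp

lemma height_bounds: "0 \<le> height y" "height y \<le> 1"
proof -
  have "ennreal (height y) \<le> ennreal 1" unfolding ennreal_height using sec_le[of "space S" y] by simp
  then show "height y \<le> 1" by (simp add: ennreal_le_iff)
qed (simp add: height_def)

text \<open>\<open>height\<close> is a bounded harmonic function, so its \<open>L\<^sup>2\<close> increments
  \<open>\<integral>\<integral> (height (g y) - height y)\<^sup>2\<close> vanish by stationarity.\<close>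

lemma height_invariant: "AE y in \<eta>. AE g in M. height (act g y) = height y"
proof -
  have eq: "{\<omega>\<in>space S. \<omega> 0 \<in> space M \<and> shift \<omega> \<in> space S} = space S"
    by (auto simp: space_PiM PiE_iff shift_def)
  have bdd: "integrable N f" if "finite_measure N" "f \<in> borel_measurable N" "\<And>x. \<bar>f x\<bar> \<le> 1"
    for N and f :: "'c \<Rightarrow> real"
    using that by (intro finite_measure.integrable_const_bound[of N f 1]) auto
  note fin = M.finite_measure_axioms Y.finite_measure_axioms ZM.finite_measure_axioms
  have hm: "AE y in \<eta>. (\<integral>g. height (act g y) \<partial>M) = height y"
    using sec_cons[OF sets.top sets.top, unfolded eq] AE_space
  proof eventually_elim
    case (elim y)
    note [measurable] = elim(2)
    have "ennreal (\<integral>g. height (act g y) \<partial>M) = (\<integral>\<^sup>+g. ennreal (height (act g y)) \<partial>M)"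
      by (rule nn_integral_eq_integral[symmetric])
         (auto intro!: bdd fin simp: height_bounds abs_le_iff intro: order_trans[OF _ height_bounds(1)])
    also have "\<dots> = (\<integral>\<^sup>+g. indicator (space M) g * sec (act g y) (space S) \<partial>M)"
      by (rule nn_integral_cong) (simp add: ennreal_height)
    also have "\<dots> = ennreal (height y)" using elim by (simp add: ennreal_height)
    finally show ?case by (simp add: height_bounds)
  qed
  have h2: "(height y)\<^sup>2 \<le> 1" "\<bar>height y * height z\<bar> \<le> 1" for y z
    using height_bounds[of y] height_bounds[of z] by (auto simp: power_le_one mult_le_one abs_mult)
  have i1: "integrable (\<eta> \<Otimes>\<^sub>M M) (\<lambda>z. (height (act (snd z) (fst z)))\<^sup>2)"
    by (rule bdd[OF fin(3)]) (auto simp: h2)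
  have i2: "integrable (\<eta> \<Otimes>\<^sub>M M) (\<lambda>z. height (act (snd z) (fst z)) * height (fst z))"
    by (rule bdd[OF fin(3)]) (auto simp: h2)
  have i3: "integrable (\<eta> \<Otimes>\<^sub>M M) (\<lambda>z. (height (fst z))\<^sup>2)"
    by (rule bdd[OF fin(3)]) (auto simp: h2)
  have e1: "(\<integral>z. (height (act (snd z) (fst z)))\<^sup>2 \<partial>(\<eta> \<Otimes>\<^sub>M M)) = (\<integral>y. (height y)\<^sup>2 \<partial>\<eta>)"
  proof -
    have "ennreal (\<integral>z. (height (act (snd z) (fst z)))\<^sup>2 \<partial>(\<eta> \<Otimes>\<^sub>M M)) =
        (\<integral>\<^sup>+z. ennreal ((height (act (snd z) (fst z)))\<^sup>2) \<partial>(\<eta> \<Otimes>\<^sub>M M))"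
      by (rule nn_integral_eq_integral[symmetric, OF i1]) simp
    also have "\<dots> = (\<integral>\<^sup>+y. \<integral>\<^sup>+g. ennreal ((height (act g y))\<^sup>2) \<partial>M \<partial>\<eta>)"
      by (subst M.nn_integral_fst[symmetric]) auto
    also have "\<dots> = (\<integral>\<^sup>+y. ennreal ((height y)\<^sup>2) \<partial>\<eta>)"
      by (rule nn_integral_act) measurable
    also have "\<dots> = ennreal (\<integral>y. (height y)\<^sup>2 \<partial>\<eta>)"
      by (rule nn_integral_eq_integral) (auto intro!: bdd fin simp: h2)
    finally show ?thesis by simp
  qed
  have e2: "(\<integral>z. height (act (snd z) (fst z)) * height (fst z) \<partial>(\<eta> \<Otimes>\<^sub>M M)) = (\<integral>y. (height y)\<^sup>2 \<partial>\<eta>)"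
  proof -
    have "(\<integral>z. height (act (snd z) (fst z)) * height (fst z) \<partial>(\<eta> \<Otimes>\<^sub>M M)) =
        (\<integral>y. (\<integral>g. height (act g y) * height y \<partial>M) \<partial>\<eta>)"
      using ZM.integral_fst'[OF i2] by simp
    also have "\<dots> = (\<integral>y. (height y)\<^sup>2 \<partial>\<eta>)"
      by (rule integral_cong_AE, measurable, use hm in eventually_elim) (simp add: power2_eq_square)
    finally show ?thesis .
  qed
  have e3: "(\<integral>z. (height (fst z))\<^sup>2 \<partial>(\<eta> \<Otimes>\<^sub>M M)) = (\<integral>y. (height y)\<^sup>2 \<partial>\<eta>)"
    using ZM.integral_fst'[OF i3] by (simp add: M.prob_space)
  have "integrable (\<eta> \<Otimes>\<^sub>M M) (\<lambda>z. (height (act (snd z) (fst z)) - height (fst z))\<^sup>2)"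
    unfolding power2_diff using i1 i2 i3 by (auto simp: mult.assoc)
  moreover have "(\<integral>z. (height (act (snd z) (fst z)) - height (fst z))\<^sup>2 \<partial>(\<eta> \<Otimes>\<^sub>M M)) = 0"
    unfolding power2_diff using i1 i2 i3 by (simp add: mult.assoc e1 e2 e3)
  ultimately have "AE z in \<eta> \<Otimes>\<^sub>M M. (height (act (snd z) (fst z)) - height (fst z))\<^sup>2 = 0"
    by (subst (asm) integral_nonneg_eq_0_iff_AE) auto
  then have "AE z in \<eta> \<Otimes>\<^sub>M M. height (act (snd z) (fst z)) = height (fst z)" by simp
  from ZM.AE_pair[OF this] show ?thesis by simp
qed

text \<open>Strip off the first letter with \<open>sec_cons\<close>, use the induction hypothesis at
  \<open>act g y\<close>, and replace \<open>height (act g y)\<close> by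
  \<open>height y\<close>.\<close>

lemma sec_cylinder:
  assumes "\<And>i. A i \<in> sets M"
  shows "AE y in \<eta>. sec y {\<omega>\<in>space S. \<forall>i<n. \<omega> i \<in> A i} =
    ennreal (height y) * emeasure S {\<omega>\<in>space S. \<forall>i<n. \<omega> i \<in> A i}"
  using assms
proof (induct n arbitrary: A)
  case 0
  then show ?case by (simp add: ennreal_height P.emeasure_space_1)
next
  case (Suc n)
  let ?C = "{\<omega>\<in>space S. \<forall>i<n. \<omega> i \<in> A (Suc i)}"
  have [measurable]: "A i \<in> sets M" for i by fact
  have C [measurable]: "?C \<in> sets S" by measurable
  have eq: "{\<omega>\<in>space S. \<forall>i<Suc n. \<omega> i \<in> A i} = {\<omega>\<in>space S. \<omega> 0 \<in> A 0 \<and> shift \<omega> \<in> ?C}"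
  proof -
    have "(\<forall>i<Suc n. \<omega> i \<in> A i) \<longleftrightarrow> \<omega> 0 \<in> A 0 \<and> (\<forall>i<n. \<omega> (Suc i) \<in> A (Suc i))" for \<omega>
      by (rule All_less_Suc2)
    moreover have "shift \<omega> \<in> space S" if "\<omega> \<in> space S" for \<omega>
      by (rule measurable_space[OF measurable_shift that])
    ultimately show ?thesis by (simp add: shift_def cong: conj_cong)
  qed
  have hC: "AE y in \<eta>. AE g in M. sec (act g y) ?C = ennreal (height (act g y)) * emeasure S ?C"
  proof (rule AE_act)
    show "AE y in \<eta>. sec y ?C = ennreal (height y) * emeasure S ?C"
      by (rule Suc(1)[of "\<lambda>i. A (Suc i)"]) (rule Suc(2))
    have "(\<lambda>y. sec y ?C) \<in> borel_measurable \<eta>" by (rule sec_measurable[OF C])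
    moreover have "(\<lambda>y. ennreal (height y) * emeasure S ?C) \<in> borel_measurable \<eta>" by measurable
    ultimately show "Measurable.pred \<eta> (\<lambda>y. sec y ?C = ennreal (height y) * emeasure S ?C)"
      by (rule borel_measurable_eq[unfolded pred_def[symmetric]] pred_intros_logic | simp add: pred_def)+
  qed
  show ?case
    using height_invariant sec_cons[OF Suc(2)[of 0] C] hC AE_space
  proof eventually_elim
    case (elim y)
    note [measurable] = elim(4)
    have "sec y {\<omega>\<in>space S. \<forall>i<Suc n. \<omega> i \<in> A i} = (\<integral>\<^sup>+g. indicator (A 0) g * sec (act g y) ?C \<partial>M)"
      unfolding eq by (rule elim(2))
    also have "\<dots> = (\<integral>\<^sup>+g. indicator (A 0) g * (ennreal (height y) * emeasure S ?C) \<partial>M)"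
      by (rule nn_integral_cong_AE, use elim(1,3) in eventually_elim) simp
    also have "\<dots> = emeasure M (A 0) * (ennreal (height y) * emeasure S ?C)"
      by (simp add: nn_integral_multc)
    finally show ?case
      unfolding eq emeasure_cons_cylinder[OF Suc(2)[of 0] C] by (simp add: ac_simps)
  qed
qed

text \<open>Both sides are finite measures in \<open>C\<close> that agree on cylinders by
  \<open>sec_cylinder\<close>. There the exceptional null set of points \<open>y\<close> depends on
  the cylinder, which is why the statement is integrated over \<open>B\<close>.\<close>

lemma nn_integral_sec:
  assumes B [measurable]: "B \<in> sets \<eta>" and "C \<in> sets S"
  shows "(\<integral>\<^sup>+y. indicator B y * sec y C \<partial>\<eta>) = (\<integral>\<^sup>+y. indicator B y * ennreal (height y) \<partial>\<eta>) * emeasure S C"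
proof -
  define c where "c = (\<integral>\<^sup>+y. indicator B y * ennreal (height y) \<partial>\<eta>)"
  have "c \<le> (\<integral>\<^sup>+y. 1 \<partial>\<eta>)" unfolding c_def
    by (intro nn_integral_mono) (auto simp: indicator_def height_bounds)
  then have c: "c \<noteq> \<infinity>" by (auto simp: Y.emeasure_space_1 top_unique)
  let ?N1 = "distr (density (\<eta> \<Otimes>\<^sub>M S) (\<lambda>z. indicator B (fst z) * indicator E z)) S snd"
  let ?N2 = "density S (\<lambda>_. c)"
  have N1: "emeasure ?N1 C = (\<integral>\<^sup>+y. indicator B y * sec y C \<partial>\<eta>)" if [measurable]: "C \<in> sets S" for C
  proof -
    have "emeasure ?N1 C = (\<integral>\<^sup>+z. indicator C (snd z) \<partial>density (\<eta> \<Otimes>\<^sub>M S) (\<lambda>z. indicator B (fst z) * indicator E z))"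
      by (subst nn_integral_indicator[symmetric], simp, subst nn_integral_distr) auto
    also have "\<dots> = (\<integral>\<^sup>+z. indicator B (fst z) * indicator E z * indicator C (snd z) \<partial>(\<eta> \<Otimes>\<^sub>M S))"
      by (subst nn_integral_density) auto
    also have "\<dots> = (\<integral>\<^sup>+y. \<integral>\<^sup>+\<omega>. indicator B y * (indicator E (y, \<omega>) * indicator C \<omega>) \<partial>S \<partial>\<eta>)"
      by (subst P.nn_integral_fst[symmetric]) (auto simp: mult.assoc)
    also have "\<dots> = (\<integral>\<^sup>+y. indicator B y * sec y C \<partial>\<eta>)"
      unfolding sec_def by (rule nn_integral_cong) (subst nn_integral_cmult, auto)
    finally show ?thesis .
  qed
  have N2: "emeasure ?N2 C = c * emeasure S C" if [measurable]: "C \<in> sets S" for C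
    by (subst emeasure_density) (auto simp: nn_integral_cmult)
  have "?N2 = ?N1"
  proof (rule measure_eqI_PiM_infinite[where I=UNIV and M="\<lambda>_. M"])
    show "finite_measure ?N2"
      using c N2[of "space S"] by (intro finite_measureI) (simp add: P.emeasure_space_1)
    fix A and J :: "nat set" assume J: "finite J" and A: "\<And>i. i \<in> J \<Longrightarrow> A i \<in> sets M"
    define A' where "A' = (\<lambda>i. if i \<in> J then A i else space M)"
    have A': "A' i \<in> sets M" for i using A by (simp add: A'_def)
    obtain n where n: "\<And>i. i \<in> J \<Longrightarrow> i < n" using J by (meson finite_nat_bounded lessThan_iff subsetD)
    have eq: "prod_emb UNIV (\<lambda>_. M) J (Pi\<^sub>E J A) = {\<omega>\<in>space S. \<forall>i<n. \<omega> i \<in> A' i}"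
    proof -
      have "\<omega> i \<in> A i" if "\<forall>i<n. \<omega> i \<in> A' i" "i \<in> J" for \<omega> i
        using n[OF that(2)] that by (auto simp: A'_def)
      moreover have "x \<in> space M" if "i \<in> J" "x \<in> A i" for i x
        using sets.sets_into_space[OF A[OF that(1)]] that(2) by auto
      ultimately show ?thesis
        unfolding prod_emb_def by (auto simp: space_PiM PiE_iff A'_def extensional_def)
    qed
    let ?C = "{\<omega>\<in>space S. \<forall>i<n. \<omega> i \<in> A' i}"
    have C: "?C \<in> sets S" using A' by measurable
    have "(\<integral>\<^sup>+y. indicator B y * sec y ?C \<partial>\<eta>) = (\<integral>\<^sup>+y. (indicator B y * ennreal (height y)) * emeasure S ?C \<partial>\<eta>)"
      by (rule nn_integral_cong_AE, use sec_cylinder[of A' n, OF A'] in eventually_elim) (simp add: mult.assoc)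
    also have "\<dots> = c * emeasure S ?C" unfolding c_def by (rule nn_integral_multc) measurable
    finally show "emeasure ?N2 (prod_emb UNIV (\<lambda>_. M) J (Pi\<^sub>E J A)) = emeasure ?N1 (prod_emb UNIV (\<lambda>_. M) J (Pi\<^sub>E J A))"
      unfolding eq N1[OF C] N2[OF C] ..
  qed simp_all
  then show ?thesis using N1[OF assms(2)] N2[OF assms(2)] unfolding c_def by simp
qed

text \<open>By \<open>nn_integral_sec\<close> the restriction of the measure to \<open>E\<close> is
  the product of \<open>S\<close> with the measure of density \<open>height\<close>. Evaluated on
  \<open>E\<close> itself, this says that \<open>height\<close> and its square have the same
  integral, so \<open>height\<close> takes only the values 0 and 1. The set where it is 1 is almost
  invariant in the base.\<close>

lemma invariant_set_01: "Z.prob E = 0 \<or> Z.prob E = 1"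
proof -
  let ?h = "density \<eta> (\<lambda>y. ennreal (height y))"
  have "(\<integral>\<^sup>+y. ennreal (height y) \<partial>\<eta>) \<le> (\<integral>\<^sup>+y. 1 \<partial>\<eta>)"
    by (intro nn_integral_mono) (auto simp: height_bounds)
  then have fh: "(\<integral>\<^sup>+y. ennreal (height y) \<partial>\<eta>) \<noteq> \<infinity>" by (auto simp: Y.emeasure_space_1 top_unique)
  interpret H: finite_measure ?h
    using fh by (intro finite_measureI) (simp add: emeasure_density cong: nn_integral_cong)
  have eq: "?h \<Otimes>\<^sub>M S = density (\<eta> \<Otimes>\<^sub>M S) (indicator E)"
  proof (rule pair_measure_eqI)
    show "sigma_finite_measure ?h" "sigma_finite_measure S" by unfold_locales
    show "sets (?h \<Otimes>\<^sub>M S) = sets (density (\<eta> \<Otimes>\<^sub>M S) (indicator E))" by (simp cong: sets_pair_measure_cong)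
    fix B C assume "B \<in> sets ?h" and C [measurable]: "C \<in> sets S"
    then have B [measurable]: "B \<in> sets \<eta>" by simp
    have "emeasure (density (\<eta> \<Otimes>\<^sub>M S) (indicator E)) (B \<times> C) =
        (\<integral>\<^sup>+z. indicator E z * indicator (B \<times> C) z \<partial>(\<eta> \<Otimes>\<^sub>M S))"
      by (subst emeasure_density) auto
    also have "\<dots> = (\<integral>\<^sup>+y. \<integral>\<^sup>+\<omega>. indicator B y * (indicator E (y, \<omega>) * indicator C \<omega>) \<partial>S \<partial>\<eta>)"
      by (subst P.nn_integral_fst[symmetric]) (auto simp: indicator_times ac_simps)
    also have "\<dots> = (\<integral>\<^sup>+y. indicator B y * sec y C \<partial>\<eta>)"
      unfolding sec_def by (rule nn_integral_cong) (subst nn_integral_cmult, auto)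
    also have "\<dots> = emeasure ?h B * emeasure S C"
      unfolding nn_integral_sec[OF B C] by (subst emeasure_density) (auto simp: mult.commute)
    finally show "emeasure ?h B * emeasure S C = emeasure (density (\<eta> \<Otimes>\<^sub>M S) (indicator E)) (B \<times> C)" ..
  qed
  have PE: "emeasure (\<eta> \<Otimes>\<^sub>M S) E = (\<integral>\<^sup>+y. ennreal (height y) \<partial>\<eta>)"
  proof -
    have "emeasure (\<eta> \<Otimes>\<^sub>M S) E = (\<integral>\<^sup>+z. indicator E z \<partial>(\<eta> \<Otimes>\<^sub>M S))" by simp
    also have "\<dots> = (\<integral>\<^sup>+y. \<integral>\<^sup>+\<omega>. indicator E (y, \<omega>) \<partial>S \<partial>\<eta>)" by (subst P.nn_integral_fst[symmetric]) auto
    also have "\<dots> = (\<integral>\<^sup>+y. ennreal (height y) \<partial>\<eta>)"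
      unfolding ennreal_height sec_def by (intro nn_integral_cong) simp
    finally show ?thesis .
  qed
  have "emeasure (density (\<eta> \<Otimes>\<^sub>M S) (indicator E)) E = emeasure (\<eta> \<Otimes>\<^sub>M S) E"
    by (subst emeasure_density) (auto simp: indicator_inter_arith[symmetric])
  moreover have "emeasure (?h \<Otimes>\<^sub>M S) E = (\<integral>\<^sup>+y. ennreal (height y * height y) \<partial>\<eta>)"
  proof -
    have [measurable]: "E \<in> sets (?h \<Otimes>\<^sub>M S)" by (simp cong: sets_pair_measure_cong)
    have "emeasure (?h \<Otimes>\<^sub>M S) E = (\<integral>\<^sup>+z. indicator E z \<partial>(?h \<Otimes>\<^sub>M S))" by simp
    also have "\<dots> = (\<integral>\<^sup>+y. \<integral>\<^sup>+\<omega>. indicator E (y, \<omega>) \<partial>S \<partial>?h)" by (subst P.nn_integral_fst[symmetric]) auto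
    also have "\<dots> = (\<integral>\<^sup>+y. ennreal (height y) \<partial>?h)"
      unfolding ennreal_height sec_def by (intro nn_integral_cong) simp
    also have "\<dots> = (\<integral>\<^sup>+y. ennreal (height y) * ennreal (height y) \<partial>\<eta>)"
      by (subst nn_integral_density) auto
    finally show ?thesis by (simp add: ennreal_mult height_bounds)
  qed
  ultimately have e: "(\<integral>\<^sup>+y. ennreal (height y * height y) \<partial>\<eta>) = (\<integral>\<^sup>+y. ennreal (height y) \<partial>\<eta>)"
    using eq PE by simp
  have ih: "integrable \<eta> height" "integrable \<eta> (\<lambda>y. height y * height y)"
    by (auto intro!: Y.integrable_const_bound[of _ 1] simp: height_bounds abs_mult mult_le_one)
  have "(\<integral>y. height y - height y * height y \<partial>\<eta>) = 0"
  proof -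
    have "ennreal (\<integral>y. height y * height y \<partial>\<eta>) = ennreal (\<integral>y. height y \<partial>\<eta>)"
      using e ih by (simp add: nn_integral_eq_integral height_bounds)
    then have "(\<integral>y. height y * height y \<partial>\<eta>) = (\<integral>y. height y \<partial>\<eta>)"
      by (subst (asm) ennreal_inj) (auto simp: height_bounds)
    then show ?thesis using ih by simp
  qed
  then have "AE y in \<eta>. height y - height y * height y = 0"
    using ih height_bounds by (subst (asm) integral_nonneg_eq_0_iff_AE) (auto simp: mult_left_le)
  then have h01: "AE y in \<eta>. height y = 0 \<or> height y = 1" by eventually_elim auto
  define H where "H = {y\<in>space \<eta>. height y = 1}"
  have [measurable]: "H \<in> sets \<eta>" unfolding H_def by measurable
  have "AE y in \<eta>. AE g in M. act g y \<in> H \<longleftrightarrow> y \<in> H"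
    using height_invariant AE_space
  proof eventually_elim
    case (elim y)
    note [measurable] = elim(2)
    have "(\<lambda>g. act g y) \<in> M \<rightarrow>\<^sub>M \<eta>" by measurable
    from elim(1) AE_space show ?case
      by eventually_elim (use elim(2) measurable_space[OF \<open>(\<lambda>g. act g y) \<in> M \<rightarrow>\<^sub>M \<eta>\<close>] in \<open>auto simp: H_def\<close>)
  qed
  then have "Y.prob H = 0 \<or> Y.prob H = 1" by (intro invariant_01) auto
  moreover have "emeasure (\<eta> \<Otimes>\<^sub>M S) E = emeasure \<eta> H"
    unfolding PE
  proof (subst nn_integral_indicator[symmetric], simp, rule nn_integral_cong_AE)
    show "AE y in \<eta>. ennreal (height y) = indicator H y"
      using h01 AE_space by eventually_elim (auto simp: H_def)
  qed
  ultimately show ?thesis by (simp add: measure_def)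
qed

end

sublocale skew: ergodic_system "\<eta> \<Otimes>\<^sub>M S" skew
  by unfold_locales (rule invariant_set_01)

end

section \<open>Borel structures of quotient spaces\<close>

lemma blinfun_rational_approx:
  fixes f :: "'a::euclidean_space \<Rightarrow>\<^sub>L 'b::euclidean_space"
  assumes "0 < e"
  shows "\<exists>m\<in>Basis \<rightarrow>\<^sub>E (Basis \<rightarrow>\<^sub>E \<rat>). dist (blinfun_of_matrix m) f < e"
proof -
  \<comment> \<open>The operator norm is at most the sum of the moduli of the entries, and there are
    \<open>DIM('a) * DIM('b)\<close> of them.\<close>
  define d where "d = e / (2 * (real DIM('a) * real DIM('b)))"
  have d: "0 < d" using assms by (simp add: d_def)
  have "\<exists>r\<in>\<rat>. \<bar>r - f j \<bullet> i\<bar> < d" for i j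
    using Rats_dense_in_real[of "f j \<bullet> i - d" "f j \<bullet> i + d"] d by (force simp: abs_less_iff)
  then have "\<forall>i j. \<exists>r. r \<in> \<rat> \<and> \<bar>r - f j \<bullet> i\<bar> < d" by blast
  then obtain r where r: "\<And>i j. r i j \<in> \<rat>" "\<And>i j. \<bar>r i j - f j \<bullet> i\<bar> < d"
    unfolding choice_iff by blast
  define m where "m = (\<lambda>i\<in>Basis. \<lambda>j\<in>Basis. r i j)"
  have "blinfun_of_matrix m - f = blinfun_of_matrix (\<lambda>i j. m i j - f j \<bullet> i)"
    by (subst blinfun_of_matrix_works[of f, symmetric])
       (simp add: blinfun_of_matrix_minus fun_diff_def)
  then have "norm (blinfun_of_matrix m - f) \<le> (\<Sum>i\<in>Basis. \<Sum>j\<in>Basis. \<bar>m i j - f j \<bullet> i\<bar>)"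
    using norm_blinfun_of_matrix[of "\<lambda>i j. m i j - f j \<bullet> i"] by simp
  also have "\<dots> \<le> (\<Sum>i\<in>(Basis :: 'b set). \<Sum>j\<in>(Basis :: 'a set). d)"
    by (intro sum_mono) (use r(2) in \<open>auto simp: m_def intro: less_imp_le\<close>)
  also have "\<dots> = e / 2" by (simp add: d_def)
  finally have "dist (blinfun_of_matrix m) f < e" using assms by (simp add: dist_norm)
  moreover have "m \<in> Basis \<rightarrow>\<^sub>E (Basis \<rightarrow>\<^sub>E \<rat>)" using r(1) by (auto simp: m_def)
  ultimately show ?thesis by blast
qed

text \<open>Operators with rational matrices are dense, so the balls around them with radius
  \<open>1 / real (Suc n)\<close> form a countable basis. Second countability identifies the Borel
  sets of a product with the product of the Borel structures, on which the measurability of the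
  actions rests.\<close>

instance blinfun :: (euclidean_space, euclidean_space) second_countable_topology
proof
  let ?D = "blinfun_of_matrix ` (Basis \<rightarrow>\<^sub>E (Basis \<rightarrow>\<^sub>E \<rat>)) :: ('a \<Rightarrow>\<^sub>L 'b) set"
  let ?B = "(\<lambda>(d, n). ball d (1 / real (Suc n))) ` (?D \<times> (UNIV :: nat set))"
  have "countable ?D"
    by (intro countable_image countable_PiE finite_Basis countable_rat)
  then have "countable ?B" by auto
  moreover have "topological_basis ?B"
  proof (rule topological_basisI)
    show "open B" if "B \<in> ?B" for B using that by auto
    fix U :: "('a \<Rightarrow>\<^sub>L 'b) set" and x assume "open U" "x \<in> U"
    then obtain e where e: "0 < e" "ball x e \<subseteq> U" by (meson open_contains_ball)
    obtain n where n: "1 / real (Suc n) < e / 2" using e nat_approx_posE[of "e / 2"] by auto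
    obtain d where d: "d \<in> ?D" "dist d x < 1 / real (Suc n)"
      using blinfun_rational_approx[of "1 / real (Suc n)" x] by auto
    have "ball d (1 / real (Suc n)) \<subseteq> ball x e"
    proof
      fix y assume "y \<in> ball d (1 / real (Suc n))"
      then show "y \<in> ball x e" using d(2) n dist_triangle[of x y d] by (simp add: dist_commute)
    qed
    then show "\<exists>B\<in>?B. x \<in> B \<and> B \<subseteq> U"
      using d e by (intro bexI[of _ "ball d (1 / real (Suc n))"]) auto
  qed
  ultimately show "\<exists>B :: ('a \<Rightarrow>\<^sub>L 'b) set set. countable B \<and> open = generate_topology B"
    using topological_basis_imp_subbasis by blast
qed

lemma measurable_continuous_on_pair_restrict:
  fixes \<Phi> :: "'a::second_countable_topology \<times> 'b::second_countable_topology \<Rightarrow> 'c::topological_space"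
  assumes c: "continuous_on (A \<times> B) \<Phi>"
    and f: "f \<in> N \<rightarrow>\<^sub>M restrict_space borel A" and g: "g \<in> N \<rightarrow>\<^sub>M restrict_space borel B"
  shows "(\<lambda>x. \<Phi> (f x, g x)) \<in> borel_measurable N"
proof -
  have "(\<lambda>x. (f x, g x)) \<in> N \<rightarrow>\<^sub>M restrict_space borel (A \<times> B)"
    using f g unfolding measurable_restrict_space2_iff borel_prod[symmetric] by (auto simp: space_restrict_space)
  from measurable_compose[OF this borel_measurable_continuous_on_restrict[OF c]] show ?thesis .
qed

section \<open>Borel sets of a topology and open quotients\<close>

lemma space_borel_of: "space (borel_of T) = topspace T"
  unfolding borel_of_def by (rule space_measure_of) (auto dest: openin_subset)

lemma sets_borel_of: "sets (borel_of T) = sigma_sets (topspace T) {U. openin T U}"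
  unfolding borel_of_def using openin_subset[of T] by (intro sets_measure_of) auto

lemma openin_in_sets_borel_of: "openin T U \<Longrightarrow> U \<in> sets (borel_of T)"
  unfolding sets_borel_of by auto

lemma continuous_map_measurable:
  assumes "continuous_map T euclideanreal f"
  shows "f \<in> borel_measurable (borel_of T)"
proof (rule borel_measurableI)
  fix U :: "real set" assume "open U"
  then have "openin T {x \<in> topspace T. f x \<in> U}" using assms by (auto simp: continuous_map_def)
  moreover have "f -` U \<inter> space (borel_of T) = {x \<in> topspace T. f x \<in> U}" by (auto simp: space_borel_of)
  ultimately show "f -` U \<inter> space (borel_of T) \<in> sets (borel_of T)"
    by (simp add: openin_in_sets_borel_of)
qed

lemma measurable_borel_ofI:
  assumes "f \<in> space N \<rightarrow> topspace T" and "\<And>U. openin T U \<Longrightarrow> f -` U \<inter> space N \<in> sets N"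
  shows "f \<in> N \<rightarrow>\<^sub>M borel_of T"
  unfolding borel_of_def by (rule measurable_measure_of) (use assms in \<open>auto dest: openin_subset\<close>)

text \<open>A quotient by an open map, which covers both P(V) - P(W) and P(V/W). Functions on the
  quotient are written through a choice \<open>rep\<close> of representatives. Nothing is claimed
  about the measurability of \<open>rep\<close> itself; it occurs only inside expressions that are
  \<open>invariant\<close>.\<close>

locale open_quotient =
  fixes D :: "'v::second_countable_topology set" and q :: "'v \<Rightarrow> 'q"
  assumes open_D: "open D" and open_saturation: "open U \<Longrightarrow> U \<subseteq> D \<Longrightarrow> open {v\<in>D. q v \<in> q ` U}"
begin

definition T where "T = quotient_topology (top_of_set D) q"
definition Y where "Y = borel_of T"
definition rep where "rep y = (SOME v. v \<in> D \<and> q v = y)"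

lemma topspace_T: "topspace T = q ` D"
  unfolding T_def by (simp add: topspace_quotient_topology)

lemma space_Y: "space Y = q ` D"
  unfolding Y_def by (simp add: space_borel_of topspace_T)

lemma q_in_space_Y: "v \<in> D \<Longrightarrow> q v \<in> space Y"
  by (auto simp: space_Y)

lemma rep: assumes "y \<in> q ` D" shows "rep y \<in> D" "q (rep y) = y"
proof -
  have "\<exists>v. v \<in> D \<and> q v = y" using assms by auto
  from someI_ex[OF this] show "rep y \<in> D" "q (rep y) = y" unfolding rep_def by auto
qed

lemma rep_q: "v \<in> D \<Longrightarrow> rep (q v) \<in> D" "v \<in> D \<Longrightarrow> q (rep (q v)) = q v"
  using rep by auto

lemma openin_T: "openin T U \<longleftrightarrow> U \<subseteq> q ` D \<and> open {v\<in>D. q v \<in> U}"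
  unfolding T_def openin_quotient_topology
  by (auto simp: openin_open_eq[OF open_D] topspace_euclidean_subtopology)

lemma openin_image: "open U \<Longrightarrow> U \<subseteq> D \<Longrightarrow> openin T (q ` U)"
  unfolding openin_T using open_saturation[of U] by auto

lemma q_measurable: "q \<in> restrict_space borel D \<rightarrow>\<^sub>M Y"
  unfolding Y_def
proof (rule measurable_borel_ofI)
  show "q \<in> space (restrict_space borel D) \<rightarrow> topspace T" by (auto simp: topspace_T space_restrict_space)
  fix U assume "openin T U"
  then have "open {v\<in>D. q v \<in> U}" by (simp add: openin_T)
  moreover have "q -` U \<inter> space (restrict_space borel D) = {v\<in>D. q v \<in> U}" by (auto simp: space_restrict_space)
  ultimately show "q -` U \<inter> space (restrict_space borel D) \<in> sets (restrict_space borel D)"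
    using open_D by (subst sets_restrict_space_iff) (auto simp: borel_open)
qed

definition invariant :: "('v \<Rightarrow> 'z) \<Rightarrow> bool" where
  "invariant F \<longleftrightarrow> (\<forall>v\<in>D. \<forall>v'\<in>D. q v = q v' \<longrightarrow> F v = F v')"

lemma invariant_rep: "invariant F \<Longrightarrow> v \<in> D \<Longrightarrow> F (rep (q v)) = F v"
  using rep_q unfolding invariant_def by blast

text \<open>An open set of pairs is a countable union of basic rectangles, and the image of a
  rectangle stays measurable because \<open>q\<close> maps open sets to open sets. Invariance makes
  the choice of the representative irrelevant. The result lies in the product of the two Borel
  structures, which is where convolution with a measure takes place.\<close>

lemma saturated_set_measurable:
  fixes G :: "'g::second_countable_topology set"
  assumes O: "open \<Omega>" and inv: "\<And>g. g \<in> G \<Longrightarrow> invariant (\<lambda>v. (g, v) \<in> \<Omega>)"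
  shows "{(g, y). g \<in> G \<and> y \<in> q ` D \<and> (g, rep y) \<in> \<Omega>} \<in> sets (restrict_space borel G \<Otimes>\<^sub>M Y)"
proof -
  obtain BA :: "'g set set" where BA: "countable BA" "topological_basis BA" using ex_countable_basis by blast
  obtain BB :: "'v set set" where BB: "countable BB" "topological_basis BB" using ex_countable_basis by blast
  define R where "R = {r \<in> BA \<times> BB. fst r \<times> snd r \<subseteq> \<Omega>}"
  have cR: "countable R"
    by (rule countable_subset[of _ "BA \<times> BB"]) (use BA BB in \<open>auto simp: R_def\<close>)
  have "{(g, y). g \<in> G \<and> y \<in> q ` D \<and> (g, rep y) \<in> \<Omega>} =
      (\<Union>r\<in>R. (fst r \<inter> G) \<times> q ` (snd r \<inter> D))" (is "?L = ?RR")
  proof (intro equalityI subsetI)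
    fix z assume "z \<in> ?L"
    then obtain g y where z: "z = (g, y)" "g \<in> G" "y \<in> q ` D" "(g, rep y) \<in> \<Omega>" by auto
    obtain A0 B0 where AB: "open A0" "open B0" "g \<in> A0" "rep y \<in> B0" "A0 \<times> B0 \<subseteq> \<Omega>"
      using O z(4) by (auto elim!: open_prod_elim)
    obtain A where A: "A \<in> BA" "g \<in> A" "A \<subseteq> A0" using topological_basisE[OF BA(2) AB(1,3)] by blast
    obtain B where B: "B \<in> BB" "rep y \<in> B" "B \<subseteq> B0" using topological_basisE[OF BB(2) AB(2,4)] by blast
    have "(A, B) \<in> R" using A B AB(5) unfolding R_def by auto
    moreover have "z \<in> (fst (A, B) \<inter> G) \<times> q ` (snd (A, B) \<inter> D)"
      using z(1,2) A(2) B(2) rep[OF z(3)] by (auto intro!: image_eqI[of _ _ "rep y"])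
    ultimately show "z \<in> ?RR" by (rule UN_I)
  next
    fix z assume "z \<in> ?RR"
    then obtain r g v where z: "r \<in> R" "z = (g, q v)" "g \<in> fst r" "g \<in> G" "v \<in> snd r" "v \<in> D"
      by (elim UN_E SigmaE imageE) blast
    then have "(g, v) \<in> \<Omega>" unfolding R_def by blast
    then have "(g, rep (q v)) \<in> \<Omega>" using invariant_rep[OF inv[OF z(4)] z(6)] by simp
    then show "z \<in> ?L" using z by simp
  qed
  moreover have "(fst r \<inter> G) \<times> q ` (snd r \<inter> D) \<in> sets (restrict_space borel G \<Otimes>\<^sub>M Y)" if "r \<in> R" for r
  proof (rule pair_measureI)
    have o: "open (fst r)" "open (snd r)"
      using that topological_basis_open[OF BA(2), of "fst r"] topological_basis_open[OF BB(2), of "snd r"]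
      by (simp_all add: R_def mem_Times_iff)
    show "fst r \<inter> G \<in> sets (restrict_space borel G)"
      using o by (auto simp: sets_restrict_space Int_commute)
    show "q ` (snd r \<inter> D) \<in> sets Y"
      unfolding Y_def using o open_D by (intro openin_in_sets_borel_of openin_image) auto
  qed
  ultimately show ?thesis by (simp only:) (rule sets.countable_UN''[OF cR])
qed

lemma rep_measurable_real:
  fixes G :: "'g::second_countable_topology set" and \<Phi> :: "'g \<Rightarrow> 'v \<Rightarrow> real"
  assumes c: "continuous_on (G \<times> D) (\<lambda>(g, v). \<Phi> g v)" and inv: "\<And>g. g \<in> G \<Longrightarrow> invariant (\<Phi> g)"
  shows "(\<lambda>(g, y). \<Phi> g (rep y)) \<in> borel_measurable (restrict_space borel G \<Otimes>\<^sub>M Y)"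
proof (rule borel_measurable_iff_greater[THEN iffD2], rule allI)
  fix a :: real
  have "openin (top_of_set (G \<times> D)) {z \<in> G \<times> D. (\<lambda>(g, v). \<Phi> g v) z \<in> {a<..}}"
    using continuous_openin_preimage_gen[OF c, of "{a<..}"] by (simp add: vimage_def Int_def)
  then obtain \<Omega> where O: "open \<Omega>" "{z \<in> G \<times> D. (\<lambda>(g, v). \<Phi> g v) z \<in> {a<..}} = (G \<times> D) \<inter> \<Omega>"
    by (auto simp: openin_open)
  have iff: "(g, v) \<in> \<Omega> \<longleftrightarrow> a < \<Phi> g v" if "g \<in> G" "v \<in> D" for g v
  proof -
    have "(g, v) \<in> {z \<in> G \<times> D. (\<lambda>(g, v). \<Phi> g v) z \<in> {a<..}} \<longleftrightarrow> (g, v) \<in> (G \<times> D) \<inter> \<Omega>"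
      by (simp only: O(2))
    then show ?thesis using that by simp
  qed
  have "{(g, y). g \<in> G \<and> y \<in> q ` D \<and> (g, rep y) \<in> \<Omega>} \<in> sets (restrict_space borel G \<Otimes>\<^sub>M Y)"
  proof (rule saturated_set_measurable[OF O(1)])
    fix g assume g: "g \<in> G"
    show "invariant (\<lambda>v. (g, v) \<in> \<Omega>)"
      unfolding invariant_def
    proof (intro ballI impI)
      fix v v' assume v: "v \<in> D" "v' \<in> D" "q v = q v'"
      have "\<Phi> g v = \<Phi> g v'" using inv[OF g] v unfolding invariant_def by blast
      then show "((g, v) \<in> \<Omega>) = ((g, v') \<in> \<Omega>)" by (simp only: iff[OF g v(1)] iff[OF g v(2)])
    qed
  qed
  moreover have "{(g, y). g \<in> G \<and> y \<in> q ` D \<and> (g, rep y) \<in> \<Omega>} =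
      {z \<in> space (restrict_space borel G \<Otimes>\<^sub>M Y). a < (\<lambda>(g, y). \<Phi> g (rep y)) z}"
    by (auto simp: space_pair_measure space_restrict_space space_Y iff rep_q)
  ultimately show "{z \<in> space (restrict_space borel G \<Otimes>\<^sub>M Y). a < (\<lambda>(g, y). \<Phi> g (rep y)) z}
      \<in> sets (restrict_space borel G \<Otimes>\<^sub>M Y)" by simp
qed

lemma continuous_map_rep:
  fixes F :: "'v \<Rightarrow> real"
  assumes c: "continuous_on D F" and inv: "invariant F"
  shows "continuous_map T euclideanreal (\<lambda>y. F (rep y))"
  unfolding continuous_map_def
proof (intro conjI allI impI)
  fix U :: "real set" assume "openin euclideanreal U"
  then have "open (D \<inter> F -` U)" using c open_D by (simp add: continuous_open_preimage)
  moreover have "{v\<in>D. q v \<in> {y \<in> topspace T. F (rep y) \<in> U}} = {v\<in>D. F (rep (q v)) \<in> U}"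
    by (auto simp: topspace_T)
  moreover have "{v\<in>D. F (rep (q v)) \<in> U} = D \<inter> F -` U"
    by (auto simp: invariant_rep[OF inv])
  moreover have "{y \<in> topspace T. F (rep y) \<in> U} \<subseteq> q ` D" unfolding topspace_T by blast
  ultimately show "openin T {y \<in> topspace T. F (rep y) \<in> U}" by (simp only: openin_T)
qed auto

lemma rep_measurable_action:
  fixes G :: "'g::second_countable_topology set" and \<psi> :: "'g \<Rightarrow> 'v \<Rightarrow> 'v"
  assumes c: "continuous_on (G \<times> D) (\<lambda>(g, v). \<psi> g v)"
    and m: "\<And>g v. g \<in> G \<Longrightarrow> v \<in> D \<Longrightarrow> \<psi> g v \<in> D"
    and inv: "\<And>g. g \<in> G \<Longrightarrow> invariant (\<lambda>v. q (\<psi> g v))"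
  shows "(\<lambda>(g, y). q (\<psi> g (rep y))) \<in> restrict_space borel G \<Otimes>\<^sub>M Y \<rightarrow>\<^sub>M Y"
  unfolding Y_def
proof (rule measurable_borel_ofI, unfold Y_def[symmetric])
  show "(\<lambda>(g, y). q (\<psi> g (rep y))) \<in> space (restrict_space borel G \<Otimes>\<^sub>M Y) \<rightarrow> topspace T"
    using m rep by (auto simp: space_pair_measure space_restrict_space space_Y topspace_T)
  fix U assume "openin T U"
  then have "open {v\<in>D. q v \<in> U}" by (simp add: openin_T)
  then have "openin (top_of_set (G \<times> D)) ((G \<times> D) \<inter> (\<lambda>(g, v). \<psi> g v) -` {v\<in>D. q v \<in> U})"
    by (rule continuous_openin_preimage_gen[OF c])
  then obtain \<Omega> where O: "open \<Omega>" "(G \<times> D) \<inter> (\<lambda>(g, v). \<psi> g v) -` {v\<in>D. q v \<in> U} = (G \<times> D) \<inter> \<Omega>"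
    by (auto simp: openin_open)
  have iff: "(g, v) \<in> \<Omega> \<longleftrightarrow> q (\<psi> g v) \<in> U" if "g \<in> G" "v \<in> D" for g v
  proof -
    have "(g, v) \<in> (G \<times> D) \<inter> (\<lambda>(g, v). \<psi> g v) -` {v\<in>D. q v \<in> U} \<longleftrightarrow> (g, v) \<in> (G \<times> D) \<inter> \<Omega>"
      by (simp only: O(2))
    then show ?thesis using that m[OF that] by simp
  qed
  have "{(g, y). g \<in> G \<and> y \<in> q ` D \<and> (g, rep y) \<in> \<Omega>} \<in> sets (restrict_space borel G \<Otimes>\<^sub>M Y)"
  proof (rule saturated_set_measurable[OF O(1)])
    fix g assume g: "g \<in> G"
    show "invariant (\<lambda>v. (g, v) \<in> \<Omega>)"
      unfolding invariant_def
    proof (intro ballI impI)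
      fix v v' assume v: "v \<in> D" "v' \<in> D" "q v = q v'"
      have "q (\<psi> g v) = q (\<psi> g v')" using inv[OF g] v unfolding invariant_def by blast
      then show "((g, v) \<in> \<Omega>) = ((g, v') \<in> \<Omega>)" by (simp only: iff[OF g v(1)] iff[OF g v(2)])
    qed
  qed
  moreover have "{(g, y). g \<in> G \<and> y \<in> q ` D \<and> (g, rep y) \<in> \<Omega>} =
      (\<lambda>(g, y). q (\<psi> g (rep y))) -` U \<inter> space (restrict_space borel G \<Otimes>\<^sub>M Y)"
    by (auto simp: space_pair_measure space_restrict_space space_Y iff rep_q)
  ultimately show "(\<lambda>(g, y). q (\<psi> g (rep y))) -` U \<inter> space (restrict_space borel G \<Otimes>\<^sub>M Y)
      \<in> sets (restrict_space borel G \<Otimes>\<^sub>M Y)" by simp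
qed

end

section \<open>The geometry of a subspace and its stabilizer\<close>

lemma bounded_linear_inv_blinfun:
  fixes g :: "'v::euclidean_space \<Rightarrow>\<^sub>L 'v"
  assumes "bij (blinfun_apply g)"
  shows "bounded_linear (inv (blinfun_apply g))"
proof -
  have s: "blinfun_apply g (inv (blinfun_apply g) x) = x" for x
    using assms by (simp add: bij_is_surj surj_f_inv_f)
  have i: "inv (blinfun_apply g) (blinfun_apply g x) = x" for x
    using assms by (simp add: bij_is_inj inv_f_f)
  have "linear (inv (blinfun_apply g))"
  proof (rule linearI)
    fix x y r
    have "blinfun_apply g (inv (blinfun_apply g) x + inv (blinfun_apply g) y) = x + y"
      by (simp add: blinfun.add_right s)
    then show "inv (blinfun_apply g) (x + y) = inv (blinfun_apply g) x + inv (blinfun_apply g) y"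
      by (metis i)
    have "blinfun_apply g (r *\<^sub>R inv (blinfun_apply g) x) = r *\<^sub>R x"
      by (simp add: blinfun.scaleR_right s)
    then show "inv (blinfun_apply g) (r *\<^sub>R x) = r *\<^sub>R inv (blinfun_apply g) x"
      by (metis i)
  qed
  then show ?thesis by (simp add: linear_conv_bounded_linear)
qed

locale subspace_setup = normed_space_over scl
  for scl :: "'k::{real_normed_field,euclidean_space} \<Rightarrow> 'v::euclidean_space \<Rightarrow> 'v" +
  fixes W :: "'v set"
  assumes subspace_W: "subspace W"
begin

abbreviation G where "G \<equiv> stabilizer scl W"

lemma real_subspace_W: "real_vector.subspace W"
  unfolding real_vector.subspace_def
  using subspace_W subspace_scale[OF subspace_W] unfolding subspace_def
  by (metis scale_of_real)

lemma W_0: "0 \<in> W" using real_subspace_W by (rule real_vector.subspace_0)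
lemma W_add: "x \<in> W \<Longrightarrow> y \<in> W \<Longrightarrow> x + y \<in> W" using real_subspace_W by (rule real_vector.subspace_add)
lemma W_diff: "x \<in> W \<Longrightarrow> y \<in> W \<Longrightarrow> x - y \<in> W" using real_subspace_W by (rule real_vector.subspace_diff)
lemma W_minus: "x \<in> W \<Longrightarrow> - x \<in> W" using real_subspace_W by (rule real_vector.subspace_neg)
lemma W_scl: "x \<in> W \<Longrightarrow> scl c x \<in> W" using subspace_W by (rule subspace_scale)

lemma W_add_iff: "w \<in> W \<Longrightarrow> v + w \<in> W \<longleftrightarrow> v \<in> W"
  using W_add[of v w] W_diff[of "v + w" w] by auto

lemma scl_scl_inverse: "c \<noteq> 0 \<Longrightarrow> scl (inverse c) (scl c v) = v"
  by (simp add: scale_scale)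

lemma W_scl_iff: "c \<noteq> 0 \<Longrightarrow> scl c v \<in> W \<longleftrightarrow> v \<in> W"
  using W_scl[of v c] W_scl[of "scl c v" "inverse c"] by (auto simp: scl_scl_inverse)

lemma closed_W: "closed W" by (rule closed_subspace[OF real_subspace_W])
lemma convex_W: "convex W" by (rule subspace_imp_convex[OF real_subspace_W])

lemma W_nonempty: "W \<noteq> {}"
  using W_0 by auto

lemma open_compl_W: "open (- W)"
  using closed_W by (simp add: open_Compl)

lemma bounded_linear_scl: "bounded_linear (scl c)"
proof (rule bounded_linear_intro[of _ "norm c"])
  show "scl c (r *\<^sub>R x) = r *\<^sub>R scl c x" for r x
    unfolding scale_of_real[symmetric] by (rule scale_left_commute)
qed (auto simp: scale_right_distrib norm_scale mult.commute)

text \<open>The orthogonal projection to \<open>W\<close>. As a closest point it commutes with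
  translations by \<open>W\<close> and with \<open>scl\<close>, since closest points are unique. The
  map \<open>perp\<close> depends only on the coset of \<open>v\<close> and so provides a section of
  V over V/W, and \<open>del\<close> is the quotient norm (\<open>coset_norm_coset\<close>).\<close>

definition pr :: "'v \<Rightarrow> 'v" where "pr v = closest_point W v"
definition perp :: "'v \<Rightarrow> 'v" where "perp v = v - pr v"
definition del :: "'v \<Rightarrow> real" where "del v = norm (perp v)"

lemma pr_in: "pr v \<in> W"
  unfolding pr_def by (rule closest_point_in_set[OF closed_W W_nonempty])

lemma del_le: "w \<in> W \<Longrightarrow> del v \<le> norm (v - w)"
  using closest_point_le[OF closed_W, of w v] by (simp add: del_def perp_def pr_def dist_norm)

lemma pr_eqI: "x \<in> W \<Longrightarrow> (\<And>w. w \<in> W \<Longrightarrow> norm (v - x) \<le> norm (v - w)) \<Longrightarrow> pr v = x"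
  unfolding pr_def
  by (rule closest_point_unique[OF convex_W closed_W, symmetric]) (auto simp: dist_norm)

lemma pr_add: assumes w: "w \<in> W" shows "pr (v + w) = pr v + w"
proof (rule pr_eqI)
  show "pr v + w \<in> W" by (intro W_add pr_in w)
  fix u assume "u \<in> W"
  then have "norm (v - pr v) \<le> norm (v - (u - w))"
    using del_le[of "u - w" v] W_diff w by (simp add: del_def perp_def)
  then show "norm (v + w - (pr v + w)) \<le> norm (v + w - u)" by (simp add: algebra_simps)
qed

lemma pr_scl: "pr (scl c v) = scl c (pr v)"
proof (cases "c = 0")
  case True
  then show ?thesis using W_0 by (auto intro!: pr_eqI)
next
  case False
  show ?thesis
  proof (rule pr_eqI)
    show "scl c (pr v) \<in> W" by (intro W_scl pr_in)
    fix u assume "u \<in> W"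
    then have "norm (v - pr v) \<le> norm (v - scl (inverse c) u)"
      using del_le[of "scl (inverse c) u" v] W_scl by (simp add: del_def perp_def)
    then have "norm c * norm (v - pr v) \<le> norm c * norm (v - scl (inverse c) u)"
      by (intro mult_left_mono) auto
    then show "norm (scl c v - scl c (pr v)) \<le> norm (scl c v - u)"
      using False by (simp add: norm_scale[symmetric] scale_right_diff_distrib scale_scale)
  qed
qed

lemma perp_add: "w \<in> W \<Longrightarrow> perp (v + w) = perp v"
  by (simp add: perp_def pr_add)
lemma perp_scl: "perp (scl c v) = scl c (perp v)"
  by (simp add: perp_def pr_scl scale_right_diff_distrib)
lemma pr_plus_perp: "pr v + perp v = v"
  by (simp add: perp_def)
lemma perp_eq: "perp v = v + (- pr v)"
  by (simp add: perp_def)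
lemma perp_perp: "perp (perp v) = perp v"
  unfolding perp_eq[of v] by (rule perp_add[of "- pr v" v, unfolded perp_eq[of v]]) (rule W_minus[OF pr_in])
lemma del_add: "w \<in> W \<Longrightarrow> del (v + w) = del v"
  by (simp add: del_def perp_add)
lemma del_scl: "del (scl c v) = norm c * del v"
  by (simp add: del_def perp_scl norm_scale)
lemma del_perp: "del (perp v) = del v"
  by (simp add: del_def perp_perp)
lemma del_nonneg: "0 \<le> del v"
  by (simp add: del_def)
lemma del_le_norm: "del v \<le> norm v"
  using del_le[OF W_0, of v] by simp

lemma del_eq_0_iff: "del v = 0 \<longleftrightarrow> v \<in> W"
proof
  assume "del v = 0"
  then have "v = pr v" by (simp add: del_def perp_def)
  then show "v \<in> W" using pr_in[of v] by simp
next
  assume "v \<in> W"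
  then show "del v = 0" using del_le[of v v] del_nonneg[of v] by simp
qed

lemma del_pos: "v \<notin> W \<Longrightarrow> 0 < del v"
  using del_eq_0_iff[of v] del_nonneg[of v] by linarith

lemma perp_notin: "v \<notin> W \<Longrightarrow> perp v \<notin> W"
  using del_eq_0_iff[of "perp v"] del_eq_0_iff[of v] by (simp add: del_perp)

lemma norm_pr_le: "norm (pr v) \<le> 2 * norm v"
proof -
  have "norm (pr v) \<le> norm v + norm (perp v)"
    using norm_triangle_ineq4[of v "perp v"] by (simp add: perp_def)
  then show ?thesis using del_le_norm[of v] by (simp add: del_def)
qed

lemma continuous_on_pr: "continuous_on A pr"
  unfolding pr_def[abs_def] by (rule continuous_on_closest_point[OF convex_W closed_W W_nonempty])
lemma continuous_on_perp: "continuous_on A perp"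
  unfolding perp_def[abs_def] by (intro continuous_intros continuous_on_pr)
lemma continuous_on_del: "continuous_on A del"
  unfolding del_def[abs_def] by (intro continuous_intros continuous_on_perp)

lemma coset_norm_coset: "coset_norm (coset W v) = del v"
  unfolding coset_norm_def
proof (rule cInf_eq_minimum)
  have "perp v \<in> coset W v"
    unfolding coset_def perp_eq by (rule imageI) (rule W_minus[OF pr_in])
  then show "del v \<in> norm ` coset W v" by (auto simp: del_def)
  show "del v \<le> x" if x: "x \<in> norm ` coset W v" for x
  proof -
    obtain w where "w \<in> W" "x = norm (v + w)" using x unfolding coset_def by blast
    then show ?thesis using del_le[of "- w" v] W_minus by simp
  qed
qed

section \<open>The stabilizer, operator sizes and growth bounds\<close>

lemma G_linear: "g \<in> G \<Longrightarrow> Vector_Spaces.linear scl scl (blinfun_apply g)"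
  by (simp add: stabilizer_def GL_def)
lemma G_bij: "g \<in> G \<Longrightarrow> bij (blinfun_apply g)"
  by (simp add: stabilizer_def GL_def)
lemma G_image: "g \<in> G \<Longrightarrow> blinfun_apply g ` W = W"
  by (simp add: stabilizer_def)
lemma G_scl: assumes "g \<in> G" shows "blinfun_apply g (scl c v) = scl c (blinfun_apply g v)"
proof -
  interpret Vector_Spaces.linear scl scl "blinfun_apply g" by (rule G_linear[OF assms])
  show ?thesis by (rule scale)
qed
lemma G_in_W: "g \<in> G \<Longrightarrow> w \<in> W \<Longrightarrow> blinfun_apply g w \<in> W"
  using G_image[of g] by blast

lemma G_in_W_iff: "g \<in> G \<Longrightarrow> blinfun_apply g v \<in> W \<longleftrightarrow> v \<in> W"
  using inj_image_mem_iff[OF bij_is_inj[OF G_bij], of g v W] G_image[of g] by simp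

lemma id_in_G: "id_blinfun \<in> G"
  unfolding stabilizer_def GL_def by (simp add: linear_ident bij_def)

lemma compose_in_G: assumes g: "g \<in> G" and h: "h \<in> G" shows "g o\<^sub>L h \<in> G"
proof -
  have e: "blinfun_apply (g o\<^sub>L h) = blinfun_apply g \<circ> blinfun_apply h" by auto
  have "Vector_Spaces.linear scl scl (blinfun_apply (g o\<^sub>L h))"
    unfolding e using Vector_Spaces.linear_compose[OF G_linear[OF h] G_linear[OF g]] .
  moreover have "bij (blinfun_apply (g o\<^sub>L h))"
    unfolding e by (rule bij_comp[OF G_bij[OF h] G_bij[OF g]])
  moreover have "blinfun_apply (g o\<^sub>L h) ` W = W"
    unfolding e image_comp[symmetric] using G_image[OF g] G_image[OF h] by simp
  ultimately show ?thesis by (simp add: stabilizer_def GL_def)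
qed

definition size :: "('v \<Rightarrow>\<^sub>L 'v) \<Rightarrow> real" where
  "size g = max (norm g) (onorm (inv (blinfun_apply g)))"

lemma norm_le_size: "norm g \<le> size g" by (simp add: size_def)

lemma norm_apply_le: "norm (blinfun_apply g v) \<le> size g * norm v"
  using norm_blinfun[of g v] mult_right_mono[OF norm_le_size[of g] norm_ge_zero[of v]] by linarith

lemma norm_inv_le:
  assumes "g \<in> G" shows "norm (inv (blinfun_apply g) v) \<le> size g * norm v"
proof -
  have "norm (inv (blinfun_apply g) v) \<le> onorm (inv (blinfun_apply g)) * norm v"
    by (rule onorm[OF bounded_linear_inv_blinfun[OF G_bij[OF assms]]])
  also have "\<dots> \<le> size g * norm v" by (rule mult_right_mono) (auto simp: size_def)
  finally show ?thesis .
qed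

lemma inv_apply: "g \<in> G \<Longrightarrow> inv (blinfun_apply g) (blinfun_apply g v) = v"
  using G_bij[of g] by (simp add: bij_is_inj inv_f_f)

lemma norm_le_apply: "g \<in> G \<Longrightarrow> norm v \<le> size g * norm (blinfun_apply g v)"
  using norm_inv_le[of g "blinfun_apply g v"] by (simp add: inv_apply)

text \<open>Applying \<open>g\<close> and then its inverse shows that the square of
  \<open>size g\<close> is at least 1. Thus \<open>ln (size g)\<close> is nonnegative and can serve
  as a dominating function.\<close>

lemma size_ge_1: assumes "g \<in> G" shows "1 \<le> size g"
proof (rule ccontr)
  assume "\<not> 1 \<le> size g"
  moreover have s0: "0 \<le> size g" using norm_le_size[of g] norm_ge_zero[of g] by linarith
  ultimately have s: "size g * size g < 1" using mult_strict_mono'[of "size g" 1 "size g" 1] by simp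
  obtain v :: 'v where v: "v \<in> Basis" using nonempty_Basis by blast
  then have n: "norm v = 1" by simp
  have "norm v \<le> size g * (size g * norm v)"
    using norm_le_apply[OF assms, of v] mult_left_mono[OF norm_apply_le[of g v] s0] by linarith
  then show False using s n by simp
qed

lemma size_id: "size id_blinfun \<le> 1"
proof -
  have "inv (blinfun_apply (id_blinfun :: 'v \<Rightarrow>\<^sub>L 'v)) = (\<lambda>x. x)"
    by (rule inv_equality) auto
  then show ?thesis by (simp add: size_def onorm_id_le norm_blinfun_id_le)
qed

lemma size_compose: assumes g: "g \<in> G" and h: "h \<in> G" shows "size (g o\<^sub>L h) \<le> size g * size h"
proof -
  have e: "blinfun_apply (g o\<^sub>L h) = blinfun_apply g \<circ> blinfun_apply h" by auto
  have p: "0 \<le> size g" "0 \<le> size h" using size_ge_1[OF g] size_ge_1[OF h] by auto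
  have "norm (g o\<^sub>L h) \<le> size g * size h"
    using norm_blinfun_compose[of g h] mult_mono[OF norm_le_size[of g] norm_le_size[of h] p(1) norm_ge_zero]
    by linarith
  moreover have "onorm (inv (blinfun_apply (g o\<^sub>L h))) \<le> size g * size h"
  proof (rule onorm_bound)
    show "0 \<le> size g * size h" using p by simp
    fix v
    have "inv (blinfun_apply (g o\<^sub>L h)) v = inv (blinfun_apply h) (inv (blinfun_apply g) v)"
      unfolding e o_inv_distrib[OF G_bij[OF g] G_bij[OF h]] by simp
    then have "norm (inv (blinfun_apply (g o\<^sub>L h)) v) \<le> size h * norm (inv (blinfun_apply g) v)"
      using norm_inv_le[OF h] by simp
    also have "\<dots> \<le> size h * (size g * norm v)" by (rule mult_left_mono[OF norm_inv_le[OF g] p(2)])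
    finally show "norm (inv (blinfun_apply (g o\<^sub>L h)) v) \<le> size g * size h * norm v" by (simp add: ac_simps)
  qed
  ultimately show ?thesis by (simp add: size_def[of "g o\<^sub>L h"])
qed

lemma apply_eq: "blinfun_apply g v = blinfun_apply g (perp v) + blinfun_apply g (pr v)"
  using blinfun.add_right[of g "perp v" "pr v"] pr_plus_perp[of v] by (simp add: add.commute)

lemma del_apply_perp: "g \<in> G \<Longrightarrow> del (blinfun_apply g (perp v)) = del (blinfun_apply g v)"
  unfolding apply_eq[of g v] by (rule del_add[symmetric]) (intro G_in_W pr_in)

lemma del_apply_le: assumes "g \<in> G" shows "del (blinfun_apply g v) \<le> size g * del v"
proof -
  have "del (blinfun_apply g v) \<le> norm (blinfun_apply g (perp v))"
    using del_le_norm[of "blinfun_apply g (perp v)"] del_apply_perp[OF assms, of v] by simp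
  also have "\<dots> \<le> size g * norm (perp v)" by (rule norm_apply_le)
  finally show ?thesis by (simp add: del_def)
qed

text \<open>As \<open>g\<close> maps \<open>W\<close> onto itself, the point of \<open>W\<close>
  closest to the image of \<open>v\<close> is itself the image of some \<open>w\<close> in
  \<open>W\<close>, and \<open>v - w\<close> is recovered from \<open>perp\<close> of the image by
  the inverse of \<open>g\<close>.\<close>

lemma del_le_apply: assumes g: "g \<in> G" shows "del v \<le> size g * del (blinfun_apply g v)"
proof -
  have "pr (blinfun_apply g v) \<in> blinfun_apply g ` W" unfolding G_image[OF g] by (rule pr_in)
  then obtain w where w: "w \<in> W" "blinfun_apply g w = pr (blinfun_apply g v)" by (elim imageE) simp
  have "blinfun_apply g (v - w) = perp (blinfun_apply g v)" by (simp add: blinfun.diff_right w perp_def)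
  then have "norm (v - w) \<le> size g * del (blinfun_apply g v)"
    using norm_le_apply[OF g, of "v - w"] by (simp add: del_def)
  then show ?thesis using del_le[OF w(1), of v] by linarith
qed

lemma abs_ln_del_ratio_le:
  assumes g: "g \<in> G" and v: "v \<notin> W"
  shows "\<bar>ln (del (blinfun_apply g v) / del v)\<bar> \<le> ln (size g)"
proof -
  have d: "0 < del v" "0 < del (blinfun_apply g v)"
    using v G_in_W_iff[OF g, of v] by (auto intro: del_pos)
  have s: "0 < size g" using size_ge_1[OF g] by simp
  have "ln (del (blinfun_apply g v)) \<le> ln (size g * del v)"
    using del_apply_le[OF g, of v] d s by (intro ln_mono) auto
  moreover have "ln (del v) \<le> ln (size g * del (blinfun_apply g v))"
    using del_le_apply[OF g, of v] d s by (intro ln_mono) auto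
  ultimately show ?thesis using d s by (simp add: ln_mult ln_div)
qed

text \<open>For \<open>W = {0}\<close> the supremum in \<open>norm_on\<close> is taken over the
  empty set. The value 0 is the operator norm in that case too, and makes \<open>contr\<close>
  vanish there.\<close>

definition nW :: "('v \<Rightarrow>\<^sub>L 'v) \<Rightarrow> real" where
  "nW g = (if W = {0} then 0 else norm_on W g)"

lemma bdd_above_norm_on: "bdd_above ((\<lambda>w. norm (blinfun_apply g w) / norm w) ` (W - {0}))"
  by (rule bdd_aboveI2[of _ _ "norm g"]) (auto simp: norm_blinfun divide_le_eq)

lemma W_nonzero: "W \<noteq> {0} \<Longrightarrow> W - {0} \<noteq> {}"
  using W_0 by auto

lemma norm_apply_le_nW: assumes "w \<in> W" shows "norm (blinfun_apply g w) \<le> nW g * norm w"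
proof (cases "w = 0")
  case False
  then have "norm (blinfun_apply g w) / norm w \<le> norm_on W g"
    unfolding norm_on_def by (intro cSUP_upper[OF _ bdd_above_norm_on]) (use assms in auto)
  then show ?thesis using False assms by (auto simp: nW_def divide_le_eq)
qed simp

lemma nW_le: assumes "0 \<le> c" "\<And>w. w \<in> W \<Longrightarrow> norm (blinfun_apply g w) \<le> c * norm w" shows "nW g \<le> c"
proof (cases "W = {0}")
  case False
  then show ?thesis
    unfolding nW_def norm_on_def using assms(2)
    by (auto intro!: cSUP_least W_nonzero simp: divide_le_eq)
qed (use assms(1) in \<open>unfold nW_def, simp\<close>)

lemma nW_nonneg: "0 \<le> nW g"
proof (cases "W = {0}")
  case False
  then obtain w where w: "w \<in> W" "w \<noteq> 0" using W_nonzero by blast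
  have "0 \<le> nW g * norm w" using norm_apply_le_nW[OF w(1), of g] norm_ge_zero order_trans by blast
  then show ?thesis using w by (simp add: zero_le_mult_iff)
qed (unfold nW_def, simp)

lemma nW_le_norm: "nW g \<le> norm g"
  by (rule nW_le) (auto simp: norm_blinfun)

lemma nW_le_size: "nW g \<le> size g"
  using nW_le_norm norm_le_size order_trans by blast

lemma nW_compose: assumes h: "h \<in> G" shows "nW (g o\<^sub>L h) \<le> nW g * nW h"
proof (rule nW_le)
  fix w assume w: "w \<in> W"
  have "norm (blinfun_apply (g o\<^sub>L h) w) \<le> nW g * norm (blinfun_apply h w)"
    using norm_apply_le_nW[OF G_in_W[OF h w], of g] by simp
  also have "\<dots> \<le> nW g * (nW h * norm w)" by (rule mult_left_mono[OF norm_apply_le_nW[OF w] nW_nonneg])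
  finally show "norm (blinfun_apply (g o\<^sub>L h) w) \<le> nW g * nW h * norm w" by (simp add: ac_simps)
qed (simp add: nW_nonneg)

lemma nW_ge: assumes g: "g \<in> G" and W: "W \<noteq> {0}" shows "1 \<le> size g * nW g"
proof -
  obtain w where w: "w \<in> W" "w \<noteq> 0" using W_nonzero[OF W] by blast
  have "norm w \<le> size g * (nW g * norm w)"
    using norm_le_apply[OF g, of w] size_ge_1[OF g] mult_left_mono[OF norm_apply_le_nW[OF w(1), of g], of "size g"]
    by linarith
  then show ?thesis using w by (simp add: mult.assoc[symmetric])
qed

lemma abs_ln_nW_le: assumes g: "g \<in> G" and W: "W \<noteq> {0}" shows "\<bar>ln (nW g)\<bar> \<le> ln (size g)" "0 < nW g"
proof -
  have s: "0 < size g" using size_ge_1[OF g] by simp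
  show p: "0 < nW g" using nW_ge[OF assms] nW_nonneg[of g] by (cases "nW g = 0") auto
  have "ln (nW g) \<le> ln (size g)" using nW_le_size[of g] p s by simp
  moreover have "0 \<le> ln (size g * nW g)" using nW_ge[OF assms] by simp
  moreover have "ln (size g * nW g) = ln (size g) + ln (nW g)" using p s by (simp add: ln_mult)
  ultimately show "\<bar>ln (nW g)\<bar> \<le> ln (size g)" by linarith
qed

lemma nW_lipschitz: "\<bar>nW g - nW h\<bar> \<le> norm (g - h)"
proof -
  have "nW g \<le> nW h + norm (g - h)" for g h
  proof (rule nW_le)
    fix w assume w: "w \<in> W"
    have "norm (blinfun_apply g w) \<le> norm (blinfun_apply h w) + norm (blinfun_apply (g - h) w)"
      using norm_triangle_sub[of "blinfun_apply g w" "blinfun_apply h w"] by (simp add: blinfun.diff_left)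
    also have "\<dots> \<le> nW h * norm w + norm (g - h) * norm w"
      by (intro add_mono norm_apply_le_nW[OF w] norm_blinfun)
    finally show "norm (blinfun_apply g w) \<le> (nW h + norm (g - h)) * norm w" by (simp add: algebra_simps)
  qed (simp add: nW_nonneg)
  from this[of g h] this[of h g] show ?thesis by (simp add: norm_minus_commute abs_le_iff)
qed

lemma continuous_on_nW: "continuous_on A nW"
proof (rule continuous_on_subset[of UNIV])
  show "continuous_on UNIV nW"
    unfolding continuous_on_iff
  proof (intro ballI allI impI)
    fix g :: "'v \<Rightarrow>\<^sub>L 'v" and e :: real assume "0 < e"
    have "dist (nW h) (nW g) < e" if "dist h g < e" for h
      using nW_lipschitz[of h g] that by (simp add: dist_norm)
    then show "\<exists>d>0. \<forall>h\<in>UNIV. dist h g < d \<longrightarrow> dist (nW h) (nW g) < e" using \<open>0 < e\<close> by blast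
  qed
qed simp

text \<open>The fibre of P(V) - P(W) over a line of V/W is an affine space modelled on
  \<open>W\<close>, with coordinate \<open>w\<close> at the line through \<open>u + w\<close> when
  \<open>u\<close> is a vector with \<open>perp u = u\<close> and \<open>del u = 1\<close>. In this
  coordinate \<open>g\<close> acts by an affine map whose linear part has norm at most
  \<open>contr g v\<close>. The function \<open>slope\<close> is the norm of the coordinate and
  tends to infinity at P(W).\<close>

definition contr :: "('v \<Rightarrow>\<^sub>L 'v) \<Rightarrow> 'v \<Rightarrow> real" where
  "contr g v = nW g * (del v / del (blinfun_apply g v))"

definition slope :: "'v \<Rightarrow> real" where
  "slope v = norm (pr v) / del v"

lemma contr_nonneg: "0 \<le> contr g v"
  by (simp add: contr_def nW_nonneg del_nonneg)
lemma slope_nonneg: "0 \<le> slope v"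
  by (simp add: slope_def del_nonneg)

lemma del_ratio_le: assumes g: "g \<in> G" and v: "v \<notin> W" shows "del v / del (blinfun_apply g v) \<le> size g"
  using del_le_apply[OF g, of v] del_pos[of "blinfun_apply g v"] G_in_W_iff[OF g, of v] v
  by (simp add: divide_le_eq mult.commute)

lemma contr_le: assumes g: "g \<in> G" and v: "v \<notin> W" shows "contr g v \<le> (size g)\<^sup>2"
  unfolding contr_def power2_eq_square using nW_le_size[of g] del_ratio_le[OF assms] size_ge_1[OF g]
  by (intro mult_mono) (auto simp: del_nonneg)

lemma contr_invariant: assumes g: "g \<in> G" and c: "c \<noteq> 0" and w: "w \<in> W"
  shows "contr g (scl c v + w) = contr g v"
proof -
  have "blinfun_apply g (scl c v + w) = scl c (blinfun_apply g v) + blinfun_apply g w"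
    by (simp add: blinfun.add_right G_scl[OF g])
  then show ?thesis
    using c by (simp add: contr_def del_add[OF w] del_add[OF G_in_W[OF g w]] del_scl)
qed

text \<open>Split \<open>v\<close> into \<open>pr v\<close> and \<open>perp v\<close>. The image of
  the first part stays in \<open>W\<close> and grows by at most \<open>nW g\<close>; the image of
  the second has norm at most \<open>size g * del v\<close>, and its component in \<open>W\<close>
  at most twice this by \<open>norm_pr_le\<close>.\<close>

lemma slope_apply_le: assumes g: "g \<in> G" and v: "v \<notin> W"
  shows "slope (blinfun_apply g v) \<le> contr g v * slope v + 2 * (size g)\<^sup>2"
proof -
  let ?d = "del (blinfun_apply g v)"
  have d: "0 < del v" "0 < ?d"
    using v G_in_W_iff[OF g, of v] by (auto intro: del_pos)
  have s: "0 \<le> size g" using size_ge_1[OF g] by simp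
  have "pr (blinfun_apply g v) = blinfun_apply g (pr v) + pr (blinfun_apply g (perp v))"
    by (subst apply_eq, subst pr_add) (auto intro: G_in_W[OF g] pr_in simp: add.commute)
  then have "norm (pr (blinfun_apply g v)) \<le> norm (blinfun_apply g (pr v)) + norm (pr (blinfun_apply g (perp v)))"
    by (simp add: norm_triangle_ineq)
  also have "\<dots> \<le> nW g * norm (pr v) + 2 * (size g * del v)"
    using norm_apply_le_nW[OF pr_in, of g v] norm_pr_le[of "blinfun_apply g (perp v)"] norm_apply_le[of g "perp v"]
    by (simp add: del_def)
  finally have "slope (blinfun_apply g v) \<le> (nW g * norm (pr v) + 2 * (size g * del v)) / ?d"
    unfolding slope_def using d by (intro divide_right_mono) auto
  also have "\<dots> = contr g v * slope v + 2 * size g * (del v / ?d)"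
    using d by (simp add: contr_def slope_def add_divide_distrib)
  also have "2 * size g * (del v / ?d) \<le> 2 * size g * size g"
    using del_ratio_le[OF g v] s by (intro mult_left_mono) auto
  finally show ?thesis by (simp add: power2_eq_square)
qed

text \<open>The two images differ by the image of \<open>pr v\<close>, a vector of \<open>W\<close>,
  to which the bound by \<open>nW g\<close> applies.\<close>

lemma fibre_contraction: assumes g: "g \<in> G" and v: "v \<notin> W"
  shows "norm (blinfun_apply g v - blinfun_apply g (perp v)) \<le> contr g v * slope v * del (blinfun_apply g v)"
proof -
  have d: "0 < del v" "0 < del (blinfun_apply g v)"
    using v G_in_W_iff[OF g, of v] by (auto intro: del_pos)
  have "norm (blinfun_apply g v - blinfun_apply g (perp v)) = norm (blinfun_apply g (pr v))"
    by (simp add: blinfun.diff_right[symmetric] perp_def)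
  also have "\<dots> \<le> nW g * norm (pr v)" by (rule norm_apply_le_nW[OF pr_in])
  finally show ?thesis using d by (simp add: contr_def slope_def)
qed

lemma continuous_on_apply: "continuous_on A (\<lambda>(g, v). blinfun_apply g v)"
  unfolding case_prod_beta
  by (intro bounded_bilinear.continuous_on[OF bounded_bilinear_blinfun_apply] continuous_intros)

lemma continuous_on_contr: "continuous_on (G \<times> (- W)) (\<lambda>(g, v). contr g v)"
proof -
  have n: "continuous_on (G \<times> (- W)) (\<lambda>z. nW (fst z))"
    by (rule continuous_on_compose2[OF continuous_on_nW[of UNIV]]) (auto intro: continuous_intros)
  have d: "continuous_on (G \<times> (- W)) (\<lambda>z. del (snd z))"
    by (rule continuous_on_compose2[OF continuous_on_del[of UNIV]]) (auto intro: continuous_intros)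
  have e: "continuous_on (G \<times> (- W)) (\<lambda>z. del (blinfun_apply (fst z) (snd z)))"
    by (rule continuous_on_compose2[OF continuous_on_del[of UNIV] continuous_on_apply[unfolded case_prod_beta]]) auto
  have "del (blinfun_apply (fst z) (snd z)) \<noteq> 0" if "z \<in> G \<times> (- W)" for z
    using that G_in_W_iff[of "fst z" "snd z"] unfolding del_eq_0_iff by (simp add: mem_Times_iff)
  then show ?thesis unfolding contr_def case_prod_beta by (intro continuous_intros n d e) auto
qed

lemma continuous_on_slope: "continuous_on (- W) slope"
  unfolding slope_def[abs_def]
  by (intro continuous_intros continuous_on_pr continuous_on_del) (simp add: del_eq_0_iff)

section \<open>Lines, cosets and the two projective spaces\<close>

lemma coset_eq_iff: "coset W u = coset W v \<longleftrightarrow> u - v \<in> W"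
proof
  assume "coset W u = coset W v"
  moreover have "u \<in> coset W u" unfolding coset_def using W_0 by (intro image_eqI[of _ _ 0]) auto
  ultimately obtain w where "w \<in> W" "u = v + w" unfolding coset_def by auto
  then show "u - v \<in> W" by simp
next
  assume uv: "u - v \<in> W"
  have sub: "coset W a \<subseteq> coset W b" if "a - b \<in> W" for a b
  proof
    fix x assume "x \<in> coset W a"
    then obtain w where "w \<in> W" "x = a + w" unfolding coset_def by auto
    then show "x \<in> coset W b" unfolding coset_def using W_add[OF that, of w]
      by (intro image_eqI[of _ _ "a - b + w"]) auto
  qed
  have "v - u \<in> W" using W_minus[OF uv] by simp
  then show "coset W u = coset W v" using sub[OF uv] sub[of v u] by (intro equalityI)
qed

lemma qline_eq_iff:
  assumes "v \<notin> W" "v' \<notin> W"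
  shows "qline scl W v = qline scl W v' \<longleftrightarrow> (\<exists>c w. c \<noteq> 0 \<and> w \<in> W \<and> v' = scl c v + w)"
proof
  assume "qline scl W v = qline scl W v'"
  moreover have "coset W v' \<in> qline scl W v'" unfolding qline_def by (rule range_eqI[of _ _ 1]) simp
  ultimately have "coset W v' \<in> qline scl W v" by simp
  then obtain c where c: "coset W v' = coset W (scl c v)" unfolding qline_def by blast
  then have w: "v' - scl c v \<in> W" by (simp add: coset_eq_iff)
  moreover have "c \<noteq> 0" using w assms(2) by auto
  ultimately show "\<exists>c w. c \<noteq> 0 \<and> w \<in> W \<and> v' = scl c v + w"
    by (intro exI[of _ c] exI[of _ "v' - scl c v"]) simp
next
  assume "\<exists>c w. c \<noteq> 0 \<and> w \<in> W \<and> v' = scl c v + w"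
  then obtain c w where c: "c \<noteq> 0" "w \<in> W" "v' = scl c v + w" by blast
  have 1: "coset W (scl a v') = coset W (scl (a * c) v)" for a
    unfolding coset_eq_iff using W_scl[OF c(2), of a] by (simp add: c(3) scale_right_distrib scale_scale)
  have 2: "coset W (scl a v) = coset W (scl (a / c) v')" for a using 1[of "a / c"] c(1) by simp
  show "qline scl W v = qline scl W v'"
    unfolding qline_def
    by (intro equalityI image_subsetI; rule range_eqI) (rule 2 1)+
qed

lemma line_eq_iff:
  assumes "v \<noteq> 0" "v' \<noteq> 0"
  shows "line scl v = line scl v' \<longleftrightarrow> (\<exists>c. c \<noteq> 0 \<and> v' = scl c v)"
proof
  assume "line scl v = line scl v'"
  moreover have "v' \<in> line scl v'" unfolding line_def by (rule range_eqI[of _ _ 1]) simp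
  ultimately have "v' \<in> line scl v" by simp
  then obtain c where "v' = scl c v" unfolding line_def by blast
  then show "\<exists>c. c \<noteq> 0 \<and> v' = scl c v" using assms(2) by (intro exI[of _ c]) auto
next
  assume "\<exists>c. c \<noteq> 0 \<and> v' = scl c v"
  then obtain c where c: "c \<noteq> 0" "v' = scl c v" by blast
  have 1: "scl a v' = scl (a * c) v" for a by (simp add: c scale_scale)
  have 2: "scl a v = scl (a / c) v'" for a using 1[of "a / c"] c(1) by simp
  show "line scl v = line scl v'"
    unfolding line_def
    by (intro equalityI image_subsetI; rule range_eqI) (rule 2 1)+
qed

text \<open>A union of preimages of \<open>U\<close> under the continuous maps that send
  \<open>v\<close> to \<open>scl c v + w\<close>. The choice \<open>K = {0}\<close> serves the lines
  of V, and \<open>K = W\<close> the lines of V/W.\<close>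

lemma open_affine_saturation:
  assumes U: "open U"
  shows "open {v\<in>- W. \<exists>c w. c \<noteq> 0 \<and> w \<in> K \<and> scl c v + w \<in> U}"
proof -
  have "{v\<in>- W. \<exists>c w. c \<noteq> 0 \<and> w \<in> K \<and> scl c v + w \<in> U} =
      - W \<inter> (\<Union>c\<in>- {0}. \<Union>w\<in>K. (\<lambda>v. scl c v + w) -` U)" by blast
  also have "open \<dots>"
    by (intro open_Int open_compl_W open_UN ballI open_vimage[OF U] continuous_intros
        bounded_linear.continuous_on[OF bounded_linear_scl])
  finally show ?thesis .
qed

lemma compl_W_nonzero: "v \<notin> W \<Longrightarrow> v \<noteq> 0"
  using W_0 by auto

sublocale L: open_quotient "- W" "line scl"
proof
  fix U assume U: "open U" "U \<subseteq> - W"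
  have "{v\<in>- W. line scl v \<in> line scl ` U} = {v\<in>- W. \<exists>c w. c \<noteq> 0 \<and> w \<in> {0} \<and> scl c v + w \<in> U}"
  proof (intro Collect_cong conj_cong refl)
    fix v assume v: "v \<in> - W"
    have "line scl v \<in> line scl ` U \<longleftrightarrow> (\<exists>u\<in>U. line scl v = line scl u)" by auto
    also have "\<dots> \<longleftrightarrow> (\<exists>u\<in>U. \<exists>c. c \<noteq> 0 \<and> u = scl c v)"
    proof (intro bex_cong refl line_eq_iff)
      show "v \<noteq> 0" using compl_W_nonzero v by simp
      show "u \<noteq> 0" if "u \<in> U" for u using compl_W_nonzero[of u] U that by auto
    qed
    finally show "line scl v \<in> line scl ` U \<longleftrightarrow> (\<exists>c w. c \<noteq> 0 \<and> w \<in> {0} \<and> scl c v + w \<in> U)" by auto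
  qed
  then show "open {v\<in>- W. line scl v \<in> line scl ` U}" using open_affine_saturation[OF U(1)] by (simp only:)
qed (rule open_compl_W)

sublocale Q: open_quotient "- W" "qline scl W"
proof
  fix U assume U: "open U" "U \<subseteq> - W"
  have "{v\<in>- W. qline scl W v \<in> qline scl W ` U} = {v\<in>- W. \<exists>c w. c \<noteq> 0 \<and> w \<in> W \<and> scl c v + w \<in> U}"
  proof (intro Collect_cong conj_cong refl)
    fix v assume v: "v \<in> - W"
    have "qline scl W v \<in> qline scl W ` U \<longleftrightarrow> (\<exists>u\<in>U. qline scl W v = qline scl W u)" by auto
    also have "\<dots> \<longleftrightarrow> (\<exists>u\<in>U. \<exists>c w. c \<noteq> 0 \<and> w \<in> W \<and> u = scl c v + w)"
      using U v by (intro bex_cong refl qline_eq_iff) auto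
    finally show "qline scl W v \<in> qline scl W ` U \<longleftrightarrow> (\<exists>c w. c \<noteq> 0 \<and> w \<in> W \<and> scl c v + w \<in> U)" by auto
  qed
  then show "open {v\<in>- W. qline scl W v \<in> qline scl W ` U}" using open_affine_saturation[OF U(1)] by (simp only:)
qed (rule open_compl_W)

lemma L_invariantI: "(\<And>c v. v \<notin> W \<Longrightarrow> c \<noteq> 0 \<Longrightarrow> F (scl c v) = F v) \<Longrightarrow> L.invariant F"
  unfolding L.invariant_def
proof (intro ballI impI)
  fix v v' assume F: "\<And>c v. v \<notin> W \<Longrightarrow> c \<noteq> 0 \<Longrightarrow> F (scl c v) = F v"
    and v: "v \<in> - W" "v' \<in> - W" "line scl v = line scl v'"
  have "v \<noteq> 0" "v' \<noteq> 0" using v(1,2) compl_W_nonzero by simp_all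
  from line_eq_iff[OF this] v(3) obtain c where "c \<noteq> 0" "v' = scl c v" by blast
  then show "F v = F v'" using F[of v c] v(1) by simp
qed

lemma Q_invariantI: "(\<And>c v w. v \<notin> W \<Longrightarrow> c \<noteq> 0 \<Longrightarrow> w \<in> W \<Longrightarrow> F (scl c v + w) = F v) \<Longrightarrow> Q.invariant F"
  unfolding Q.invariant_def
proof (intro ballI impI)
  fix v v' assume F: "\<And>c v w. v \<notin> W \<Longrightarrow> c \<noteq> 0 \<Longrightarrow> w \<in> W \<Longrightarrow> F (scl c v + w) = F v"
    and v: "v \<in> - W" "v' \<in> - W" "qline scl W v = qline scl W v'"
  have "v \<notin> W" "v' \<notin> W" using v(1,2) by simp_all
  from qline_eq_iff[OF this] v(3) obtain c w where "c \<noteq> 0" "w \<in> W" "v' = scl c v + w" by blast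
  then show "F v = F v'" using F[of v c w] v(1) by simp
qed

lemma act_line: "g \<in> G \<Longrightarrow> act g (line scl v) = line scl (blinfun_apply g v)"
  unfolding act_def line_def by (simp add: image_image G_scl)

lemma apply_coset: "g \<in> G \<Longrightarrow> blinfun_apply g ` coset W v = coset W (blinfun_apply g v)"
proof -
  assume g: "g \<in> G"
  have "blinfun_apply g ` coset W v = (\<lambda>w. blinfun_apply g v + w) ` (blinfun_apply g ` W)"
    unfolding coset_def by (simp add: image_image blinfun.add_right)
  then show ?thesis unfolding coset_def G_image[OF g] .
qed

lemma qact_qline: "g \<in> G \<Longrightarrow> qact g (qline scl W v) = qline scl W (blinfun_apply g v)"
  unfolding qact_def qline_def by (simp add: image_image apply_coset G_scl)

lemma proj_map_line: "proj_map W (line scl v) = qline scl W v"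
  unfolding proj_map_def line_def qline_def by (simp add: image_image)

lemma proj_minus_space: "proj_space scl UNIV - proj_space scl W = line scl ` (- W)"
proof (intro equalityI subsetI)
  fix x assume "x \<in> proj_space scl UNIV - proj_space scl W"
  then obtain v where v: "x = line scl v" "v \<noteq> 0" "x \<notin> line scl ` (W - {0})" unfolding proj_space_def by auto
  then have "v \<notin> W" by auto
  then show "x \<in> line scl ` (- W)" using v by auto
next
  fix x assume "x \<in> line scl ` (- W)"
  then obtain v where v: "x = line scl v" "v \<notin> W" by auto
  have "line scl v \<noteq> line scl w" if w: "w \<in> W" "w \<noteq> 0" for w
  proof
    assume "line scl v = line scl w"
    then obtain c where "c \<noteq> 0" "w = scl c v" using line_eq_iff[of v w] w v compl_W_nonzero by auto
    then show False using W_scl_iff[of c v] v w by simp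
  qed
  then show "x \<in> proj_space scl UNIV - proj_space scl W"
    using v compl_W_nonzero[OF v(2)] unfolding proj_space_def by blast
qed

text \<open>The set \<open>- W\<close> is open and is a union of punctured lines. On such a
  saturated open set the subspace topology of the quotient is the quotient topology of the
  restricted map.\<close>

lemma proj_minus_topology_eq: "proj_minus_topology scl W = L.T"
proof (rule topology_eq[THEN iffD2], intro allI)
  fix U
  let ?A = "line scl ` (- W)"
  have ne: "(- {0} :: 'v set) = - W \<union> (W - {0})" using W_0 by auto
  have opn: "openin (proj_topology scl) V \<longleftrightarrow> V \<subseteq> line scl ` (- {0}) \<and> open {v\<in>- {0}. line scl v \<in> V}" for V
    unfolding proj_topology_def openin_quotient_topology
    unfolding openin_open_eq[OF open_Compl[OF closed_singleton]] topspace_euclidean_subtopology by blast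
  have eq: "{v\<in>- {0}. line scl v \<in> V} = {v\<in>- W. line scl v \<in> V}" if "V \<subseteq> ?A" for V
  proof -
    have "v \<notin> W" if "v \<noteq> 0" "line scl v \<in> V" for v
    proof
      assume "v \<in> W"
      then have "line scl v \<in> proj_space scl W" using that unfolding proj_space_def by auto
      then show False using that \<open>V \<subseteq> ?A\<close> unfolding proj_minus_space[symmetric] by blast
    qed
    then show ?thesis using compl_W_nonzero by auto
  qed
  have "{v\<in>- W. line scl v \<in> ?A} = - W" by blast
  then have "openin (proj_topology scl) ?A"
    unfolding opn using eq[of ?A] open_compl_W compl_W_nonzero by (simp add: image_subset_iff)
  then have "openin (proj_minus_topology scl W) U \<longleftrightarrow> openin (proj_topology scl) U \<and> U \<subseteq> ?A"
    unfolding proj_minus_topology_def proj_minus_space by (rule openin_open_subtopology)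
  also have "\<dots> \<longleftrightarrow> U \<subseteq> ?A \<and> open {v\<in>- W. line scl v \<in> U}"
    unfolding opn using eq[of U] ne by auto
  also have "\<dots> \<longleftrightarrow> openin L.T U" by (rule L.openin_T[symmetric])
  finally show "openin (proj_minus_topology scl W) U \<longleftrightarrow> openin L.T U" .
qed

lemma qproj_topology_eq: "qproj_topology scl W = Q.T"
  unfolding qproj_topology_def Q.T_def ..

end

section \<open>The random walk and its fibrewise contraction\<close>

text \<open>Letters are counted from 0 here and from 1 in \<open>walk\<close>. With this convention
  a block starting at time \<open>i\<close> is \<open>wk\<close> of the sequence shifted
  \<open>i\<close> times.\<close>

primrec wk :: "(nat \<Rightarrow> 'v::euclidean_space \<Rightarrow>\<^sub>L 'v) \<Rightarrow> nat \<Rightarrow> 'v \<Rightarrow>\<^sub>L 'v" where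
  "wk \<omega> 0 = id_blinfun"
| "wk \<omega> (Suc n) = \<omega> n o\<^sub>L wk \<omega> n"

lemma wk_add: "wk \<omega> (m + n) = wk ((shift ^^ m) \<omega>) n o\<^sub>L wk \<omega> m"
  by (induct n) (auto simp: funpow_shift intro!: blinfun_eqI)

lemma wk_cong: "(\<And>i. i < n \<Longrightarrow> \<omega> i = \<omega>' i) \<Longrightarrow> wk \<omega> n = wk \<omega>' n"
  by (induct n) auto

lemma wk_comb_seq: "n \<le> i \<Longrightarrow> wk (comb_seq i \<omega> \<omega>') n = wk \<omega> n"
  by (rule wk_cong) (simp add: comb_seq_def)

lemma shift_comb_seq: "(shift ^^ i) (comb_seq i \<omega> \<omega>') = \<omega>'"
  by (auto simp: funpow_shift comb_seq_def)

text \<open>The law of a step is carried by the stabilizer itself, so that every path, and not only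
  almost every one, acts on \<open>W\<close> and on V/W.\<close>

locale random_walk = subspace_setup scl W + sequence_space gm
  for scl :: "'k::{real_normed_field,euclidean_space} \<Rightarrow> 'v::euclidean_space \<Rightarrow> 'v" and W
    and gm :: "('v \<Rightarrow>\<^sub>L 'v) measure" +
  assumes sets_gm: "sets gm = sets (restrict_space borel (stabilizer scl W))"
    and moment: "integrable gm (\<lambda>g. ln (size g))"
begin

lemma space_gm: "space gm = G"
  using sets_eq_imp_space_eq[OF sets_gm] by (simp add: space_restrict_space)

lemma S_in_G: "\<omega> \<in> space S \<Longrightarrow> \<omega> i \<in> G"
  by (auto simp: space_PiM PiE_iff space_gm)

lemma shift_space: "\<omega> \<in> space S \<Longrightarrow> (shift ^^ i) \<omega> \<in> space S"
  by (auto simp: space_PiM PiE_iff funpow_shift)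

lemma wk_in_G: "\<omega> \<in> space S \<Longrightarrow> wk \<omega> n \<in> G"
  by (induct n) (auto intro: id_in_G compose_in_G S_in_G)

lemma measurable_compose_G:
  assumes "f \<in> N \<rightarrow>\<^sub>M gm" "h \<in> N \<rightarrow>\<^sub>M gm"
  shows "(\<lambda>x. f x o\<^sub>L h x) \<in> N \<rightarrow>\<^sub>M gm"
proof -
  have f: "f \<in> N \<rightarrow>\<^sub>M restrict_space borel G" "h \<in> N \<rightarrow>\<^sub>M restrict_space borel G"
    using assms measurable_cong_sets[OF refl sets_gm] by blast+
  have c: "continuous_on (G \<times> G) (\<lambda>z. fst z o\<^sub>L snd z)"
    by (intro bounded_bilinear.continuous_on[OF bounded_bilinear_blinfun_compose] continuous_intros)
  have "(\<lambda>x. f x o\<^sub>L h x) \<in> borel_measurable N"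
    using measurable_continuous_on_pair_restrict[OF c f] by simp
  moreover have "f x o\<^sub>L h x \<in> G" if "x \<in> space N" for x
    using measurable_space[OF assms(1) that] measurable_space[OF assms(2) that]
    unfolding space_gm by (rule compose_in_G)
  ultimately have "(\<lambda>x. f x o\<^sub>L h x) \<in> N \<rightarrow>\<^sub>M restrict_space borel G"
    by (intro measurable_restrict_space2) auto
  then show ?thesis using measurable_cong_sets[OF refl sets_gm] by blast
qed

lemma id_measurable: "(\<lambda>x. id_blinfun) \<in> N \<rightarrow>\<^sub>M gm"
  using id_in_G by (simp add: space_gm)

lemma wk_measurable [measurable]: "(\<lambda>\<omega>. wk \<omega> n) \<in> S \<rightarrow>\<^sub>M gm"
proof (induct n)
  case (Suc n)
  have "(\<lambda>\<omega>. \<omega> n) \<in> S \<rightarrow>\<^sub>M gm" by measurable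
  from measurable_compose_G[OF this Suc] show ?case by simp
qed (simp add: id_measurable)

lemma measurable_funpow_shift [measurable]: "(shift ^^ n) \<in> S \<rightarrow>\<^sub>M S"
  by (induct n) auto

lemma size_measurable [measurable]: "size \<in> borel_measurable gm"
proof -
  have "(\<lambda>g. exp (ln (size g))) \<in> borel_measurable gm" using moment by measurable
  moreover have "exp (ln (size g)) = size g" if "g \<in> space gm" for g
    using size_ge_1[of g] that by (simp add: space_gm)
  ultimately show ?thesis by (simp cong: measurable_cong)
qed

lemma nW_measurable [measurable]: "nW \<in> borel_measurable gm"
  using borel_measurable_continuous_on_restrict[OF continuous_on_nW[of G]]
    measurable_cong_sets[OF sets_gm refl] by blast

lemma ln_size_nonneg: "g \<in> G \<Longrightarrow> 0 \<le> ln (size g)"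
  using size_ge_1[of g] by simp

lemma ln_size_wk_le:
  assumes "\<omega> \<in> space S"
  shows "ln (size (wk \<omega> n)) \<le> (\<Sum>i<n. ln (size (\<omega> i)))"
proof (induct n)
  case 0
  show ?case using size_id size_ge_1[OF id_in_G] by simp
next
  case (Suc n)
  have p: "0 < size (\<omega> n)" "0 < size (wk \<omega> n)" "0 < size (wk \<omega> (Suc n))"
    using size_ge_1[OF S_in_G[OF assms, of n]] size_ge_1[OF wk_in_G[OF assms, of n]]
      size_ge_1[OF wk_in_G[OF assms, of "Suc n"]] by linarith+
  have "ln (size (wk \<omega> (Suc n))) \<le> ln (size (\<omega> n) * size (wk \<omega> n))"
    using size_compose[OF S_in_G[OF assms, of n] wk_in_G[OF assms, of n]] p by (intro ln_mono) simp_all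
  also have "\<dots> = ln (size (\<omega> n)) + ln (size (wk \<omega> n))" using p by (simp add: ln_mult)
  finally show ?case using Suc by simp
qed

lemma Q_rep_measurable:
  assumes "continuous_on (G \<times> (- W)) (\<lambda>(g, v). \<phi> g v)" "\<And>g. g \<in> G \<Longrightarrow> Q.invariant (\<phi> g)"
    and f: "f \<in> N \<rightarrow>\<^sub>M gm" and h: "h \<in> N \<rightarrow>\<^sub>M Q.Y"
  shows "(\<lambda>x. \<phi> (f x) (Q.rep (h x)) :: real) \<in> borel_measurable N"
proof -
  have "(\<lambda>x. (f x, h x)) \<in> N \<rightarrow>\<^sub>M restrict_space borel G \<Otimes>\<^sub>M Q.Y"
    using f h measurable_cong_sets[OF refl sets_gm] by (intro measurable_Pair) auto
  from measurable_compose[OF this Q.rep_measurable_real[OF assms(1,2)]] show ?thesis by simp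
qed

lemma contr_Q_invariant: "g \<in> G \<Longrightarrow> Q.invariant (contr g)"
  by (rule Q_invariantI) (rule contr_invariant)

lemma contr_rep_measurable:
  "f \<in> N \<rightarrow>\<^sub>M gm \<Longrightarrow> h \<in> N \<rightarrow>\<^sub>M Q.Y \<Longrightarrow> (\<lambda>x. contr (f x) (Q.rep (h x))) \<in> borel_measurable N"
  by (rule Q_rep_measurable[OF continuous_on_contr contr_Q_invariant])

section \<open>The growth cocycle on V/W and the actions on lines\<close>

definition lcoc :: "('v \<Rightarrow>\<^sub>L 'v) \<Rightarrow> 'v \<Rightarrow> real" where
  "lcoc g v = ln (del (blinfun_apply g v) / del v)"

lemma abs_lcoc_le: "g \<in> G \<Longrightarrow> v \<notin> W \<Longrightarrow> \<bar>lcoc g v\<bar> \<le> ln (size g)"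
  unfolding lcoc_def by (rule abs_ln_del_ratio_le)

lemma lcoc_Q_invariant: "g \<in> G \<Longrightarrow> Q.invariant (lcoc g)"
proof (rule Q_invariantI)
  fix c :: 'k and v w assume g: "g \<in> G" and c: "c \<noteq> 0" and w: "w \<in> W"
  have "blinfun_apply g (scl c v + w) = scl c (blinfun_apply g v) + blinfun_apply g w"
    by (simp add: blinfun.add_right G_scl[OF g])
  then show "lcoc g (scl c v + w) = lcoc g v"
    using c by (simp add: lcoc_def del_add[OF w] del_add[OF G_in_W[OF g w]] del_scl)
qed

lemma continuous_on_lcoc: "continuous_on (G \<times> (- W)) (\<lambda>(g, v). lcoc g v)"
proof -
  have d: "continuous_on (G \<times> (- W)) (\<lambda>z. del (snd z))"
    by (rule continuous_on_compose2[OF continuous_on_del[of UNIV]]) (auto intro: continuous_intros)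
  have e: "continuous_on (G \<times> (- W)) (\<lambda>z. del (blinfun_apply (fst z) (snd z)))"
    by (rule continuous_on_compose2[OF continuous_on_del[of UNIV] continuous_on_apply[unfolded case_prod_beta]]) auto
  have ne: "del (blinfun_apply (fst z) (snd z)) \<noteq> 0" "del (snd z) \<noteq> 0" if "z \<in> G \<times> (- W)" for z
    using that G_in_W_iff[of "fst z" "snd z"] unfolding del_eq_0_iff by (simp_all add: mem_Times_iff)
  show ?thesis unfolding lcoc_def case_prod_beta
    by (intro continuous_on_ln continuous_on_divide d e ballI) (simp_all add: ne)
qed

lemma lcoc_rep_measurable:
  "f \<in> N \<rightarrow>\<^sub>M gm \<Longrightarrow> h \<in> N \<rightarrow>\<^sub>M Q.Y \<Longrightarrow> (\<lambda>x. lcoc (f x) (Q.rep (h x))) \<in> borel_measurable N"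
  by (rule Q_rep_measurable[OF continuous_on_lcoc lcoc_Q_invariant])

lemma lcoc_compose:
  assumes g: "g \<in> G" and h: "h \<in> G" and v: "v \<notin> W"
  shows "lcoc (g o\<^sub>L h) v = lcoc g (blinfun_apply h v) + lcoc h v"
proof -
  have "blinfun_apply h v \<notin> W" "blinfun_apply g (blinfun_apply h v) \<notin> W"
    using v G_in_W_iff[OF h, of v] G_in_W_iff[OF g, of "blinfun_apply h v"] by simp_all
  then show ?thesis using v by (simp add: lcoc_def ln_div del_eq_0_iff)
qed

lemma qact_measurable: "(\<lambda>(g, y). qact g y) \<in> gm \<Otimes>\<^sub>M Q.Y \<rightarrow>\<^sub>M Q.Y"
proof -
  have "(\<lambda>(g, y). qline scl W (blinfun_apply g (Q.rep y))) \<in> restrict_space borel G \<Otimes>\<^sub>M Q.Y \<rightarrow>\<^sub>M Q.Y"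
  proof (rule Q.rep_measurable_action)
    show "continuous_on (G \<times> - W) (\<lambda>(g, v). blinfun_apply g v)" by (rule continuous_on_apply)
    show "blinfun_apply g v \<in> - W" if "g \<in> G" "v \<in> - W" for g v using that G_in_W_iff[of g v] by simp
    show "Q.invariant (\<lambda>v. qline scl W (blinfun_apply g v))" if "g \<in> G" for g
      unfolding Q.invariant_def using that by (simp add: qact_qline[symmetric])
  qed
  moreover have "sets (gm \<Otimes>\<^sub>M Q.Y) = sets (restrict_space borel G \<Otimes>\<^sub>M Q.Y)"
    by (rule sets_pair_measure_cong[OF sets_gm refl])
  ultimately have "(\<lambda>(g, y). qline scl W (blinfun_apply g (Q.rep y))) \<in> gm \<Otimes>\<^sub>M Q.Y \<rightarrow>\<^sub>M Q.Y"
    using measurable_cong_sets by blast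
  moreover have "(\<lambda>(g, y). qline scl W (blinfun_apply g (Q.rep y))) z = (\<lambda>(g, y). qact g y) z"
    if "z \<in> space (gm \<Otimes>\<^sub>M Q.Y)" for z
    using that Q.rep(2)[of "snd z"] qact_qline[of "fst z" "Q.rep (snd z)"]
    by (auto simp: space_pair_measure space_gm Q.space_Y)
  ultimately show ?thesis by (simp cong: measurable_cong)
qed

lemma act_measurable: "(\<lambda>(g, y). act g y) \<in> gm \<Otimes>\<^sub>M L.Y \<rightarrow>\<^sub>M L.Y"
proof -
  have "(\<lambda>(g, y). line scl (blinfun_apply g (L.rep y))) \<in> restrict_space borel G \<Otimes>\<^sub>M L.Y \<rightarrow>\<^sub>M L.Y"
  proof (rule L.rep_measurable_action)
    show "continuous_on (G \<times> - W) (\<lambda>(g, v). blinfun_apply g v)" by (rule continuous_on_apply)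
    show "blinfun_apply g v \<in> - W" if "g \<in> G" "v \<in> - W" for g v using that G_in_W_iff[of g v] by simp
    show "L.invariant (\<lambda>v. line scl (blinfun_apply g v))" if "g \<in> G" for g
      unfolding L.invariant_def using that by (simp add: act_line[symmetric])
  qed
  moreover have "sets (gm \<Otimes>\<^sub>M L.Y) = sets (restrict_space borel G \<Otimes>\<^sub>M L.Y)"
    by (rule sets_pair_measure_cong[OF sets_gm refl])
  ultimately have "(\<lambda>(g, y). line scl (blinfun_apply g (L.rep y))) \<in> gm \<Otimes>\<^sub>M L.Y \<rightarrow>\<^sub>M L.Y"
    using measurable_cong_sets by blast
  moreover have "(\<lambda>(g, y). line scl (blinfun_apply g (L.rep y))) z = (\<lambda>(g, y). act g y) z"
    if "z \<in> space (gm \<Otimes>\<^sub>M L.Y)" for z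
    using that L.rep(2)[of "snd z"] act_line[of "fst z" "L.rep (snd z)"]
    by (auto simp: space_pair_measure space_gm L.space_Y)
  ultimately show ?thesis by (simp cong: measurable_cong)
qed

end

section \<open>Growth rates along the skew product\<close>

locale random_walk_base = random_walk scl W gm + ergodic_action gm \<eta> qact
  for scl :: "'k::{real_normed_field,euclidean_space} \<Rightarrow> 'v::euclidean_space \<Rightarrow> 'v" and W gm
    and \<eta> :: "'v set set measure" +
  assumes sets_\<eta>: "sets \<eta> = sets Q.Y"
begin

lemma space_\<eta>: "space \<eta> = qline scl W ` (- W)"
  using sets_eq_imp_space_eq[OF sets_\<eta>] by (simp add: Q.space_Y)

lemma \<eta>_measurable: "f \<in> N \<rightarrow>\<^sub>M \<eta> \<Longrightarrow> f \<in> N \<rightarrow>\<^sub>M Q.Y"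
  using measurable_cong_sets[OF refl sets_\<eta>] by blast

lemma rep_\<eta>: "y \<in> space \<eta> \<Longrightarrow> Q.rep y \<notin> W" "y \<in> space \<eta> \<Longrightarrow> qline scl W (Q.rep y) = y"
  using Q.rep[of y] by (simp_all add: space_\<eta>)

lemma funpow_skew:
  assumes "y \<in> space \<eta>" "\<omega> \<in> space S"
  shows "(skew ^^ n) (y, \<omega>) = (qline scl W (blinfun_apply (wk \<omega> n) (Q.rep y)), (shift ^^ n) \<omega>)"
proof (induct n)
  case 0
  show ?case using rep_\<eta>(2)[OF assms(1)] by simp
next
  case (Suc n)
  have "(shift ^^ n) \<omega> 0 = \<omega> n" by (simp add: funpow_shift)
  have "(skew ^^ Suc n) (y, \<omega>) = skew (qline scl W (blinfun_apply (wk \<omega> n) (Q.rep y)), (shift ^^ n) \<omega>)"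
    by (simp add: Suc)
  also have "\<dots> = (qline scl W (blinfun_apply (wk \<omega> (Suc n)) (Q.rep y)), (shift ^^ Suc n) \<omega>)"
    unfolding skew_def by (simp add: qact_qline[OF S_in_G[OF assms(2)]] \<open>(shift ^^ n) \<omega> 0 = \<omega> n\<close>)
  finally show ?case .
qed

lemma moment_coordinate: "integrable S (\<lambda>\<omega>. ln (size (\<omega> i)))"
proof -
  have "integrable (distr S gm (\<lambda>\<omega>. \<omega> i)) (\<lambda>g. ln (size g))"
    using PiM_component[of i] moment by simp
  then show ?thesis by (subst (asm) integrable_distr_eq) auto
qed

lemma moment_Z: "integrable (\<eta> \<Otimes>\<^sub>M S) (\<lambda>z. ln (size (snd z 0)))"
proof -
  have "integrable (distr (S \<Otimes>\<^sub>M \<eta>) S fst) (\<lambda>\<omega>. ln (size (\<omega> 0)))"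
    using moment_coordinate[of 0] by (simp add: Y.distr_pair_fst)
  then have "integrable (S \<Otimes>\<^sub>M \<eta>) (\<lambda>z. ln (size (fst z 0)))"
    by (subst (asm) integrable_distr_eq) auto
  moreover have "pair_sigma_finite S \<eta>" ..
  ultimately show ?thesis
    using pair_sigma_finite.integrable_product_swap[of S \<eta> "\<lambda>z. ln (size (fst z 0))"] by (simp add: case_prod_unfold)
qed

lemma AE_snd: "(AE z in \<eta> \<Otimes>\<^sub>M S. Q (snd z)) \<Longrightarrow> AE \<omega> in S. Q \<omega>"
proof -
  assume "AE z in \<eta> \<Otimes>\<^sub>M S. Q (snd z)"
  from Z.AE_pair[OF this] have "AE y in \<eta>. AE \<omega> in S. Q \<omega>" by simp
  then show ?thesis by simp
qed

text \<open>Kingman's theorem for the norms on \<open>W\<close>. The cocycle depends on the sequence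
  alone, but it is viewed on the skew product because ergodicity is known there;
  \<open>AE_snd\<close> removes the base again. The bound \<open>nW_ge\<close> controls the
  logarithm from below.\<close>

lemma furstenberg_kesten:
  assumes W: "W \<noteq> {0}"
  obtains l where "AE z in \<eta> \<Otimes>\<^sub>M S. (\<lambda>n. ln (nW (wk (snd z) n)) / real n) \<longlonglongrightarrow> l"
proof -
  interpret K: ergodic_subadditive_cocycle "\<eta> \<Otimes>\<^sub>M S" skew
    "\<lambda>n z. ln (nW (wk (snd z) n))" "\<lambda>z. ln (size (snd z 0))"
  proof
    fix z n m assume z: "z \<in> space (\<eta> \<Otimes>\<^sub>M S)"
    then obtain y \<omega> where yw: "z = (y, \<omega>)" "y \<in> space \<eta>" "\<omega> \<in> space S"
      by (auto simp: space_pair_measure)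
    note G = wk_in_G[OF yw(3)] wk_in_G[OF shift_space[OF yw(3)]]
    have p: "0 < nW (wk ((shift ^^ n) \<omega>) m)" "0 < nW (wk \<omega> n)" "0 < nW (wk \<omega> (n + m))"
      by (rule abs_ln_nW_le(2)[OF _ W], rule G)+
    have "ln (nW (wk \<omega> (n + m))) \<le> ln (nW (wk ((shift ^^ n) \<omega>) m) * nW (wk \<omega> n))"
      using p nW_compose[OF G(1), of "wk ((shift ^^ n) \<omega>) m" n]
      by (intro ln_mono) (simp_all add: wk_add)
    also have "\<dots> = ln (nW (wk \<omega> n)) + ln (nW (wk ((shift ^^ n) \<omega>) m))"
      using p by (simp add: ln_mult)
    finally show "ln (nW (wk (snd z) (n + m))) \<le>
        ln (nW (wk (snd z) n)) + ln (nW (wk (snd ((skew ^^ n) z)) m))"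
      by (simp add: yw(1) funpow_skew[OF yw(2,3)])
    have id: "nW id_blinfun = 1"
    proof (rule antisym)
      show "nW id_blinfun \<le> 1" by (rule nW_le) auto
      have "size id_blinfun * nW id_blinfun \<le> 1 * nW id_blinfun"
        by (intro mult_right_mono size_id nW_nonneg)
      then show "1 \<le> nW id_blinfun" using nW_ge[OF id_in_G W] by linarith
    qed
    then show "ln (nW (wk (snd z) 0)) = 0" by simp
    have "\<bar>ln (nW (wk \<omega> 1))\<bar> \<le> ln (size (wk \<omega> 1))" by (rule abs_ln_nW_le(1)[OF G(1) W])
    moreover have "wk \<omega> 1 = \<omega> 0" by (auto intro: blinfun_eqI)
    ultimately show "\<bar>ln (nW (wk (snd z) 1))\<bar> \<le> ln (size (snd z 0))" by (simp add: yw(1))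
    have "(\<Sum>i<n. ln (size (snd ((skew ^^ i) z) 0))) = (\<Sum>i<n. ln (size (\<omega> i)))"
      by (rule sum.cong) (simp_all add: yw(1) funpow_skew[OF yw(2,3)] funpow_shift)
    moreover have "- ln (size (wk \<omega> n)) \<le> ln (nW (wk \<omega> n))"
      using abs_ln_nW_le(1)[OF G(1)[of n] W] by linarith
    ultimately show "- (\<Sum>i<n. ln (size (snd ((skew ^^ i) z) 0))) \<le> ln (nW (wk (snd z) n))"
      using ln_size_wk_le[OF yw(3), of n] by (simp add: yw(1))
  next
    show "(\<lambda>z. ln (nW (wk (snd z) n))) \<in> borel_measurable (\<eta> \<Otimes>\<^sub>M S)" for n by measurable
  qed (rule moment_Z)
  show ?thesis using K.kingman that by blast
qed

lemma lcoc_rep_q: "g \<in> G \<Longrightarrow> v \<notin> W \<Longrightarrow> lcoc g (Q.rep (qline scl W v)) = lcoc g v"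
  by (rule Q.invariant_rep[OF lcoc_Q_invariant]) auto

definition avg_coc :: real where
  "avg_coc = (\<integral>y. (\<integral>g. lcoc g (Q.rep y) \<partial>gm) \<partial>\<eta>)"

text \<open>By \<open>lcoc_compose\<close> the Birkhoff sums of the one-step growth are the growth
  of the product, and the integral of one step is \<open>avg_coc\<close> because the first letter
  has law \<open>gm\<close>.\<close>

lemma lcoc_eventually_ge:
  assumes "c < avg_coc"
  shows "AE z in \<eta> \<Otimes>\<^sub>M S. \<forall>\<^sub>F n in sequentially. real n * c \<le> lcoc (wk (snd z) n) (Q.rep (fst z))"
proof -
  let ?f = "\<lambda>z. lcoc (snd z 0) (Q.rep (fst z))"
  have fm [measurable]: "?f \<in> borel_measurable (\<eta> \<Otimes>\<^sub>M S)"
  proof (rule lcoc_rep_measurable)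
    show "(\<lambda>z. snd z 0) \<in> \<eta> \<Otimes>\<^sub>M S \<rightarrow>\<^sub>M gm"
      by (rule measurable_compose[OF measurable_snd measurable_component_singleton]) simp
  qed (rule \<eta>_measurable[OF measurable_fst])
  have int: "integrable (\<eta> \<Otimes>\<^sub>M S) ?f"
  proof (rule Bochner_Integration.integrable_bound[OF moment_Z fm], rule AE_I2)
    fix z assume "z \<in> space (\<eta> \<Otimes>\<^sub>M S)"
    then have z: "fst z \<in> space \<eta>" "snd z \<in> space S" by (auto simp: space_pair_measure)
    show "norm (?f z) \<le> norm (ln (size (snd z 0)))"
      using abs_lcoc_le[OF S_in_G[OF z(2)] rep_\<eta>(1)[OF z(1)], of 0]
        ln_size_nonneg[OF S_in_G[OF z(2)], of 0] by simp
  qed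
  have "(\<integral>z. ?f z \<partial>(\<eta> \<Otimes>\<^sub>M S)) = (\<integral>y. (\<integral>\<omega>. lcoc (\<omega> 0) (Q.rep y) \<partial>S) \<partial>\<eta>)"
    using Z.integral_fst'[OF int] by simp
  also have "\<dots> = avg_coc"
    unfolding avg_coc_def
  proof (rule Bochner_Integration.integral_cong[OF refl])
    fix y assume y: "y \<in> space \<eta>"
    have m: "(\<lambda>g. lcoc g (Q.rep y)) \<in> borel_measurable gm"
      by (rule lcoc_rep_measurable) (use y in \<open>auto simp: space_\<eta> Q.space_Y\<close>)
    have "(\<integral>\<omega>. lcoc (\<omega> 0) (Q.rep y) \<partial>S) = (\<integral>g. lcoc g (Q.rep y) \<partial>distr S gm (\<lambda>\<omega>. \<omega> 0))"
      by (rule integral_distr[symmetric]) (measurable, rule m)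
    then show "(\<integral>\<omega>. lcoc (\<omega> 0) (Q.rep y) \<partial>S) = (\<integral>g. lcoc g (Q.rep y) \<partial>gm)"
      using PiM_component[of 0] by simp
  qed
  finally have "AE z in \<eta> \<Otimes>\<^sub>M S. \<forall>\<^sub>F n in sequentially. real n * c \<le> (\<Sum>i<n. ?f ((skew ^^ i) z))"
    using skew.birkhoff_eventually_ge[OF int, of c] assms by simp
  with AE_space show ?thesis
  proof eventually_elim
    case (elim z)
    then obtain y \<omega> where z: "z = (y, \<omega>)" "y \<in> space \<eta>" "\<omega> \<in> space S"
      by (auto simp: space_pair_measure)
    have "(\<Sum>i<n. ?f ((skew ^^ i) z)) = lcoc (wk \<omega> n) (Q.rep y)" for n
    proof (induct n)
      case 0
      show ?case using del_pos[OF rep_\<eta>(1)[OF z(2)]] by (simp add: lcoc_def)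
    next
      case (Suc n)
      let ?u = "blinfun_apply (wk \<omega> n) (Q.rep y)"
      have u: "?u \<notin> W" using G_in_W_iff[OF wk_in_G[OF z(3)]] rep_\<eta>(1)[OF z(2)] by simp
      have "?f ((skew ^^ n) z) = lcoc (\<omega> n) ?u"
        by (simp add: z(1) funpow_skew[OF z(2,3)] funpow_shift lcoc_rep_q[OF S_in_G[OF z(3)] u])
      then show ?case
        using Suc lcoc_compose[OF S_in_G[OF z(3)] wk_in_G[OF z(3)] rep_\<eta>(1)[OF z(2)], of n n] by simp
    qed
    then show ?case using elim(2) by (simp add: z(1))
  qed
qed

end

text \<open>The conditions on \<open>l\<close> are confined to \<open>W \<noteq> {0}\<close>: for
  \<open>W = {0}\<close> the exponent is \<open>-\<infinity>\<close>, which no real \<open>l\<close>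
  represents, and \<open>contr\<close> is 0.\<close>

locale contracting_walk = random_walk_base +
  fixes l :: real
  assumes lyapunov: "W \<noteq> {0} \<Longrightarrow> AE z in \<eta> \<Otimes>\<^sub>M S. (\<lambda>n. ln (nW (wk (snd z) n)) / real n) \<longlonglongrightarrow> l"
    and gap: "W \<noteq> {0} \<Longrightarrow> l < avg_coc"
begin

lemma contraction:
  obtains \<theta> where "0 < \<theta>" "AE z in \<eta> \<Otimes>\<^sub>M S. \<forall>\<^sub>F n in sequentially.
    contr (wk (snd z) n) (Q.rep (fst z)) \<le> exp (- 2 * \<theta> * real n)"
proof (cases "W = {0}")
  case True
  then have "contr g v = 0" for g v unfolding contr_def nW_def by simp
  then show ?thesis by (intro that[of 1]) auto
next
  case False
  \<comment> \<open>The gap is \<open>6 * \<theta>\<close>: the estimates for \<open>W\<close> and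
    for V/W lose \<open>2 * \<theta>\<close> each, and \<open>2 * \<theta>\<close> remains as the
    rate of contraction.\<close>
  define \<theta> where "\<theta> = (avg_coc - l) / 6"
  have th: "0 < \<theta>" using gap[OF False] by (simp add: \<theta>_def)
  have "avg_coc - 2 * \<theta> < avg_coc" using th by simp
  from lcoc_eventually_ge[OF this] lyapunov[OF False] AE_space
  have "AE z in \<eta> \<Otimes>\<^sub>M S. \<forall>\<^sub>F n in sequentially.
    contr (wk (snd z) n) (Q.rep (fst z)) \<le> exp (- 2 * \<theta> * real n)"
  proof eventually_elim
    case (elim z)
    then have z: "fst z \<in> space \<eta>" "snd z \<in> space S" by (auto simp: space_pair_measure)
    let ?v = "Q.rep (fst z)"
    have v: "?v \<notin> W" by (rule rep_\<eta>(1)[OF z(1)])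
    have "\<forall>\<^sub>F n in sequentially. ln (nW (wk (snd z) n)) / real n < l + 2 * \<theta>"
      using elim(2) th by (intro order_tendstoD(2)) auto
    with elim(1) show ?case using eventually_gt_at_top[of 0]
    proof eventually_elim
      case (elim n)
      let ?g = "wk (snd z) n"
      have g: "?g \<in> G" by (rule wk_in_G[OF z(2)])
      have p: "0 < nW ?g" by (rule abs_ln_nW_le(2)[OF g False])
      have d: "0 < del ?v" "0 < del (blinfun_apply ?g ?v)"
        using v G_in_W_iff[OF g, of ?v] by (auto intro: del_pos)
      have "ln (contr ?g ?v) = ln (nW ?g) - lcoc ?g ?v"
        using p d by (simp add: contr_def lcoc_def ln_mult ln_div)
      also have "\<dots> \<le> real n * (l + 2 * \<theta>) - real n * (avg_coc - 2 * \<theta>)"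
        using elim by (intro diff_mono) (auto simp: field_simps)
      also have "\<dots> = - 2 * \<theta> * real n" by (simp add: \<theta>_def field_simps)
      finally have "ln (contr ?g ?v) \<le> - 2 * \<theta> * real n" .
      moreover have "0 < contr ?g ?v" using p d by (simp add: contr_def)
      ultimately show "contr ?g ?v \<le> exp (- 2 * \<theta> * real n)" by (metis exp_le_cancel_iff exp_ln)
    qed
  qed
  then show ?thesis by (rule that[OF th])
qed

lemma contr_Z_measurable [measurable]:
  "(\<lambda>z. contr (wk (snd z) k) (Q.rep (fst z))) \<in> borel_measurable (\<eta> \<Otimes>\<^sub>M S)"
  by (rule contr_rep_measurable)
     (rule measurable_compose[OF measurable_snd wk_measurable] \<eta>_measurable[OF measurable_fst])+

text \<open>With a weight of at least \<open>exp (\<theta> * real k)\<close> in front of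
  \<open>contr\<close>, the minimum equals 1 on every block whose contraction factor is at least
  \<open>exp (- \<theta> * real k)\<close>. It is thus a majorant of the indicator of bad blocks
  that is continuous in the point. The weight uses up half of the exponent
  \<open>2 * \<theta>\<close>, and it is rounded to a natural number so that only countably many
  such functions occur.\<close>

lemma contr_integral_tendsto:
  obtains \<theta> where "0 < \<theta>" "(\<lambda>k. \<integral>z. min 1 (real (nat \<lceil>exp (\<theta> * real k)\<rceil>) * contr (wk (snd z) k) (Q.rep (fst z)))
    \<partial>(\<eta> \<Otimes>\<^sub>M S)) \<longlonglongrightarrow> 0"
proof -
  obtain \<theta> where th: "0 < \<theta>" and ae: "AE z in \<eta> \<Otimes>\<^sub>M S. \<forall>\<^sub>F n in sequentially.
    contr (wk (snd z) n) (Q.rep (fst z)) \<le> exp (- 2 * \<theta> * real n)" by (rule contraction)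
  let ?F = "\<lambda>k z. min 1 (real (nat \<lceil>exp (\<theta> * real k)\<rceil>) * contr (wk (snd z) k) (Q.rep (fst z)))"
  have nn: "0 \<le> ?F k z" for k z
    by (intro min.boundedI mult_nonneg_nonneg of_nat_0_le_iff contr_nonneg) simp
  have "(\<lambda>k. \<integral>z. ?F k z \<partial>(\<eta> \<Otimes>\<^sub>M S)) \<longlonglongrightarrow> (\<integral>z. 0 \<partial>(\<eta> \<Otimes>\<^sub>M S))"
  proof (rule integral_dominated_convergence[where w="\<lambda>_. 1"])
    show "AE z in \<eta> \<Otimes>\<^sub>M S. (\<lambda>k. ?F k z) \<longlonglongrightarrow> 0"
      using ae
    proof eventually_elim
      case (elim z)
      have "(\<lambda>k. (exp (\<theta> * real k) + 1) * exp (- 2 * \<theta> * real k)) \<longlonglongrightarrow> 0"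
        using th by real_asymp
      moreover have "\<forall>\<^sub>F k in sequentially. ?F k z \<le> (exp (\<theta> * real k) + 1) * exp (- 2 * \<theta> * real k)"
        using elim
      proof eventually_elim
        case (elim k)
        have "real (nat \<lceil>exp (\<theta> * real k)\<rceil>) \<le> exp (\<theta> * real k) + 1"
          using of_int_ceiling_le_add_one[of "exp (\<theta> * real k)"] by (simp add: of_nat_nat)
        then have "real (nat \<lceil>exp (\<theta> * real k)\<rceil>) * contr (wk (snd z) k) (Q.rep (fst z))
            \<le> (exp (\<theta> * real k) + 1) * exp (- 2 * \<theta> * real k)"
          using elim contr_nonneg by (intro mult_mono) auto
        then show ?case by linarith
      qed
      ultimately show ?case
        using tendsto_sandwich[of "\<lambda>_. 0" "\<lambda>k. ?F k z" sequentially] nn[of _ z] by auto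
    qed
    show "AE z in \<eta> \<Otimes>\<^sub>M S. norm (?F k z) \<le> 1" for k
      by (intro AE_I2) (simp only: real_norm_def abs_of_nonneg[OF nn] min.cobounded1)
  qed simp_all
  then show ?thesis using that[OF th] by simp
qed

end

section \<open>Tightness and convergence of Cesaro averages\<close>

text \<open>Only the first \<open>k\<close> terms survive with a positive sign. This pays for
  comparing the walk with itself \<open>k\<close> steps later.\<close>

lemma sum_telescope_shift_le:
  fixes a :: "nat \<Rightarrow> real"
  assumes "\<And>i. 0 \<le> a i"
  shows "(\<Sum>i=1..n. a i - a (i + k)) \<le> (\<Sum>i=1..k. a i)"
proof -
  have "(\<Sum>i=1..n. a i) \<le> (\<Sum>i=1..n + k. a i)"
    by (rule sum_mono2) (auto simp: assms)
  also have "{1..n + k} = {1..k} \<union> {1 + k..n + k}" by auto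
  also have "(\<Sum>i\<in>{1..k} \<union> {1 + k..n + k}. a i) = (\<Sum>i=1..k. a i) + (\<Sum>i=1 + k..n + k. a i)"
    by (rule sum.union_disjoint) auto
  also have "(\<Sum>i=1 + k..n + k. a i) = (\<Sum>i=1..n. a (i + k))"
    by (rule sum.shift_bounds_cl_nat_ivl)
  finally show ?thesis by (simp add: sum_subtractf)
qed

section \<open>The drift inequality for blocks\<close>

context random_walk
begin

definition blk :: "(nat \<Rightarrow> 'v \<Rightarrow>\<^sub>L 'v) \<Rightarrow> nat \<Rightarrow> nat \<Rightarrow> 'v \<Rightarrow>\<^sub>L 'v" where
  "blk \<omega> i k = wk ((shift ^^ i) \<omega>) k"

lemma blk_in_G: "\<omega> \<in> space S \<Longrightarrow> blk \<omega> i k \<in> G"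
  unfolding blk_def by (intro wk_in_G shift_space)

lemma blk_measurable [measurable]: "(\<lambda>\<omega>. blk \<omega> i k) \<in> S \<rightarrow>\<^sub>M gm"
  unfolding blk_def by measurable

lemma ln_size_blk_le: "\<omega> \<in> space S \<Longrightarrow> ln (size (blk \<omega> i k)) \<le> (\<Sum>j<k. ln (size (\<omega> (i + j))))"
  using ln_size_wk_le[OF shift_space[of \<omega> i], of k] by (simp add: blk_def funpow_shift)

lemma wk_apply_add: "blinfun_apply (wk \<omega> (i + k)) v = blinfun_apply (blk \<omega> i k) (blinfun_apply (wk \<omega> i) v)"
  by (simp add: wk_add blk_def)

lemma wk_apply_notin: "\<omega> \<in> space S \<Longrightarrow> v \<notin> W \<Longrightarrow> blinfun_apply (wk \<omega> i) v \<notin> W"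
  using G_in_W_iff[OF wk_in_G] by simp

text \<open>The cut at \<open>R\<close> absorbs the additive term of \<open>slope_apply_le\<close>:
  below \<open>R\<close> the potential is constant, and far above it the logarithm turns a
  contraction of the slope into a decrease by a fixed amount.\<close>

definition potential :: "real \<Rightarrow> 'v \<Rightarrow> real" where
  "potential R v = ln (max (slope v) R)"

lemma potential_nonneg: "1 \<le> R \<Longrightarrow> 0 \<le> potential R v"
  by (simp add: potential_def ln_ge_zero)

text \<open>On a good block \<open>RC\<close> bounds the additive term by the difference between the
  decay rates \<open>exp (- x / 2)\<close> and \<open>exp (- x)\<close>, so the new slope is at most
  \<open>exp (- x / 2)\<close> times \<open>max (slope v) R\<close>. Hence the potential drops by
  \<open>x / 2\<close> if the slope exceeds \<open>R * exp (x / 2)\<close>, and it never increases.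
  On a bad block the maximum grows at most by the factor \<open>3 * (size g)\<^sup>2\<close>, with
  \<open>ln 3 \<le> 2\<close>, and the additional \<open>x / 2\<close> in the error offsets the
  indicator.\<close>

lemma potential_step:
  assumes g: "g \<in> G" and v: "v \<notin> W" and x: "0 < x" and R: "1 \<le> R" and C: "0 < C"
    and RC: "2 * C\<^sup>2 \<le> R * (exp (- x / 2) - exp (- x))"
  shows "potential R (blinfun_apply g v) \<le> potential R v - x / 2 * indicator {R * exp (x / 2)<..} (slope v)
    + (if contr g v \<le> exp (- x) \<and> size g \<le> C then 0 else x / 2 + 2 + 2 * ln (size g))"
proof -
  let ?s = "slope v" and ?s' = "slope (blinfun_apply g v)" and ?N = "size g"
  have N: "1 \<le> ?N" by (rule size_ge_1[OF g])
  have s: "0 \<le> ?s" by (rule slope_nonneg)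
  have sl: "?s' \<le> contr g v * ?s + 2 * ?N\<^sup>2" by (rule slope_apply_le[OF g v])
  show ?thesis
  proof (cases "contr g v \<le> exp (- x) \<and> ?N \<le> C")
    case True
    have "?N\<^sup>2 \<le> C\<^sup>2" using True N by (intro power_mono) auto
    moreover have "contr g v * ?s \<le> exp (- x) * ?s" using True s by (intro mult_right_mono) auto
    moreover have "exp (- x) * ?s \<le> exp (- x) * max ?s R" by (intro mult_left_mono) auto
    moreover have "R * (exp (- x / 2) - exp (- x)) \<le> max ?s R * (exp (- x / 2) - exp (- x))"
      using x by (intro mult_right_mono) auto
    ultimately have "?s' \<le> exp (- x) * max ?s R + max ?s R * (exp (- x / 2) - exp (- x))"
      using sl RC by linarith
    then have s': "?s' \<le> exp (- x / 2) * max ?s R" by (simp add: algebra_simps)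
    show ?thesis
    proof (cases "?s > R * exp (x / 2)")
      case big: True
      have "1 \<le> exp (x / 2)" using x by simp
      then have "R * 1 \<le> R * exp (x / 2)" using R by (intro mult_left_mono) auto
      then have m: "max ?s R = ?s" using big by linarith
      have "exp (- x / 2) * (R * exp (x / 2)) \<le> exp (- x / 2) * ?s" using big by (intro mult_left_mono) auto
      moreover have "exp (- x / 2) * (R * exp (x / 2)) = R * (exp (- x / 2) * exp (x / 2))"
        by (rule mult.left_commute)
      moreover have e1: "exp (- x / 2) * exp (x / 2) = 1" unfolding exp_add[symmetric] by simp
      ultimately have "R \<le> exp (- x / 2) * ?s" unfolding e1 by linarith
      moreover have "?s' \<le> exp (- x / 2) * ?s" using s' m by simp
      ultimately have "max ?s' R \<le> exp (- x / 2) * ?s" by simp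
      moreover have sp: "0 < ?s" "0 < max ?s' R" using m R by linarith+
      ultimately have "ln (max ?s' R) \<le> ln (exp (- x / 2) * ?s)" by (intro ln_mono) auto
      also have "\<dots> = - x / 2 + ln ?s" using sp by (simp add: ln_mult)
      finally show ?thesis using True big m by (simp add: potential_def)
    next
      case small: False
      have "exp (- x / 2) * max ?s R \<le> 1 * max ?s R" using x s by (intro mult_right_mono) auto
      then have "max ?s' R \<le> max ?s R" using s' by linarith
      then have "ln (max ?s' R) \<le> ln (max ?s R)" using R by (intro ln_mono) auto
      then show ?thesis using True small by (simp add: potential_def)
    qed
  next
    case False
    have m: "1 \<le> max ?s R" using R by simp
    have N2: "1 \<le> ?N\<^sup>2" using N by simp
    have "contr g v * ?s \<le> ?N\<^sup>2 * max ?s R"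
      using contr_le[OF g v] s by (intro mult_mono) auto
    moreover have "2 * ?N\<^sup>2 * 1 \<le> 2 * ?N\<^sup>2 * max ?s R" using m by (intro mult_left_mono) auto
    moreover have "1 * max ?s R \<le> 3 * ?N\<^sup>2 * max ?s R" using m N2 by (intro mult_right_mono) auto
    ultimately have "max ?s' R \<le> 3 * ?N\<^sup>2 * max ?s R" using sl by simp
    then have "ln (max ?s' R) \<le> ln (3 * ?N\<^sup>2 * max ?s R)" using R by (intro ln_mono) auto
    also have "\<dots> = ln 3 + 2 * ln ?N + ln (max ?s R)"
    proof -
      have p: "0 < max ?s R" "0 < ?N\<^sup>2" "0 < ?N" using m N by auto
      have "ln (3 * ?N\<^sup>2 * max ?s R) = ln (3 * ?N\<^sup>2) + ln (max ?s R)" using p by (intro ln_mult_pos) auto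
      also have "ln (3 * ?N\<^sup>2) = ln 3 + ln (?N\<^sup>2)" using p by (intro ln_mult_pos) auto
      also have "ln (?N\<^sup>2) = 2 * ln ?N" using p by (simp add: ln_realpow)
      finally show ?thesis by simp
    qed
    also have "ln 3 \<le> (2 :: real)" using ln_le_minus_one[of 3] by simp
    finally have "potential R (blinfun_apply g v) \<le> potential R v + 2 + 2 * ln ?N" by (simp add: potential_def)
    moreover have "x / 2 * indicator {R * exp (x / 2)<..} ?s \<le> x / 2" using x by (simp add: indicator_def)
    moreover have "p \<le> q - a + (b + 2 + 2 * l)" if "p \<le> q + 2 + 2 * l" "a \<le> b" for p q l a b :: real
      using that by linarith
    ultimately show ?thesis unfolding if_not_P[OF False] by blast
  qed
qed

text \<open>A crude bound for the first \<open>k\<close> positions, which are the terms left over by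
  \<open>sum_telescope_shift_le\<close>.\<close>

lemma potential_le:
  assumes g: "g \<in> G" and v: "v \<notin> W" and R: "1 \<le> R"
  shows "potential R (blinfun_apply g v) \<le> ln R + ln (slope v + 2) + 2 * ln (size g)"
proof -
  have N: "1 \<le> size g" by (rule size_ge_1[OF g])
  then have N2: "1 \<le> (size g)\<^sup>2" by simp
  have s: "0 \<le> slope v" by (rule slope_nonneg)
  have "contr g v * slope v \<le> (size g)\<^sup>2 * slope v"
    using contr_le[OF g v] s by (intro mult_right_mono) auto
  then have "slope (blinfun_apply g v) \<le> (size g)\<^sup>2 * (slope v + 2)"
    using slope_apply_le[OF g v] by (simp add: algebra_simps)
  also have "\<dots> * 1 \<le> (size g)\<^sup>2 * (slope v + 2) * R" using R s by (intro mult_left_mono) auto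
  finally have 1: "slope (blinfun_apply g v) \<le> (size g)\<^sup>2 * (slope v + 2) * R" by simp
  have "1 * 1 \<le> (size g)\<^sup>2 * (slope v + 2)" using N2 s by (intro mult_mono) auto
  then have "1 * R \<le> (size g)\<^sup>2 * (slope v + 2) * R" using R by (intro mult_right_mono) auto
  then have "max (slope (blinfun_apply g v)) R \<le> (size g)\<^sup>2 * (slope v + 2) * R" using 1 by simp
  then have "potential R (blinfun_apply g v) \<le> ln ((size g)\<^sup>2 * (slope v + 2) * R)"
    unfolding potential_def using R by (intro ln_mono) auto
  also have "\<dots> = ln ((size g)\<^sup>2 * (slope v + 2)) + ln R" using N R s by (intro ln_mult_pos) auto
  also have "ln ((size g)\<^sup>2 * (slope v + 2)) = ln ((size g)\<^sup>2) + ln (slope v + 2)" using N s by (intro ln_mult_pos) auto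
  also have "ln ((size g)\<^sup>2) = 2 * ln (size g)" using N by (simp add: ln_realpow)
  finally show ?thesis by simp
qed

definition excess :: "nat \<Rightarrow> ('v \<Rightarrow>\<^sub>L 'v) \<Rightarrow> real" where
  "excess m g = max 0 (ln (size g) - real m)"

lemma excess_nonneg: "0 \<le> excess m g"
  by (simp add: excess_def)

text \<open>Summing the one-block drift inequality along the walk; the unbounded error terms are
  truncated at level \<open>m\<close> per step.\<close>

lemma occupation_bound:
  assumes \<omega>: "\<omega> \<in> space S" and v: "v \<notin> W" and \<theta>: "0 < \<theta>" and k: "1 \<le> k" and R: "1 \<le> R"
    and RC: "2 * (real (Suc C))\<^sup>2 \<le> R * (exp (- (\<theta> * real k) / 2) - exp (- (\<theta> * real k)))"
  defines "c \<equiv> nat \<lceil>exp (\<theta> * real k)\<rceil>"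
  shows "(\<Sum>i=1..n. \<theta> * real k / 2 * indicator {R * exp (\<theta> * real k / 2)<..} (slope (blinfun_apply (wk \<omega> i) v)))
    \<le> (\<Sum>i=1..k. ln R + ln (slope v + 2) + 2 * (\<Sum>j<i. ln (size (\<omega> j))))
      + (\<Sum>i=1..n. (\<theta> * real k / 2 + 2 + 2 * (real k * real m)) *
          (min 1 (real c * contr (blk \<omega> i k) (blinfun_apply (wk \<omega> i) v)) + min 1 (size (blk \<omega> i k) / real (Suc C)))
        + 2 * (\<Sum>j<k. excess m (\<omega> (i + j))))"
proof -
  let ?x = "\<theta> * real k"
  let ?v = "\<lambda>i. blinfun_apply (wk \<omega> i) v"
  let ?D = "?x / 2 + 2 + 2 * (real k * real m)"
  let ?I = "\<lambda>i. indicator {R * exp (?x / 2)<..} (slope (?v i)) :: real"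
  let ?\<phi> = "\<lambda>i. min 1 (real c * contr (blk \<omega> i k) (?v i)) + min 1 (size (blk \<omega> i k) / real (Suc C))"
  have x: "0 < ?x" using \<theta> k by simp
  have step: "?x / 2 * ?I i \<le> potential R (?v i) - potential R (?v (i + k)) + (?D * ?\<phi> i + 2 * (\<Sum>j<k. excess m (\<omega> (i + j))))" for i
  proof -
    let ?g = "blk \<omega> i k"
    have g: "?g \<in> G" by (rule blk_in_G[OF \<omega>])
    have N: "1 \<le> size ?g" by (rule size_ge_1[OF g])
    have p: "0 \<le> real c * contr ?g (?v i)" "0 \<le> size ?g / real (Suc C)" using contr_nonneg N by simp_all
    have Dp: "0 \<le> ?D" using x by simp
    have e0: "0 \<le> (\<Sum>j<k. excess m (\<omega> (i + j)))" by (intro sum_nonneg excess_nonneg)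
    have "(if contr ?g (?v i) \<le> exp (- ?x) \<and> size ?g \<le> real (Suc C) then 0 else ?x / 2 + 2 + 2 * ln (size ?g))
        \<le> ?D * ?\<phi> i + 2 * (\<Sum>j<k. excess m (\<omega> (i + j)))"
    proof (cases "contr ?g (?v i) \<le> exp (- ?x) \<and> size ?g \<le> real (Suc C)")
      case True
      have "0 \<le> ?D * ?\<phi> i" by (rule mult_nonneg_nonneg[OF Dp]) (use p in simp)
      then show ?thesis using True e0 by simp
    next
      case False
      \<comment> \<open>On a bad block one of the two minima equals 1: either the block is large, or
        its contraction factor exceeds \<open>exp (- ?x)\<close> and \<open>real c\<close> is at
        least \<open>exp ?x\<close>.\<close>
      have "1 \<le> ?\<phi> i"
      proof (cases "size ?g \<le> real (Suc C)")
        case True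
        then have "exp (- ?x) < contr ?g (?v i)" using False by simp
        moreover have "exp ?x \<le> real c" unfolding c_def by (simp add: real_nat_ceiling_ge)
        ultimately have "exp ?x * exp (- ?x) \<le> real c * contr ?g (?v i)" by (intro mult_mono) auto
        then have "1 \<le> real c * contr ?g (?v i)" by (simp add: exp_minus)
        then show ?thesis using p(2) by simp
      next
        case False
        then have "1 \<le> size ?g / real (Suc C)" by (simp add: le_divide_eq)
        then show ?thesis using p(1) by simp
      qed
      then have "?D * 1 \<le> ?D * ?\<phi> i" using Dp by (rule mult_left_mono)
      moreover have "ln (size ?g) \<le> real k * real m + (\<Sum>j<k. excess m (\<omega> (i + j)))"
      proof -
        have "ln (size ?g) \<le> (\<Sum>j<k. ln (size (\<omega> (i + j))))" by (rule ln_size_blk_le[OF \<omega>])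
        also have "\<dots> \<le> (\<Sum>j<k. real m + excess m (\<omega> (i + j)))" by (rule sum_mono) (simp add: excess_def)
        finally show ?thesis by (simp add: sum.distrib)
      qed
      moreover have "a + 2 * l \<le> p + 2 * e" if "(a + 2 * r) * 1 \<le> p" "l \<le> r + e" for a l p e r :: real
        using that unfolding mult_1_right by linarith
      ultimately show ?thesis unfolding if_not_P[OF False] by blast
    qed
    moreover have "potential R (?v (i + k)) \<le> potential R (?v i) - ?x / 2 * ?I i
      + (if contr ?g (?v i) \<le> exp (- ?x) \<and> size ?g \<le> real (Suc C) then 0 else ?x / 2 + 2 + 2 * ln (size ?g))"
      unfolding wk_apply_add[of \<omega> i k v]
      by (rule potential_step[OF g wk_apply_notin[OF \<omega> v] x R _ RC]) simp
    ultimately show ?thesis by linarith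
  qed
  have "(\<Sum>i=1..n. ?x / 2 * ?I i) \<le> (\<Sum>i=1..n. potential R (?v i) - potential R (?v (i + k)) + (?D * ?\<phi> i + 2 * (\<Sum>j<k. excess m (\<omega> (i + j)))))"
    by (rule sum_mono) (rule step)
  also have "\<dots> = (\<Sum>i=1..n. potential R (?v i) - potential R (?v (i + k))) + (\<Sum>i=1..n. ?D * ?\<phi> i + 2 * (\<Sum>j<k. excess m (\<omega> (i + j))))"
    by (rule sum.distrib)
  also have "(\<Sum>i=1..n. potential R (?v i) - potential R (?v (i + k))) \<le> (\<Sum>i=1..k. potential R (?v i))"
    by (rule sum_telescope_shift_le) (rule potential_nonneg[OF R])
  also have "(\<Sum>i=1..k. potential R (?v i)) \<le> (\<Sum>i=1..k. ln R + ln (slope v + 2) + 2 * (\<Sum>j<i. ln (size (\<omega> j))))"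
  proof (rule sum_mono)
    fix i
    show "potential R (?v i) \<le> ln R + ln (slope v + 2) + 2 * (\<Sum>j<i. ln (size (\<omega> j)))"
      using potential_le[OF wk_in_G[OF \<omega>, of i] v R] ln_size_wk_le[OF \<omega>, of i] by linarith
  qed
  finally show ?thesis by simp
qed

lemma wk_apply_measurable [measurable]: "(\<lambda>\<omega>. blinfun_apply (wk \<omega> i) v) \<in> borel_measurable S"
proof -
  have "continuous_on G (\<lambda>g. blinfun_apply g v)" by (intro continuous_intros)
  then have "(\<lambda>g. blinfun_apply g v) \<in> borel_measurable gm"
    using borel_measurable_continuous_on_restrict measurable_cong_sets[OF sets_gm refl] by blast
  from measurable_compose[OF wk_measurable this] show ?thesis .
qed

lemma del_measurable [measurable]: "del \<in> borel_measurable borel"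
  by (rule borel_measurable_continuous_onI[OF continuous_on_del])
lemma pr_measurable [measurable]: "pr \<in> borel_measurable borel"
  by (rule borel_measurable_continuous_onI[OF continuous_on_pr])
lemma slope_measurable [measurable]: "slope \<in> borel_measurable borel"
  unfolding slope_def[abs_def] by measurable

lemma contr_blk_measurable [measurable]:
  "(\<lambda>\<omega>. contr (blk \<omega> i k) (blinfun_apply (wk \<omega> i) v)) \<in> borel_measurable S"
  unfolding contr_def wk_apply_add[symmetric] by measurable

lemma excess_measurable [measurable]: "excess m \<in> borel_measurable gm"
  unfolding excess_def[abs_def] by measurable

lemma excess_integral_tendsto: "(\<lambda>m. \<integral>g. excess m g \<partial>gm) \<longlonglongrightarrow> 0"
proof -
  have "(\<lambda>m. \<integral>g. excess m g \<partial>gm) \<longlonglongrightarrow> (\<integral>g. 0 \<partial>gm)"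
  proof (rule integral_dominated_convergence[where w="\<lambda>g. ln (size g)"])
    show "AE g in gm. (\<lambda>m. excess m g) \<longlonglongrightarrow> 0"
    proof (rule AE_I2)
      fix g
      have "\<forall>\<^sub>F m in sequentially. excess m g = 0"
        using eventually_ge_at_top[of "nat \<lceil>ln (size g)\<rceil>"]
        by eventually_elim (simp add: excess_def nat_le_iff ceiling_le_iff)
      then show "(\<lambda>m. excess m g) \<longlonglongrightarrow> 0" by (rule tendsto_eventually)
    qed
    show "AE g in gm. norm (excess m g) \<le> ln (size g)" for m
      by (rule AE_I2) (use ln_size_nonneg in \<open>auto simp: space_gm excess_def\<close>)
  qed (use moment in auto)
  then show ?thesis by simp
qed

end

text \<open>With \<open>K = S\<close> the quantity \<open>avg\<close> is the Cesaro average of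
  expectations, and with \<open>K = return S \<omega>\<close> it is the empirical average along the
  path \<open>\<omega>\<close>. Both assertions of the theorem thereby rest on the same
  estimates.\<close>

locale cesaro_walk = contracting_walk +
  fixes K :: "(nat \<Rightarrow> 'b \<Rightarrow>\<^sub>L 'b) measure" and v0 :: 'b
  assumes prob_K: "prob_space K" and sets_K: "sets K = sets S" and v0: "v0 \<notin> W"
begin

sublocale K: prob_space K by (rule prob_K)

lemma space_K: "space K = space S"
  by (rule sets_eq_imp_space_eq[OF sets_K])

lemma K_measurable: "f \<in> borel_measurable S \<Longrightarrow> f \<in> borel_measurable K"
  using measurable_cong_sets[OF sets_K refl] by blast

definition pos :: "(nat \<Rightarrow> 'b \<Rightarrow>\<^sub>L 'b) \<Rightarrow> nat \<Rightarrow> 'b" where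
  "pos \<omega> i = blinfun_apply (wk \<omega> i) v0"

definition avg :: "(nat \<Rightarrow> (nat \<Rightarrow> 'b \<Rightarrow>\<^sub>L 'b) \<Rightarrow> real) \<Rightarrow> nat \<Rightarrow> real" where
  "avg F n = (\<Sum>i=1..n. \<integral>\<omega>. F i \<omega> \<partial>K) / real n"

text \<open>In the limit the current position has law \<open>\<eta>\<close> in P(V/W) and the
  following \<open>k\<close> steps are independent of it.\<close>

definition equidistributed :: "nat \<Rightarrow> (('b \<Rightarrow>\<^sub>L 'b) \<Rightarrow> 'b \<Rightarrow> real) \<Rightarrow> bool" where
  "equidistributed k \<phi> \<longleftrightarrow> avg (\<lambda>i \<omega>. \<phi> (blk \<omega> i k) (pos \<omega> i)) \<longlonglongrightarrow>
     (\<integral>z. \<phi> (wk (snd z) k) (Q.rep (fst z)) \<partial>(\<eta> \<Otimes>\<^sub>M S))"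

lemma pos_measurable [measurable]: "(\<lambda>\<omega>. pos \<omega> i) \<in> borel_measurable S"
  unfolding pos_def by measurable

lemma K_integrable_bounded:
  assumes "f \<in> borel_measurable S" "\<And>\<omega>. \<omega> \<in> space S \<Longrightarrow> \<bar>f \<omega>\<bar> \<le> (B :: real)"
  shows "integrable K f"
  using assms(2) by (intro K.integrable_const_bound[of _ B] K_measurable assms(1) AE_I2) (simp add: space_K)

lemma avg_mono:
  assumes "\<And>i. integrable K (F i)" "\<And>i. integrable K (H i)" "\<And>i \<omega>. \<omega> \<in> space S \<Longrightarrow> F i \<omega> \<le> H i \<omega>"
  shows "avg F n \<le> avg H n"
  unfolding avg_def using assms
  by (intro divide_right_mono sum_mono integral_mono) (auto simp: space_K)

lemma avg_add:
  assumes "\<And>i. integrable K (F i)" "\<And>i. integrable K (H i)"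
  shows "avg (\<lambda>i \<omega>. F i \<omega> + H i \<omega>) n = avg F n + avg H n"
  unfolding avg_def using assms by (simp add: sum.distrib add_divide_distrib)

lemma avg_cmult: "avg (\<lambda>i \<omega>. c * F i \<omega>) n = c * avg F n"
  unfolding avg_def by (simp add: sum_distrib_left)

lemma avg_sum:
  assumes "\<And>i j. integrable K (F j i)"
  shows "avg (\<lambda>i \<omega>. \<Sum>j\<in>J. F j i \<omega>) n = (\<Sum>j\<in>J. avg (F j) n)"
proof -
  have "(\<Sum>i=1..n. \<integral>\<omega>. (\<Sum>j\<in>J. F j i \<omega>) \<partial>K) = (\<Sum>i=1..n. \<Sum>j\<in>J. \<integral>\<omega>. F j i \<omega> \<partial>K)"
    using assms by (intro sum.cong refl Bochner_Integration.integral_sum) auto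
  also have "\<dots> = (\<Sum>j\<in>J. \<Sum>i=1..n. \<integral>\<omega>. F j i \<omega> \<partial>K)" by (rule sum.swap)
  finally show ?thesis unfolding avg_def by (simp add: sum_divide_distrib)
qed

lemma avg_integral: "(\<And>i. integrable K (F i)) \<Longrightarrow> avg F n = (\<integral>\<omega>. (\<Sum>i=1..n. F i \<omega>) \<partial>K) / real n"
  unfolding avg_def by (simp add: Bochner_Integration.integral_sum)

end

text \<open>The averages that occur in \<open>occupation_bound\<close>. They are required for all
  parameters because \<open>c\<close>, \<open>k\<close> and \<open>m\<close> are chosen only when
  \<open>\<epsilon>\<close> is given.\<close>

locale equidistributed_walk = cesaro_walk +
  assumes equi_contr: "equidistributed k (\<lambda>g v. min 1 (real c * contr g v))"
    and equi_size: "equidistributed k (\<lambda>g v. min 1 (size g / real (Suc c)))"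
    and avg_excess: "avg (\<lambda>i \<omega>. excess m (\<omega> (i + j))) \<longlonglongrightarrow> (\<integral>g. excess m g \<partial>gm)"
    and moment_K: "integrable K (\<lambda>\<omega>. ln (size (\<omega> j)))"
begin

lemma size_integral_tendsto:
  "(\<lambda>C. \<integral>z. min 1 (size (wk (snd z) k) / real (Suc C)) \<partial>(\<eta> \<Otimes>\<^sub>M S)) \<longlonglongrightarrow> 0"
proof -
  have m: "(\<lambda>z. size (wk (snd z) k)) \<in> borel_measurable (\<eta> \<Otimes>\<^sub>M S)" by measurable
  have "(\<lambda>C. \<integral>z. min 1 (size (wk (snd z) k) / real (Suc C)) \<partial>(\<eta> \<Otimes>\<^sub>M S)) \<longlonglongrightarrow> (\<integral>z. 0 \<partial>(\<eta> \<Otimes>\<^sub>M S))"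
  proof (rule integral_dominated_convergence[where w="\<lambda>_. 1"])
    show "AE z in \<eta> \<Otimes>\<^sub>M S. (\<lambda>C. min 1 (size (wk (snd z) k) / real (Suc C))) \<longlonglongrightarrow> 0"
    proof (rule AE_I2)
      fix z
      have "(\<lambda>C. size (wk (snd z) k) / real (Suc C)) \<longlonglongrightarrow> 0"
        by (rule LIMSEQ_Suc[OF lim_const_over_n])
      from tendsto_min[OF tendsto_const[of 1] this]
      show "(\<lambda>C. min 1 (size (wk (snd z) k) / real (Suc C))) \<longlonglongrightarrow> 0" by simp
    qed
    show "AE z in \<eta> \<Otimes>\<^sub>M S. norm (min 1 (size (wk (snd z) k) / real (Suc C))) \<le> 1" for C
    proof (rule AE_I2)
      fix z assume "z \<in> space (\<eta> \<Otimes>\<^sub>M S)"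
      then have "0 \<le> size (wk (snd z) k) / real (Suc C)"
        using size_ge_1[OF wk_in_G[of "snd z" k]] by (simp add: space_pair_measure mem_Times_iff)
      then show "norm (min 1 (size (wk (snd z) k) / real (Suc C))) \<le> 1" by simp
    qed
  qed (use m in simp_all)
  then show ?thesis by simp
qed

text \<open>\<open>occupation_bound\<close>, averaged and divided by
  \<open>\<theta> * real k / 2\<close>, bounds the proportion of time spent above a level. The
  choices come in the order \<open>m\<close>, \<open>k\<close>, \<open>C\<close>, \<open>R\<close>:
  the excess of the steps becomes small, then weak contraction rare, then large blocks rare, and
  finally the level dominates the additive error of the good blocks.\<close>

lemma tight:
  assumes "0 < \<epsilon>"
  shows "\<exists>R. \<forall>\<^sub>F n in sequentially. avg (\<lambda>i \<omega>. indicator {R<..} (slope (pos \<omega> i))) n < \<epsilon>"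
proof -
  obtain \<theta> where th: "0 < \<theta>" and lim1: "(\<lambda>k. \<integral>z. min 1 (real (nat \<lceil>exp (\<theta> * real k)\<rceil>) * contr (wk (snd z) k) (Q.rep (fst z)))
    \<partial>(\<eta> \<Otimes>\<^sub>M S)) \<longlonglongrightarrow> 0" by (rule contr_integral_tendsto)
  \<comment> \<open>Each of the \<open>k\<close> steps of a block counts its excess with the factor
    \<open>4 / (\<theta> * real k)\<close>, so the total contribution is below
    \<open>\<epsilon> / 2\<close>.\<close>
  have "\<forall>\<^sub>F m in sequentially. (\<integral>g. excess m g \<partial>gm) < \<epsilon> * \<theta> / 8"
    using excess_integral_tendsto th assms by (intro order_tendstoD(2)) auto
  then obtain m where m: "(\<integral>g. excess m g \<partial>gm) < \<epsilon> * \<theta> / 8" unfolding eventually_sequentially by blast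
  \<comment> \<open>A bound for \<open>2 * ?D / ?x\<close> that is uniform in
    \<open>k \<ge> 1\<close> and can therefore be fixed before \<open>k\<close>. The two averages
    multiplied by \<open>?D\<close> will then contribute less than
    \<open>\<epsilon> / 2\<close>.\<close>
  define B where "B = 1 + 4 / \<theta> + 4 * real m / \<theta>"
  have B: "0 < B" using th unfolding B_def by (intro add_pos_nonneg) auto
  define I1 where "I1 = (\<lambda>k. \<integral>z. min 1 (real (nat \<lceil>exp (\<theta> * real k)\<rceil>) * contr (wk (snd z) k) (Q.rep (fst z)))
    \<partial>(\<eta> \<Otimes>\<^sub>M S))"
  have "\<forall>\<^sub>F k in sequentially. I1 k < \<epsilon> / (4 * B)"
    unfolding I1_def using lim1 B assms by (intro order_tendstoD(2)) auto
  then have "\<forall>\<^sub>F k in sequentially. I1 k < \<epsilon> / (4 * B) \<and> 1 \<le> k"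
    using eventually_ge_at_top[of 1] by (rule eventually_conj)
  then obtain k where k: "1 \<le> k" "I1 k < \<epsilon> / (4 * B)" unfolding eventually_sequentially by blast
  define I2 where "I2 = (\<lambda>C. \<integral>z. min 1 (size (wk (snd z) k) / real (Suc C)) \<partial>(\<eta> \<Otimes>\<^sub>M S))"
  have "\<forall>\<^sub>F C in sequentially. I2 C < \<epsilon> / (4 * B)"
    unfolding I2_def using size_integral_tendsto B assms by (intro order_tendstoD(2)) auto
  then obtain C where C: "I2 C < \<epsilon> / (4 * B)" unfolding eventually_sequentially by blast
  let ?x = "\<theta> * real k"
  have x: "0 < ?x" using th k by simp
  have d: "0 < exp (- ?x / 2) - exp (- ?x)" using x by simp
  define R where "R = max 1 (2 * (real (Suc C))\<^sup>2 / (exp (- ?x / 2) - exp (- ?x)))"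
  have R1: "1 \<le> R" by (simp add: R_def)
  have "2 * (real (Suc C))\<^sup>2 / (exp (- ?x / 2) - exp (- ?x)) \<le> R" by (simp add: R_def)
  then have RC: "2 * (real (Suc C))\<^sup>2 \<le> R * (exp (- ?x / 2) - exp (- ?x))"
    using d by (simp only: pos_divide_le_eq)
  define c where "c = nat \<lceil>exp ?x\<rceil>"
  let ?D = "?x / 2 + 2 + 2 * (real k * real m)"
  let ?I = "\<lambda>i \<omega>. indicator {R * exp (?x / 2)<..} (slope (pos \<omega> i)) :: real"
  let ?\<phi>1 = "\<lambda>i \<omega>. min 1 (real c * contr (blk \<omega> i k) (pos \<omega> i))"
  let ?\<phi>2 = "\<lambda>i \<omega>. min 1 (size (blk \<omega> i k) / real (Suc C))"
  let ?E = "\<lambda>i \<omega>. \<Sum>j<k. excess m (\<omega> (i + j))"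
  let ?K0 = "\<lambda>\<omega>. \<Sum>i=1..k. ln R + ln (slope v0 + 2) + 2 * (\<Sum>j<i. ln (size (\<omega> j)))"
  have i1: "integrable K (?\<phi>1 i)" for i
    unfolding pos_def by (rule K_integrable_bounded[of _ 1], measurable) (simp add: contr_nonneg)
  have i2: "integrable K (?\<phi>2 i)" for i
  proof (rule K_integrable_bounded[of _ 1])
    fix \<omega> assume "\<omega> \<in> space S"
    then have "0 \<le> size (blk \<omega> i k) / real (Suc C)" using size_ge_1[OF blk_in_G[of \<omega> i k]] by simp
    then show "\<bar>?\<phi>2 i \<omega>\<bar> \<le> 1" by simp
  qed measurable
  have i3: "integrable K (?I i)" for i
  proof (rule K_integrable_bounded[of _ 1])
    show "?I i \<in> borel_measurable S" by measurable
  qed (simp add: indicator_def)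
  have i4: "integrable K (\<lambda>\<omega>. excess m (\<omega> j))" for j
  proof (rule Bochner_Integration.integrable_bound[OF moment_K[of j]])
    show "(\<lambda>\<omega>. excess m (\<omega> j)) \<in> borel_measurable K" by (rule K_measurable) measurable
    show "AE \<omega> in K. norm (excess m (\<omega> j)) \<le> norm (ln (size (\<omega> j)))"
      using ln_size_nonneg[OF S_in_G] by (intro AE_I2) (auto simp: space_K excess_def)
  qed
  have i5: "integrable K ?K0"
    by (intro Bochner_Integration.integrable_sum Bochner_Integration.integrable_add
        Bochner_Integration.integrable_mult_right moment_K) simp_all
  have i6: "integrable K (\<lambda>\<omega>. ?D * (?\<phi>1 i \<omega> + ?\<phi>2 i \<omega>) + 2 * ?E i \<omega>)" for i
    by (intro Bochner_Integration.integrable_sum Bochner_Integration.integrable_add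
        Bochner_Integration.integrable_mult_right i1 i2 i4)
  have main: "?x / 2 * avg ?I n \<le> (\<integral>\<omega>. ?K0 \<omega> \<partial>K) / real n
      + (?D * (avg ?\<phi>1 n + avg ?\<phi>2 n) + 2 * (\<Sum>j<k. avg (\<lambda>i \<omega>. excess m (\<omega> (i + j))) n))" for n
  proof -
    have "?x / 2 * avg ?I n = avg (\<lambda>i \<omega>. ?x / 2 * ?I i \<omega>) n" by (rule avg_cmult[symmetric])
    also have "\<dots> = (\<integral>\<omega>. (\<Sum>i=1..n. ?x / 2 * ?I i \<omega>) \<partial>K) / real n"
      by (rule avg_integral) (intro Bochner_Integration.integrable_mult_right i3)
    also have "\<dots> \<le> (\<integral>\<omega>. ?K0 \<omega> + (\<Sum>i=1..n. ?D * (?\<phi>1 i \<omega> + ?\<phi>2 i \<omega>) + 2 * ?E i \<omega>) \<partial>K) / real n"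
    proof (intro divide_right_mono integral_mono)
      show "integrable K (\<lambda>\<omega>. \<Sum>i=1..n. ?x / 2 * ?I i \<omega>)"
        by (intro Bochner_Integration.integrable_sum Bochner_Integration.integrable_mult_right i3)
      show "integrable K (\<lambda>\<omega>. ?K0 \<omega> + (\<Sum>i=1..n. ?D * (?\<phi>1 i \<omega> + ?\<phi>2 i \<omega>) + 2 * ?E i \<omega>))"
        by (intro Bochner_Integration.integrable_add i5 Bochner_Integration.integrable_sum i6)
      fix \<omega> assume "\<omega> \<in> space K"
      then show "(\<Sum>i=1..n. ?x / 2 * ?I i \<omega>) \<le> ?K0 \<omega> + (\<Sum>i=1..n. ?D * (?\<phi>1 i \<omega> + ?\<phi>2 i \<omega>) + 2 * ?E i \<omega>)"
        unfolding pos_def c_def by (intro occupation_bound[OF _ v0 th k(1) R1 RC]) (simp add: space_K)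
    qed simp
    also have "\<dots> = (\<integral>\<omega>. ?K0 \<omega> \<partial>K) / real n + avg (\<lambda>i \<omega>. ?D * (?\<phi>1 i \<omega> + ?\<phi>2 i \<omega>) + 2 * ?E i \<omega>) n"
      by (subst Bochner_Integration.integral_add[OF i5 Bochner_Integration.integrable_sum[OF i6]])
         (simp only: add_divide_distrib avg_integral[OF i6])
    also have "avg (\<lambda>i \<omega>. ?D * (?\<phi>1 i \<omega> + ?\<phi>2 i \<omega>) + 2 * ?E i \<omega>) n =
        ?D * (avg ?\<phi>1 n + avg ?\<phi>2 n) + 2 * (\<Sum>j<k. avg (\<lambda>i \<omega>. excess m (\<omega> (i + j))) n)"
      by (subst avg_add, intro Bochner_Integration.integrable_mult_right Bochner_Integration.integrable_add i1 i2,
          intro Bochner_Integration.integrable_mult_right Bochner_Integration.integrable_sum i4,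
          simp only: avg_cmult avg_add[OF i1 i2] avg_sum[OF i4])
    finally show ?thesis .
  qed
  have "(\<lambda>n. 2 / ?x * ((\<integral>\<omega>. ?K0 \<omega> \<partial>K) / real n
      + (?D * (avg ?\<phi>1 n + avg ?\<phi>2 n) + 2 * (\<Sum>j<k. avg (\<lambda>i \<omega>. excess m (\<omega> (i + j))) n))))
      \<longlonglongrightarrow> 2 / ?x * (0 + (?D * (I1 k + I2 C) + 2 * (\<Sum>j<k. (\<integral>g. excess m g \<partial>gm))))"
    using equi_contr[of k c] equi_size[of k C] unfolding equidistributed_def I1_def I2_def c_def
    by (intro tendsto_mult tendsto_add tendsto_sum tendsto_const lim_const_over_n avg_excess)
  moreover have "2 / ?x * (0 + (?D * (I1 k + I2 C) + 2 * (\<Sum>j<k. (\<integral>g. excess m g \<partial>gm)))) < \<epsilon>"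
  proof -
    have "2 / ?x * (0 + (?D * (I1 k + I2 C) + 2 * (\<Sum>j<k. (\<integral>g. excess m g \<partial>gm)))) =
        (1 + 4 / ?x + 4 * real m / \<theta>) * (I1 k + I2 C) + 4 / \<theta> * (\<integral>g. excess m g \<partial>gm)"
      using th k by (simp add: field_simps)
    also have "(1 + 4 / ?x + 4 * real m / \<theta>) * (I1 k + I2 C) \<le> B * (I1 k + I2 C)"
    proof (rule mult_right_mono)
      have "\<theta> * 1 \<le> ?x" using th k by (intro mult_left_mono) auto
      then have "4 / ?x \<le> 4 / \<theta>" using th by (intro divide_left_mono) auto
      then show "1 + 4 / ?x + 4 * real m / \<theta> \<le> B" by (simp add: B_def)
      have "0 \<le> I1 k" unfolding I1_def
        by (intro Bochner_Integration.integral_nonneg min.boundedI mult_nonneg_nonneg of_nat_0_le_iff contr_nonneg) simp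
      moreover have "0 \<le> I2 C" unfolding I2_def
      proof (rule Bochner_Integration.integral_nonneg)
        fix z assume "z \<in> space (\<eta> \<Otimes>\<^sub>M S)"
        then show "0 \<le> min 1 (size (wk (snd z) k) / real (Suc C))"
          using size_ge_1[OF wk_in_G[of "snd z" k]] by (simp add: space_pair_measure mem_Times_iff)
      qed
      ultimately show "0 \<le> I1 k + I2 C" by simp
    qed
    also have "B * (I1 k + I2 C) < \<epsilon> / 2"
    proof -
      have "I1 k + I2 C < \<epsilon> / (4 * B) + \<epsilon> / (4 * B)" using k C by linarith
      then have "B * (I1 k + I2 C) < B * (\<epsilon> / (4 * B) + \<epsilon> / (4 * B))" using B by (rule mult_strict_left_mono)
      also have "\<dots> = \<epsilon> / 2" using B by (simp add: field_simps)
      finally show ?thesis .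
    qed
    also have "4 / \<theta> * (\<integral>g. excess m g \<partial>gm) < 4 / \<theta> * (\<epsilon> * \<theta> / 8)"
      using m th by (intro mult_strict_left_mono) auto
    also have "\<epsilon> / 2 + 4 / \<theta> * (\<epsilon> * \<theta> / 8) = \<epsilon>" using th by simp
    finally show ?thesis by simp
  qed
  ultimately have "\<forall>\<^sub>F n in sequentially. 2 / ?x * ((\<integral>\<omega>. ?K0 \<omega> \<partial>K) / real n
      + (?D * (avg ?\<phi>1 n + avg ?\<phi>2 n) + 2 * (\<Sum>j<k. avg (\<lambda>i \<omega>. excess m (\<omega> (i + j))) n))) < \<epsilon>"
    by (rule order_tendstoD(2))
  then have "\<forall>\<^sub>F n in sequentially. avg ?I n < \<epsilon>"
  proof eventually_elim
    case (elim n)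
    have "a = 2 / y * (y / 2 * a)" if "0 < y" for a y :: real using that by simp
    then have "avg ?I n = 2 / ?x * (?x / 2 * avg ?I n)" using x by blast
    also have "\<dots> \<le> 2 / ?x * ((\<integral>\<omega>. ?K0 \<omega> \<partial>K) / real n
      + (?D * (avg ?\<phi>1 n + avg ?\<phi>2 n) + 2 * (\<Sum>j<k. avg (\<lambda>i \<omega>. excess m (\<omega> (i + j))) n)))"
      using x by (intro mult_left_mono main) auto
    finally show ?case using elim by linarith
  qed
  then show ?thesis by blast
qed

end

section \<open>Observables of blocks and of points\<close>

context random_walk
begin

text \<open>In \<open>g\<close> measurability is enough, which covers \<open>size\<close>;
  continuity in the point passes to \<open>hat\<close>, so that weak convergence in P(V/W) applies
  to it. Measurability is stated for vectors and again for representatives, since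
  \<open>Q.rep\<close> is not known to be measurable.\<close>

definition test_function :: "(('v \<Rightarrow>\<^sub>L 'v) \<Rightarrow> 'v \<Rightarrow> real) \<Rightarrow> bool" where
  "test_function \<phi> \<longleftrightarrow> (\<forall>g\<in>G. Q.invariant (\<phi> g) \<and> continuous_on (- W) (\<phi> g) \<and> (\<forall>v\<in>- W. 0 \<le> \<phi> g v \<and> \<phi> g v \<le> 1)) \<and>
    (\<lambda>(g, v). \<phi> g v) \<in> borel_measurable (gm \<Otimes>\<^sub>M restrict_space borel (- W)) \<and>
    (\<lambda>(g, y). \<phi> g (Q.rep y)) \<in> borel_measurable (gm \<Otimes>\<^sub>M Q.Y)"

lemma test_functionD:
  assumes "test_function \<phi>"
  shows "g \<in> G \<Longrightarrow> Q.invariant (\<phi> g)" "g \<in> G \<Longrightarrow> continuous_on (- W) (\<phi> g)"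
    "g \<in> G \<Longrightarrow> v \<notin> W \<Longrightarrow> 0 \<le> \<phi> g v" "g \<in> G \<Longrightarrow> v \<notin> W \<Longrightarrow> \<phi> g v \<le> 1"
  using assms unfolding test_function_def by auto

lemma test_function_measurable:
  assumes "test_function \<phi>" "f \<in> N \<rightarrow>\<^sub>M gm" "h \<in> borel_measurable N" "\<And>x. x \<in> space N \<Longrightarrow> h x \<notin> W"
  shows "(\<lambda>x. \<phi> (f x) (h x)) \<in> borel_measurable N"
proof -
  have "h \<in> N \<rightarrow>\<^sub>M restrict_space borel (- W)" using assms(3,4) by (intro measurable_restrict_space2) auto
  then have "(\<lambda>x. (f x, h x)) \<in> N \<rightarrow>\<^sub>M gm \<Otimes>\<^sub>M restrict_space borel (- W)" using assms(2) by measurable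
  moreover have "(\<lambda>(g, v). \<phi> g v) \<in> borel_measurable (gm \<Otimes>\<^sub>M restrict_space borel (- W))"
    using assms(1) unfolding test_function_def by blast
  ultimately show ?thesis using measurable_compose by fastforce
qed

lemma test_function_rep_measurable:
  assumes "test_function \<phi>" "f \<in> N \<rightarrow>\<^sub>M gm" "h \<in> N \<rightarrow>\<^sub>M Q.Y"
  shows "(\<lambda>x. \<phi> (f x) (Q.rep (h x))) \<in> borel_measurable N"
proof -
  have "(\<lambda>x. (f x, h x)) \<in> N \<rightarrow>\<^sub>M gm \<Otimes>\<^sub>M Q.Y" using assms(2,3) by measurable
  moreover have "(\<lambda>(g, y). \<phi> g (Q.rep y)) \<in> borel_measurable (gm \<Otimes>\<^sub>M Q.Y)"
    using assms(1) unfolding test_function_def by blast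
  ultimately show ?thesis using measurable_compose by fastforce
qed

lemma sets_gm_pair: "sets (gm \<Otimes>\<^sub>M N) = sets (restrict_space borel G \<Otimes>\<^sub>M N)"
  by (rule sets_pair_measure_cong[OF sets_gm refl])

lemma continuous_test_function:
  assumes c: "continuous_on (G \<times> (- W)) (\<lambda>(g, v). \<phi> g v)"
    and i: "\<And>g. g \<in> G \<Longrightarrow> Q.invariant (\<phi> g)"
    and b: "\<And>g v. g \<in> G \<Longrightarrow> v \<notin> W \<Longrightarrow> 0 \<le> \<phi> g v \<and> \<phi> g v \<le> 1"
  shows "test_function \<phi>"
  unfolding test_function_def
proof (intro conjI ballI)
  fix g assume g: "g \<in> G"
  show "Q.invariant (\<phi> g)" by (rule i[OF g])
  show "continuous_on (- W) (\<phi> g)"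
  proof -
    have "continuous_on (- W) (\<lambda>v. (\<lambda>(g, v). \<phi> g v) (g, v))"
      by (rule continuous_on_compose2[OF c]) (use g in \<open>auto intro!: continuous_intros\<close>)
    then show ?thesis by simp
  qed
next
  have "(\<lambda>x. (\<lambda>(g, v). \<phi> g v) (fst x, snd x)) \<in> borel_measurable (restrict_space borel G \<Otimes>\<^sub>M restrict_space borel (- W))"
    by (rule measurable_continuous_on_pair_restrict[OF c]) measurable
  then show "(\<lambda>(g, v). \<phi> g v) \<in> borel_measurable (gm \<Otimes>\<^sub>M restrict_space borel (- W))"
    by (simp add: case_prod_unfold measurable_cong_sets[OF sets_gm_pair refl])
  show "(\<lambda>(g, y). \<phi> g (Q.rep y)) \<in> borel_measurable (gm \<Otimes>\<^sub>M Q.Y)"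
    using Q.rep_measurable_real[OF c i] measurable_cong_sets[OF sets_gm_pair refl] by blast
qed (use b in auto)

lemma test_contr: "test_function (\<lambda>g v. min 1 (real c * contr g v))"
proof (rule continuous_test_function)
  have "continuous_on (G \<times> (- W)) (\<lambda>z. min 1 (real c * (\<lambda>(g, v). contr g v) z))"
    by (intro continuous_intros continuous_on_contr)
  then show "continuous_on (G \<times> (- W)) (\<lambda>(g, v). min 1 (real c * contr g v))" by (simp add: case_prod_beta)
  show "Q.invariant (\<lambda>v. min 1 (real c * contr g v))" if "g \<in> G" for g
    using contr_Q_invariant[OF that] unfolding Q.invariant_def by metis
qed (simp add: contr_nonneg)

lemma test_size: "test_function (\<lambda>g v. min 1 (size g / real (Suc c)))"
  unfolding test_function_def
proof (intro conjI ballI)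
  show "Q.invariant (\<lambda>v. min 1 (size g / real (Suc c)))" for g unfolding Q.invariant_def by simp
  show "0 \<le> min 1 (size g / real (Suc c))" if "g \<in> G" for g using size_ge_1[OF that] by simp
qed (simp_all add: case_prod_beta)

text \<open>The regularity of an observable along the fibres of \<open>P(V) - P(W) \<rightarrow> P(V/W)\<close> that is used
  for comparing it with its values on the section \<open>[v] \<mapsto> [perp v]\<close>.\<close>

definition fibre_lipschitz :: "real \<Rightarrow> ('v \<Rightarrow> real) \<Rightarrow> bool" where
  "fibre_lipschitz B F \<longleftrightarrow> 0 \<le> B \<and> L.invariant F \<and> continuous_on (- W) F \<and> (\<forall>v\<in>- W. 0 \<le> F v \<and> F v \<le> 1) \<and>
    (\<forall>v\<in>- W. \<forall>w\<in>W. \<bar>F v - F (v - w)\<bar> \<le> B * (norm w / del v))"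

lemma fibre_lipschitzD:
  assumes "fibre_lipschitz B F"
  shows "0 \<le> B" "L.invariant F" "continuous_on (- W) F" "v \<notin> W \<Longrightarrow> 0 \<le> F v" "v \<notin> W \<Longrightarrow> F v \<le> 1"
    "v \<notin> W \<Longrightarrow> w \<in> W \<Longrightarrow> \<bar>F v - F (v - w)\<bar> \<le> B * (norm w / del v)"
  using assms unfolding fibre_lipschitz_def by auto

lemma apply_perp_notin: "g \<in> G \<Longrightarrow> v \<notin> W \<Longrightarrow> blinfun_apply g (perp v) \<notin> W"
  using G_in_W_iff[of g "perp v"] perp_notin[of v] by simp

lemma L_invariant_scl: "L.invariant F \<Longrightarrow> v \<notin> W \<Longrightarrow> c \<noteq> 0 \<Longrightarrow> F (scl c v) = F v"
proof -
  assume F: "L.invariant F" and v: "v \<notin> W" and c: "c \<noteq> 0"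
  have n: "scl c v \<notin> W" using W_scl_iff[OF c, of v] v by simp
  have "line scl v = line scl (scl c v)"
    unfolding line_eq_iff[OF compl_W_nonzero[OF v] compl_W_nonzero[OF n]] using c by blast
  moreover have "v \<in> - W" "scl c v \<in> - W" using v n by simp_all
  ultimately show "F (scl c v) = F v" using F unfolding L.invariant_def by metis
qed

text \<open>Replacing \<open>v\<close> by \<open>scl c v + w\<close> multiplies
  \<open>perp v\<close> by \<open>c\<close>, so the value of \<open>F\<close> on the section, moved
  by \<open>g\<close>, is a function on P(V/W). This is the observable for which convergence
  downstairs is exploited.\<close>

lemma test_perp:
  assumes F: "fibre_lipschitz B F"
  shows "test_function (\<lambda>g v. F (blinfun_apply g (perp v)))"
proof (rule continuous_test_function)
  have "continuous_on (G \<times> (- W)) (\<lambda>z. perp (snd z))"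
    by (rule continuous_on_compose2[OF continuous_on_perp[of UNIV]]) (auto intro: continuous_intros)
  then have p: "continuous_on (G \<times> (- W)) (\<lambda>z. blinfun_apply (fst z) (perp (snd z)))"
    by (intro bounded_bilinear.continuous_on[OF bounded_bilinear_blinfun_apply] continuous_intros)
  have "continuous_on (G \<times> (- W)) (\<lambda>z. F (blinfun_apply (fst z) (perp (snd z))))"
    by (rule continuous_on_compose2[OF fibre_lipschitzD(3)[OF F] p])
       (use apply_perp_notin in \<open>simp add: image_subset_iff mem_Times_iff\<close>)
  then show "continuous_on (G \<times> (- W)) (\<lambda>(g, v). F (blinfun_apply g (perp v)))" by (simp add: case_prod_beta)
  show "Q.invariant (\<lambda>v. F (blinfun_apply g (perp v)))" if g: "g \<in> G" for g
  proof (rule Q_invariantI)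
    fix c :: 'k and v w assume v: "v \<notin> W" and c: "c \<noteq> 0" and w: "w \<in> W"
    have "blinfun_apply g (perp (scl c v + w)) = scl c (blinfun_apply g (perp v))"
      by (simp add: perp_add[OF w] perp_scl G_scl[OF g])
    then show "F (blinfun_apply g (perp (scl c v + w))) = F (blinfun_apply g (perp v))"
      using L_invariant_scl[OF fibre_lipschitzD(2)[OF F] apply_perp_notin[OF g v] c] by simp
  qed
  show "0 \<le> F (blinfun_apply g (perp v)) \<and> F (blinfun_apply g (perp v)) \<le> 1" if "g \<in> G" "v \<notin> W" for g v
    using fibre_lipschitzD(4,5)[OF F apply_perp_notin[OF that]] by simp
qed

text \<open>If the slope is at most \<open>R\<close>, the two image vectors differ by a vector of
  \<open>W\<close> controlled by \<open>fibre_contraction\<close>, and the Lipschitz bound turns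
  this into \<open>B * R * contr g v\<close>. Otherwise the indicator is 1 and both values of
  \<open>F\<close> lie in the unit interval.\<close>

lemma fibre_comparison:
  assumes F: "fibre_lipschitz B F" and g: "g \<in> G" and v: "v \<notin> W" and R: "0 \<le> R"
  shows "\<bar>F (blinfun_apply g v) - F (blinfun_apply g (perp v))\<bar> \<le>
    min 1 (real (nat \<lceil>B * R\<rceil>) * contr g v) + indicator {R<..} (slope v)"
proof -
  have n: "blinfun_apply g v \<notin> W" using G_in_W_iff[OF g, of v] v by simp
  have d: "0 < del (blinfun_apply g v)" by (rule del_pos[OF n])
  have one: "\<bar>F (blinfun_apply g v) - F (blinfun_apply g (perp v))\<bar> \<le> 1"
    using fibre_lipschitzD(4,5)[OF F n] fibre_lipschitzD(4,5)[OF F apply_perp_notin[OF g v]] by linarith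
  have B: "0 \<le> B" by (rule fibre_lipschitzD(1)[OF F])
  show ?thesis
  proof (cases "slope v \<le> R")
    case True
    have e: "blinfun_apply g (perp v) = blinfun_apply g v - blinfun_apply g (pr v)"
      by (simp add: perp_def blinfun.diff_right)
    have "\<bar>F (blinfun_apply g v) - F (blinfun_apply g (perp v))\<bar> \<le>
        B * (norm (blinfun_apply g (pr v)) / del (blinfun_apply g v))"
      unfolding e by (rule fibre_lipschitzD(6)[OF F n G_in_W[OF g pr_in]])
    also have "\<dots> \<le> B * (contr g v * slope v)"
    proof (rule mult_left_mono[OF _ B])
      have "norm (blinfun_apply g (pr v)) \<le> contr g v * slope v * del (blinfun_apply g v)"
        using fibre_contraction[OF g v] unfolding e by simp
      then show "norm (blinfun_apply g (pr v)) / del (blinfun_apply g v) \<le> contr g v * slope v"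
        using d by (simp add: divide_le_eq)
    qed
    also have "\<dots> \<le> B * (contr g v * R)"
      using True B contr_nonneg by (intro mult_left_mono) auto
    also have "\<dots> = (B * R) * contr g v" by simp
    also have "\<dots> \<le> real (nat \<lceil>B * R\<rceil>) * contr g v"
      by (intro mult_right_mono real_nat_ceiling_ge contr_nonneg)
    finally have "\<bar>F (blinfun_apply g v) - F (blinfun_apply g (perp v))\<bar> \<le> min 1 (real (nat \<lceil>B * R\<rceil>) * contr g v)"
      using one by simp
    then show ?thesis using True by simp
  next
    case False
    moreover have "0 \<le> min 1 (real (nat \<lceil>B * R\<rceil>) * contr g v)"
      by (intro min.boundedI mult_nonneg_nonneg of_nat_0_le_iff contr_nonneg) simp
    ultimately show ?thesis using one by simp
  qed
qed

end

section \<open>The stationary lift and the comparison with it\<close>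

locale lifted_walk = contracting_walk scl W gm \<eta> l + N: stationary_action gm \<nu> act
  for scl :: "'k::{real_normed_field,euclidean_space} \<Rightarrow> 'v::euclidean_space \<Rightarrow> 'v" and W gm
    and \<eta> :: "'v set set measure" and l :: real and \<nu> :: "'v set measure" +
  assumes sets_\<nu>: "sets \<nu> = sets L.Y" and distr_\<nu>: "distr \<nu> Q.Y (proj_map W) = \<eta>"
begin

lemma space_\<nu>: "space \<nu> = line scl ` (- W)"
  using sets_eq_imp_space_eq[OF sets_\<nu>] by (simp add: L.space_Y)

lemma rep_\<nu>: "y \<in> space \<nu> \<Longrightarrow> L.rep y \<notin> W" "y \<in> space \<nu> \<Longrightarrow> line scl (L.rep y) = y"
  using L.rep[of y] by (simp_all add: space_\<nu>)

lemma proj_map_measurable: "proj_map W \<in> \<nu> \<rightarrow>\<^sub>M Q.Y"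
proof -
  have "proj_map W \<in> L.Y \<rightarrow>\<^sub>M Q.Y"
    unfolding Q.Y_def
  proof (rule measurable_borel_ofI)
    show "proj_map W \<in> space L.Y \<rightarrow> topspace Q.T"
      by (auto simp: L.space_Y Q.topspace_T proj_map_line)
    fix U assume "openin Q.T U"
    then have "open {v\<in>- W. qline scl W v \<in> U}" by (simp add: Q.openin_T)
    then have "openin L.T {y\<in>line scl ` (- W). proj_map W y \<in> U}"
      unfolding L.openin_T by (simp add: proj_map_line cong: conj_cong)
    moreover have "proj_map W -` U \<inter> space L.Y = {y\<in>line scl ` (- W). proj_map W y \<in> U}"
      unfolding L.space_Y by blast
    ultimately show "proj_map W -` U \<inter> space L.Y \<in> sets L.Y"
      unfolding L.Y_def by (simp add: openin_in_sets_borel_of)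
  qed
  then show ?thesis using measurable_cong_sets[OF sets_\<nu> refl] by blast
qed

lemma funpow_skew_\<nu>:
  assumes "y \<in> space \<nu>" "\<omega> \<in> space S"
  shows "(N.skew ^^ n) (y, \<omega>) = (line scl (blinfun_apply (wk \<omega> n) (L.rep y)), (shift ^^ n) \<omega>)"
proof (induct n)
  case 0
  show ?case using rep_\<nu>(2)[OF assms(1)] by simp
next
  case (Suc n)
  have "(shift ^^ n) \<omega> 0 = \<omega> n" by (simp add: funpow_shift)
  have "(N.skew ^^ Suc n) (y, \<omega>) = N.skew (line scl (blinfun_apply (wk \<omega> n) (L.rep y)), (shift ^^ n) \<omega>)"
    by (simp add: Suc)
  also have "\<dots> = (line scl (blinfun_apply (wk \<omega> (Suc n)) (L.rep y)), (shift ^^ Suc n) \<omega>)"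
    unfolding N.skew_def by (simp add: act_line[OF S_in_G[OF assms(2)]] \<open>(shift ^^ n) \<omega> 0 = \<omega> n\<close>)
  finally show ?case .
qed

lemma L_rep_measurable:
  assumes "continuous_on (- W) (F :: 'v \<Rightarrow> real)" "L.invariant F"
  shows "(\<lambda>y. F (L.rep y)) \<in> borel_measurable \<nu>"
  using continuous_map_measurable[OF L.continuous_map_rep[OF assms]] measurable_cong_sets[OF sets_\<nu> refl]
  unfolding L.Y_def by blast

text \<open>Stationarity of \<open>\<nu>\<close> iterated \<open>k\<close> times: the skew product
  over \<open>\<nu>\<close> preserves the measure, and \<open>F\<close> is read off from its first
  coordinate after \<open>k\<close> steps.\<close>

lemma integral_iterate:
  assumes F: "fibre_lipschitz B F"
  shows "(\<lambda>z. F (blinfun_apply (wk (snd z) k) (L.rep (fst z)))) \<in> borel_measurable (\<nu> \<Otimes>\<^sub>M S)"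
    and "(\<integral>z. F (blinfun_apply (wk (snd z) k) (L.rep (fst z))) \<partial>(\<nu> \<Otimes>\<^sub>M S)) = (\<integral>y. F (L.rep y) \<partial>\<nu>)"
proof -
  note Fm = L_rep_measurable[OF fibre_lipschitzD(3,2)[OF F]]
  have m: "(\<lambda>z. F (L.rep (fst z))) \<in> borel_measurable (\<nu> \<Otimes>\<^sub>M S)"
    by (rule measurable_compose[OF measurable_fst Fm])
  have e: "F (L.rep (fst ((N.skew ^^ k) z))) = F (blinfun_apply (wk (snd z) k) (L.rep (fst z)))"
    if "z \<in> space (\<nu> \<Otimes>\<^sub>M S)" for z
  proof -
    obtain y \<omega> where z: "z = (y, \<omega>)" "y \<in> space \<nu>" "\<omega> \<in> space S"
      using \<open>z \<in> space (\<nu> \<Otimes>\<^sub>M S)\<close> by (auto simp: space_pair_measure)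
    have "blinfun_apply (wk \<omega> k) (L.rep y) \<in> - W"
      using wk_apply_notin[OF z(3) rep_\<nu>(1)[OF z(2)]] by simp
    from L.invariant_rep[OF fibre_lipschitzD(2)[OF F] this]
    show ?thesis by (simp add: z(1) funpow_skew_\<nu>[OF z(2,3)])
  qed
  have "(\<lambda>z. F (L.rep (fst ((N.skew ^^ k) z)))) \<in> borel_measurable (\<nu> \<Otimes>\<^sub>M S)"
    by (rule measurable_compose[OF N.skew.funpow_T_measurable m])
  then show "(\<lambda>z. F (blinfun_apply (wk (snd z) k) (L.rep (fst z)))) \<in> borel_measurable (\<nu> \<Otimes>\<^sub>M S)"
    using measurable_cong[of "\<nu> \<Otimes>\<^sub>M S" "\<lambda>z. F (L.rep (fst ((N.skew ^^ k) z)))"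
      "\<lambda>z. F (blinfun_apply (wk (snd z) k) (L.rep (fst z)))" borel, OF e] by blast
  have int: "integrable (\<nu> \<Otimes>\<^sub>M S) (\<lambda>z. F (L.rep (fst z)))"
  proof (rule N.Z.integrable_const_bound[of _ 1])
    show "AE z in \<nu> \<Otimes>\<^sub>M S. norm (F (L.rep (fst z))) \<le> 1"
    proof (rule AE_I2)
      fix z assume "z \<in> space (\<nu> \<Otimes>\<^sub>M S)"
      then have "L.rep (fst z) \<notin> W" using rep_\<nu>(1) by (simp add: space_pair_measure mem_Times_iff)
      then show "norm (F (L.rep (fst z))) \<le> 1" using fibre_lipschitzD(4,5)[OF F] by simp
    qed
  qed (rule m)
  have "(\<integral>z. F (blinfun_apply (wk (snd z) k) (L.rep (fst z))) \<partial>(\<nu> \<Otimes>\<^sub>M S)) =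
      (\<integral>z. F (L.rep (fst ((N.skew ^^ k) z))) \<partial>(\<nu> \<Otimes>\<^sub>M S))"
    by (rule Bochner_Integration.integral_cong[OF refl]) (rule e[symmetric])
  also have "\<dots> = (\<integral>z. F (L.rep (fst z)) \<partial>(\<nu> \<Otimes>\<^sub>M S))" by (rule N.skew.integral_funpow_T[OF m])
  also have "\<dots> = (\<integral>y. F (L.rep y) \<partial>\<nu>)" using N.Z.integral_fst'[OF int] by (simp add: P.prob_space)
  finally show "(\<integral>z. F (blinfun_apply (wk (snd z) k) (L.rep (fst z))) \<partial>(\<nu> \<Otimes>\<^sub>M S)) = (\<integral>y. F (L.rep y) \<partial>\<nu>)" .
qed

lemma test_function_Z_integrable:
  assumes "test_function \<phi>"
  shows "integrable (\<eta> \<Otimes>\<^sub>M S) (\<lambda>z. \<phi> (wk (snd z) k) (Q.rep (fst z)))"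
proof (rule Z.integrable_const_bound[of _ 1])
  show "(\<lambda>z. \<phi> (wk (snd z) k) (Q.rep (fst z))) \<in> borel_measurable (\<eta> \<Otimes>\<^sub>M S)"
    by (rule test_function_rep_measurable[OF assms])
       (rule measurable_compose[OF measurable_snd wk_measurable] \<eta>_measurable[OF measurable_fst])+
  show "AE z in \<eta> \<Otimes>\<^sub>M S. norm (\<phi> (wk (snd z) k) (Q.rep (fst z))) \<le> 1"
  proof (rule AE_I2)
    fix z assume "z \<in> space (\<eta> \<Otimes>\<^sub>M S)"
    then have "Q.rep (fst z) \<notin> W" "wk (snd z) k \<in> G"
      using rep_\<eta>(1) wk_in_G by (simp_all add: space_pair_measure mem_Times_iff)
    then show "norm (\<phi> (wk (snd z) k) (Q.rep (fst z))) \<le> 1"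
      using test_functionD(3,4)[OF assms] by simp
  qed
qed

text \<open>A test function sees a line only through its image in P(V/W), so
  \<open>distr_\<nu>\<close> turns an integral over \<open>\<nu>\<close> into one over
  \<open>\<eta>\<close>.\<close>

lemma integral_push:
  assumes \<phi>: "test_function \<phi>"
  shows "integrable (\<nu> \<Otimes>\<^sub>M S) (\<lambda>z. \<phi> (wk (snd z) k) (L.rep (fst z)))" (is ?int)
    and "(\<integral>z. \<phi> (wk (snd z) k) (L.rep (fst z)) \<partial>(\<nu> \<Otimes>\<^sub>M S)) =
      (\<integral>z. \<phi> (wk (snd z) k) (Q.rep (fst z)) \<partial>(\<eta> \<Otimes>\<^sub>M S))" (is ?eq)
proof -
  let ?\<psi> = "\<lambda>z. \<phi> (wk (snd z) k) (Q.rep (proj_map W (fst z)))"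
  have e: "\<phi> (wk (snd z) k) (L.rep (fst z)) = ?\<psi> z" if "z \<in> space (\<nu> \<Otimes>\<^sub>M S)" for z
  proof -
    have z: "fst z \<in> space \<nu>" "snd z \<in> space S" using that by (simp_all add: space_pair_measure mem_Times_iff)
    have "proj_map W (fst z) = qline scl W (L.rep (fst z))"
      using rep_\<nu>(2)[OF z(1)] proj_map_line[of "L.rep (fst z)"] by simp
    moreover have "L.rep (fst z) \<in> - W" using rep_\<nu>(1)[OF z(1)] by simp
    ultimately show ?thesis
      using Q.invariant_rep[OF test_functionD(1)[OF \<phi> wk_in_G[OF z(2), of k]]] by simp
  qed
  have \<psi>m: "?\<psi> \<in> borel_measurable (\<nu> \<Otimes>\<^sub>M S)"
    by (rule test_function_rep_measurable[OF \<phi>])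
       (rule measurable_compose[OF measurable_snd wk_measurable] measurable_compose[OF measurable_fst proj_map_measurable])+
  have bd: "\<bar>?\<psi> z\<bar> \<le> 1" if "z \<in> space (\<nu> \<Otimes>\<^sub>M S)" for z
  proof -
    have z: "fst z \<in> space \<nu>" "snd z \<in> space S" using that by (simp_all add: space_pair_measure mem_Times_iff)
    show ?thesis
      unfolding e[OF that, symmetric]
      using test_functionD(3,4)[OF \<phi> wk_in_G[OF z(2), of k] rep_\<nu>(1)[OF z(1)]] by simp
  qed
  have int: "integrable (\<nu> \<Otimes>\<^sub>M S) ?\<psi>"
    by (rule N.Z.integrable_const_bound[of _ 1, OF AE_I2 \<psi>m]) (use bd in simp)
  then show ?int
    using Bochner_Integration.integrable_cong[of "\<nu> \<Otimes>\<^sub>M S" "\<nu> \<Otimes>\<^sub>M S"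
      "\<lambda>z. \<phi> (wk (snd z) k) (L.rep (fst z))" ?\<psi>, OF refl e] by blast
  have "(\<integral>z. \<phi> (wk (snd z) k) (Q.rep (fst z)) \<partial>(\<eta> \<Otimes>\<^sub>M S)) = (\<integral>y. (\<integral>\<omega>. \<phi> (wk \<omega> k) (Q.rep y) \<partial>S) \<partial>\<eta>)"
    using Z.integral_fst'[OF test_function_Z_integrable[OF \<phi>]] by simp
  also have "\<dots> = (\<integral>y. (\<integral>\<omega>. \<phi> (wk \<omega> k) (Q.rep y) \<partial>S) \<partial>distr \<nu> Q.Y (proj_map W))" by (simp only: distr_\<nu>)
  also have "\<dots> = (\<integral>y. (\<integral>\<omega>. \<phi> (wk \<omega> k) (Q.rep (proj_map W y)) \<partial>S) \<partial>\<nu>)"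
  proof (rule integral_distr[OF proj_map_measurable])
    have "(\<lambda>z. \<phi> (wk (snd z) k) (Q.rep (fst z))) \<in> borel_measurable (Q.Y \<Otimes>\<^sub>M S)"
      by (rule test_function_rep_measurable[OF \<phi>])
         (rule measurable_compose[OF measurable_snd wk_measurable] measurable_fst)+
    then have "case_prod (\<lambda>y \<omega>. \<phi> (wk \<omega> k) (Q.rep y)) \<in> borel_measurable (Q.Y \<Otimes>\<^sub>M S)"
      by (simp add: case_prod_unfold)
    then show "(\<lambda>y. \<integral>\<omega>. \<phi> (wk \<omega> k) (Q.rep y) \<partial>S) \<in> borel_measurable Q.Y"
      by (rule P.borel_measurable_lebesgue_integral)
  qed
  also have "\<dots> = (\<integral>z. ?\<psi> z \<partial>(\<nu> \<Otimes>\<^sub>M S))" using N.Z.integral_fst'[OF int] by simp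
  also have "\<dots> = (\<integral>z. \<phi> (wk (snd z) k) (L.rep (fst z)) \<partial>(\<nu> \<Otimes>\<^sub>M S))"
    by (rule Bochner_Integration.integral_cong[OF refl]) (rule e[symmetric])
  finally show ?eq ..
qed

text \<open>For fixed \<open>c\<close> the exponential weight of
  \<open>contr_integral_tendsto\<close> exceeds \<open>c\<close> once \<open>k\<close> is
  large.\<close>

lemma contr_integral_small:
  assumes "0 < \<epsilon>"
  obtains k where "(\<integral>z. min 1 (real c * contr (wk (snd z) k) (Q.rep (fst z))) \<partial>(\<eta> \<Otimes>\<^sub>M S)) < \<epsilon>"
proof -
  obtain \<theta> where th: "0 < \<theta>" and lim: "(\<lambda>k. \<integral>z. min 1 (real (nat \<lceil>exp (\<theta> * real k)\<rceil>) * contr (wk (snd z) k) (Q.rep (fst z)))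
    \<partial>(\<eta> \<Otimes>\<^sub>M S)) \<longlonglongrightarrow> 0" by (rule contr_integral_tendsto)
  have "filterlim (\<lambda>k. exp (\<theta> * real k)) at_top sequentially" using th by real_asymp
  then have "\<forall>\<^sub>F k in sequentially. real c \<le> exp (\<theta> * real k)" by (simp add: filterlim_at_top)
  moreover have "\<forall>\<^sub>F k in sequentially. (\<integral>z. min 1 (real (nat \<lceil>exp (\<theta> * real k)\<rceil>) * contr (wk (snd z) k) (Q.rep (fst z)))
    \<partial>(\<eta> \<Otimes>\<^sub>M S)) < \<epsilon>" using lim assms by (intro order_tendstoD(2)) auto
  ultimately have "\<forall>\<^sub>F k in sequentially. real c \<le> exp (\<theta> * real k) \<and> (\<integral>z. min 1 (real (nat \<lceil>exp (\<theta> * real k)\<rceil>) * contr (wk (snd z) k) (Q.rep (fst z)))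
    \<partial>(\<eta> \<Otimes>\<^sub>M S)) < \<epsilon>" by (rule eventually_conj)
  then obtain k where k: "real c \<le> exp (\<theta> * real k)" "(\<integral>z. min 1 (real (nat \<lceil>exp (\<theta> * real k)\<rceil>) * contr (wk (snd z) k) (Q.rep (fst z)))
    \<partial>(\<eta> \<Otimes>\<^sub>M S)) < \<epsilon>" unfolding eventually_sequentially by blast
  have "(\<integral>z. min 1 (real c * contr (wk (snd z) k) (Q.rep (fst z))) \<partial>(\<eta> \<Otimes>\<^sub>M S)) \<le>
    (\<integral>z. min 1 (real (nat \<lceil>exp (\<theta> * real k)\<rceil>) * contr (wk (snd z) k) (Q.rep (fst z))) \<partial>(\<eta> \<Otimes>\<^sub>M S))"
  proof (rule integral_mono[OF test_function_Z_integrable[OF test_contr] test_function_Z_integrable[OF test_contr]])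
    fix z
    have "real c \<le> real (nat \<lceil>exp (\<theta> * real k)\<rceil>)" using k(1) real_nat_ceiling_ge order_trans by blast
    then have "real c * contr (wk (snd z) k) (Q.rep (fst z)) \<le> real (nat \<lceil>exp (\<theta> * real k)\<rceil>) * contr (wk (snd z) k) (Q.rep (fst z))"
      by (rule mult_right_mono) (rule contr_nonneg)
    then show "min 1 (real c * contr (wk (snd z) k) (Q.rep (fst z))) \<le>
      min 1 (real (nat \<lceil>exp (\<theta> * real k)\<rceil>) * contr (wk (snd z) k) (Q.rep (fst z)))"
      by (rule min.mono[OF order_refl])
  qed
  from le_less_trans[OF this k(2)] show ?thesis by (rule that)
qed

lemma slope_L_invariant: "L.invariant slope"
proof (rule L_invariantI)
  fix c :: 'k and v assume "c \<noteq> 0"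
  then show "slope (scl c v) = slope v" by (simp add: slope_def pr_scl del_scl norm_scale)
qed

text \<open>The slope is finite at every point of P(V) - P(W), where the lift is carried: this is
  how the absence of mass on P(W) enters.\<close>

lemma slope_\<nu>_tendsto: "(\<lambda>m. \<integral>y. indicator {real m<..} (slope (L.rep y)) \<partial>\<nu>) \<longlonglongrightarrow> (0 :: real)"
proof -
  have sm: "(\<lambda>y. slope (L.rep y)) \<in> borel_measurable \<nu>"
    by (rule L_rep_measurable[OF continuous_on_slope slope_L_invariant])
  have "(\<lambda>m. \<integral>y. indicator {real m<..} (slope (L.rep y)) \<partial>\<nu>) \<longlonglongrightarrow> (\<integral>y. (0 :: real) \<partial>\<nu>)"
  proof (rule integral_dominated_convergence[where w="\<lambda>_. 1"])
    show "AE y in \<nu>. (\<lambda>m. indicator {real m<..} (slope (L.rep y))) \<longlonglongrightarrow> (0 :: real)"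
    proof (rule AE_I2)
      fix y
      have "\<forall>\<^sub>F m in sequentially. indicator {real m<..} (slope (L.rep y)) = (0 :: real)"
        using eventually_ge_at_top[of "nat \<lceil>slope (L.rep y)\<rceil>"]
        by eventually_elim (simp add: nat_le_iff ceiling_le_iff)
      then show "(\<lambda>m. indicator {real m<..} (slope (L.rep y))) \<longlonglongrightarrow> (0 :: real)" by (rule tendsto_eventually)
    qed
    show "(\<lambda>y. indicator {real m<..} (slope (L.rep y)) :: real) \<in> borel_measurable \<nu>" for m
      using sm by measurable
  qed (auto simp: indicator_def)
  then show ?thesis by simp
qed

end

locale lifted_equidistributed_walk = lifted_walk scl W gm \<eta> l \<nu> + equidistributed_walk scl W gm \<eta> l K v0
  for scl :: "'k::{real_normed_field,euclidean_space} \<Rightarrow> 'v::euclidean_space \<Rightarrow> 'v" and W gm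
    and \<eta> :: "'v set set measure" and l :: real and \<nu> :: "'v set measure" and K v0
begin

text \<open>First comes \<open>R\<close>, above which neither the walk nor \<open>\<nu>\<close> has
  much mass, and then \<open>k\<close>, for which blocks contract so strongly that \<open>F\<close>
  is almost constant on the parts of the fibres with slope at most \<open>R\<close>. Six errors
  below \<open>\<epsilon>\<close> arise: contraction and escape, each for the walk and for
  \<open>\<nu>\<close>, the shift of time by \<open>k\<close>, and the convergence in
  P(V/W).\<close>

theorem avg_converges:
  assumes F: "fibre_lipschitz B F"
    and eq: "\<And>k. equidistributed k (\<lambda>g v. F (blinfun_apply g (perp v)))"
  shows "avg (\<lambda>i \<omega>. F (pos \<omega> i)) \<longlonglongrightarrow> (\<integral>y. F (L.rep y) \<partial>\<nu>)"
proof (rule tendstoI)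
  fix e :: real assume e: "0 < e"
  define \<epsilon> where "\<epsilon> = e / 8"
  have \<epsilon>: "0 < \<epsilon>" using e by (simp add: \<epsilon>_def)
  obtain R1 where R1: "\<forall>\<^sub>F n in sequentially. avg (\<lambda>i \<omega>. indicator {R1<..} (slope (pos \<omega> i))) n < \<epsilon>"
    using tight[OF \<epsilon>] by blast
  have "\<forall>\<^sub>F m in sequentially. (\<integral>y. indicator {real m<..} (slope (L.rep y)) \<partial>\<nu>) < \<epsilon>"
    using slope_\<nu>_tendsto \<epsilon> by (intro order_tendstoD(2)) auto
  moreover have "\<forall>\<^sub>F m in sequentially. R1 \<le> real m"
    using eventually_ge_at_top[of "nat \<lceil>R1\<rceil>"] by eventually_elim (simp add: nat_le_iff ceiling_le_iff)
  ultimately have "\<forall>\<^sub>F m in sequentially. (\<integral>y. indicator {real m<..} (slope (L.rep y)) \<partial>\<nu>) < \<epsilon> \<and> R1 \<le> real m"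
    by (rule eventually_conj)
  then obtain m where m: "(\<integral>y. indicator {real m<..} (slope (L.rep y)) \<partial>\<nu>) < \<epsilon>" "R1 \<le> real m"
    unfolding eventually_sequentially by blast
  define R where "R = real m"
  have R: "0 \<le> R" "R1 \<le> R" using m by (simp_all add: R_def)
  define c where "c = nat \<lceil>B * R\<rceil>"
  obtain k where k: "(\<integral>z. min 1 (real c * contr (wk (snd z) k) (Q.rep (fst z))) \<partial>(\<eta> \<Otimes>\<^sub>M S)) < \<epsilon>"
    by (rule contr_integral_small[OF \<epsilon>])
  let ?J = "\<integral>z. min 1 (real c * contr (wk (snd z) k) (Q.rep (fst z))) \<partial>(\<eta> \<Otimes>\<^sub>M S)"
  let ?\<phi> = "\<lambda>g v. F (blinfun_apply g (perp v))"
  let ?I = "\<integral>z. ?\<phi> (wk (snd z) k) (Q.rep (fst z)) \<partial>(\<eta> \<Otimes>\<^sub>M S)"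
  let ?L = "\<integral>y. F (L.rep y) \<partial>\<nu>"
  let ?ind = "\<lambda>i \<omega>. indicator {R<..} (slope (pos \<omega> i)) :: real"
  let ?con = "\<lambda>i \<omega>. min 1 (real c * contr (blk \<omega> i k) (pos \<omega> i))"
  have pn: "pos \<omega> i \<notin> W" if "\<omega> \<in> space S" for \<omega> i unfolding pos_def by (rule wk_apply_notin[OF that v0])
  have Fm: "(\<lambda>\<omega>. F (pos \<omega> i)) \<in> borel_measurable S" for i
  proof -
    have "(\<lambda>\<omega>. pos \<omega> i) \<in> S \<rightarrow>\<^sub>M restrict_space borel (- W)"
      using pn by (intro measurable_restrict_space2) auto
    from measurable_compose[OF this borel_measurable_continuous_on_restrict[OF fibre_lipschitzD(3)[OF F]]]
    show ?thesis .
  qed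
  have iF: "integrable K (\<lambda>\<omega>. F (pos \<omega> i))" for i
    by (rule K_integrable_bounded[OF Fm, of _ 1]) (use fibre_lipschitzD(4,5)[OF F pn] in simp)
  have it: "integrable K (\<lambda>\<omega>. \<psi> (blk \<omega> i k) (pos \<omega> i))" if "test_function \<psi>" for i \<psi>
  proof (rule K_integrable_bounded[of _ 1])
    show "(\<lambda>\<omega>. \<psi> (blk \<omega> i k) (pos \<omega> i)) \<in> borel_measurable S"
      by (rule test_function_measurable[OF that blk_measurable pos_measurable pn])
    show "\<bar>\<psi> (blk \<omega> i k) (pos \<omega> i)\<bar> \<le> 1" if "\<omega> \<in> space S" for \<omega>
      using test_functionD(3,4)[OF \<open>test_function \<psi>\<close> blk_in_G[OF that] pn[OF that]] by simp
  qed
  have ii: "integrable K (?ind i)" for i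
  proof (rule K_integrable_bounded[of _ 1])
    show "?ind i \<in> borel_measurable S" by measurable
  qed (simp add: indicator_def)
  have ii1: "integrable K (\<lambda>\<omega>. indicator {R1<..} (slope (pos \<omega> i)) :: real)" for i
  proof (rule K_integrable_bounded[of _ 1])
    show "(\<lambda>\<omega>. indicator {R1<..} (slope (pos \<omega> i)) :: real) \<in> borel_measurable S" by measurable
  qed (simp add: indicator_def)
  note ic = it[OF test_contr[of c]] and ip = it[OF test_perp[OF F]]
  have comp: "\<bar>F (pos \<omega> (i + k)) - ?\<phi> (blk \<omega> i k) (pos \<omega> i)\<bar> \<le> ?con i \<omega> + ?ind i \<omega>" if "\<omega> \<in> space S" for i \<omega>
    using fibre_comparison[OF F blk_in_G[OF that] pn[OF that] R(1)] unfolding c_def pos_def wk_apply_add .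
  have d1: "\<bar>avg (\<lambda>i \<omega>. F (pos \<omega> (i + k))) n - avg (\<lambda>i \<omega>. ?\<phi> (blk \<omega> i k) (pos \<omega> i)) n\<bar> \<le> avg ?con n + avg ?ind n" for n
  proof -
    have "avg (\<lambda>i \<omega>. F (pos \<omega> (i + k))) n \<le> avg (\<lambda>i \<omega>. ?\<phi> (blk \<omega> i k) (pos \<omega> i) + (?con i \<omega> + ?ind i \<omega>)) n"
    proof (rule avg_mono)
      show "F (pos \<omega> (i + k)) \<le> ?\<phi> (blk \<omega> i k) (pos \<omega> i) + (?con i \<omega> + ?ind i \<omega>)" if "\<omega> \<in> space S" for i \<omega>
        using comp[OF that, of i] by linarith
    qed (intro iF Bochner_Integration.integrable_add ip ic ii)+
    moreover have "avg (\<lambda>i \<omega>. ?\<phi> (blk \<omega> i k) (pos \<omega> i)) n \<le> avg (\<lambda>i \<omega>. F (pos \<omega> (i + k)) + (?con i \<omega> + ?ind i \<omega>)) n"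
    proof (rule avg_mono)
      show "?\<phi> (blk \<omega> i k) (pos \<omega> i) \<le> F (pos \<omega> (i + k)) + (?con i \<omega> + ?ind i \<omega>)" if "\<omega> \<in> space S" for i \<omega>
        using comp[OF that, of i] by linarith
    qed (intro iF Bochner_Integration.integrable_add ip ic ii)+
    moreover have "avg (\<lambda>i \<omega>. ?\<phi> (blk \<omega> i k) (pos \<omega> i) + (?con i \<omega> + ?ind i \<omega>)) n =
        avg (\<lambda>i \<omega>. ?\<phi> (blk \<omega> i k) (pos \<omega> i)) n + (avg ?con n + avg ?ind n)"
      by (subst avg_add[OF ip Bochner_Integration.integrable_add[OF ic ii]]) (simp only: avg_add[OF ic ii])
    moreover have "avg (\<lambda>i \<omega>. F (pos \<omega> (i + k)) + (?con i \<omega> + ?ind i \<omega>)) n =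
        avg (\<lambda>i \<omega>. F (pos \<omega> (i + k))) n + (avg ?con n + avg ?ind n)"
      by (subst avg_add[OF iF Bochner_Integration.integrable_add[OF ic ii]]) (simp only: avg_add[OF ic ii])
    ultimately show ?thesis by linarith
  qed
  have d2: "\<bar>avg (\<lambda>i \<omega>. F (pos \<omega> i)) n - avg (\<lambda>i \<omega>. F (pos \<omega> (i + k))) n\<bar> \<le> real k / real n" for n
  proof -
    define a where "a = (\<lambda>i. \<integral>\<omega>. F (pos \<omega> i) \<partial>K)"
    have a: "0 \<le> a i" "a i \<le> 1" for i
    proof -
      show "0 \<le> a i" unfolding a_def
        by (rule Bochner_Integration.integral_nonneg) (use fibre_lipschitzD(4)[OF F pn] in \<open>simp add: space_K\<close>)
      have "a i \<le> (\<integral>\<omega>. 1 \<partial>K)" unfolding a_def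
        by (rule integral_mono[OF iF]) (use fibre_lipschitzD(5)[OF F pn] in \<open>simp_all add: space_K\<close>)
      then show "a i \<le> 1" by (simp add: K.prob_space)
    qed
    have "(\<Sum>i=1..n. a i - a (i + k)) \<le> (\<Sum>i=1..k. a i)" by (rule sum_telescope_shift_le) (rule a)
    also have "\<dots> \<le> (\<Sum>i=1..k. 1)" by (rule sum_mono) (rule a)
    finally have 1: "(\<Sum>i=1..n. a i - a (i + k)) \<le> real k" by simp
    \<comment> \<open>The telescoping bound is one-sided, so it is applied to \<open>1 - a i\<close>
      as well.\<close>
    have "(\<Sum>i=1..n. (1 - a i) - (1 - a (i + k))) \<le> (\<Sum>i=1..k. 1 - a i)"
      by (rule sum_telescope_shift_le) (simp add: a)
    also have "\<dots> \<le> (\<Sum>i=1..k. 1)" by (rule sum_mono) (simp add: a)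
    finally have 2: "(\<Sum>i=1..n. a (i + k) - a i) \<le> real k" by simp
    have "avg (\<lambda>i \<omega>. F (pos \<omega> i)) n - avg (\<lambda>i \<omega>. F (pos \<omega> (i + k))) n = (\<Sum>i=1..n. a i - a (i + k)) / real n"
      unfolding avg_def a_def by (simp add: sum_subtractf diff_divide_distrib)
    moreover have "\<bar>\<Sum>i=1..n. a i - a (i + k)\<bar> \<le> real k"
      using 1 2 by (simp add: sum_subtractf abs_le_iff)
    ultimately show ?thesis by (simp add: divide_right_mono)
  qed
  \<comment> \<open>The comparison under \<open>\<nu>\<close>: by \<open>integral_iterate\<close> a
    block of length \<open>k\<close> may be inserted without changing the integral of
    \<open>F\<close>, and by \<open>integral_push\<close> the values on the section integrate to
    \<open>?I\<close>.\<close>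
  have d3: "\<bar>?I - ?L\<bar> \<le> ?J + \<epsilon>"
  proof -
    let ?n1 = "\<lambda>z. F (blinfun_apply (wk (snd z) k) (L.rep (fst z)))"
    let ?n2 = "\<lambda>z. ?\<phi> (wk (snd z) k) (L.rep (fst z))"
    let ?n3 = "\<lambda>z. min 1 (real c * contr (wk (snd z) k) (L.rep (fst z)))"
    let ?n4 = "\<lambda>z. indicator {R<..} (slope (L.rep (fst z))) :: real"
    have zs: "fst z \<in> space \<nu>" "snd z \<in> space S" if "z \<in> space (\<nu> \<Otimes>\<^sub>M S)" for z
      using that by (simp_all add: space_pair_measure mem_Times_iff)
    have j1: "integrable (\<nu> \<Otimes>\<^sub>M S) ?n1"
    proof (rule N.Z.integrable_const_bound[of _ 1, OF AE_I2 integral_iterate(1)[OF F]])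
      fix z assume "z \<in> space (\<nu> \<Otimes>\<^sub>M S)"
      then show "norm (?n1 z) \<le> 1"
        using fibre_lipschitzD(4,5)[OF F wk_apply_notin[OF zs(2) rep_\<nu>(1)[OF zs(1)]]] by simp
    qed
    note j2 = integral_push[OF test_perp[OF F], of k] and j3 = integral_push[OF test_contr[of c], of k]
    have sm: "(\<lambda>y. indicator {R<..} (slope (L.rep y)) :: real) \<in> borel_measurable \<nu>"
      using L_rep_measurable[OF continuous_on_slope slope_L_invariant] by measurable
    have j4: "integrable (\<nu> \<Otimes>\<^sub>M S) ?n4"
      by (rule N.Z.integrable_const_bound[of _ 1, OF AE_I2 measurable_compose[OF measurable_fst sm]])
         (simp add: indicator_def)
    have "(\<integral>z. ?n4 z \<partial>(\<nu> \<Otimes>\<^sub>M S)) = (\<integral>y. indicator {R<..} (slope (L.rep y)) \<partial>\<nu>)"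
      using N.Z.integral_fst'[OF j4] by (simp add: P.prob_space)
    then have i4: "(\<integral>z. ?n4 z \<partial>(\<nu> \<Otimes>\<^sub>M S)) < \<epsilon>" using m(1) by (simp add: R_def)
    have "\<bar>\<integral>z. ?n2 z - ?n1 z \<partial>(\<nu> \<Otimes>\<^sub>M S)\<bar> \<le> (\<integral>z. \<bar>?n2 z - ?n1 z\<bar> \<partial>(\<nu> \<Otimes>\<^sub>M S))"
      by (rule integral_abs_bound)
    also have "\<dots> \<le> (\<integral>z. ?n3 z + ?n4 z \<partial>(\<nu> \<Otimes>\<^sub>M S))"
    proof (rule integral_mono)
      show "integrable (\<nu> \<Otimes>\<^sub>M S) (\<lambda>z. \<bar>?n2 z - ?n1 z\<bar>)"
        by (intro integrable_abs Bochner_Integration.integrable_diff j2(1) j1)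
      show "integrable (\<nu> \<Otimes>\<^sub>M S) (\<lambda>z. ?n3 z + ?n4 z)"
        by (intro Bochner_Integration.integrable_add j3(1) j4)
      fix z assume z: "z \<in> space (\<nu> \<Otimes>\<^sub>M S)"
      show "\<bar>?n2 z - ?n1 z\<bar> \<le> ?n3 z + ?n4 z"
        using fibre_comparison[OF F wk_in_G[OF zs(2)[OF z], of k] rep_\<nu>(1)[OF zs(1)[OF z]] R(1)]
        unfolding c_def by (subst abs_minus_commute)
    qed
    also have "\<dots> = (\<integral>z. ?n3 z \<partial>(\<nu> \<Otimes>\<^sub>M S)) + (\<integral>z. ?n4 z \<partial>(\<nu> \<Otimes>\<^sub>M S))"
      by (rule Bochner_Integration.integral_add[OF j3(1) j4])
    also have "(\<integral>z. ?n2 z - ?n1 z \<partial>(\<nu> \<Otimes>\<^sub>M S)) = ?I - ?L"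
      unfolding Bochner_Integration.integral_diff[OF j2(1) j1] j2(2) integral_iterate(2)[OF F] ..
    finally show ?thesis using i4 unfolding j3(2) by linarith
  qed
  have l1: "\<forall>\<^sub>F n in sequentially. avg ?con n < \<epsilon>"
    using equi_contr[of k c] k unfolding equidistributed_def by (intro order_tendstoD(2)) auto
  have l2: "\<forall>\<^sub>F n in sequentially. real k / real n < \<epsilon>"
    using lim_const_over_n[of "real k"] \<epsilon> by (intro order_tendstoD(2)) auto
  have l3: "\<forall>\<^sub>F n in sequentially. \<bar>avg (\<lambda>i \<omega>. ?\<phi> (blk \<omega> i k) (pos \<omega> i)) n - ?I\<bar> < \<epsilon>"
    using eq[of k] \<epsilon> unfolding equidistributed_def tendsto_iff dist_real_def by blast
  show "\<forall>\<^sub>F n in sequentially. dist (avg (\<lambda>i \<omega>. F (pos \<omega> i)) n) ?L < e"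
    using R1 l1 l2 l3
  proof eventually_elim
    case (elim n)
    have "avg ?ind n \<le> avg (\<lambda>i \<omega>. indicator {R1<..} (slope (pos \<omega> i))) n"
      by (rule avg_mono[OF ii ii1]) (use R(2) in \<open>auto simp: indicator_def\<close>)
    then have "\<bar>avg (\<lambda>i \<omega>. F (pos \<omega> i)) n - ?L\<bar> < 8 * \<epsilon>"
      using elim d1[of n] d2[of n] d3 k \<epsilon> by linarith
    then show ?case by (simp add: dist_real_def \<epsilon>_def)
  qed
qed

end

section \<open>Laws of large numbers along the walk\<close>

text \<open>After expanding the square, each of the \<open>n\<close> rows has at most
  \<open>2 * k\<close> entries with \<open>j\<close> closer than \<open>k\<close> to
  \<open>i\<close>, each of them at most 1; all others vanish.\<close>

lemma (in prob_space) second_moment_finite_range_correlations: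
  fixes D :: "nat \<Rightarrow> 'a \<Rightarrow> real"
  assumes D [measurable]: "\<And>i. D i \<in> borel_measurable M"
    and b: "\<And>i x. x \<in> space M \<Longrightarrow> \<bar>D i x\<bar> \<le> 1"
    and corr: "\<And>i j. i + k \<le> j \<Longrightarrow> expectation (\<lambda>x. D i x * D j x) = 0"
  shows "expectation (\<lambda>x. (\<Sum>i=1..n. D i x)\<^sup>2) \<le> 2 * real k * real n"
proof -
  have b2: "\<bar>D i x * D j x\<bar> \<le> 1" if "x \<in> space M" for i j x
    using b[OF that, of i] b[OF that, of j] by (simp add: abs_mult mult_le_one)
  have int: "integrable M (\<lambda>x. D i x * D j x)" for i j
    by (rule integrable_const_bound[of _ 1, OF AE_I2]) (use b2 in auto)
  have le: "expectation (\<lambda>x. D i x * D j x) \<le> of_bool (i < j + k \<and> j < i + k)" for i j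
  proof (cases "i < j + k \<and> j < i + k")
    case True
    have "expectation (\<lambda>x. D i x * D j x) \<le> expectation (\<lambda>x. 1)"
      by (rule integral_mono[OF int]) (use b2 in \<open>auto simp: abs_le_iff\<close>)
    then show ?thesis using True by (simp add: prob_space)
  next
    case False
    then have "i + k \<le> j \<or> j + k \<le> i" by auto
    then have "expectation (\<lambda>x. D i x * D j x) = 0"
      using corr[of i j] corr[of j i] by (auto simp: mult.commute)
    then show ?thesis by simp
  qed
  have card: "(\<Sum>j=1..n. of_bool (i < j + k \<and> j < i + k)) \<le> 2 * real k" for i :: nat
  proof -
    have "(\<Sum>j\<in>A. of_bool (i < j + k \<and> j < i + k)) = real (card (A \<inter> {j. i < j + k \<and> j < i + k}))"
      if "finite A" for A :: "nat set" using that by simp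
    then have "(\<Sum>j=1..n. of_bool (i < j + k \<and> j < i + k)) = real (card ({1..n} \<inter> {j. i < j + k \<and> j < i + k}))"
      by blast
    also have "card ({1..n} \<inter> {j. i < j + k \<and> j < i + k}) \<le> card {i + 1 - k..<i + k}"
      by (rule card_mono) auto
    also have "\<dots> \<le> 2 * k" by simp
    finally show ?thesis by simp
  qed
  have "expectation (\<lambda>x. (\<Sum>i=1..n. D i x)\<^sup>2) = expectation (\<lambda>x. \<Sum>i=1..n. \<Sum>j=1..n. D i x * D j x)"
    by (simp add: power2_eq_square sum_product)
  also have "\<dots> = (\<Sum>i=1..n. \<Sum>j=1..n. expectation (\<lambda>x. D i x * D j x))"
    by (subst Bochner_Integration.integral_sum, intro Bochner_Integration.integrable_sum int)
       (intro sum.cong refl Bochner_Integration.integral_sum int)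
  also have "\<dots> \<le> (\<Sum>i=1..n. \<Sum>j=1..n. of_bool (i < j + k \<and> j < i + k))" by (intro sum_mono le)
  also have "\<dots> \<le> (\<Sum>i=1..n. 2 * real k)" by (intro sum_mono card)
  finally show ?thesis by (simp add: mult.commute)
qed

text \<open>Between the square of \<open>r\<close> and the next one at most \<open>2 * r\<close>
  further terms occur, each bounded by 1, which is negligible against the square of
  \<open>r\<close>.\<close>

lemma average_tendsto_0_of_squares:
  fixes a :: "nat \<Rightarrow> real"
  assumes b: "\<And>i. \<bar>a i\<bar> \<le> 1" and sq: "(\<lambda>m. (\<Sum>i=1..m\<^sup>2. a i) / real (m\<^sup>2)) \<longlonglongrightarrow> 0"
  shows "(\<lambda>n. (\<Sum>i=1..n. a i) / real n) \<longlonglongrightarrow> 0"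
proof -
  define r where "r = (\<lambda>n :: nat. nat \<lfloor>sqrt (real n)\<rfloor>)"
  have r_top: "filterlim r at_top sequentially"
    unfolding filterlim_at_top
  proof
    fix Z :: nat
    show "\<forall>\<^sub>F n in sequentially. Z \<le> r n"
      using eventually_ge_at_top[of "Z\<^sup>2"]
    proof eventually_elim
      case (elim n)
      then have "real (Z\<^sup>2) \<le> real n" by (simp only: of_nat_le_iff)
      then have "real Z \<le> sqrt (real n)" by (intro real_le_rsqrt) simp
      then show ?case unfolding r_def by (simp add: le_nat_iff le_floor_iff)
    qed
  qed
  let ?q = "\<lambda>m. (\<Sum>i=1..m\<^sup>2. a i) / real (m\<^sup>2)"
  have "(\<lambda>m. \<bar>?q m\<bar> + 2 / real m) \<longlonglongrightarrow> 0 + 0"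
    by (intro tendsto_add tendsto_rabs_zero sq lim_const_over_n)
  then have lim: "(\<lambda>n. \<bar>?q (r n)\<bar> + 2 / real (r n)) \<longlonglongrightarrow> 0"
    using filterlim_compose[OF _ r_top, of "\<lambda>m. \<bar>?q m\<bar> + 2 / real m" "nhds 0"] by simp
  have "\<forall>\<^sub>F n in sequentially. 1 \<le> r n" using r_top unfolding filterlim_at_top by blast
  then have "\<forall>\<^sub>F n in sequentially. norm ((\<Sum>i=1..n. a i) / real n) \<le> \<bar>?q (r n)\<bar> + 2 / real (r n)"
  proof eventually_elim
    case (elim n)
    have "real (r n) \<le> sqrt (real n)" unfolding r_def by simp
    then have "(real (r n))\<^sup>2 \<le> (sqrt (real n))\<^sup>2" by (intro power_mono) auto
    then have r1: "real ((r n)\<^sup>2) \<le> real n" by simp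
    have "(of_int \<lfloor>sqrt (real n)\<rfloor> :: real) = real (r n)" unfolding r_def by simp
    then have "sqrt (real n) < real (Suc (r n))" using floor_correct[of "sqrt (real n)"] by linarith
    then have "(sqrt (real n))\<^sup>2 < (real (Suc (r n)))\<^sup>2" by (intro power_strict_mono) auto
    then have "real n < real ((Suc (r n))\<^sup>2)" by simp
    then have "n < (Suc (r n))\<^sup>2" by (simp only: of_nat_less_iff)
    moreover have "(Suc (r n))\<^sup>2 = (r n)\<^sup>2 + 2 * r n + 1" by (simp add: power2_eq_square)
    ultimately have r2: "n - (r n)\<^sup>2 \<le> 2 * r n" by linarith
    have r1': "(r n)\<^sup>2 \<le> n" using r1 by (simp only: of_nat_le_iff)
    have "{1..n} = {1..(r n)\<^sup>2} \<union> {Suc ((r n)\<^sup>2)..n}" using r1' by auto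
    then have "(\<Sum>i=1..n. a i) = (\<Sum>i=1..(r n)\<^sup>2. a i) + (\<Sum>i=Suc ((r n)\<^sup>2)..n. a i)"
      by (simp only:) (rule sum.union_disjoint, auto)
    moreover have "\<bar>\<Sum>i=Suc ((r n)\<^sup>2)..n. a i\<bar> \<le> (\<Sum>i=Suc ((r n)\<^sup>2)..n. 1)"
      by (rule order_trans[OF sum_abs]) (intro sum_mono b)
    moreover have "(\<Sum>i=Suc ((r n)\<^sup>2)..n. 1 :: real) \<le> 2 * real (r n)" using r2 by simp
    ultimately have "\<bar>\<Sum>i=1..n. a i\<bar> \<le> \<bar>\<Sum>i=1..(r n)\<^sup>2. a i\<bar> + 2 * real (r n)" by linarith
    then have "\<bar>\<Sum>i=1..n. a i\<bar> / real n \<le> (\<bar>\<Sum>i=1..(r n)\<^sup>2. a i\<bar> + 2 * real (r n)) / real n"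
      by (intro divide_right_mono) auto
    also have "\<dots> \<le> (\<bar>\<Sum>i=1..(r n)\<^sup>2. a i\<bar> + 2 * real (r n)) / real ((r n)\<^sup>2)"
    proof (rule divide_left_mono[OF r1])
      have "1 \<le> (r n)\<^sup>2" using elim by simp
      then have "0 < n" using r1' by linarith
      then show "0 < real n * real ((r n)\<^sup>2)" using elim by simp
    qed simp
    also have "\<dots> = \<bar>?q (r n)\<bar> + 2 / real (r n)"
      using elim by (simp add: add_divide_distrib power2_eq_square)
    finally show ?case by simp
  qed
  from Lim_null_comparison[OF this lim] show ?thesis .
qed

text \<open>Along the squares \<open>m\<^sup>2\<close> the second moments of the averages are of
  order \<open>1 / m\<^sup>2\<close>, hence summable, so these averages tend to 0 almost surely;
  \<open>average_tendsto_0_of_squares\<close> fills the gaps.\<close>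

lemma (in prob_space) lln_finite_range_correlations:
  fixes D :: "nat \<Rightarrow> 'a \<Rightarrow> real"
  assumes D [measurable]: "\<And>i. D i \<in> borel_measurable M"
    and b: "\<And>i x. x \<in> space M \<Longrightarrow> \<bar>D i x\<bar> \<le> 1"
    and corr: "\<And>i j. i + k \<le> j \<Longrightarrow> expectation (\<lambda>x. D i x * D j x) = 0"
  shows "AE x in M. (\<lambda>n. (\<Sum>i=1..n. D i x) / real n) \<longlonglongrightarrow> 0"
proof -
  let ?Z = "\<lambda>m x. ((\<Sum>i=1..m\<^sup>2. D i x) / real (m\<^sup>2))\<^sup>2"
  have sb: "\<bar>\<Sum>i=1..n. D i x\<bar> \<le> real n" if "x \<in> space M" for n x
  proof -
    have "\<bar>\<Sum>i=1..n. D i x\<bar> \<le> (\<Sum>i=1..n. 1)"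
      by (rule order_trans[OF sum_abs]) (intro sum_mono b[OF that])
    then show ?thesis by simp
  qed
  have intS: "integrable M (\<lambda>x. (\<Sum>i=1..n. D i x)\<^sup>2)" for n
  proof (rule integrable_const_bound[of _ "(real n)\<^sup>2", OF AE_I2])
    fix x assume "x \<in> space M"
    then have "\<bar>\<Sum>i=1..n. D i x\<bar>\<^sup>2 \<le> (real n)\<^sup>2" by (intro power_mono sb) auto
    then show "norm ((\<Sum>i=1..n. D i x)\<^sup>2) \<le> (real n)\<^sup>2" by simp
  qed measurable
  have Zint: "integrable M (?Z m)" for m
    unfolding power_divide by (intro integrable_divide intS)
  have EZ: "expectation (?Z m) \<le> 2 * real k * (1 / (real m)\<^sup>2)" for m
  proof (cases "m = 0")
    case False
    have "expectation (?Z m) = expectation (\<lambda>x. (\<Sum>i=1..m\<^sup>2. D i x)\<^sup>2) / (real (m\<^sup>2))\<^sup>2"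
      unfolding power_divide by simp
    also have "\<dots> \<le> 2 * real k * real (m\<^sup>2) / (real (m\<^sup>2))\<^sup>2"
      by (intro divide_right_mono second_moment_finite_range_correlations[OF D b corr]) auto
    also have "\<dots> = 2 * real k * (1 / (real m)\<^sup>2)" using False by (simp add: power2_eq_square)
    finally show ?thesis .
  qed simp
  have sm: "summable (\<lambda>m. 2 * real k * (1 / (real m)\<^sup>2))"
    by (intro summable_mult) (use inverse_power_summable[of 2, where 'a=real] in \<open>simp add: inverse_eq_divide\<close>)
  have nn: "0 \<le> expectation (?Z m)" for m by (rule Bochner_Integration.integral_nonneg) simp
  have "summable (\<lambda>m. expectation (?Z m))"
    by (rule summable_comparison_test'[OF sm, of 0]) (use EZ nn in simp)
  then have fin: "(\<Sum>m. ennreal (expectation (?Z m))) \<noteq> \<infinity>"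
    using suminf_ennreal2[OF nn] by simp
  have "(\<integral>\<^sup>+x. (\<Sum>m. ennreal (?Z m x)) \<partial>M) = (\<Sum>m. \<integral>\<^sup>+x. ennreal (?Z m x) \<partial>M)"
    by (rule nn_integral_suminf) measurable
  also have "\<dots> = (\<Sum>m. ennreal (expectation (?Z m)))"
    by (intro suminf_cong nn_integral_eq_integral Zint) simp
  finally have "(\<integral>\<^sup>+x. (\<Sum>m. ennreal (?Z m x)) \<partial>M) \<noteq> \<infinity>" using fin by simp
  then have "AE x in M. (\<Sum>m. ennreal (?Z m x)) \<noteq> \<infinity>"
    by (intro nn_integral_PInf_AE) auto
  with AE_space show ?thesis
  proof eventually_elim
    case (elim x)
    have "summable (\<lambda>m. ?Z m x)"
      by (rule summable_suminf_not_top) (use elim(2) in auto)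
    then have "(\<lambda>m. ?Z m x) \<longlonglongrightarrow> 0" by (rule summable_LIMSEQ_zero)
    then have "(\<lambda>m. sqrt (?Z m x)) \<longlonglongrightarrow> sqrt 0" by (rule tendsto_real_sqrt)
    then have "(\<lambda>m. (\<Sum>i=1..m\<^sup>2. D i x) / real (m\<^sup>2)) \<longlonglongrightarrow> 0"
      unfolding real_sqrt_abs by (simp only: real_sqrt_zero tendsto_rabs_zero_iff)
    then show ?case by (rule average_tendsto_0_of_squares[OF b[OF elim(1)]])
  qed
qed

section \<open>Conditional expectations of block observables\<close>

context random_walk
begin

text \<open>Continuing the first \<open>i\<close> letters of one sequence by an independent second
  sequence reproduces the law of the walk. The inner integral is the conditional expectation given
  the first \<open>i\<close> steps.\<close>

lemma integral_comb_seq: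
  fixes f :: "(nat \<Rightarrow> 'v \<Rightarrow>\<^sub>L 'v) \<Rightarrow> real"
  assumes f [measurable]: "f \<in> borel_measurable S" and b: "\<And>\<omega>. \<omega> \<in> space S \<Longrightarrow> \<bar>f \<omega>\<bar> \<le> B"
  shows "(\<integral>\<omega>. f \<omega> \<partial>S) = (\<integral>\<omega>. (\<integral>\<omega>'. f (comb_seq i \<omega> \<omega>') \<partial>S) \<partial>S)"
proof -
  interpret SS: pair_prob_space S S ..
  let ?c = "\<lambda>(\<omega>, \<omega>'). comb_seq i \<omega> \<omega>'"
  have m: "(\<lambda>z. f (?c z)) \<in> borel_measurable (S \<Otimes>\<^sub>M S)"
    by (rule measurable_compose[OF measurable_comb_seq f])
  have int: "integrable (S \<Otimes>\<^sub>M S) (\<lambda>z. f (?c z))"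
  proof (rule SS.integrable_const_bound[of _ B, OF AE_I2 m])
    fix z assume "z \<in> space (S \<Otimes>\<^sub>M S)"
    then have "?c z \<in> space S" by (rule measurable_space[OF measurable_comb_seq])
    then show "norm (f (?c z)) \<le> B" using b by simp
  qed
  have "(\<integral>\<omega>. f \<omega> \<partial>S) = (\<integral>\<omega>. f \<omega> \<partial>distr (S \<Otimes>\<^sub>M S) S ?c)" by (simp only: PiM_comb_seq)
  also have "\<dots> = (\<integral>z. f (?c z) \<partial>(S \<Otimes>\<^sub>M S))" by (rule integral_distr[OF measurable_comb_seq f])
  also have "\<dots> = (\<integral>\<omega>. (\<integral>\<omega>'. f (comb_seq i \<omega> \<omega>') \<partial>S) \<partial>S)" using SS.integral_fst'[OF int] by simp
  finally show ?thesis .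
qed

lemma blk_comb_seq: "blk (comb_seq i \<omega> \<omega>') i k = wk \<omega>' k"
  by (simp add: blk_def shift_comb_seq)

lemma blk_comb_seq_early: "i + k \<le> j \<Longrightarrow> blk (comb_seq j \<omega> \<omega>') i k = blk \<omega> i k"
  unfolding blk_def by (rule wk_cong) (simp add: funpow_shift comb_seq_def)

text \<open>The conditional expectation of the observable of the next \<open>k\<close> steps, as a
  function of the current position. It is a continuous function on P(V/W), which the block
  observable itself is not.\<close>

definition hat :: "(('v \<Rightarrow>\<^sub>L 'v) \<Rightarrow> 'v \<Rightarrow> real) \<Rightarrow> nat \<Rightarrow> 'v \<Rightarrow> real" where
  "hat \<phi> k v = (\<integral>\<omega>. \<phi> (wk \<omega> k) v \<partial>S)"

lemma test_wk_integrable: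
  assumes "test_function \<phi>" "v \<notin> W"
  shows "integrable S (\<lambda>\<omega>. \<phi> (wk \<omega> k) v)"
proof (rule P.integrable_const_bound[of _ 1, OF AE_I2])
  show "norm (\<phi> (wk \<omega> k) v) \<le> 1" if "\<omega> \<in> space S" for \<omega>
    using test_functionD(3,4)[OF assms(1) wk_in_G[OF that] assms(2)] by simp
  show "(\<lambda>\<omega>. \<phi> (wk \<omega> k) v) \<in> borel_measurable S"
    by (rule test_function_measurable[OF assms(1) wk_measurable]) (use assms(2) in auto)
qed

lemma hat_bounds:
  assumes "test_function \<phi>" "v \<notin> W"
  shows "0 \<le> hat \<phi> k v" "hat \<phi> k v \<le> 1"
proof -
  show "0 \<le> hat \<phi> k v" unfolding hat_def
    by (rule Bochner_Integration.integral_nonneg) (rule test_functionD(3)[OF assms(1) wk_in_G assms(2)])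
  have "hat \<phi> k v \<le> (\<integral>\<omega>. 1 \<partial>S)" unfolding hat_def
    by (rule integral_mono[OF test_wk_integrable[OF assms]])
       (auto intro: test_functionD(4)[OF assms(1) wk_in_G assms(2)])
  then show "hat \<phi> k v \<le> 1" by (simp add: P.prob_space)
qed

lemma hat_invariant:
  assumes "test_function \<phi>"
  shows "Q.invariant (hat \<phi> k)"
  unfolding Q.invariant_def hat_def
proof (intro ballI impI Bochner_Integration.integral_cong refl)
  fix v v' \<omega> assume v: "v \<in> - W" "v' \<in> - W" "qline scl W v = qline scl W v'" and \<omega>: "\<omega> \<in> space S"
  show "\<phi> (wk \<omega> k) v = \<phi> (wk \<omega> k) v'"
    using test_functionD(1)[OF assms wk_in_G[OF \<omega>, of k]] v unfolding Q.invariant_def by blast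
qed

lemma hat_continuous:
  assumes "test_function \<phi>"
  shows "continuous_on (- W) (hat \<phi> k)"
  unfolding continuous_on_sequentially
proof (intro allI ballI impI)
  fix x a assume a: "a \<in> - W" and x: "(\<forall>n. x n \<in> - W) \<and> x \<longlonglongrightarrow> a"
  have "(\<lambda>n. \<integral>\<omega>. \<phi> (wk \<omega> k) (x n) \<partial>S) \<longlonglongrightarrow> (\<integral>\<omega>. \<phi> (wk \<omega> k) a \<partial>S)"
  proof (rule integral_dominated_convergence[where w="\<lambda>_. 1"])
    show "(\<lambda>\<omega>. \<phi> (wk \<omega> k) a) \<in> borel_measurable S"
      using test_wk_integrable[OF assms, of a k] a by auto
    show "(\<lambda>\<omega>. \<phi> (wk \<omega> k) (x n)) \<in> borel_measurable S" for n
      using test_wk_integrable[OF assms, of "x n" k] x by auto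
    show "AE \<omega> in S. (\<lambda>n. \<phi> (wk \<omega> k) (x n)) \<longlonglongrightarrow> \<phi> (wk \<omega> k) a"
    proof (rule AE_I2)
      fix \<omega> assume "\<omega> \<in> space S"
      from test_functionD(2)[OF assms wk_in_G[OF this, of k]] a x
      show "(\<lambda>n. \<phi> (wk \<omega> k) (x n)) \<longlonglongrightarrow> \<phi> (wk \<omega> k) a"
        unfolding continuous_on_sequentially comp_def by blast
    qed
    show "AE \<omega> in S. norm (\<phi> (wk \<omega> k) (x n)) \<le> 1" for n
    proof (rule AE_I2)
      fix \<omega> assume \<omega>: "\<omega> \<in> space S"
      have "x n \<notin> W" using x by simp
      from test_functionD(3,4)[OF assms wk_in_G[OF \<omega>] this] show "norm (\<phi> (wk \<omega> k) (x n)) \<le> 1" by simp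
    qed
  qed simp
  then show "(hat \<phi> k \<circ> x) \<longlonglongrightarrow> hat \<phi> k a" by (simp add: hat_def comp_def)
qed

lemma continuous_wk_measurable:
  assumes "continuous_on (- W) (F :: 'v \<Rightarrow> real)" "v0 \<notin> W"
  shows "(\<lambda>\<omega>. F (blinfun_apply (wk \<omega> i) v0)) \<in> borel_measurable S"
proof -
  have "(\<lambda>\<omega>. blinfun_apply (wk \<omega> i) v0) \<in> S \<rightarrow>\<^sub>M restrict_space borel (- W)"
    using wk_apply_notin[OF _ assms(2)] by (intro measurable_restrict_space2) auto
  from measurable_compose[OF this borel_measurable_continuous_on_restrict[OF assms(1)]] show ?thesis .
qed

lemma test_blk_measurable:
  "test_function \<phi> \<Longrightarrow> v0 \<notin> W \<Longrightarrow> (\<lambda>\<omega>. \<phi> (blk \<omega> i k) (blinfun_apply (wk \<omega> i) v0)) \<in> borel_measurable S"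
  by (rule test_function_measurable[OF _ blk_measurable wk_apply_measurable wk_apply_notin])

lemma test_blk_bounds:
  assumes "test_function \<phi>" "v0 \<notin> W" "\<omega> \<in> space S"
  shows "0 \<le> \<phi> (blk \<omega> i k) (blinfun_apply (wk \<omega> i) v0)" "\<phi> (blk \<omega> i k) (blinfun_apply (wk \<omega> i) v0) \<le> 1"
  using test_functionD(3,4)[OF assms(1) blk_in_G[OF assms(3)] wk_apply_notin[OF assms(3,2)]] by auto

lemma integral_test_blk:
  assumes "test_function \<phi>" "v0 \<notin> W"
  shows "(\<integral>\<omega>. \<phi> (blk \<omega> i k) (blinfun_apply (wk \<omega> i) v0) \<partial>S) = (\<integral>\<omega>. hat \<phi> k (blinfun_apply (wk \<omega> i) v0) \<partial>S)"
proof -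
  have "\<bar>\<phi> (blk \<omega> i k) (blinfun_apply (wk \<omega> i) v0)\<bar> \<le> 1" if "\<omega> \<in> space S" for \<omega>
    using test_blk_bounds[OF assms that, of i k] by simp
  from integral_comb_seq[OF test_blk_measurable[OF assms] this, of i]
  show ?thesis unfolding hat_def blk_comb_seq wk_comb_seq[OF order_refl] .
qed

text \<open>The differences have mean zero given the steps before their block. If
  \<open>i + k \<le> j\<close>, the term at \<open>i\<close> is determined by the first
  \<open>j\<close> steps, given which the term at \<open>j\<close> has mean zero, so the two are
  uncorrelated.\<close>

lemma lln_test_function:
  assumes \<phi>: "test_function \<phi>" and v0: "v0 \<notin> W"
  shows "AE \<omega> in S. (\<lambda>n. (\<Sum>i=1..n. \<phi> (blk \<omega> i k) (blinfun_apply (wk \<omega> i) v0)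
    - hat \<phi> k (blinfun_apply (wk \<omega> i) v0)) / real n) \<longlonglongrightarrow> 0"
proof (rule P.lln_finite_range_correlations)
  let ?D = "\<lambda>i \<omega>. \<phi> (blk \<omega> i k) (blinfun_apply (wk \<omega> i) v0) - hat \<phi> k (blinfun_apply (wk \<omega> i) v0)"
  show m: "?D i \<in> borel_measurable S" for i
    by (intro borel_measurable_diff test_blk_measurable[OF \<phi> v0] continuous_wk_measurable[OF hat_continuous[OF \<phi>] v0])
  show b: "\<bar>?D i \<omega>\<bar> \<le> 1" if "\<omega> \<in> space S" for i \<omega>
    using test_blk_bounds[OF \<phi> v0 that, of i k] hat_bounds[OF \<phi> wk_apply_notin[OF that v0], of k i] by linarith
  fix i j assume ij: "i + k \<le> j"
  have "(\<integral>\<omega>. ?D i \<omega> * ?D j \<omega> \<partial>S) = (\<integral>\<omega>. (\<integral>\<omega>'. ?D i (comb_seq j \<omega> \<omega>') * ?D j (comb_seq j \<omega> \<omega>') \<partial>S) \<partial>S)"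
  proof (rule integral_comb_seq[of _ 1])
    show "(\<lambda>\<omega>. ?D i \<omega> * ?D j \<omega>) \<in> borel_measurable S" by (intro borel_measurable_times m)
    show "\<bar>?D i \<omega> * ?D j \<omega>\<bar> \<le> 1" if "\<omega> \<in> space S" for \<omega>
      using b[OF that, of i] b[OF that, of j] by (simp add: abs_mult mult_le_one)
  qed
  also have "\<dots> = (\<integral>\<omega>. 0 \<partial>S)"
  proof (rule Bochner_Integration.integral_cong[OF refl])
    fix \<omega> assume \<omega>: "\<omega> \<in> space S"
    let ?v = "blinfun_apply (wk \<omega> j) v0"
    have ij': "i \<le> j" using ij by simp
    have "(\<integral>\<omega>'. ?D i (comb_seq j \<omega> \<omega>') * ?D j (comb_seq j \<omega> \<omega>') \<partial>S) =
        (\<integral>\<omega>'. ?D i \<omega> * (\<phi> (wk \<omega>' k) ?v - hat \<phi> k ?v) \<partial>S)"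
      unfolding blk_comb_seq_early[OF ij] wk_comb_seq[OF ij'] blk_comb_seq wk_comb_seq[OF order_refl] ..
    also have "\<dots> = ?D i \<omega> * (\<integral>\<omega>'. \<phi> (wk \<omega>' k) ?v - hat \<phi> k ?v \<partial>S)" by simp
    also have "(\<integral>\<omega>'. \<phi> (wk \<omega>' k) ?v - hat \<phi> k ?v \<partial>S) = 0"
      using test_wk_integrable[OF \<phi> wk_apply_notin[OF \<omega> v0], of k j]
      by (simp add: hat_def P.prob_space)
    finally show "(\<integral>\<omega>'. ?D i (comb_seq j \<omega> \<omega>') * ?D j (comb_seq j \<omega> \<omega>') \<partial>S) = 0" by simp
  qed
  finally show "(\<integral>\<omega>. ?D i \<omega> * ?D j \<omega> \<partial>S) = 0" by simp
qed

end

section \<open>Lifting the two modes of convergence\<close>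

context lifted_walk
begin

lemma excess_le: "g \<in> G \<Longrightarrow> norm (excess m g) \<le> norm (ln (size g))"
  using ln_size_nonneg[of g] by (simp add: excess_def)

lemma integral_coordinate:
  assumes "f \<in> borel_measurable gm"
  shows "(\<integral>\<omega>. (f (\<omega> i) :: real) \<partial>S) = (\<integral>g. f g \<partial>gm)"
proof -
  have "(\<integral>g. f g \<partial>distr S gm (\<lambda>\<omega>. \<omega> i)) = (\<integral>\<omega>. f (\<omega> i) \<partial>S)"
    by (rule integral_distr[OF _ assms]) measurable
  then show ?thesis using PiM_component[of i] by simp
qed

lemma lln_excess: "AE \<omega> in S. (\<lambda>n. (\<Sum>i=1..n. excess m (\<omega> (i + j))) / real n) \<longlonglongrightarrow> (\<integral>g. excess m g \<partial>gm)"
proof -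
  let ?f = "\<lambda>z. excess m (snd z 0)"
  have fm: "?f \<in> borel_measurable (\<eta> \<Otimes>\<^sub>M S)"
    by (rule measurable_compose[OF _ excess_measurable],
        rule measurable_compose[OF measurable_snd measurable_component_singleton]) simp
  have int: "integrable (\<eta> \<Otimes>\<^sub>M S) ?f"
    by (rule Bochner_Integration.integrable_bound[OF moment_Z fm AE_I2])
       (rule excess_le, simp add: space_pair_measure mem_Times_iff S_in_G)
  have "(\<integral>z. ?f z \<partial>(\<eta> \<Otimes>\<^sub>M S)) = (\<integral>g. excess m g \<partial>gm)"
    using Z.integral_fst'[OF int] by (simp add: integral_coordinate[OF excess_measurable] Y.prob_space)
  then have "AE z in \<eta> \<Otimes>\<^sub>M S. (\<lambda>n. (\<Sum>i<n. ?f ((skew ^^ i) z)) / real n) \<longlonglongrightarrow> (\<integral>g. excess m g \<partial>gm)"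
    using skew.birkhoff[OF int] by simp
  \<comment> \<open>The sum starts at \<open>i = 1\<close> and reads the letter
    \<open>i + j\<close>, so the orbit is started \<open>Suc j\<close> steps later.\<close>
  from skew.AE_funpow_T[OF this, of "Suc j"] AE_space
  have "AE z in \<eta> \<Otimes>\<^sub>M S. (\<lambda>n. (\<Sum>i=1..n. excess m (snd z (i + j))) / real n) \<longlonglongrightarrow> (\<integral>g. excess m g \<partial>gm)"
  proof eventually_elim
    case (elim z)
    then obtain y \<omega> where z: "z = (y, \<omega>)" "y \<in> space \<eta>" "\<omega> \<in> space S" by (auto simp: space_pair_measure)
    have "?f ((skew ^^ i) ((skew ^^ Suc j) z)) = excess m (\<omega> (Suc i + j))" for i
    proof -
      have "(skew ^^ i) ((skew ^^ Suc j) z) = (skew ^^ (i + Suc j)) z" by (simp only: funpow_add comp_apply)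
      then show ?thesis by (simp only: z(1) funpow_skew[OF z(2,3)] snd_conv) (simp add: funpow_shift shift_def)
    qed
    moreover have "(\<Sum>i<n. excess m (\<omega> (Suc i + j))) = (\<Sum>i=1..n. excess m (\<omega> (i + j)))" for n
      by (rule sum.reindex_bij_witness[of _ "\<lambda>i. i - 1" Suc]) auto
    ultimately show ?case using elim(1) by (simp add: z(1))
  qed
  then show ?thesis by (rule AE_snd)
qed

lemma hat_integral:
  assumes "test_function \<phi>"
  shows "(\<integral>y. hat \<phi> k (Q.rep y) \<partial>\<eta>) = (\<integral>z. \<phi> (wk (snd z) k) (Q.rep (fst z)) \<partial>(\<eta> \<Otimes>\<^sub>M S))"
  unfolding hat_def using Z.integral_fst'[OF test_function_Z_integrable[OF assms]] by simp

text \<open>The case \<open>K = S\<close>: conditioning on the first \<open>i\<close> steps replaces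
  every test function by its \<open>hat\<close>, a continuous function on P(V/W), to which
  \<open>base\<close> applies.\<close>

theorem lift_expectation:
  assumes v0: "v0 \<notin> W"
    and base: "\<And>F. continuous_on (- W) F \<Longrightarrow> Q.invariant F \<Longrightarrow> (\<And>v. v \<notin> W \<Longrightarrow> 0 \<le> F v \<and> F v \<le> 1) \<Longrightarrow>
      (\<lambda>n. (\<Sum>i=1..n. \<integral>\<omega>. F (blinfun_apply (wk \<omega> i) v0) \<partial>S) / real n) \<longlonglongrightarrow> (\<integral>y. F (Q.rep y) \<partial>\<eta>)"
    and F: "fibre_lipschitz B F"
  shows "(\<lambda>n. (\<Sum>i=1..n. \<integral>\<omega>. F (blinfun_apply (wk \<omega> i) v0) \<partial>S) / real n) \<longlonglongrightarrow> (\<integral>y. F (L.rep y) \<partial>\<nu>)"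
proof -
  interpret C: cesaro_walk scl W gm \<eta> l S v0
    by unfold_locales (rule refl, rule v0)
  have eq: "C.equidistributed k \<phi>" if \<phi>: "test_function \<phi>" for k \<phi>
    unfolding C.equidistributed_def C.avg_def C.pos_def integral_test_blk[OF \<phi> v0] hat_integral[OF \<phi>, symmetric]
    by (rule base[OF hat_continuous[OF \<phi>] hat_invariant[OF \<phi>]]) (use hat_bounds[OF \<phi>] in simp)
  interpret E: lifted_equidistributed_walk scl W gm \<eta> l \<nu> S v0
  proof unfold_locales
    show "C.equidistributed k (\<lambda>g v. min 1 (real c * contr g v))" for k c by (rule eq[OF test_contr])
    show "C.equidistributed k (\<lambda>g v. min 1 (size g / real (Suc c)))" for k c by (rule eq[OF test_size])
    show "C.avg (\<lambda>i \<omega>. excess m (\<omega> (i + j))) \<longlonglongrightarrow> (\<integral>g. excess m g \<partial>gm)" for m j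
    proof (rule tendsto_eventually)
      show "\<forall>\<^sub>F n in sequentially. C.avg (\<lambda>i \<omega>. excess m (\<omega> (i + j))) n = (\<integral>g. excess m g \<partial>gm)"
        using eventually_gt_at_top[of 0]
        by eventually_elim (simp add: C.avg_def integral_coordinate[OF excess_measurable])
    qed
    show "integrable S (\<lambda>\<omega>. ln (size (\<omega> j)))" for j by (rule moment_coordinate)
  qed
  show ?thesis
    using E.avg_converges[OF F eq[OF test_perp[OF F]]] unfolding C.avg_def C.pos_def .
qed

text \<open>A pathwise implication outside a null set that is fixed before anything is assumed about
  the path. To obtain it, the laws of large numbers are collected for countably many functions:
  natural parameters \<open>c\<close>, \<open>k\<close>, \<open>m\<close>, \<open>j\<close> and the
  countable family \<open>\<F>\<close>.\<close>

theorem lift_almost_surely: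
  assumes v0: "v0 \<notin> W" and count: "countable \<F>" and F: "\<And>F. F \<in> \<F> \<Longrightarrow> \<exists>B. fibre_lipschitz B F"
  shows "AE \<omega> in S.
    (\<forall>F. continuous_on (- W) F \<longrightarrow> Q.invariant F \<longrightarrow> (\<forall>v. v \<notin> W \<longrightarrow> 0 \<le> F v \<and> F v \<le> 1) \<longrightarrow>
      (\<lambda>n. (\<Sum>i=1..n. F (blinfun_apply (wk \<omega> i) v0)) / real n) \<longlonglongrightarrow> (\<integral>y. F (Q.rep y) \<partial>\<eta>)) \<longrightarrow>
    (\<forall>F\<in>\<F>. (\<lambda>n. (\<Sum>i=1..n. F (blinfun_apply (wk \<omega> i) v0)) / real n) \<longlonglongrightarrow> (\<integral>y. F (L.rep y) \<partial>\<nu>))"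
proof -
  let ?lln = "\<lambda>\<phi> k \<omega>. (\<lambda>n. (\<Sum>i=1..n. \<phi> (blk \<omega> i k) (blinfun_apply (wk \<omega> i) v0)
    - hat \<phi> k (blinfun_apply (wk \<omega> i) v0)) / real n) \<longlonglongrightarrow> 0"
  have "AE \<omega> in S. \<forall>c k. ?lln (\<lambda>g v. min 1 (real c * contr g v)) k \<omega>"
    unfolding AE_all_countable by (intro allI lln_test_function[OF test_contr v0])
  moreover have "AE \<omega> in S. \<forall>c k. ?lln (\<lambda>g v. min 1 (size g / real (Suc c))) k \<omega>"
    unfolding AE_all_countable by (intro allI lln_test_function[OF test_size v0])
  moreover have "AE \<omega> in S. \<forall>F\<in>\<F>. \<forall>k. ?lln (\<lambda>g v. F (blinfun_apply g (perp v))) k \<omega>"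
  proof (subst AE_ball_countable[OF count], intro ballI)
    fix H assume "H \<in> \<F>"
    then obtain B where "fibre_lipschitz B H" using F by blast
    then show "AE \<omega> in S. \<forall>k. ?lln (\<lambda>g v. H (blinfun_apply g (perp v))) k \<omega>"
      unfolding AE_all_countable by (intro allI lln_test_function[OF test_perp v0])
  qed
  moreover have "AE \<omega> in S. \<forall>m j. (\<lambda>n. (\<Sum>i=1..n. excess m (\<omega> (i + j))) / real n) \<longlonglongrightarrow> (\<integral>g. excess m g \<partial>gm)"
    unfolding AE_all_countable by (intro allI lln_excess)
  ultimately show ?thesis using AE_space
  proof eventually_elim
    case (elim \<omega>)
    show ?case
    proof (intro impI ballI)
      assume base: "\<forall>F. continuous_on (- W) F \<longrightarrow> Q.invariant F \<longrightarrow> (\<forall>v. v \<notin> W \<longrightarrow> 0 \<le> F v \<and> F v \<le> 1) \<longrightarrow>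
        (\<lambda>n. (\<Sum>i=1..n. F (blinfun_apply (wk \<omega> i) v0)) / real n) \<longlonglongrightarrow> (\<integral>y. F (Q.rep y) \<partial>\<eta>)"
      fix H assume H: "H \<in> \<F>"
      then obtain B where B: "fibre_lipschitz B H" using F by blast
      have \<omega>: "\<omega> \<in> space S" by (rule elim(5))
      interpret RS: prob_space "return S \<omega>" by (rule prob_space_return[OF \<omega>])
      \<comment> \<open>For the point mass at the path, integrals are evaluations and
        \<open>avg\<close> is the empirical average.\<close>
      interpret C: cesaro_walk scl W gm \<eta> l "return S \<omega>" v0
        by unfold_locales (rule sets_return, rule v0)
      have ret: "(\<integral>x. f x \<partial>return S \<omega>) = f \<omega>" if "f \<in> borel_measurable S" for f :: "_ \<Rightarrow> real"
        by (rule integral_return[OF \<omega> that])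
      have eq: "C.equidistributed k \<phi>" if \<phi>: "test_function \<phi>" and l: "?lln \<phi> k \<omega>" for k \<phi>
      proof -
        have "(\<lambda>n. (\<Sum>i=1..n. hat \<phi> k (blinfun_apply (wk \<omega> i) v0)) / real n) \<longlonglongrightarrow> (\<integral>y. hat \<phi> k (Q.rep y) \<partial>\<eta>)"
          using base hat_continuous[OF \<phi>] hat_invariant[OF \<phi>] hat_bounds[OF \<phi>] by blast
        from tendsto_add[OF l this]
        have "(\<lambda>n. (\<Sum>i=1..n. \<phi> (blk \<omega> i k) (blinfun_apply (wk \<omega> i) v0)) / real n) \<longlonglongrightarrow> (\<integral>y. hat \<phi> k (Q.rep y) \<partial>\<eta>)"
          by (simp add: sum_subtractf diff_divide_distrib)
        then show ?thesis
          unfolding C.equidistributed_def C.avg_def C.pos_def ret[OF test_blk_measurable[OF \<phi> v0]] hat_integral[OF \<phi>] .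
      qed
      have cm: "(\<lambda>\<omega>. ln (size (\<omega> j))) \<in> borel_measurable S" "(\<lambda>\<omega>. excess m (\<omega> j)) \<in> borel_measurable S" for j m
        by measurable
      interpret E: lifted_equidistributed_walk scl W gm \<eta> l \<nu> "return S \<omega>" v0
      proof unfold_locales
        show "C.equidistributed k (\<lambda>g v. min 1 (real c * contr g v))" for k c
          by (rule eq[OF test_contr]) (use elim(1) in blast)
        show "C.equidistributed k (\<lambda>g v. min 1 (size g / real (Suc c)))" for k c
          by (rule eq[OF test_size]) (use elim(2) in blast)
        show "C.avg (\<lambda>i \<omega>. excess m (\<omega> (i + j))) \<longlonglongrightarrow> (\<integral>g. excess m g \<partial>gm)" for m j
          using elim(4) unfolding C.avg_def ret[OF cm(2)] by blast
        show "integrable (return S \<omega>) (\<lambda>\<omega>. ln (size (\<omega> j)))" for j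
        proof (rule integrableI_bounded)
          have "(\<lambda>x. ennreal (norm (ln (size (x j))))) \<in> borel_measurable S" by measurable
          then show "(\<integral>\<^sup>+x. ennreal (norm (ln (size (x j)))) \<partial>return S \<omega>) < \<infinity>"
            by (simp add: nn_integral_return[OF \<omega>])
        qed (use cm(1) in simp)
      qed
      have "C.equidistributed k (\<lambda>g v. H (blinfun_apply g (perp v)))" for k
        by (rule eq[OF test_perp[OF B]]) (use elim(3) H in blast)
      from E.avg_converges[OF B this]
      show "(\<lambda>n. (\<Sum>i=1..n. H (blinfun_apply (wk \<omega> i) v0)) / real n) \<longlonglongrightarrow> (\<integral>y. H (L.rep y) \<partial>\<nu>)"
        unfolding C.avg_def C.pos_def ret[OF continuous_wk_measurable[OF fibre_lipschitzD(3)[OF B] v0]] .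
    qed
  qed
qed

end

section \<open>Testing weak convergence on a countable family\<close>

text \<open>The sum counts the indices \<open>j\<close> below \<open>real n * y\<close>, and their
  number falls short of \<open>real n * y\<close> by at most 1.\<close>

lemma layer_sum_bounds:
  fixes y :: real
  assumes "0 \<le> y" "y \<le> 1" "0 < n"
  shows "(\<Sum>j=1..n. of_bool (real j / real n < y)) / real n \<le> y"
    and "y \<le> (\<Sum>j=1..n. of_bool (real j / real n < y)) / real n + 1 / real n"
proof -
  let ?A = "{1..n} \<inter> {j. real j / real n < y}"
  have s: "(\<Sum>j=1..n. of_bool (real j / real n < y)) = real (card ?A)"
  proof -
    have "(\<Sum>j\<in>B. of_bool (real j / real n < y)) = real (card (B \<inter> {j. real j / real n < y}))"
      if "finite B" for B using that by simp
    then show ?thesis by blast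
  qed
  have "?A \<subseteq> {1..nat \<lfloor>real n * y\<rfloor>}"
  proof
    fix j assume "j \<in> ?A"
    then have "1 \<le> j" "real j < real n * y" using assms by (auto simp: field_simps)
    then show "j \<in> {1..nat \<lfloor>real n * y\<rfloor>}" by (simp add: le_nat_iff le_floor_iff)
  qed
  then have "card ?A \<le> card {1..nat \<lfloor>real n * y\<rfloor>}" by (intro card_mono) auto
  then have "real (card ?A) \<le> real (nat \<lfloor>real n * y\<rfloor>)" by simp
  also have "\<dots> \<le> real n * y" using assms by simp
  finally show "(\<Sum>j=1..n. of_bool (real j / real n < y)) / real n \<le> y"
    unfolding s using assms by (simp add: field_simps)
  have "{1..nat (\<lceil>real n * y\<rceil> - 1)} \<subseteq> ?A"
  proof
    fix j assume j: "j \<in> {1..nat (\<lceil>real n * y\<rceil> - 1)}"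
    then have "int j \<le> \<lceil>real n * y\<rceil> - 1" by auto
    then have lt: "real j < real n * y" by linarith
    also have "\<dots> \<le> real n * 1" using assms by (intro mult_left_mono) auto
    finally have "j \<le> n" by simp
    then show "j \<in> ?A" using j lt assms by (simp add: field_simps)
  qed
  then have "card {1..nat (\<lceil>real n * y\<rceil> - 1)} \<le> card ?A" by (intro card_mono) auto
  then have "nat (\<lceil>real n * y\<rceil> - 1) \<le> card ?A" by simp
  then have "real n * y \<le> real (card ?A) + 1" by linarith
  then show "y \<le> (\<Sum>j=1..n. of_bool (real j / real n < y)) / real n + 1 / real n"
    unfolding s using assms by (simp add: field_simps)
qed

text \<open>The portmanteau theorem for a prescribed family of tests: the sets in \<open>B\<close>
  exhaust every open set, and the functions \<open>f V m\<close> approach the indicator of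
  \<open>V\<close> from below. The index 0 is left out because an average of no measures has no
  mass.\<close>

locale weak_test =
  fixes T :: "'a topology" and N :: "nat \<Rightarrow> 'a measure" and \<eta> :: "'a measure"
    and B :: "'a set set" and f :: "'a set \<Rightarrow> nat \<Rightarrow> 'a \<Rightarrow> real"
  assumes prob_\<eta>: "prob_space \<eta>" and sets_\<eta>: "sets \<eta> = sets (borel_of T)"
    and prob_N: "\<And>n. 0 < n \<Longrightarrow> prob_space (N n)" and sets_N: "\<And>n. 0 < n \<Longrightarrow> sets (N n) = sets (borel_of T)"
    and exhaust: "\<And>U. openin T U \<Longrightarrow> \<exists>u. (\<forall>j :: nat. u j \<in> B) \<and> incseq u \<and> U = (\<Union>j. u j)"
    and B_sets: "\<And>V. V \<in> B \<Longrightarrow> V \<in> sets (borel_of T)"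
    and f_measurable: "\<And>V m. V \<in> B \<Longrightarrow> f V m \<in> borel_measurable (borel_of T)"
    and f_bounds: "\<And>V m x. V \<in> B \<Longrightarrow> x \<in> topspace T \<Longrightarrow> 0 \<le> f V m x \<and> f V m x \<le> 1"
    and f_outside: "\<And>V m x. V \<in> B \<Longrightarrow> x \<in> topspace T \<Longrightarrow> x \<notin> V \<Longrightarrow> f V m x = 0"
    and f_inside: "\<And>V x. V \<in> B \<Longrightarrow> x \<in> topspace T \<Longrightarrow> x \<in> V \<Longrightarrow> (\<lambda>m. f V m x) \<longlonglongrightarrow> 1"
    and f_conv: "\<And>V m. V \<in> B \<Longrightarrow> (\<lambda>n. \<integral>x. f V m x \<partial>N n) \<longlonglongrightarrow> (\<integral>x. f V m x \<partial>\<eta>)"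
begin

lemma space_\<eta>: "space \<eta> = topspace T"
  using sets_eq_imp_space_eq[OF sets_\<eta>] by (simp add: space_borel_of)
lemma space_N: "0 < n \<Longrightarrow> space (N n) = topspace T"
  using sets_eq_imp_space_eq[OF sets_N] by (simp add: space_borel_of)

sublocale P: prob_space \<eta> by (rule prob_\<eta>)

lemma measurable_N: "0 < n \<Longrightarrow> h \<in> borel_measurable (borel_of T) \<Longrightarrow> h \<in> borel_measurable (N n)"
  using measurable_cong_sets[OF sets_N refl] by blast
lemma measurable_\<eta>: "h \<in> borel_measurable (borel_of T) \<Longrightarrow> h \<in> borel_measurable \<eta>"
  using measurable_cong_sets[OF sets_\<eta> refl] by blast

text \<open>The portmanteau inequality for open sets: exhaust \<open>U\<close> by a member
  \<open>?V\<close> of \<open>B\<close>, then replace its indicator by some \<open>f ?V m\<close>,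
  which lies below it. Each of the three approximations loses \<open>e / 3\<close>.\<close>

lemma open_eventually_ge:
  assumes U: "openin T U" and e: "0 < e"
  shows "\<forall>\<^sub>F n in sequentially. measure \<eta> U - e < measure (N n) U"
proof -
  obtain u where u: "\<And>j :: nat. u j \<in> B" "incseq u" "U = (\<Union>j. u j)" using exhaust[OF U] by blast
  have us: "u j \<in> sets \<eta>" for j using B_sets[OF u(1)] by (simp add: sets_\<eta>)
  have "(\<lambda>j. measure \<eta> (u j)) \<longlonglongrightarrow> measure \<eta> U"
    unfolding u(3) by (rule P.finite_Lim_measure_incseq) (use us u(2) in auto)
  then have "\<forall>\<^sub>F j in sequentially. measure \<eta> U - e / 3 < measure \<eta> (u j)"
    using e by (intro order_tendstoD(1)) auto
  then obtain j where j: "measure \<eta> U - e / 3 < measure \<eta> (u j)" unfolding eventually_sequentially by blast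
  let ?V = "u j"
  have "(\<lambda>m. \<integral>x. f ?V m x \<partial>\<eta>) \<longlonglongrightarrow> (\<integral>x. indicator ?V x \<partial>\<eta>)"
  proof (rule integral_dominated_convergence[where w="\<lambda>_. 1"])
    show "AE x in \<eta>. (\<lambda>m. f ?V m x) \<longlonglongrightarrow> indicator ?V x"
    proof (rule AE_I2)
      fix x assume x: "x \<in> space \<eta>"
      show "(\<lambda>m. f ?V m x) \<longlonglongrightarrow> indicator ?V x"
      proof (cases "x \<in> ?V")
        case True
        then show ?thesis using f_inside[OF u(1), of x j] x by (simp add: space_\<eta>)
      next
        case False
        then show ?thesis using f_outside[OF u(1), of x j] x by (simp add: space_\<eta>)
      qed
    qed
    show "AE x in \<eta>. norm (f ?V m x) \<le> 1" for m
      using f_bounds[OF u(1)] by (intro AE_I2) (simp add: space_\<eta>)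
  qed (use us measurable_\<eta>[OF f_measurable[OF u(1)]] in auto)
  then have "(\<lambda>m. \<integral>x. f ?V m x \<partial>\<eta>) \<longlonglongrightarrow> measure \<eta> ?V" using us by simp
  then have "\<forall>\<^sub>F m in sequentially. measure \<eta> ?V - e / 3 < (\<integral>x. f ?V m x \<partial>\<eta>)"
    using e by (intro order_tendstoD(1)) auto
  then obtain m where m: "measure \<eta> ?V - e / 3 < (\<integral>x. f ?V m x \<partial>\<eta>)" unfolding eventually_sequentially by blast
  have "\<forall>\<^sub>F n in sequentially. (\<integral>x. f ?V m x \<partial>\<eta>) - e / 3 < (\<integral>x. f ?V m x \<partial>N n)"
    using f_conv[OF u(1), of j m] e by (intro order_tendstoD(1)) auto
  then show ?thesis using eventually_gt_at_top[of 0]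
  proof eventually_elim
    case (elim n)
    interpret Nn: prob_space "N n" by (rule prob_N[OF elim(2)])
    have Vn: "?V \<in> sets (N n)" "U \<in> sets (N n)"
      using B_sets[OF u(1), of j] openin_in_sets_borel_of[OF U] by (simp_all add: sets_N[OF elim(2)])
    have "(\<integral>x. f ?V m x \<partial>N n) \<le> (\<integral>x. indicator ?V x \<partial>N n)"
    proof (rule integral_mono)
      show "integrable (N n) (f ?V m)"
        by (rule Nn.integrable_const_bound[of _ 1, OF AE_I2 measurable_N[OF elim(2) f_measurable[OF u(1)]]])
           (use f_bounds[OF u(1)] in \<open>simp add: space_N[OF elim(2)]\<close>)
      show "integrable (N n) (indicator ?V :: 'a \<Rightarrow> real)" using Vn by (simp add: less_top[symmetric])
      show "f ?V m x \<le> indicator ?V x" if "x \<in> space (N n)" for x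
        using f_bounds[OF u(1), of x j m] f_outside[OF u(1), of x j m] that
        by (cases "x \<in> ?V") (simp_all add: space_N[OF elim(2)])
    qed
    also have "\<dots> = measure (N n) ?V" using Vn by simp
    also have "\<dots> \<le> measure (N n) U"
      by (rule Nn.finite_measure_mono[OF _ Vn(2)]) (use u(3) in blast)
    finally show ?case using elim(1) m j by linarith
  qed
qed

text \<open>Up to \<open>1 / real p\<close> the function is the mean of the indicators of
  \<open>p\<close> open superlevel sets, so finitely many instances of
  \<open>open_eventually_ge\<close> suffice.\<close>

lemma integral_eventually_ge:
  assumes h: "continuous_map T euclideanreal h" and b: "\<And>x. x \<in> topspace T \<Longrightarrow> 0 \<le> h x \<and> h x \<le> 1" and e: "0 < e"
  shows "\<forall>\<^sub>F n in sequentially. (\<integral>x. h x \<partial>\<eta>) - e < (\<integral>x. h x \<partial>N n)"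
proof -
  obtain p :: nat where p: "0 < p" "1 / real p < e / 2"
    using nat_approx_posE[of "e / 2"] e by (metis half_gt_zero zero_less_Suc)
  let ?U = "\<lambda>j. {x \<in> topspace T. real j / real p < h x}"
  have U: "openin T (?U j)" for j :: nat
  proof -
    have "\<forall>U. open U \<longrightarrow> openin T {x \<in> topspace T. h x \<in> U}" using h by (simp add: continuous_map_def)
    then have "openin T {x \<in> topspace T. h x \<in> {real j / real p<..}}" using open_greaterThan by blast
    then show ?thesis by simp
  qed
  note hm = continuous_map_measurable[OF h]
  let ?s = "\<lambda>x. (\<Sum>j=1..p. indicator (?U j) x) / real p"
  have s: "?s x = (\<Sum>j=1..p. of_bool (real j / real p < h x)) / real p" if "x \<in> topspace T" for x
    using that by (simp add: indicator_def of_bool_def)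
  have sint: "integrable Q ?s" "(\<integral>x. ?s x \<partial>Q) = (\<Sum>j=1..p. measure Q (?U j)) / real p"
    "integrable Q h" if "prob_space Q" "sets Q = sets (borel_of T)" for Q
  proof -
    interpret Q: prob_space Q by fact
    have sp: "space Q = topspace T" using sets_eq_imp_space_eq[OF that(2)] by (simp add: space_borel_of)
    have Us: "?U j \<in> sets Q" for j using openin_in_sets_borel_of[OF U] by (simp add: that(2))
    have ind: "integrable Q (indicator (?U j) :: 'a \<Rightarrow> real)" for j using Us[of j] by (simp add: less_top[symmetric])
    then show "integrable Q ?s" by (intro integrable_divide Bochner_Integration.integrable_sum)
    show "(\<integral>x. ?s x \<partial>Q) = (\<Sum>j=1..p. measure Q (?U j)) / real p"
      using ind Us by (simp add: Bochner_Integration.integral_sum)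
    show "integrable Q h"
    proof (rule Q.integrable_const_bound[of _ 1, OF AE_I2])
      show "h \<in> borel_measurable Q" using hm measurable_cong_sets[OF that(2) refl] by blast
    qed (use b in \<open>simp add: sp\<close>)
  qed
  have "\<forall>\<^sub>F n in sequentially. \<forall>j\<in>{1..p}. measure \<eta> (?U j) - e / 2 < measure (N n) (?U j)"
    using e by (intro eventually_ball_finite ballI open_eventually_ge[OF U]) auto
  then show ?thesis using eventually_gt_at_top[of 0]
  proof eventually_elim
    case (elim n)
    have "(\<integral>x. h x \<partial>\<eta>) \<le> (\<integral>x. ?s x + 1 / real p \<partial>\<eta>)"
    proof (rule integral_mono[OF sint(3)[OF prob_\<eta> sets_\<eta>]])
      show "integrable \<eta> (\<lambda>x. ?s x + 1 / real p)"
        by (intro Bochner_Integration.integrable_add sint(1)[OF prob_\<eta> sets_\<eta>]) simp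
      show "h x \<le> ?s x + 1 / real p" if "x \<in> space \<eta>" for x
        using layer_sum_bounds(2)[of "h x" p] b[of x] p(1) that s[of x] by (simp add: space_\<eta>)
    qed
    also have "\<dots> = (\<Sum>j=1..p. measure \<eta> (?U j)) / real p + 1 / real p"
      by (subst Bochner_Integration.integral_add[OF sint(1)[OF prob_\<eta> sets_\<eta>]])
         (simp_all only: sint(2)[OF prob_\<eta> sets_\<eta>], simp_all add: P.prob_space)
    also have "(\<Sum>j=1..p. measure \<eta> (?U j)) / real p \<le> (\<Sum>j=1..p. measure (N n) (?U j) + e / 2) / real p"
      using elim(1) by (intro divide_right_mono sum_mono) force+
    also have "\<dots> = (\<Sum>j=1..p. measure (N n) (?U j)) / real p + e / 2"
      using p(1) by (simp add: sum.distrib add_divide_distrib)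
    also have "(\<Sum>j=1..p. measure (N n) (?U j)) / real p = (\<integral>x. ?s x \<partial>N n)"
      by (rule sint(2)[OF prob_N[OF elim(2)] sets_N[OF elim(2)], symmetric])
    also have "\<dots> \<le> (\<integral>x. h x \<partial>N n)"
    proof (rule integral_mono)
      show "?s x \<le> h x" if "x \<in> space (N n)" for x
        using layer_sum_bounds(1)[of "h x" p] b[of x] p(1) that s[of x] by (simp add: space_N[OF elim(2)])
    qed (rule sint(1,3)[OF prob_N[OF elim(2)] sets_N[OF elim(2)]])+
    finally show ?case using p(2) by linarith
  qed
qed

theorem weakly_converges: "weakly_converges T N \<eta>"
  unfolding weakly_converges_def
proof (intro allI impI)
  fix h assume h: "continuous_map T euclideanreal h" and "bounded (h ` topspace T)"
  then obtain C where C: "0 < C" "\<And>x. x \<in> topspace T \<Longrightarrow> \<bar>h x\<bar> \<le> C"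
    unfolding bounded_pos by auto
  \<comment> \<open>After rescaling to values in the unit interval, the lower bound is used for
    \<open>?g\<close> and for \<open>1 - ?g x\<close>, which yields both sides of the limit.\<close>
  let ?g = "\<lambda>x. (h x + C) / (2 * C)"
  have g: "continuous_map T euclideanreal ?g" "continuous_map T euclideanreal (\<lambda>x. 1 - ?g x)"
    using h C(1) by (intro continuous_intros; simp)+
  have gb: "0 \<le> ?g x \<and> ?g x \<le> 1" if "x \<in> topspace T" for x
    using C(2)[OF that] C(1) by (auto simp: divide_simps abs_le_iff)
  have gi: "integrable Q ?g" "integrable Q h" if "prob_space Q" "sets Q = sets (borel_of T)" for Q
  proof -
    interpret Q: prob_space Q by fact
    have sp: "space Q = topspace T" using sets_eq_imp_space_eq[OF that(2)] by (simp add: space_borel_of)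
    have "h \<in> borel_measurable Q"
      using continuous_map_measurable[OF h] measurable_cong_sets[OF that(2) refl] by blast
    then show hi: "integrable Q h"
      by (intro Q.integrable_const_bound[of _ C] AE_I2) (use C(2) in \<open>simp_all add: sp\<close>)
    show "integrable Q ?g"
      by (intro integrable_divide Bochner_Integration.integrable_add hi) simp
  qed
  have "(\<lambda>n. \<integral>x. ?g x \<partial>N n) \<longlonglongrightarrow> (\<integral>x. ?g x \<partial>\<eta>)"
  proof (rule tendstoI)
    fix e :: real assume e: "0 < e"
    have gb': "0 \<le> 1 - ?g x \<and> 1 - ?g x \<le> 1" if "x \<in> topspace T" for x using gb[OF that] by linarith
    have 1: "\<forall>\<^sub>F n in sequentially. (\<integral>x. ?g x \<partial>\<eta>) - e < (\<integral>x. ?g x \<partial>N n)"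
      by (rule integral_eventually_ge[OF g(1) gb e])
    have 2: "\<forall>\<^sub>F n in sequentially. (\<integral>x. 1 - ?g x \<partial>\<eta>) - e < (\<integral>x. 1 - ?g x \<partial>N n)"
      by (rule integral_eventually_ge[OF g(2) gb' e])
    from 1 2 eventually_gt_at_top[of 0]
    show "\<forall>\<^sub>F n in sequentially. dist (\<integral>x. ?g x \<partial>N n) (\<integral>x. ?g x \<partial>\<eta>) < e"
    proof eventually_elim
      case (elim n)
      interpret Nn: prob_space "N n" by (rule prob_N[OF elim(3)])
      have "(\<integral>x. 1 - ?g x \<partial>N n) = 1 - (\<integral>x. ?g x \<partial>N n)"
        using gi(1)[OF prob_N[OF elim(3)] sets_N[OF elim(3)]] Nn.prob_space
        by (subst Bochner_Integration.integral_diff) simp_all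
      moreover have "(\<integral>x. 1 - ?g x \<partial>\<eta>) = 1 - (\<integral>x. ?g x \<partial>\<eta>)"
        using gi(1)[OF prob_\<eta> sets_\<eta>] P.prob_space
        by (subst Bochner_Integration.integral_diff) simp_all
      ultimately show ?case using elim(1,2) by (simp only: dist_real_def abs_less_iff) linarith
    qed
  qed
  then have lim: "(\<lambda>n. 2 * C * (\<integral>x. ?g x \<partial>N n) - C) \<longlonglongrightarrow> 2 * C * (\<integral>x. ?g x \<partial>\<eta>) - C"
    by (intro tendsto_intros)
  have val: "2 * C * (\<integral>x. ?g x \<partial>Q) - C = (\<integral>x. h x \<partial>Q)"
    if "prob_space Q" "sets Q = sets (borel_of T)" for Q
  proof -
    interpret Q: prob_space Q by fact
    have "(\<integral>x. ?g x \<partial>Q) = ((\<integral>x. h x \<partial>Q) + C) / (2 * C)"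
      using gi(2)[OF that] by (simp add: Q.prob_space)
    then show ?thesis using C(1) by simp
  qed
  have "\<forall>\<^sub>F n in sequentially. 2 * C * (\<integral>x. ?g x \<partial>N n) - C = (\<integral>x. h x \<partial>N n)"
    using eventually_gt_at_top[of 0] by eventually_elim (rule val[OF prob_N sets_N])
  from Lim_transform_eventually[OF lim this]
  show "(\<lambda>n. \<integral>x. h x \<partial>N n) \<longlonglongrightarrow> (\<integral>x. h x \<partial>\<eta>)"
    by (simp only: val[OF prob_\<eta> sets_\<eta>])
qed

end

section \<open>Bump functions of open sets of lines\<close>

context random_walk
begin

text \<open>The distance to the complement of the open cone over \<open>V\<close> is homogeneous of
  degree 1, so its quotient by the norm is a function of the line, positive exactly on
  \<open>V\<close>. Multiplication by \<open>m\<close> and the cut at 1 let it approach the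
  indicator of \<open>V\<close>.\<close>

definition bump :: "'v set set \<Rightarrow> nat \<Rightarrow> 'v \<Rightarrow> real" where
  "bump V m v = min 1 (real m * (infdist v (- {v \<in> - W. line scl v \<in> V}) / norm v))"

context
  fixes V :: "'v set set" assumes V: "openin L.T V"
begin

abbreviation "cover \<equiv> {v \<in> - W. line scl v \<in> V}"

lemma open_cone: "open cover"
  using V by (simp add: L.openin_T)

lemma zero_notin_cone: "0 \<in> - cover"
  using W_0 by simp

lemma cone_scl_iff: assumes "c \<noteq> 0" shows "scl c v \<in> - cover \<longleftrightarrow> v \<in> - cover"
proof (cases "v \<in> W")
  case True
  then show ?thesis using W_scl_iff[OF assms, of v] by simp
next
  case False
  then have n: "scl c v \<notin> W" using W_scl_iff[OF assms, of v] by simp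
  have "line scl v = line scl (scl c v)"
    unfolding line_eq_iff[OF compl_W_nonzero[OF False] compl_W_nonzero[OF n]] using assms by blast
  then show ?thesis using False n by simp
qed

lemma infdist_scl_le: assumes "c \<noteq> 0" shows "infdist (scl c v) (- cover) \<le> norm c * infdist v (- cover)"
proof -
  have "closed (- cover)" using open_cone by (simp add: closed_Compl)
  then obtain y where y: "y \<in> - cover" "infdist v (- cover) = dist v y"
    using infdist_attains_inf[of "- cover" v] zero_notin_cone by blast
  have "infdist (scl c v) (- cover) \<le> dist (scl c v) (scl c y)"
    by (rule infdist_le) (use cone_scl_iff[OF assms, of y] y(1) in simp)
  also have "\<dots> = norm c * dist v y" by (simp add: dist_norm scale_right_diff_distrib[symmetric] norm_scale)
  finally show ?thesis unfolding y(2) .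
qed

lemma infdist_scl: assumes "c \<noteq> 0" shows "infdist (scl c v) (- cover) = norm c * infdist v (- cover)"
proof (rule antisym[OF infdist_scl_le[OF assms]])
  have "infdist (scl (inverse c) (scl c v)) (- cover) \<le> norm (inverse c) * infdist (scl c v) (- cover)"
    by (rule infdist_scl_le) (use assms in simp)
  then have "norm c * infdist v (- cover) \<le> norm c * (norm (inverse c) * infdist (scl c v) (- cover))"
    unfolding scl_scl_inverse[OF assms] by (intro mult_left_mono) auto
  also have "\<dots> = infdist (scl c v) (- cover)"
    using assms by (simp add: norm_inverse)
  finally show "norm c * infdist v (- cover) \<le> infdist (scl c v) (- cover)" .
qed

text \<open>Distance and norm are both 1-Lipschitz, and the distance is at most the norm because 0
  lies outside the cone. Hence their quotient changes by at most
  \<open>2 * (norm w / norm v)\<close>, and \<open>del v\<close> is at most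
  \<open>norm v\<close>.\<close>

lemma bump_fibre_lipschitz: "fibre_lipschitz (2 * real m) (bump V m)"
  unfolding fibre_lipschitz_def
proof (intro conjI ballI)
  show "0 \<le> 2 * real m" by simp
  show "L.invariant (bump V m)"
  proof (rule L_invariantI)
    fix c :: 'k and v assume "c \<noteq> 0"
    then show "bump V m (scl c v) = bump V m v"
      unfolding bump_def infdist_scl[OF \<open>c \<noteq> 0\<close>] norm_scale by simp
  qed
  show "continuous_on (- W) (bump V m)"
    unfolding bump_def[abs_def] using compl_W_nonzero by (intro continuous_intros) auto
  show "0 \<le> bump V m v" "bump V m v \<le> 1" for v unfolding bump_def by (simp_all add: infdist_nonneg)
  fix v w assume v: "v \<in> - W" and w: "w \<in> W"
  let ?v = "v - w"
  let ?i = "\<lambda>v. infdist v (- cover)"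
  have v': "?v \<notin> W" using W_add_iff[OF W_minus[OF w], of v] v by simp
  have n: "0 < norm v" "0 < norm ?v" using compl_W_nonzero[of v] compl_W_nonzero[OF v'] v by simp_all
  have iv: "?i ?v \<le> norm ?v" using infdist_le[OF zero_notin_cone, of ?v] by simp
  have d: "\<bar>?i v - ?i ?v\<bar> \<le> norm w" using infdist_triangle_abs[of v "- cover" ?v] by (simp add: dist_norm)
  have "\<bar>norm ?v - norm v\<bar> \<le> norm w" using norm_triangle_ineq3[of ?v v] by simp
  then have "?i ?v * \<bar>norm ?v - norm v\<bar> \<le> norm ?v * norm w"
    using iv infdist_nonneg[of ?v "- cover"] by (intro mult_mono) auto
  moreover have "\<bar>?i v - ?i ?v\<bar> * norm ?v \<le> norm w * norm ?v" using d by (intro mult_right_mono) auto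
  moreover have "\<bar>?i v * norm ?v - ?i ?v * norm v\<bar> \<le> \<bar>?i v - ?i ?v\<bar> * norm ?v + ?i ?v * \<bar>norm ?v - norm v\<bar>"
  proof -
    have "?i v * norm ?v - ?i ?v * norm v = (?i v - ?i ?v) * norm ?v + ?i ?v * (norm ?v - norm v)"
      by (simp add: algebra_simps)
    then have "\<bar>?i v * norm ?v - ?i ?v * norm v\<bar> \<le> \<bar>(?i v - ?i ?v) * norm ?v\<bar> + \<bar>?i ?v * (norm ?v - norm v)\<bar>"
      by (simp only: abs_triangle_ineq)
    then show ?thesis by (simp add: abs_mult infdist_nonneg)
  qed
  ultimately have "\<bar>?i v * norm ?v - ?i ?v * norm v\<bar> \<le> norm w * norm ?v + norm ?v * norm w" by linarith
  moreover have "norm w * norm ?v + norm ?v * norm w = 2 * norm w * norm ?v" by simp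
  ultimately have k: "\<bar>?i v * norm ?v - ?i ?v * norm v\<bar> \<le> 2 * norm w * norm ?v" by (simp only:)
  have "?i v / norm v - ?i ?v / norm ?v = (?i v * norm ?v - ?i ?v * norm v) / (norm v * norm ?v)"
    using n by (simp add: field_simps)
  then have "\<bar>?i v / norm v - ?i ?v / norm ?v\<bar> = \<bar>?i v * norm ?v - ?i ?v * norm v\<bar> / (norm v * norm ?v)"
    by (simp add: abs_mult)
  also have "\<dots> \<le> 2 * norm w * norm ?v / (norm v * norm ?v)" using k by (rule divide_right_mono) simp
  also have "\<dots> = 2 * (norm w / norm v)" using n by simp
  also have "norm w / norm v \<le> norm w / del v"
    using del_le_norm[of v] del_pos[of v] v n by (intro divide_left_mono) auto
  finally have r: "\<bar>?i v / norm v - ?i ?v / norm ?v\<bar> \<le> 2 * (norm w / del v)" by simp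
  have "\<bar>min 1 a - min 1 b\<bar> \<le> \<bar>a - b\<bar>" for a b :: real by (simp add: min_def)
  then have "\<bar>bump V m v - bump V m ?v\<bar> \<le> \<bar>real m * (?i v / norm v) - real m * (?i ?v / norm ?v)\<bar>"
    unfolding bump_def by blast
  also have "\<dots> = real m * \<bar>?i v / norm v - ?i ?v / norm ?v\<bar>"
    by (simp only: right_diff_distrib[symmetric] abs_mult abs_of_nat)
  also have "\<dots> \<le> real m * (2 * (norm w / del v))" using r by (rule mult_left_mono) simp
  also have "\<dots> = 2 * real m * (norm w / del v)" by simp
  finally show "\<bar>bump V m v - bump V m (v - w)\<bar> \<le> 2 * real m * (norm w / del v)" .
qed

lemma bump_outside: "v \<notin> W \<Longrightarrow> line scl v \<notin> V \<Longrightarrow> bump V m v = 0"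
  unfolding bump_def by simp

lemma bump_inside:
  assumes v: "v \<notin> W" "line scl v \<in> V"
  shows "(\<lambda>m. bump V m v) \<longlonglongrightarrow> 1"
proof -
  have "closed (- cover)" using open_cone by (simp add: closed_Compl)
  then have "0 < infdist v (- cover)"
    using zero_notin_cone v infdist_pos_not_in_closed[of "- cover" v] by blast
  then have p: "0 < infdist v (- cover) / norm v" using compl_W_nonzero[OF v(1)] by simp
  obtain k :: nat where k: "1 < real k * (infdist v (- cover) / norm v)"
    using reals_Archimedean3[OF p] by blast
  have "\<forall>\<^sub>F m in sequentially. bump V m v = 1"
    using eventually_ge_at_top[of k]
  proof eventually_elim
    case (elim m)
    then have "real k * (infdist v (- cover) / norm v) \<le> real m * (infdist v (- cover) / norm v)"
      using p by (intro mult_right_mono) auto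
    then show ?case unfolding bump_def using k by simp
  qed
  then show ?thesis by (rule tendsto_eventually)
qed

end

text \<open>The images of finite unions of basic open sets, cut with \<open>- W\<close>. They are
  countably many, and passing to finite unions makes the exhausting sequence increasing.\<close>

lemma countable_exhausting_family:
  obtains B where "countable B" "\<And>V. V \<in> B \<Longrightarrow> openin L.T V"
    "\<And>U. openin L.T U \<Longrightarrow> \<exists>u. (\<forall>j :: nat. u j \<in> B) \<and> incseq u \<and> U = (\<Union>j. u j)"
proof -
  obtain BB :: "'v set set" where BB: "countable BB" "topological_basis BB" using ex_countable_basis by blast
  let ?C = "{F. finite F \<and> F \<subseteq> insert {} BB}"
  let ?l = "\<lambda>F. line scl ` (\<Union>F \<inter> - W)"
  have "countable ?C" using BB(1) by (intro countable_Collect_finite_subset) auto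
  then have c: "countable (?l ` ?C)" by (rule countable_image)
  have op: "open b" if "b \<in> insert {} BB" for b using that topological_basis_open[OF BB(2)] by auto
  have o: "openin L.T V" if V: "V \<in> ?l ` ?C" for V
  proof -
    obtain F where F: "F \<in> ?C" "V = ?l F" using V by (elim imageE)
    have "open (\<Union>F \<inter> - W)" using F(1) by (intro open_Int open_Union open_compl_W ballI op) auto
    then show ?thesis unfolding F(2) by (intro L.openin_image) auto
  qed
  have e: "\<exists>u. (\<forall>j :: nat. u j \<in> ?l ` ?C) \<and> incseq u \<and> U = (\<Union>j. u j)" if U: "openin L.T U" for U
  proof -
    let ?U = "{v \<in> - W. line scl v \<in> U}"
    have oU: "open ?U" "U \<subseteq> line scl ` (- W)" using U by (simp_all add: L.openin_T)
    \<comment> \<open>The empty set is added so that there is something to enumerate even if no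
      basic set lies in \<open>?U\<close>.\<close>
    define A where "A = insert {} {b \<in> BB. b \<subseteq> ?U}"
    have cA: "countable A" "A \<noteq> {}" unfolding A_def using BB(1) by auto
    define ee where "ee = from_nat_into A"
    have rg: "range ee = A" unfolding ee_def by (rule range_from_nat_into[OF cA(2,1)])
    define u where "u = (\<lambda>j. ?l (ee ` {..j}))"
    have "u j \<in> ?l ` ?C" for j
    proof -
      have "ee i \<in> insert {} BB" for i using rangeI[of ee i] unfolding rg A_def by auto
      then have "ee ` {..j} \<subseteq> insert {} BB" by (intro image_subsetI)
      then have "ee ` {..j} \<in> ?C" by simp
      then show ?thesis unfolding u_def by (rule imageI)
    qed
    moreover have "incseq u"
    proof (rule incseq_SucI)
      fix j
      have "ee ` {..j} \<subseteq> ee ` {..Suc j}" by (intro image_mono) auto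
      then show "u j \<subseteq> u (Suc j)" unfolding u_def by (intro image_mono Int_mono Union_mono) auto
    qed
    moreover have "U = (\<Union>j. u j)"
    proof (intro equalityI subsetI)
      fix y assume y: "y \<in> U"
      then obtain v where v0: "v \<in> - W" "y = line scl v" using oU(2) by blast
      with y have v: "v \<in> ?U" "y = line scl v" by simp_all
      obtain b where b: "b \<in> BB" "v \<in> b" "b \<subseteq> ?U" by (rule topological_basisE[OF BB(2) oU(1) v(1)])
      then have "b \<in> range ee" unfolding rg A_def by simp
      then obtain j where j: "b = ee j" by (elim rangeE)
      have "v \<in> \<Union>(ee ` {..j}) \<inter> - W" using v(1) b(2) j by auto
      then have "y \<in> u j" unfolding u_def v(2) by (rule imageI)
      then show "y \<in> (\<Union>j. u j)" by (rule UN_I[OF UNIV_I])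
    next
      fix y assume "y \<in> (\<Union>j. u j)"
      then obtain j i v where "v \<in> ee i" "y = line scl v" unfolding u_def by auto
      moreover have "ee i \<subseteq> ?U" using rangeI[of ee i] unfolding rg A_def by auto
      ultimately show "y \<in> U" by auto
    qed
    ultimately show ?thesis by (intro exI[of _ u] conjI allI)
  qed
  show ?thesis by (rule that[OF c o e])
qed

end

context lifted_walk
begin

lemma weakly_converges_L:
  assumes B: "\<And>V. V \<in> B \<Longrightarrow> openin L.T V"
    "\<And>U. openin L.T U \<Longrightarrow> \<exists>u. (\<forall>j :: nat. u j \<in> B) \<and> incseq u \<and> U = (\<Union>j. u j)"
    and N: "\<And>n. 0 < n \<Longrightarrow> prob_space (N n)" "\<And>n. 0 < n \<Longrightarrow> sets (N n) = sets L.Y"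
    and conv: "\<And>V m. V \<in> B \<Longrightarrow> (\<lambda>n. \<integral>y. bump V m (L.rep y) \<partial>N n) \<longlonglongrightarrow> (\<integral>y. bump V m (L.rep y) \<partial>\<nu>)"
  shows "weakly_converges L.T N \<nu>"
proof -
  have r: "L.rep x \<notin> W" "line scl (L.rep x) = x" if "x \<in> topspace L.T" for x
    using L.rep[OF that[unfolded L.topspace_T]] by simp_all
  interpret weak_test L.T N \<nu> B "\<lambda>V m y. bump V m (L.rep y)"
  proof (rule weak_test.intro)
    show "prob_space \<nu>" by (rule N.Y.prob_space_axioms)
  next
    fix V m assume V: "V \<in> B"
    note fl = bump_fibre_lipschitz[OF B(1)[OF V]]
    show "V \<in> sets (borel_of L.T)" by (rule openin_in_sets_borel_of[OF B(1)[OF V]])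
    show "(\<lambda>y. bump V m (L.rep y)) \<in> borel_measurable (borel_of L.T)"
      by (rule continuous_map_measurable[OF L.continuous_map_rep[OF fibre_lipschitzD(3,2)[OF fl]]])
    fix x assume x: "x \<in> topspace L.T"
    show "0 \<le> bump V m (L.rep x) \<and> bump V m (L.rep x) \<le> 1"
      using fibre_lipschitzD(4,5)[OF fl r(1)[OF x]] by simp
    show "bump V m (L.rep x) = 0" if "x \<notin> V"
      by (rule bump_outside[OF B(1)[OF V] r(1)[OF x]]) (unfold r(2)[OF x], rule that)
    show "(\<lambda>m. bump V m (L.rep x)) \<longlonglongrightarrow> 1" if "x \<in> V"
      by (rule bump_inside[OF B(1)[OF V] r(1)[OF x]]) (unfold r(2)[OF x], rule that)
  next
    show "sets \<nu> = sets (borel_of L.T)" using sets_\<nu> unfolding L.Y_def .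
    show "prob_space (N n)" if "0 < n" for n by (rule N(1)[OF that])
    show "sets (N n) = sets (borel_of L.T)" if "0 < n" for n using N(2)[OF that] unfolding L.Y_def .
    show "\<exists>u. (\<forall>j :: nat. u j \<in> B) \<and> incseq u \<and> U = (\<Union>j. u j)" if "openin L.T U" for U
      by (rule B(2)[OF that])
    show "(\<lambda>n. \<integral>y. bump V m (L.rep y) \<partial>N n) \<longlonglongrightarrow> (\<integral>y. bump V m (L.rep y) \<partial>\<nu>)" if "V \<in> B" for V m
      by (rule conv[OF that])
  qed
  show ?thesis by (rule weakly_converges)
qed

end

section \<open>Weak convergence of the averages\<close>

lemma average_properties:
  assumes n: "0 < n" and N: "\<And>i. 1 \<le> i \<Longrightarrow> prob_space (N i)" "\<And>i. 1 \<le> i \<Longrightarrow> sets (N i) = sets K"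
  shows "prob_space (average N n)" "sets (average N n) = sets K"
    and "\<And>(f :: 'a \<Rightarrow> real) C. f \<in> borel_measurable K \<Longrightarrow> (\<And>x. x \<in> space K \<Longrightarrow> \<bar>f x\<bar> \<le> C) \<Longrightarrow>
      (\<integral>x. f x \<partial>average N n) = (\<Sum>i=1..n. \<integral>x. f x \<partial>N i) / real n"
proof -
  let ?U = "uniform_count_measure {1..n}"
  have U: "prob_space ?U" by (rule prob_space_uniform_count_measure) (use n in auto)
  have ne: "space ?U \<noteq> {}" using n by (simp add: space_uniform_count_measure)
  have "N i \<in> space (subprob_algebra K)" if "i \<in> {1..n}" for i
    unfolding space_subprob_algebra
    using prob_space_imp_subprob_space[OF N(1)[of i]] N(2)[of i] that by simp
  then have "N \<in> count_space {1..n} \<rightarrow>\<^sub>M subprob_algebra K"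
    unfolding measurable_count_space_eq1 by blast
  then have m: "N \<in> ?U \<rightarrow>\<^sub>M subprob_algebra K"
    using measurable_cong_sets[OF sets_uniform_count_measure_count_space refl] by blast
  show "sets (average N n) = sets K"
    unfolding average_def by (rule sets_bind[OF sets_kernel[OF m] ne])
  have AE: "AE i in ?U. prob_space (N i)"
    by (rule AE_I2) (use N(1) in \<open>simp add: space_uniform_count_measure\<close>)
  show "prob_space (average N n)"
    unfolding average_def by (rule prob_space.prob_space_bind[OF U AE m])
  fix f :: "'a \<Rightarrow> real" and C assume f: "f \<in> borel_measurable K" "\<And>x. x \<in> space K \<Longrightarrow> \<bar>f x\<bar> \<le> C"
  have "(\<integral>x. f x \<partial>average N n) = (\<integral>i. (\<integral>x. f x \<partial>N i) \<partial>?U)"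
    unfolding average_def
  proof (rule integral_bind[OF f m])
    show "finite_measure ?U" by (rule prob_space.finite_measure[OF U])
    show "AE i in ?U. emeasure (N i) (space (N i)) \<le> ennreal 1"
      using AE by eventually_elim (simp add: prob_space.emeasure_space_1)
  qed
  also have "\<dots> = (\<Sum>i=1..n. \<integral>x. f x \<partial>N i) / real n"
    by (subst integral_uniform_count_measure) simp_all
  finally show "(\<integral>x. f x \<partial>average N n) = (\<Sum>i=1..n. \<integral>x. f x \<partial>N i) / real n" .
qed

context lifted_walk
begin

text \<open>Under \<open>K = S\<close> this is the law of the \<open>i\<close>-th position, a
  convolution power applied to a point; under \<open>K = return S \<omega>\<close> it is the point
  mass at that position of one path.\<close>

definition up :: "(nat \<Rightarrow> 'v \<Rightarrow>\<^sub>L 'v) measure \<Rightarrow> 'v \<Rightarrow> nat \<Rightarrow> 'v set measure" where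
  "up K v i = distr K L.Y (\<lambda>\<omega>. line scl (blinfun_apply (wk \<omega> i) v))"

definition down :: "(nat \<Rightarrow> 'v \<Rightarrow>\<^sub>L 'v) measure \<Rightarrow> 'v \<Rightarrow> nat \<Rightarrow> 'v set set measure" where
  "down K v i = distr K Q.Y (\<lambda>\<omega>. qline scl W (blinfun_apply (wk \<omega> i) v))"

lemma continuous_map_proj_map: "continuous_map L.T Q.T (proj_map W)"
  unfolding continuous_map_def
proof (intro conjI allI impI)
  show "proj_map W \<in> topspace L.T \<rightarrow> topspace Q.T"
    by (auto simp: L.topspace_T Q.topspace_T proj_map_line)
  fix U assume "openin Q.T U"
  then have "open {v\<in>- W. qline scl W v \<in> U}" by (simp add: Q.openin_T)
  then have "openin L.T {y\<in>line scl ` (- W). proj_map W y \<in> U}"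
    unfolding L.openin_T by (simp add: proj_map_line cong: conj_cong)
  then show "openin L.T {y \<in> topspace L.T. proj_map W y \<in> U}" by (simp only: L.topspace_T)
qed

context
  fixes K :: "(nat \<Rightarrow> 'v \<Rightarrow>\<^sub>L 'v) measure" and v :: 'v
  assumes K: "prob_space K" and sets_K: "sets K = sets S" and v: "v \<notin> W"
begin

lemma up_measurable: "(\<lambda>\<omega>. line scl (blinfun_apply (wk \<omega> i) v)) \<in> K \<rightarrow>\<^sub>M L.Y"
  and down_measurable: "(\<lambda>\<omega>. qline scl W (blinfun_apply (wk \<omega> i) v)) \<in> K \<rightarrow>\<^sub>M Q.Y"
proof -
  have "(\<lambda>\<omega>. blinfun_apply (wk \<omega> i) v) \<in> S \<rightarrow>\<^sub>M restrict_space borel (- W)"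
    using wk_apply_notin[OF _ v] by (intro measurable_restrict_space2) auto
  then have m: "(\<lambda>\<omega>. blinfun_apply (wk \<omega> i) v) \<in> K \<rightarrow>\<^sub>M restrict_space borel (- W)"
    using measurable_cong_sets[OF sets_K refl] by blast
  show "(\<lambda>\<omega>. line scl (blinfun_apply (wk \<omega> i) v)) \<in> K \<rightarrow>\<^sub>M L.Y"
    by (rule measurable_compose[OF m L.q_measurable])
  show "(\<lambda>\<omega>. qline scl W (blinfun_apply (wk \<omega> i) v)) \<in> K \<rightarrow>\<^sub>M Q.Y"
    by (rule measurable_compose[OF m Q.q_measurable])
qed

lemma up_prob: "prob_space (up K v i)" "sets (up K v i) = sets L.Y"
  unfolding up_def by (rule prob_space.prob_space_distr[OF K up_measurable]) simp

lemma down_prob: "prob_space (down K v i)" "sets (down K v i) = sets Q.Y"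
  unfolding down_def by (rule prob_space.prob_space_distr[OF K down_measurable]) simp

lemma space_K: "space K = space S"
  by (rule sets_eq_imp_space_eq[OF sets_K])

lemma integral_average_up:
  assumes "0 < n" "f \<in> borel_measurable L.Y" "\<And>x. x \<in> space L.Y \<Longrightarrow> \<bar>f x\<bar> \<le> (C :: real)"
  shows "(\<integral>x. f x \<partial>average (up K v) n) =
    (\<Sum>i=1..n. \<integral>\<omega>. f (line scl (blinfun_apply (wk \<omega> i) v)) \<partial>K) / real n"
proof -
  have "(\<integral>x. f x \<partial>average (up K v) n) = (\<Sum>i=1..n. \<integral>x. f x \<partial>up K v i) / real n"
    by (rule average_properties(3)[OF assms(1) up_prob assms(2,3)])
  then show ?thesis unfolding up_def by (simp only: integral_distr[OF up_measurable assms(2)])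
qed

lemma integral_average_down:
  assumes "0 < n" "f \<in> borel_measurable Q.Y" "\<And>x. x \<in> space Q.Y \<Longrightarrow> \<bar>f x\<bar> \<le> (C :: real)"
  shows "(\<integral>x. f x \<partial>average (down K v) n) =
    (\<Sum>i=1..n. \<integral>\<omega>. f (qline scl W (blinfun_apply (wk \<omega> i) v)) \<partial>K) / real n"
proof -
  have "(\<integral>x. f x \<partial>average (down K v) n) = (\<Sum>i=1..n. \<integral>x. f x \<partial>down K v i) / real n"
    by (rule average_properties(3)[OF assms(1) down_prob assms(2,3)])
  then show ?thesis unfolding down_def by (simp only: integral_distr[OF down_measurable assms(2)])
qed

text \<open>Weak convergence passes to images under the continuous map \<open>proj_map W\<close>,
  which carries \<open>\<nu>\<close> to \<open>\<eta>\<close> and the walk upstairs to the walk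
  downstairs.\<close>

lemma weakly_converges_down:
  assumes "weakly_converges L.T (average (up K v)) \<nu>"
  shows "weakly_converges Q.T (average (down K v)) \<eta>"
  unfolding weakly_converges_def
proof (intro allI impI)
  fix f assume f: "continuous_map Q.T euclideanreal f" and b: "bounded (f ` topspace Q.T)"
  let ?h = "\<lambda>x. f (proj_map W x)"
  have h: "continuous_map L.T euclideanreal ?h"
    using continuous_map_compose[OF continuous_map_proj_map f] by (simp add: comp_def)
  have sub: "?h ` topspace L.T \<subseteq> f ` topspace Q.T"
    using continuous_map_proj_map unfolding continuous_map_def by blast
  have bh: "bounded (?h ` topspace L.T)" by (rule bounded_subset[OF b sub])
  obtain C where C: "\<And>x. x \<in> topspace Q.T \<Longrightarrow> \<bar>f x\<bar> \<le> C"
    using b unfolding bounded_iff by auto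
  have C': "\<bar>?h x\<bar> \<le> C" if x: "x \<in> topspace L.T" for x
  proof (rule C)
    show "proj_map W x \<in> topspace Q.T" using continuous_map_proj_map x unfolding continuous_map_def by blast
  qed
  have fm: "f \<in> borel_measurable Q.Y" unfolding Q.Y_def by (rule continuous_map_measurable[OF f])
  have hm: "?h \<in> borel_measurable L.Y" unfolding L.Y_def by (rule continuous_map_measurable[OF h])
  have "(\<lambda>n. \<integral>x. ?h x \<partial>average (up K v) n) \<longlonglongrightarrow> (\<integral>x. ?h x \<partial>\<nu>)"
    using assms h bh unfolding weakly_converges_def by blast
  moreover have "(\<integral>x. ?h x \<partial>\<nu>) = (\<integral>x. f x \<partial>\<eta>)"
    using integral_distr[OF proj_map_measurable fm] by (simp add: distr_\<nu>)
  moreover have "\<forall>\<^sub>F n in sequentially. (\<integral>x. ?h x \<partial>average (up K v) n) = (\<integral>x. f x \<partial>average (down K v) n)"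
    using eventually_gt_at_top[of 0]
  proof eventually_elim
    case (elim n)
    have 1: "(\<integral>x. ?h x \<partial>average (up K v) n) =
        (\<Sum>i=1..n. \<integral>\<omega>. ?h (line scl (blinfun_apply (wk \<omega> i) v)) \<partial>K) / real n"
      by (rule integral_average_up[OF elim hm, of C])
         (use C' sets_eq_imp_space_eq[OF refl] in \<open>simp add: L.space_Y L.topspace_T\<close>)
    have 2: "(\<integral>x. f x \<partial>average (down K v) n) =
        (\<Sum>i=1..n. \<integral>\<omega>. f (qline scl W (blinfun_apply (wk \<omega> i) v)) \<partial>K) / real n"
      by (rule integral_average_down[OF elim fm, of C]) (use C in \<open>simp add: Q.space_Y Q.topspace_T\<close>)
    show ?case unfolding 1 2 proj_map_line ..
  qed
  ultimately show "(\<lambda>n. \<integral>x. f x \<partial>average (down K v) n) \<longlonglongrightarrow> (\<integral>x. f x \<partial>\<eta>)"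
    using Lim_transform_eventually by fastforce
qed

lemma base_averages:
  assumes w: "weakly_converges Q.T (average (down K v)) \<eta>"
    and F: "continuous_on (- W) F" "Q.invariant F" "\<And>v. v \<notin> W \<Longrightarrow> 0 \<le> F v \<and> F v \<le> (1 :: real)"
  shows "(\<lambda>n. (\<Sum>i=1..n. \<integral>\<omega>. F (blinfun_apply (wk \<omega> i) v) \<partial>K) / real n) \<longlonglongrightarrow> (\<integral>y. F (Q.rep y) \<partial>\<eta>)"
proof -
  let ?f = "\<lambda>y. F (Q.rep y)"
  have f: "continuous_map Q.T euclideanreal ?f" by (rule Q.continuous_map_rep[OF F(1,2)])
  have fb: "\<bar>?f y\<bar> \<le> 1" if y: "y \<in> qline scl W ` (- W)" for y
    using F(3)[of "Q.rep y"] Q.rep(1)[OF y] by simp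
  have b: "bounded (?f ` topspace Q.T)"
    unfolding bounded_iff Q.topspace_T using fb by (intro exI[of _ 1]) auto
  have fm: "?f \<in> borel_measurable Q.Y" unfolding Q.Y_def by (rule continuous_map_measurable[OF f])
  have "(\<lambda>n. \<integral>x. ?f x \<partial>average (down K v) n) \<longlonglongrightarrow> (\<integral>x. ?f x \<partial>\<eta>)"
    using w f b unfolding weakly_converges_def by blast
  moreover have "\<forall>\<^sub>F n in sequentially. (\<integral>x. ?f x \<partial>average (down K v) n) =
      (\<Sum>i=1..n. \<integral>\<omega>. F (blinfun_apply (wk \<omega> i) v) \<partial>K) / real n"
    using eventually_gt_at_top[of 0]
  proof eventually_elim
    case (elim n)
    have 1: "(\<integral>x. ?f x \<partial>average (down K v) n) =
        (\<Sum>i=1..n. \<integral>\<omega>. ?f (qline scl W (blinfun_apply (wk \<omega> i) v)) \<partial>K) / real n"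
      by (rule integral_average_down[OF elim fm, of 1]) (use fb in \<open>simp add: Q.space_Y\<close>)
    have 2: "(\<integral>\<omega>. ?f (qline scl W (blinfun_apply (wk \<omega> i) v)) \<partial>K) = (\<integral>\<omega>. F (blinfun_apply (wk \<omega> i) v) \<partial>K)" for i
    proof (rule Bochner_Integration.integral_cong[OF refl])
      fix \<omega> assume "\<omega> \<in> space K"
      then have "blinfun_apply (wk \<omega> i) v \<in> - W" using wk_apply_notin[OF _ v] by (simp add: space_K)
      then show "?f (qline scl W (blinfun_apply (wk \<omega> i) v)) = F (blinfun_apply (wk \<omega> i) v)"
        by (rule Q.invariant_rep[OF F(2)])
    qed
    show ?case unfolding 1 2 ..
  qed
  ultimately show ?thesis by (rule Lim_transform_eventually)
qed

lemma weakly_converges_up: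
  assumes B: "\<And>V. V \<in> B \<Longrightarrow> openin L.T V"
    "\<And>U. openin L.T U \<Longrightarrow> \<exists>u. (\<forall>j :: nat. u j \<in> B) \<and> incseq u \<and> U = (\<Union>j. u j)"
    and conv: "\<And>V m. V \<in> B \<Longrightarrow> (\<lambda>n. (\<Sum>i=1..n. \<integral>\<omega>. bump V m (blinfun_apply (wk \<omega> i) v) \<partial>K) / real n)
      \<longlonglongrightarrow> (\<integral>y. bump V m (L.rep y) \<partial>\<nu>)"
  shows "weakly_converges L.T (average (up K v)) \<nu>"
proof (rule weakly_converges_L[OF B])
  fix V m assume V: "V \<in> B"
  note fl = bump_fibre_lipschitz[OF B(1)[OF V], of m]
  let ?f = "\<lambda>y. bump V m (L.rep y)"
  have fm: "?f \<in> borel_measurable L.Y"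
    unfolding L.Y_def by (rule continuous_map_measurable[OF L.continuous_map_rep[OF fibre_lipschitzD(3,2)[OF fl]]])
  have fb: "\<bar>?f y\<bar> \<le> 1" if y: "y \<in> space L.Y" for y
    using fibre_lipschitzD(4,5)[OF fl, of "L.rep y"] L.rep(1)[OF y[unfolded L.space_Y]] by simp
  have "\<forall>\<^sub>F n in sequentially. (\<Sum>i=1..n. \<integral>\<omega>. bump V m (blinfun_apply (wk \<omega> i) v) \<partial>K) / real n =
      (\<integral>x. ?f x \<partial>average (up K v) n)"
    using eventually_gt_at_top[of 0]
  proof eventually_elim
    case (elim n)
    have 1: "(\<integral>x. ?f x \<partial>average (up K v) n) =
        (\<Sum>i=1..n. \<integral>\<omega>. ?f (line scl (blinfun_apply (wk \<omega> i) v)) \<partial>K) / real n"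
      by (rule integral_average_up[OF elim fm fb])
    have 2: "(\<integral>\<omega>. ?f (line scl (blinfun_apply (wk \<omega> i) v)) \<partial>K) = (\<integral>\<omega>. bump V m (blinfun_apply (wk \<omega> i) v) \<partial>K)" for i
    proof (rule Bochner_Integration.integral_cong[OF refl])
      fix \<omega> assume "\<omega> \<in> space K"
      then have "blinfun_apply (wk \<omega> i) v \<in> - W" using wk_apply_notin[OF _ v] by (simp add: space_K)
      then show "?f (line scl (blinfun_apply (wk \<omega> i) v)) = bump V m (blinfun_apply (wk \<omega> i) v)"
        by (rule L.invariant_rep[OF fibre_lipschitzD(2)[OF fl]])
    qed
    show ?case unfolding 1 2 ..
  qed
  from Lim_transform_eventually[OF conv[OF V] this]
  show "(\<lambda>n. \<integral>y. bump V m (L.rep y) \<partial>average (up K v) n) \<longlonglongrightarrow> (\<integral>y. bump V m (L.rep y) \<partial>\<nu>)" .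
next
  fix n :: nat assume n: "0 < n"
  show "prob_space (average (up K v) n)" by (rule average_properties(1)[OF n up_prob])
  show "sets (average (up K v) n) = sets L.Y" by (rule average_properties(2)[OF n up_prob])
qed

end

theorem weakly_converges_mean_iff:
  assumes v: "v \<notin> W"
  shows "weakly_converges L.T (average (up S v)) \<nu> \<longleftrightarrow> weakly_converges Q.T (average (down S v)) \<eta>"
proof
  assume "weakly_converges L.T (average (up S v)) \<nu>"
  then show "weakly_converges Q.T (average (down S v)) \<eta>"
    by (rule weakly_converges_down[OF P.prob_space_axioms refl v])
next
  assume w: "weakly_converges Q.T (average (down S v)) \<eta>"
  obtain B where B: "countable B" "\<And>V. V \<in> B \<Longrightarrow> openin L.T V"
    "\<And>U. openin L.T U \<Longrightarrow> \<exists>u. (\<forall>j :: nat. u j \<in> B) \<and> incseq u \<and> U = (\<Union>j. u j)"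
    by (rule countable_exhausting_family) blast
  show "weakly_converges L.T (average (up S v)) \<nu>"
  proof (rule weakly_converges_up[OF P.prob_space_axioms refl v B(2,3)])
    fix V m assume V: "V \<in> B"
    show "(\<lambda>n. (\<Sum>i=1..n. \<integral>\<omega>. bump V m (blinfun_apply (wk \<omega> i) v) \<partial>S) / real n) \<longlonglongrightarrow> (\<integral>y. bump V m (L.rep y) \<partial>\<nu>)"
      by (rule lift_expectation[OF v base_averages[OF P.prob_space_axioms refl v w] bump_fibre_lipschitz[OF B(2)[OF V]]])
  qed
qed

text \<open>The null set comes from a countable family of bumps and does not depend on whether the
  averages converge, so the equivalence holds path by path.\<close>

theorem weakly_converges_AE_iff:
  assumes v: "v \<notin> W"
  shows "AE \<omega> in S. weakly_converges L.T (average (up (return S \<omega>) v)) \<nu> \<longleftrightarrow>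
    weakly_converges Q.T (average (down (return S \<omega>) v)) \<eta>"
proof -
  obtain B where B: "countable B" "\<And>V. V \<in> B \<Longrightarrow> openin L.T V"
    "\<And>U. openin L.T U \<Longrightarrow> \<exists>u. (\<forall>j :: nat. u j \<in> B) \<and> incseq u \<and> U = (\<Union>j. u j)"
    by (rule countable_exhausting_family) blast
  let ?\<F> = "(\<lambda>(V, m). bump V m) ` (B \<times> (UNIV :: nat set))"
  have c: "countable ?\<F>" using B(1) by auto
  have fl: "\<exists>C. fibre_lipschitz C F" if F: "F \<in> ?\<F>" for F
  proof -
    obtain V m where "V \<in> B" "F = bump V m" using F by auto
    then show ?thesis using bump_fibre_lipschitz[OF B(2), of V m] by blast
  qed
  have las: "AE \<omega> in S. (\<forall>F :: 'v \<Rightarrow> real. continuous_on (- W) F \<longrightarrow> Q.invariant F \<longrightarrow> (\<forall>v. v \<notin> W \<longrightarrow> 0 \<le> F v \<and> F v \<le> 1) \<longrightarrow>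
      (\<lambda>n. (\<Sum>i=1..n. F (blinfun_apply (wk \<omega> i) v)) / real n) \<longlonglongrightarrow> (\<integral>y. F (Q.rep y) \<partial>\<eta>)) \<longrightarrow>
    (\<forall>F\<in>?\<F>. (\<lambda>n. (\<Sum>i=1..n. F (blinfun_apply (wk \<omega> i) v)) / real n) \<longlonglongrightarrow> (\<integral>y. F (L.rep y) \<partial>\<nu>))"
    by (rule lift_almost_surely[OF v c]) (rule fl)
  show ?thesis
    using las AE_space
  proof eventually_elim
    case (elim \<omega>)
    note ps = prob_space_return[OF elim(2)]
    have ret: "(\<integral>x. F (blinfun_apply (wk x i) v) \<partial>return S \<omega>) = F (blinfun_apply (wk \<omega> i) v)"
      if "continuous_on (- W) (F :: 'v \<Rightarrow> real)" for F i
      by (rule integral_return[OF elim(2) continuous_wk_measurable[OF that v]])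
    show ?case
    proof
      assume "weakly_converges L.T (average (up (return S \<omega>) v)) \<nu>"
      then show "weakly_converges Q.T (average (down (return S \<omega>) v)) \<eta>"
        by (rule weakly_converges_down[OF ps sets_return v])
    next
      assume w: "weakly_converges Q.T (average (down (return S \<omega>) v)) \<eta>"
      have base: "(\<lambda>n. (\<Sum>i=1..n. F (blinfun_apply (wk \<omega> i) v)) / real n) \<longlonglongrightarrow> (\<integral>y. F (Q.rep y) \<partial>\<eta>)"
        if F: "continuous_on (- W) F" "Q.invariant F" "\<forall>v. v \<notin> W \<longrightarrow> 0 \<le> F v \<and> F v \<le> 1" for F
        using base_averages[OF ps sets_return v w F(1,2)] F(3) unfolding ret[OF F(1)] by blast
      have "\<forall>F\<in>?\<F>. (\<lambda>n. (\<Sum>i=1..n. F (blinfun_apply (wk \<omega> i) v)) / real n) \<longlonglongrightarrow> (\<integral>y. F (L.rep y) \<partial>\<nu>)"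
        using elim(1) base by blast
      then have up: "(\<lambda>n. (\<Sum>i=1..n. bump V m (blinfun_apply (wk \<omega> i) v)) / real n) \<longlonglongrightarrow> (\<integral>y. bump V m (L.rep y) \<partial>\<nu>)"
        if "V \<in> B" for V m using that by force
      show "weakly_converges L.T (average (up (return S \<omega>) v)) \<nu>"
      proof (rule weakly_converges_up[OF ps sets_return v B(2,3)])
        fix V m assume V: "V \<in> B"
        show "(\<lambda>n. (\<Sum>i=1..n. \<integral>x. bump V m (blinfun_apply (wk x i) v) \<partial>return S \<omega>) / real n) \<longlonglongrightarrow> (\<integral>y. bump V m (L.rep y) \<partial>\<nu>)"
          unfolding ret[OF fibre_lipschitzD(3)[OF bump_fibre_lipschitz[OF B(2)[OF V]]]] by (rule up[OF V])
      qed
    qed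
  qed
qed

end

section \<open>Reduction to the stabilizer\<close>

text \<open>An injective linear map preserves dimension. So invariance of \<open>W\<close> as an
  inclusion already puts an element of GL(V) into the stabilizer.\<close>

lemma image_subspace_eq:
  fixes f :: "'v::euclidean_space \<Rightarrow> 'v"
  assumes f: "bounded_linear f" "inj f" and W: "subspace W" "f ` W \<subseteq> W"
  shows "f ` W = W"
proof (rule subspace_dim_equal)
  have l: "linear f" by (rule bounded_linear.linear[OF f(1)])
  show "subspace (f ` W)" by (rule linear_subspace_image[OF l W(1)])
  have "dim (f ` W) = dim W" by (rule dim_image_eq[OF l]) (rule inj_on_subset[OF f(2)], simp)
  then show "dim W \<le> dim (f ` W)" by simp
qed (rule W)+

text \<open>Every point outside the support has a basic neighbourhood of measure 0, and there are
  only countably many basic sets.\<close>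

lemma AE_msupport:
  fixes \<mu> :: "'a::second_countable_topology measure"
  assumes s: "sets \<mu> = sets (restrict_space borel A)"
  shows "AE g in \<mu>. g \<in> msupport \<mu>"
proof -
  obtain B :: "'a set set" where B: "countable B" "topological_basis B" using ex_countable_basis by blast
  have sp: "space \<mu> = A" using sets_eq_imp_space_eq[OF s] by (simp add: space_restrict_space)
  have op: "U \<inter> space \<mu> \<in> sets \<mu>" if "open U" for U
    unfolding s sets_restrict_space sp using that by (intro image_eqI[of _ _ U]) auto
  have "AE g in \<mu>. emeasure \<mu> (U \<inter> space \<mu>) = 0 \<longrightarrow> g \<notin> U" if U: "U \<in> B" for U
  proof (cases "emeasure \<mu> (U \<inter> space \<mu>) = 0")
    case True
    show ?thesis by (rule AE_I[of _ _ "U \<inter> space \<mu>"]) (use True op topological_basis_open[OF B(2) U] in auto)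
  qed simp
  then have "AE g in \<mu>. \<forall>U\<in>B. emeasure \<mu> (U \<inter> space \<mu>) = 0 \<longrightarrow> g \<notin> U"
    by (subst AE_ball_countable[OF B(1)]) blast
  with AE_space show ?thesis
  proof eventually_elim
    case (elim g)
    have "0 < emeasure \<mu> (U \<inter> space \<mu>)" if U: "open U" "g \<in> U" for U
    proof -
      obtain V where V: "V \<in> B" "g \<in> V" "V \<subseteq> U" by (rule topological_basisE[OF B(2) U])
      have "emeasure \<mu> (V \<inter> space \<mu>) \<le> emeasure \<mu> (U \<inter> space \<mu>)"
        using V(3) by (intro emeasure_mono op[OF U(1)]) auto
      moreover have "emeasure \<mu> (V \<inter> space \<mu>) \<noteq> 0" using elim(2) V(1,2) by blast
      ultimately show ?thesis by (metis not_gr_zero le_zero_eq)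
    qed
    then show ?case using elim(1) unfolding msupport_def by simp
  qed
qed

lemma (in prob_space) indep_vars_Suc:
  assumes "indep_vars M' X {1..}"
  shows "indep_vars (\<lambda>i. M' (Suc i)) (\<lambda>i. X (Suc i)) UNIV"
proof -
  have *: "indep_sets (\<lambda>i. F (Suc i)) UNIV" if F: "indep_sets F {1..}" for F
  proof (rule indep_setsI)
    show "F (Suc i) \<subseteq> events" for i using F unfolding indep_sets_def by simp
    fix A and J :: "nat set" assume J: "J \<noteq> {}" "finite J" "\<forall>j\<in>J. A j \<in> F (Suc j)"
    have "prob (\<Inter>j\<in>Suc ` J. A (j - 1)) = (\<Prod>j\<in>Suc ` J. prob (A (j - 1)))"
      by (rule indep_setsD[OF F]) (use J in auto)
    then show "prob (\<Inter>j\<in>J. A j) = (\<Prod>j\<in>J. prob (A j))" by (simp add: prod.reindex)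
  qed
  show ?thesis using assms *[of "\<lambda>i. sigma_sets (space M) {X i -` A \<inter> space M | A. A \<in> sets (M' i)}"]
    unfolding indep_vars_def by simp
qed

lemma distr_pair_return:
  assumes x: "x \<in> space Y" and a: "(\<lambda>(g, y). a g y) \<in> K \<Otimes>\<^sub>M Y \<rightarrow>\<^sub>M Y"
  shows "distr (K \<Otimes>\<^sub>M return Y x) (return Y x) (\<lambda>(g, y). a g y) = distr K Y (\<lambda>g. a g x)"
proof (rule measure_eqI)
  show "sets (distr (K \<Otimes>\<^sub>M return Y x) (return Y x) (\<lambda>(g, y). a g y)) = sets (distr K Y (\<lambda>g. a g x))" by simp
  interpret R: prob_space "return Y x" by (rule prob_space_return[OF x])
  have sK: "sets (K \<Otimes>\<^sub>M return Y x) = sets (K \<Otimes>\<^sub>M Y)" by (rule sets_pair_measure_cong) simp_all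
  have aR: "(\<lambda>(g, y). a g y) \<in> K \<Otimes>\<^sub>M return Y x \<rightarrow>\<^sub>M Y"
    using a measurable_cong_sets[OF sK refl] by blast
  have aR': "(\<lambda>(g, y). a g y) \<in> K \<Otimes>\<^sub>M return Y x \<rightarrow>\<^sub>M return Y x"
    using aR by simp
  have am: "(\<lambda>g. a g x) \<in> K \<rightarrow>\<^sub>M Y"
    using measurable_compose[OF measurable_Pair[OF measurable_ident measurable_const[OF x]] a] by simp
  fix A assume "A \<in> sets (distr (K \<Otimes>\<^sub>M return Y x) (return Y x) (\<lambda>(g, y). a g y))"
  then have A: "A \<in> sets Y" by simp
  have im: "indicator A \<in> Y \<rightarrow>\<^sub>M (borel :: ennreal measure)" using A by simp
  have "emeasure (distr (K \<Otimes>\<^sub>M return Y x) (return Y x) (\<lambda>(g, y). a g y)) A =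
      (\<integral>\<^sup>+z. indicator A z \<partial>distr (K \<Otimes>\<^sub>M return Y x) (return Y x) (\<lambda>(g, y). a g y))"
    using A by simp
  also have "\<dots> = (\<integral>\<^sup>+z. indicator A (case z of (g, y) \<Rightarrow> a g y) \<partial>(K \<Otimes>\<^sub>M return Y x))"
    by (rule nn_integral_distr[OF aR']) (use A in simp)
  also have "\<dots> = (\<integral>\<^sup>+g. \<integral>\<^sup>+y. indicator A (a g y) \<partial>return Y x \<partial>K)"
    using R.nn_integral_fst[OF measurable_compose[OF aR im]] by simp
  also have "\<dots> = (\<integral>\<^sup>+g. indicator A (a g x) \<partial>K)"
  proof (rule nn_integral_cong, rule nn_integral_return[OF x])
    fix g assume g: "g \<in> space K"
    have "(\<lambda>y. a g y) \<in> Y \<rightarrow>\<^sub>M Y"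
      using measurable_compose[OF measurable_Pair[OF measurable_const[OF g] measurable_ident] a] by simp
    then show "(\<lambda>y. indicator A (a g y)) \<in> Y \<rightarrow>\<^sub>M (borel :: ennreal measure)" using im by (rule measurable_compose)
  qed
  also have "\<dots> = (\<integral>\<^sup>+z. indicator A z \<partial>distr K Y (\<lambda>g. a g x))" by (rule nn_integral_distr[OF am, symmetric]) (use A in simp)
  also have "\<dots> = emeasure (distr K Y (\<lambda>g. a g x)) A" using A by simp
  finally show "emeasure (distr (K \<Otimes>\<^sub>M return Y x) (return Y x) (\<lambda>(g, y). a g y)) A =
    emeasure (distr K Y (\<lambda>g. a g x)) A" .
qed

section \<open>The measure on the stabilizer\<close>

locale invariant_measure = subspace_setup scl W + mu: prob_space \<mu>
  for scl :: "'k::{real_normed_field,euclidean_space} \<Rightarrow> 'v::euclidean_space \<Rightarrow> 'v" and W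
    and \<mu> :: "('v \<Rightarrow>\<^sub>L 'v) measure" +
  assumes sets_\<mu>: "sets \<mu> = sets (GL_borel scl)"
    and finite_moment: "finite_first_moment \<mu>"
    and invariant_W: "invariant_subspace scl \<mu> W"
begin

abbreviation gm where "gm \<equiv> restrict_space \<mu> G"

lemma space_\<mu>: "space \<mu> = GL scl"
  using sets_eq_imp_space_eq[OF sets_\<mu>] by (simp add: GL_borel_def space_restrict_space)

lemma G_subset: "G \<subseteq> GL scl"
  by (auto simp: stabilizer_def)

lemma in_G_iff: "g \<in> G \<longleftrightarrow> g \<in> GL scl \<and> (\<forall>w\<in>W. blinfun_apply g w \<in> W)"
proof
  assume g: "g \<in> GL scl \<and> (\<forall>w\<in>W. blinfun_apply g w \<in> W)"
  have "inj (blinfun_apply g)" using g by (simp add: GL_def bij_is_inj)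
  then have "blinfun_apply g ` W = W"
    by (rule image_subspace_eq[OF blinfun.bounded_linear_right _ real_subspace_W]) (use g in auto)
  then show "g \<in> G" using g by (simp add: stabilizer_def)
qed (auto simp: stabilizer_def)

text \<open>Preserving \<open>W\<close> is a closed condition: it is the intersection of one closed
  condition for each vector of \<open>W\<close>.\<close>

lemma G_events: "G \<in> sets \<mu>"
proof -
  let ?C = "\<Inter>w\<in>W. (\<lambda>g :: 'v \<Rightarrow>\<^sub>L 'v. blinfun_apply g w) -` W"
  have "continuous_on UNIV (\<lambda>g :: 'v \<Rightarrow>\<^sub>L 'v. blinfun_apply g w)" for w
    by (intro continuous_intros)
  then have "closed ?C" by (intro closed_INT ballI closed_vimage[OF closed_W]) simp
  then have "?C \<in> sets borel" by (rule borel_closed)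
  moreover have "G = GL scl \<inter> ?C" by (auto simp: in_G_iff)
  ultimately show ?thesis unfolding sets_\<mu> GL_borel_def sets_restrict_space by blast
qed

lemma AE_in_G: "AE g in \<mu>. g \<in> G"
  using AE_msupport[OF sets_\<mu>[unfolded GL_borel_def]] AE_space
proof eventually_elim
  case (elim g)
  then have "blinfun_apply g ` W \<subseteq> W"
    using invariant_W Gamma.gen unfolding invariant_subspace_def by blast
  then show ?case using elim(2) by (auto simp: in_G_iff space_\<mu>)
qed

lemma G_int: "G \<inter> space \<mu> \<in> sets \<mu>"
  using G_events by simp

sublocale random_walk scl W "restrict_space \<mu> (stabilizer scl W)"
proof -
  have p: "prob_space gm"
  proof (rule prob_space_restrict_space[OF G_events])
    show "emeasure \<mu> G = 1"
      using mu.AE_in_set_eq_1[OF G_events] AE_in_G by (simp add: mu.emeasure_eq_measure)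
  qed
  have "product_prob_space (\<lambda>i :: nat. gm)" by (rule product_prob_spaceI) (rule p)
  then have "sequence_space gm" unfolding sequence_space_def .
  then show "random_walk scl W gm"
  proof (intro random_walk.intro random_walk_axioms.intro)
    show "subspace_setup scl W" by unfold_locales
    have "sets gm = sets (restrict_space (restrict_space borel (GL scl)) G)"
      by (rule sets_restrict_space_cong) (simp add: sets_\<mu> GL_borel_def)
    also have "\<dots> = sets (restrict_space borel (GL scl \<inter> G))" by (rule sets_restrict_restrict_space)
    also have "GL scl \<inter> G = G" using G_subset by blast
    finally show "sets gm = sets (restrict_space borel G)" .
    show "integrable gm (\<lambda>g. ln (size g))"
      unfolding integrable_restrict_space[OF G_int] size_def
      by (rule integrable_real_mult_indicator[OF G_events finite_moment[unfolded finite_first_moment_def], simplified mult.commute[of _ "indicator _ _"], folded real_scaleR_def])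
  qed
qed

lemma measurable_gm: "f \<in> N \<rightarrow>\<^sub>M gm \<Longrightarrow> f \<in> N \<rightarrow>\<^sub>M \<mu>"
  by (simp add: measurable_restrict_space2_iff)

lemma id_gm_measurable: "(\<lambda>g. g) \<in> gm \<rightarrow>\<^sub>M \<mu>"
  by (rule measurable_gm) (rule measurable_ident_sets[OF refl])

lemma distr_gm: "distr gm \<mu> (\<lambda>g. g) = \<mu>"
proof (rule measure_eqI)
  fix A assume "A \<in> sets (distr gm \<mu> (\<lambda>g. g))"
  then have A: "A \<in> sets \<mu>" by simp
  have e: "(\<lambda>g. g) -` A \<inter> space gm = A \<inter> G"
    using sets.sets_into_space[OF A] by (auto simp: space_restrict_space)
  have "emeasure (distr gm \<mu> (\<lambda>g. g)) A = emeasure gm (A \<inter> G)"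
    by (subst emeasure_distr[OF id_gm_measurable A]) (simp only: e)
  also have "\<dots> = emeasure \<mu> (A \<inter> G)" by (rule emeasure_restrict_space[OF G_int]) simp
  also have "\<dots> = emeasure \<mu> A"
    by (rule emeasure_eq_AE, use AE_in_G in eventually_elim) (use A G_events in auto)
  finally show "emeasure (distr gm \<mu> (\<lambda>g. g)) A = emeasure \<mu> A" .
qed simp

text \<open>A measurable map to the stabilizer that moves \<open>g\<close> only on a null set. It
  replaces a walk in GL(V) by one all of whose steps preserve \<open>W\<close>.\<close>

definition retract :: "('v \<Rightarrow>\<^sub>L 'v) \<Rightarrow> 'v \<Rightarrow>\<^sub>L 'v" where
  "retract g = (if g \<in> G then g else id_blinfun)"

lemma retract_in_G: "retract g \<in> G"
  using id_in_G by (simp add: retract_def)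

lemma retract_measurable: "retract \<in> \<mu> \<rightarrow>\<^sub>M gm"
proof (rule measurable_restrict_space2)
  show "retract \<in> space \<mu> \<rightarrow> G" using retract_in_G by blast
  have "{g \<in> space \<mu>. g \<in> G} = G" using G_subset by (auto simp: space_\<mu>)
  moreover have "id_blinfun \<in> space \<mu>" using id_in_G G_subset by (auto simp: space_\<mu>)
  ultimately show "retract \<in> \<mu> \<rightarrow>\<^sub>M \<mu>"
    unfolding retract_def using G_events by (intro measurable_If) auto
qed

lemma distr_retract: "distr \<mu> gm retract = gm"
proof -
  have "distr \<mu> gm retract = distr (distr gm \<mu> (\<lambda>g. g)) gm retract" by (simp only: distr_gm)
  also have "\<dots> = distr gm gm (retract \<circ> (\<lambda>g. g))" by (rule distr_distr[OF retract_measurable id_gm_measurable])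
  also have "\<dots> = distr gm gm (\<lambda>g. g)" by (rule distr_cong) (auto simp: space_gm retract_def)
  also have "\<dots> = gm" by (rule distr_id2) (rule refl)
  finally show ?thesis .
qed

definition coupling :: "(nat \<Rightarrow> 'o \<Rightarrow> 'v \<Rightarrow>\<^sub>L 'v) \<Rightarrow> 'o \<Rightarrow> nat \<Rightarrow> 'v \<Rightarrow>\<^sub>L 'v" where
  "coupling X \<omega> = (\<lambda>i. retract (X (Suc i) \<omega>))"

text \<open>The retracted steps are again independent, have law \<open>gm\<close>, and agree almost
  surely with the given ones. The index drops by one, since \<open>walk\<close> begins with
  \<open>X 1\<close> and \<open>wk\<close> with the letter 0.\<close>

lemma coupling:
  assumes "prob_space M" and X: "prob_space.indep_vars M (\<lambda>_. \<mu>) X {1..}"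
    and law: "\<And>i. 1 \<le> i \<Longrightarrow> distr M \<mu> (X i) = \<mu>"
  shows "coupling X \<in> M \<rightarrow>\<^sub>M S" and "distr M S (coupling X) = S"
    and "AE \<omega> in M. \<forall>n. walk (\<lambda>j. X j \<omega>) n = wk (coupling X \<omega>) n"
proof -
  interpret Mp: prob_space M by fact
  have X_meas: "X (Suc i) \<in> M \<rightarrow>\<^sub>M \<mu>" for i using X unfolding Mp.indep_vars_def by simp
  have m: "(\<lambda>\<omega>. coupling X \<omega> i) \<in> M \<rightarrow>\<^sub>M gm" for i
    unfolding coupling_def by (rule measurable_compose[OF X_meas retract_measurable])
  show "coupling X \<in> M \<rightarrow>\<^sub>M S"
    by (rule measurable_PiM_single') (use m in \<open>auto simp: space_PiM PiE_iff space_gm coupling_def retract_in_G\<close>)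
  have law': "distr M gm (\<lambda>\<omega>. coupling X \<omega> i) = gm" for i
  proof -
    have "distr M gm (\<lambda>\<omega>. coupling X \<omega> i) = distr (distr M \<mu> (X (Suc i))) gm retract"
      by (subst distr_distr[OF retract_measurable X_meas]) (simp add: coupling_def comp_def)
    then show ?thesis by (simp add: law distr_retract)
  qed
  have "Mp.indep_vars (\<lambda>_. gm) (\<lambda>i \<omega>. coupling X \<omega> i) UNIV"
    unfolding coupling_def
    by (rule Mp.indep_vars_compose2[OF Mp.indep_vars_Suc[OF X]]) (rule retract_measurable)
  then have "distr M S (\<lambda>\<omega>. \<lambda>i\<in>UNIV. coupling X \<omega> i) = (\<Pi>\<^sub>M i\<in>UNIV. distr M gm (\<lambda>\<omega>. coupling X \<omega> i))"
    by (subst (asm) Mp.indep_vars_iff_distr_eq_PiM) (use m in auto)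
  then show "distr M S (coupling X) = S" by (simp add: law' restrict_def)
  have "AE \<omega> in M. X (Suc i) \<omega> \<in> G" for i
  proof (rule AE_distrD[OF X_meas])
    have l: "distr M \<mu> (X (Suc i)) = \<mu>" by (rule law) simp
    show "AE g in distr M \<mu> (X (Suc i)). g \<in> G" unfolding l by (rule AE_in_G)
  qed
  then have "AE \<omega> in M. \<forall>i. X (Suc i) \<omega> \<in> G" by (simp add: AE_all_countable)
  then show "AE \<omega> in M. \<forall>n. walk (\<lambda>j. X j \<omega>) n = wk (coupling X \<omega>) n"
  proof eventually_elim
    case (elim \<omega>)
    show ?case
    proof
      fix n show "walk (\<lambda>j. X j \<omega>) n = wk (coupling X \<omega>) n"
        using elim by (induct n) (simp_all add: coupling_def retract_def)
    qed
  qed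
qed

text \<open>The definite description picks out the almost sure limit, which is unique because the
  space has measure 1. The limit is carried over from \<open>S\<close> by applying
  \<open>coupling\<close> to the coordinates of the product over \<open>{1..}\<close>.\<close>

lemma top_lyapunov_eq:
  assumes W: "W \<noteq> {0}" and l: "AE \<omega> in S. (\<lambda>n. ln (nW (wk \<omega> n)) / real n) \<longlonglongrightarrow> l"
  shows "top_lyapunov W \<mu> = ereal l"
proof -
  let ?P = "\<Pi>\<^sub>M i\<in>{1::nat..}. \<mu>"
  interpret P: product_prob_space "\<lambda>i. \<mu>" "{1::nat..}"
    by (rule product_prob_spaceI) (rule mu.prob_space_axioms)
  have law: "distr ?P \<mu> (\<lambda>\<omega>. \<omega> i) = \<mu>" if "1 \<le> i" for i by (rule P.PiM_component) (use that in simp)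
  have "distr ?P ?P (\<lambda>\<omega>. \<lambda>i\<in>{1..}. \<omega> i) = distr ?P ?P (\<lambda>\<omega>. \<omega>)"
    by (rule distr_cong) (auto simp: space_PiM PiE_iff extensional_def restrict_def fun_eq_iff)
  also have "\<dots> = ?P" by (rule distr_id2) (rule refl)
  also have "\<dots> = (\<Pi>\<^sub>M i\<in>{1..}. distr ?P \<mu> (\<lambda>\<omega>. \<omega> i))" by (intro PiM_cong refl law[symmetric]) simp
  finally have "P.P.indep_vars (\<lambda>_. \<mu>) (\<lambda>i \<omega>. \<omega> i) {1..}"
    by (subst P.P.indep_vars_iff_distr_eq_PiM') auto
  note i = this
  have c: "coupling (\<lambda>i \<omega>. \<omega> i) \<in> ?P \<rightarrow>\<^sub>M S" "distr ?P S (coupling (\<lambda>i \<omega>. \<omega> i)) = S"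
    "AE \<omega> in ?P. \<forall>n. walk (\<lambda>j. \<omega> j) n = wk (coupling (\<lambda>i \<omega>. \<omega> i) \<omega>) n"
    by (rule coupling[OF P.P.prob_space_axioms i], rule law, assumption)+
  have "AE \<omega> in ?P. (\<lambda>n. ln (nW (wk (coupling (\<lambda>i \<omega>. \<omega> i) \<omega>) n)) / real n) \<longlonglongrightarrow> l"
    by (rule AE_distrD[OF c(1)]) (simp only: c(2) l)
  with c(3) have lim: "AE \<omega> in ?P. (\<lambda>n. ereal (ln (norm_on W (walk \<omega> n)) / real n)) \<longlonglongrightarrow> ereal l"
    by eventually_elim (simp add: nW_def W)
  have "(THE l. AE \<omega> in ?P. (\<lambda>n. ereal (ln (norm_on W (walk \<omega> n)) / real n)) \<longlonglongrightarrow> l) = ereal l"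
  proof (rule the_equality)
    show "AE \<omega> in ?P. (\<lambda>n. ereal (ln (norm_on W (walk \<omega> n)) / real n)) \<longlonglongrightarrow> ereal l" by (rule lim)
    fix l' assume "AE \<omega> in ?P. (\<lambda>n. ereal (ln (norm_on W (walk \<omega> n)) / real n)) \<longlonglongrightarrow> l'"
    with lim have "AE \<omega> in ?P. l' = ereal l" by eventually_elim (rule LIMSEQ_unique)
    then show "l' = ereal l" by simp
  qed
  then show ?thesis unfolding top_lyapunov_def using W by simp
qed

text \<open>The coset selected by \<open>SOME\<close> is that of \<open>scl c v\<close> with
  \<open>c \<noteq> 0\<close>, and the norm of \<open>c\<close> cancels in the quotient.\<close>

lemma log_cocycle_eq:
  assumes g: "g \<in> G" and v: "v \<notin> W"
  shows "log_cocycle W g (qline scl W v) = lcoc g v"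
proof -
  define C where "C = (SOME C. C \<in> qline scl W v \<and> C \<noteq> W)"
  have "coset W 0 = (\<lambda>w. w) ` W" unfolding coset_def by (rule image_cong) simp_all
  then have c0: "coset W 0 = W" by simp
  have "coset W v \<noteq> coset W 0" using v by (simp only: coset_eq_iff diff_zero not_False_eq_True)
  then have "coset W v \<noteq> W" by (simp only: c0 not_False_eq_True)
  moreover have "coset W v \<in> qline scl W v" unfolding qline_def by (rule range_eqI[of _ _ 1]) simp
  ultimately have "\<exists>C. C \<in> qline scl W v \<and> C \<noteq> W" by (intro exI[of _ "coset W v"] conjI)
  from someI_ex[OF this] have "C \<in> qline scl W v \<and> C \<noteq> W" unfolding C_def .
  then obtain c where c: "C = coset W (scl c v)" "C \<noteq> W" unfolding qline_def by (elim conjE rangeE)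
  have "c \<noteq> 0"
  proof
    assume "c = 0"
    then have "C = coset W 0" by (simp only: c(1) scale_zero_left)
    then show False using c(2) c0 by (simp only: simp_thms)
  qed
  then have nc: "norm c \<noteq> 0" by simp
  have "log_cocycle W g (qline scl W v) = ln (coset_norm (blinfun_apply g ` C) / coset_norm C)"
    by (simp only: log_cocycle_def Let_def C_def)
  also have "\<dots> = ln ((norm c * del (blinfun_apply g v)) / (norm c * del v))"
    by (simp only: c(1) apply_coset[OF g] coset_norm_coset G_scl[OF g] del_scl)
  also have "\<dots> = lcoc g v" unfolding lcoc_def mult_divide_mult_cancel_left[OF nc] ..
  finally show ?thesis .
qed

text \<open>If an almost invariant \<open>H\<close> had measure strictly between 0 and 1, then
  \<open>\<eta>\<close> would be a proper convex combination of its normalised restrictions to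
  \<open>H\<close> and to the complement, both of them stationary. Extremality makes the first equal
  to \<open>\<eta>\<close>, so that \<open>H\<close> has full measure, a contradiction.\<close>

lemma ergodic_walk_base:
  assumes erg: "ergodic scl W qact \<mu> (qproj_topology scl W) \<eta>"
  shows "random_walk_base scl W gm \<eta>"
proof -
  have st: "stationary scl W qact \<mu> (qproj_topology scl W) \<eta>" using erg unfolding ergodic_def by blast
  then have "prob_space \<eta>" and sets_\<eta>: "sets \<eta> = sets Q.Y"
    and d: "distr (gm \<Otimes>\<^sub>M \<eta>) \<eta> (\<lambda>(g, y). qact g y) = \<eta>"
    unfolding stationary_def act_conv_def qproj_topology_eq Q.Y_def by simp_all
  interpret E: prob_space \<eta> by fact
  have m: "(\<lambda>(g, y). qact g y) \<in> gm \<Otimes>\<^sub>M \<eta> \<rightarrow>\<^sub>M \<eta>"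
    using qact_measurable measurable_cong_sets[OF sets_pair_measure_cong[OF refl sets_\<eta>] sets_\<eta>] by blast
  interpret A: stationary_action gm \<eta> qact by unfold_locales (rule m, rule d)
  have inv01: "E.prob H = 0 \<or> E.prob H = 1"
    if H: "H \<in> sets \<eta>" and inv: "AE y in \<eta>. AE g in gm. qact g y \<in> H \<longleftrightarrow> y \<in> H" for H
  proof (rule ccontr)
    assume "\<not> (E.prob H = 0 \<or> E.prob H = 1)"
    then have t: "E.prob H \<noteq> 0" "E.prob H \<noteq> 1" by auto
    let ?H = "space \<eta> - H"
    have H': "?H \<in> sets \<eta>" using H by auto
    have t': "E.prob ?H = 1 - E.prob H" by (rule E.prob_compl[OF H])
    have st_U: "stationary scl W qact \<mu> (qproj_topology scl W) (uniform_measure \<eta> B)"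
      if B: "B \<in> sets \<eta>" "E.prob B \<noteq> 0" "AE y in \<eta>. AE g in gm. qact g y \<in> B \<longleftrightarrow> y \<in> B" for B
    proof -
      have "prob_space (uniform_measure \<eta> B)"
        by (rule prob_space_uniform_measure) (use B(2) in \<open>auto simp: E.emeasure_eq_measure\<close>)
      then show ?thesis
        using A.distr_act_uniform_measure[OF B] sets_\<eta>
        unfolding stationary_def act_conv_def qproj_topology_eq Q.Y_def by simp
    qed
    have inv': "AE y in \<eta>. AE g in gm. qact g y \<in> ?H \<longleftrightarrow> y \<in> ?H"
      using inv AE_space
    proof eventually_elim
      case (elim y)
      show ?case
        using elim(1) AE_space
      proof eventually_elim
        case (elim g)
        have "qact g y \<in> space \<eta>"
          using measurable_space[OF m, of "(g, y)"] elim(2) \<open>y \<in> space \<eta>\<close> by (simp add: space_pair_measure)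
        then show ?case using elim(1) \<open>y \<in> space \<eta>\<close> by simp
      qed
    qed
    have mu: "E.prob B * measure (uniform_measure \<eta> B) C = E.prob (B \<inter> C)"
      if "E.prob B \<noteq> 0" "C \<in> sets \<eta>" for B C
      by (subst measure_uniform_measure) (use that in \<open>auto simp: E.emeasure_eq_measure\<close>)
    have dec: "\<forall>C\<in>sets \<eta>. E.prob C = E.prob H * measure (uniform_measure \<eta> H) C
        + (1 - E.prob H) * measure (uniform_measure \<eta> ?H) C"
    proof
      fix C assume C: "C \<in> sets \<eta>"
      have "C = (H \<inter> C) \<union> (?H \<inter> C)" using sets.sets_into_space[OF C] by auto
      then have "E.prob C = E.prob ((H \<inter> C) \<union> (?H \<inter> C))" by simp
      also have "\<dots> = E.prob (H \<inter> C) + E.prob (?H \<inter> C)"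
        by (rule E.finite_measure_Union) (use H C in auto)
      finally show "E.prob C = E.prob H * measure (uniform_measure \<eta> H) C
          + (1 - E.prob H) * measure (uniform_measure \<eta> ?H) C"
        using mu[OF t(1) C] mu[of ?H, OF _ C] t t' by simp
    qed
    have pos: "0 < E.prob H" "E.prob H < 1"
      using t measure_nonneg[of \<eta> H] E.prob_le_1[of H] by linarith+
    have nz: "E.prob ?H \<noteq> 0" using t t' by simp
    have extremal: "\<forall>\<eta>1 \<eta>2 t. stationary scl W qact \<mu> (qproj_topology scl W) \<eta>1 \<longrightarrow>
        stationary scl W qact \<mu> (qproj_topology scl W) \<eta>2 \<longrightarrow> 0 < t \<longrightarrow> t < 1 \<longrightarrow>
        (\<forall>C\<in>sets \<eta>. E.prob C = t * measure \<eta>1 C + (1 - t) * measure \<eta>2 C) \<longrightarrow> \<eta>1 = \<eta> \<and> \<eta>2 = \<eta>"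
      using erg unfolding ergodic_def by (rule conjunct2)
    have "uniform_measure \<eta> H = \<eta> \<and> uniform_measure \<eta> ?H = \<eta>"
      by (rule extremal[rule_format, of _ _ "E.prob H"], rule st_U[OF H t(1) inv],
          rule st_U[OF H' nz inv'], rule pos, rule pos, rule dec[rule_format])
    then have eq: "uniform_measure \<eta> H = \<eta>" ..
    have "E.prob H * measure (uniform_measure \<eta> H) H = E.prob (H \<inter> H)" by (rule mu[OF t(1) H])
    then show False unfolding eq using t by simp
  qed
  have "ergodic_action gm \<eta> qact"
    by (rule ergodic_action.intro[OF A.stationary_action_axioms], rule ergodic_action_axioms.intro, rule inv01)
  then show ?thesis
    by (rule random_walk_base.intro[OF random_walk_axioms _ random_walk_base_axioms.intro[OF sets_\<eta>]])
qed

end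

section \<open>Convolution powers and the two equivalences\<close>

context invariant_measure
begin

lemma compose_measurable: "(\<lambda>z. fst z o\<^sub>L snd z) \<in> \<mu> \<Otimes>\<^sub>M \<mu> \<rightarrow>\<^sub>M \<mu>"
proof -
  have c: "continuous_on (GL scl \<times> GL scl) (\<lambda>z. fst z o\<^sub>L snd z)"
    by (intro bounded_bilinear.continuous_on[OF bounded_bilinear_blinfun_compose] continuous_intros)
  have f: "fst \<in> \<mu> \<Otimes>\<^sub>M \<mu> \<rightarrow>\<^sub>M restrict_space borel (GL scl)" "snd \<in> \<mu> \<Otimes>\<^sub>M \<mu> \<rightarrow>\<^sub>M restrict_space borel (GL scl)"
    using measurable_fst[of \<mu> \<mu>] measurable_snd[of \<mu> \<mu>] measurable_cong_sets[OF refl sets_\<mu>]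
    unfolding GL_borel_def by blast+
  have "(\<lambda>z. fst z o\<^sub>L snd z) \<in> borel_measurable (\<mu> \<Otimes>\<^sub>M \<mu>)"
    using measurable_continuous_on_pair_restrict[OF c f] by simp
  moreover have "g o\<^sub>L h \<in> GL scl" if "g \<in> GL scl" "h \<in> GL scl" for g h
  proof -
    have e: "blinfun_apply (g o\<^sub>L h) = blinfun_apply g \<circ> blinfun_apply h" by auto
    show ?thesis
      using that Vector_Spaces.linear_compose[of scl scl "blinfun_apply h" scl "blinfun_apply g"]
        bij_comp[of "blinfun_apply h" "blinfun_apply g"]
      by (simp only: GL_def mem_Collect_eq e)
  qed
  ultimately have "(\<lambda>z. fst z o\<^sub>L snd z) \<in> \<mu> \<Otimes>\<^sub>M \<mu> \<rightarrow>\<^sub>M restrict_space borel (GL scl)"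
    by (intro measurable_restrict_space2) (auto simp: space_pair_measure space_\<mu>)
  then show ?thesis using measurable_cong_sets[OF refl sets_\<mu>] unfolding GL_borel_def by blast
qed

text \<open>Both \<open>conv_power\<close> and \<open>wk\<close> put the new factor on the left, and
  in \<open>wk\<close> it is the letter with index \<open>n\<close>. Continuing the first
  \<open>n\<close> letters by an independent sequence makes it the first letter of the second
  sequence; the two sequences are then swapped to match the order of the factors in the product
  measure.\<close>

lemma distr_wk: "distr S \<mu> (\<lambda>\<omega>. wk \<omega> n) = conv_power \<mu> n"
proof (induct n)
  case 0
  have "id_blinfun \<in> space \<mu>" using id_in_G G_subset by (auto simp: space_\<mu>)
  from prob_space.distr_const[OF P.prob_space_axioms this] show ?case by simp
next
  case (Suc n)
  have m0: "(\<lambda>\<omega>. \<omega> 0) \<in> S \<rightarrow>\<^sub>M gm" by (rule measurable_component_singleton) simp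
  note z = measurable_gm[OF m0] and w = measurable_gm[OF wk_measurable[of n]]
  have "distr S \<mu> (\<lambda>\<omega>. \<omega> 0) = distr (distr S gm (\<lambda>\<omega>. \<omega> 0)) \<mu> (\<lambda>g. g)"
    by (subst distr_distr[OF id_gm_measurable m0]) (simp add: comp_def)
  also have "\<dots> = distr gm \<mu> (\<lambda>g. g)" by (simp only: PiM_component[OF UNIV_I])
  finally have d0: "distr S \<mu> (\<lambda>\<omega>. \<omega> 0) = \<mu>" by (simp only: distr_gm)
  interpret SS: pair_prob_space S S ..
  let ?p = "\<lambda>z. (fst z 0, wk (snd z) n)" and ?F = "\<lambda>z. fst z 0 o\<^sub>L wk (snd z) n"
  have p: "?p \<in> S \<Otimes>\<^sub>M S \<rightarrow>\<^sub>M \<mu> \<Otimes>\<^sub>M \<mu>"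
    by (rule measurable_Pair[OF measurable_compose[OF measurable_fst z] measurable_compose[OF measurable_snd w]])
  have F: "?F \<in> S \<Otimes>\<^sub>M S \<rightarrow>\<^sub>M \<mu>" using measurable_compose[OF p compose_measurable] by simp
  have sw: "(\<lambda>z. (snd z, fst z)) \<in> S \<Otimes>\<^sub>M S \<rightarrow>\<^sub>M S \<Otimes>\<^sub>M S"
    by (rule measurable_Pair[OF measurable_snd measurable_fst])
  have cs: "(\<lambda>z. comb_seq n (fst z) (snd z)) \<in> S \<Otimes>\<^sub>M S \<rightarrow>\<^sub>M S"
    using measurable_comb_seq[of n gm] by (simp add: case_prod_beta')
  have swap: "distr (S \<Otimes>\<^sub>M S) (S \<Otimes>\<^sub>M S) (\<lambda>z. (snd z, fst z)) = S \<Otimes>\<^sub>M S"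
    using SS.distr_pair_swap by (simp add: case_prod_beta')
  have comb: "distr (S \<Otimes>\<^sub>M S) S (\<lambda>z. comb_seq n (fst z) (snd z)) = S"
    using PiM_comb_seq[of n] by (simp add: case_prod_beta')
  have e: "wk (comb_seq n \<omega> \<omega>') (Suc n) = \<omega>' 0 o\<^sub>L wk \<omega> n" for \<omega> \<omega>'
    using wk_comb_seq[of n n \<omega> \<omega>'] by (simp add: comb_seq_def)
  have "distr S \<mu> (\<lambda>\<omega>. wk \<omega> (Suc n)) =
      distr (distr (S \<Otimes>\<^sub>M S) S (\<lambda>z. comb_seq n (fst z) (snd z))) \<mu> (\<lambda>\<omega>. wk \<omega> (Suc n))"
    by (simp only: comb)
  also have "\<dots> = distr (S \<Otimes>\<^sub>M S) \<mu> (\<lambda>z. ?F (snd z, fst z))"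
    by (subst distr_distr[OF measurable_gm[OF wk_measurable] cs]) (simp only: comp_def e fst_conv snd_conv)
  also have "\<dots> = distr (distr (S \<Otimes>\<^sub>M S) (S \<Otimes>\<^sub>M S) (\<lambda>z. (snd z, fst z))) \<mu> ?F"
    by (subst distr_distr[OF F sw]) (simp only: comp_def)
  also have "\<dots> = distr (S \<Otimes>\<^sub>M S) \<mu> ?F" by (simp only: swap)
  also have "\<dots> = distr (distr (S \<Otimes>\<^sub>M S) (\<mu> \<Otimes>\<^sub>M \<mu>) ?p) \<mu> (\<lambda>z. fst z o\<^sub>L snd z)"
    by (subst distr_distr[OF compose_measurable p]) (simp only: comp_def fst_conv snd_conv)
  also have "distr (S \<Otimes>\<^sub>M S) (\<mu> \<Otimes>\<^sub>M \<mu>) ?p = distr S \<mu> (\<lambda>\<omega>. \<omega> 0) \<Otimes>\<^sub>M distr S \<mu> (\<lambda>\<omega>. wk \<omega> n)"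
  proof -
    have "prob_space (distr S \<mu> (\<lambda>\<omega>. wk \<omega> n))" by (rule prob_space.prob_space_distr[OF P.prob_space_axioms w])
    then have "sigma_finite_measure (distr S \<mu> (\<lambda>\<omega>. wk \<omega> n))" by (rule prob_space_imp_sigma_finite)
    from pair_measure_distr[OF z w this] show ?thesis by (simp add: case_prod_beta')
  qed
  finally show ?case by (simp only: d0 Suc conv_power.simps case_prod_beta')
qed

lemma act_conv_power:
  assumes x: "x \<in> space Y" and a: "(\<lambda>(g, y). a g y) \<in> gm \<Otimes>\<^sub>M Y \<rightarrow>\<^sub>M Y"
  shows "act_conv scl W a (conv_power \<mu> n) (return Y x) = distr S Y (\<lambda>\<omega>. a (wk \<omega> n) x)"
proof -
  let ?K = "distr S gm (\<lambda>\<omega>. wk \<omega> n)"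
  have r: "restrict_space (conv_power \<mu> n) G = ?K"
    unfolding distr_wk[symmetric] by (rule restrict_distr[OF measurable_gm[OF wk_measurable] G_int]) (use wk_in_G in blast)
  have aK: "(\<lambda>(g, y). a g y) \<in> ?K \<Otimes>\<^sub>M Y \<rightarrow>\<^sub>M Y"
    using a measurable_cong_sets[OF sets_pair_measure_cong[OF sets_distr refl] refl] by blast
  have am: "(\<lambda>g. a g x) \<in> gm \<rightarrow>\<^sub>M Y"
    using measurable_compose[OF measurable_Pair[OF measurable_ident measurable_const[OF x]] a] by simp
  have "act_conv scl W a (conv_power \<mu> n) (return Y x) = distr (?K \<Otimes>\<^sub>M return Y x) (return Y x) (\<lambda>(g, y). a g y)"
    unfolding act_conv_def r ..
  also have "\<dots> = distr ?K Y (\<lambda>g. a g x)" by (rule distr_pair_return[OF x aK])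
  also have "\<dots> = distr S Y (\<lambda>\<omega>. a (wk \<omega> n) x)"
    by (subst distr_distr[OF am wk_measurable]) (simp only: comp_def)
  finally show ?thesis .
qed

text \<open>The rate found by \<open>furstenberg_kesten\<close> is the exponent on \<open>W\<close>
  by \<open>top_lyapunov_eq\<close>, so the hypothesis on the cocycle average becomes the gap in
  \<open>contracting_walk\<close>. For \<open>W = {0}\<close> any \<open>l\<close> will do.\<close>

lemma lifted_walk_exists:
  assumes erg: "ergodic scl W qact \<mu> (qproj_topology scl W) \<eta>"
    and gap: "top_lyapunov W \<mu> < ereal (cocycle_average scl W \<mu> \<eta>)"
    and lift: "stationary_lift scl W \<mu> \<eta> \<nu>"
  obtains l where "lifted_walk scl W gm \<eta> l \<nu>"
proof -
  interpret B: random_walk_base scl W gm \<eta> by (rule ergodic_walk_base[OF erg])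
  have avg: "cocycle_average scl W \<mu> \<eta> = B.avg_coc"
    unfolding cocycle_average_def B.avg_coc_def
  proof (intro Bochner_Integration.integral_cong[OF refl])
    fix y g assume y: "y \<in> space \<eta>" and "g \<in> space gm"
    then have g: "g \<in> G" by (simp only: space_gm)
    show "log_cocycle W g y = lcoc g (Q.rep y)"
      using log_cocycle_eq[OF g B.rep_\<eta>(1)[OF y]] by (simp only: B.rep_\<eta>(2)[OF y])
  qed
  have "\<exists>l. W \<noteq> {0} \<longrightarrow> (AE z in \<eta> \<Otimes>\<^sub>M S. (\<lambda>n. ln (nW (wk (snd z) n)) / real n) \<longlonglongrightarrow> l)"
  proof (cases "W = {0}")
    case False
    show ?thesis by (rule B.furstenberg_kesten[OF False]) blast
  qed simp
  then obtain l where l: "W \<noteq> {0} \<Longrightarrow> AE z in \<eta> \<Otimes>\<^sub>M S. (\<lambda>n. ln (nW (wk (snd z) n)) / real n) \<longlonglongrightarrow> l"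
    by blast
  have lt: "l < B.avg_coc" if W: "W \<noteq> {0}"
    using gap unfolding top_lyapunov_eq[OF W B.AE_snd[OF l[OF W]]] avg by simp
  have cw: "contracting_walk scl W gm \<eta> l"
    by (rule contracting_walk.intro[OF B.random_walk_base_axioms], rule contracting_walk_axioms.intro)
      (rule l lt; assumption)+
  have p\<nu>: "prob_space \<nu>" and sets_\<nu>: "sets \<nu> = sets L.Y"
    and d: "distr (gm \<Otimes>\<^sub>M \<nu>) \<nu> (\<lambda>(g, y). act g y) = \<nu>" and pr: "distr \<nu> Q.Y (proj_map W) = \<eta>"
    using lift unfolding stationary_lift_def stationary_def act_conv_def proj_minus_topology_eq qproj_topology_eq
      L.Y_def Q.Y_def by simp_all
  interpret V: prob_space \<nu> by (rule p\<nu>)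
  have m: "(\<lambda>(g, y). act g y) \<in> gm \<Otimes>\<^sub>M \<nu> \<rightarrow>\<^sub>M \<nu>"
    using act_measurable measurable_cong_sets[OF sets_pair_measure_cong[OF refl sets_\<nu>] sets_\<nu>] by blast
  have "stationary_action gm \<nu> act" by unfold_locales (rule m, rule d)
  from lifted_walk.intro[OF cw this lifted_walk_axioms.intro[OF sets_\<nu> pr]] show thesis by (rule that)
qed

context
  fixes \<eta> l \<nu> v assumes lifted: "lifted_walk scl W gm \<eta> l \<nu>" and v: "v \<notin> W"
begin

interpretation K: lifted_walk scl W gm \<eta> l \<nu> by (rule lifted)

lemma cesaro_mean_iff:
  "weakly_converges L.T (average (\<lambda>i. act_conv scl W act (conv_power \<mu> i) (return L.Y (line scl v)))) \<nu> \<longleftrightarrow>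
   weakly_converges Q.T (average (\<lambda>i. act_conv scl W qact (conv_power \<mu> i) (return Q.Y (qline scl W v)))) \<eta>"
proof -
  have vc: "v \<in> - W" using v by simp
  have 1: "act_conv scl W act (conv_power \<mu> i) (return L.Y (line scl v)) = K.up S v i" for i
    unfolding act_conv_power[OF L.q_in_space_Y[OF vc] act_measurable] K.up_def
    by (rule distr_cong) (simp_all add: act_line wk_in_G)
  have 2: "act_conv scl W qact (conv_power \<mu> i) (return Q.Y (qline scl W v)) = K.down S v i" for i
    unfolding act_conv_power[OF Q.q_in_space_Y[OF vc] qact_measurable] K.down_def
    by (rule distr_cong) (simp_all add: qact_qline wk_in_G)
  show ?thesis unfolding 1 2 by (rule K.weakly_converges_mean_iff[OF v])
qed

text \<open>The pathwise equivalence for the walk on the stabilizer is pulled back along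
  \<open>coupling\<close>; at a single path \<open>up\<close> and \<open>down\<close> are the point
  masses at the positions of the walk driven by \<open>X\<close>.\<close>

lemma empirical_measure_iff:
  assumes M: "prob_space M" and X: "prob_space.indep_vars M (\<lambda>_. \<mu>) X {1..}"
    and law: "\<And>i. 1 \<le> i \<Longrightarrow> distr M \<mu> (X i) = \<mu>"
  shows "(AE \<omega> in M. weakly_converges L.T (average (\<lambda>i. return L.Y (act (walk (\<lambda>j. X j \<omega>) i) (line scl v)))) \<nu>) \<longleftrightarrow>
    (AE \<omega> in M. weakly_converges Q.T (average (\<lambda>i. return Q.Y (qact (walk (\<lambda>j. X j \<omega>) i) (qline scl W v)))) \<eta>)"
    (is "(AE \<omega> in M. ?L \<omega>) \<longleftrightarrow> (AE \<omega> in M. ?Q \<omega>)")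
proof -
  have c: "coupling X \<in> M \<rightarrow>\<^sub>M S" "distr M S (coupling X) = S"
    "AE \<omega> in M. \<forall>n. walk (\<lambda>j. X j \<omega>) n = wk (coupling X \<omega>) n"
    by (rule coupling[OF M X], rule law, assumption)+
  let ?u = "\<lambda>\<omega>. weakly_converges L.T (average (K.up (return S \<omega>) v)) \<nu>"
  let ?d = "\<lambda>\<omega>. weakly_converges Q.T (average (K.down (return S \<omega>) v)) \<eta>"
  have "AE \<omega> in M. ?u (coupling X \<omega>) \<longleftrightarrow> ?d (coupling X \<omega>)"
  proof (rule AE_distrD[OF c(1)])
    show "AE \<omega> in distr M S (coupling X). ?u \<omega> \<longleftrightarrow> ?d \<omega>"
      unfolding c(2) by (rule K.weakly_converges_AE_iff[OF v])
  qed
  then have iff: "AE \<omega> in M. ?L \<omega> \<longleftrightarrow> ?Q \<omega>"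
    using c(3) AE_space
  proof eventually_elim
    case (elim \<omega>)
    note s = measurable_space[OF c(1) elim(3)]
    have 1: "K.up (return S (coupling X \<omega>)) v i = return L.Y (act (walk (\<lambda>j. X j \<omega>) i) (line scl v))" for i
      unfolding K.up_def distr_return[OF K.up_measurable[OF P.prob_space_axioms refl v] s]
      by (simp only: elim(2) act_line[OF wk_in_G[OF s]])
    have 2: "K.down (return S (coupling X \<omega>)) v i = return Q.Y (qact (walk (\<lambda>j. X j \<omega>) i) (qline scl W v))" for i
      unfolding K.down_def distr_return[OF K.down_measurable[OF P.prob_space_axioms refl v] s]
      by (simp only: elim(2) qact_qline[OF wk_in_G[OF s]])
    have "K.up (return S (coupling X \<omega>)) v = (\<lambda>i. return L.Y (act (walk (\<lambda>j. X j \<omega>) i) (line scl v)))"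
      "K.down (return S (coupling X \<omega>)) v = (\<lambda>i. return Q.Y (qact (walk (\<lambda>j. X j \<omega>) i) (qline scl W v)))"
      by (rule ext, rule 1) (rule ext, rule 2)
    then show ?case using elim(1) by (simp only:)
  qed
  show ?thesis
  proof
    assume "AE \<omega> in M. ?L \<omega>"
    with iff show "AE \<omega> in M. ?Q \<omega>" by eventually_elim (rule iffD1)
  next
    assume "AE \<omega> in M. ?Q \<omega>"
    with iff show "AE \<omega> in M. ?L \<omega>" by eventually_elim (rule iffD2)
  qed
qed

end

end

theorem proposition1p2:
  fixes scl :: "'k::{real_normed_field,euclidean_space} \<Rightarrow> 'v::euclidean_space \<Rightarrow> 'v"
    and \<mu> :: "('v \<Rightarrow>\<^sub>L 'v) measure"
    and W :: "'v set"
    and \<nu>' :: "'v set set measure"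
    and \<nu> :: "'v set measure"
    and M :: "'o measure"
    and X :: "nat \<Rightarrow> 'o \<Rightarrow> ('v \<Rightarrow>\<^sub>L 'v)"
  assumes "normed_space_over scl"
    and "prob_space \<mu>" and "sets \<mu> = sets (GL_borel scl)"
    and "finite_first_moment \<mu>"
    and "invariant_subspace scl \<mu> W"
    and "ergodic scl W qact \<mu> (qproj_topology scl W) \<nu>'"
    and "ereal (cocycle_average scl W \<mu> \<nu>') > top_lyapunov W \<mu>"
    and "stationary_lift scl W \<mu> \<nu>' \<nu>"
    and "prob_space M"
    and "prob_space.indep_vars M (\<lambda>_. GL_borel scl) X {1..}"
    and "\<And>i. i \<ge> 1 \<Longrightarrow> distr M (GL_borel scl) (X i) = \<mu>"
  shows
    "(\<forall>x \<in> proj_space scl UNIV - proj_space scl W.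
        weakly_converges (proj_minus_topology scl W)
          (average (\<lambda>i. act_conv scl W act (conv_power \<mu> i)
             (return (borel_of (proj_minus_topology scl W)) x))) \<nu>
        \<longleftrightarrow>
        weakly_converges (qproj_topology scl W)
          (average (\<lambda>i. act_conv scl W qact (conv_power \<mu> i)
             (return (borel_of (qproj_topology scl W)) (proj_map W x)))) \<nu>') \<and>
     (\<forall>x \<in> proj_space scl UNIV - proj_space scl W.
        (AE \<omega> in M. weakly_converges (proj_minus_topology scl W)
          (average (\<lambda>i. return (borel_of (proj_minus_topology scl W))
             (act (walk (\<lambda>j. X j \<omega>) i) x))) \<nu>)
        \<longleftrightarrow>
        (AE \<omega> in M. weakly_converges (qproj_topology scl W)
          (average (\<lambda>i. return (borel_of (qproj_topology scl W))
             (qact (walk (\<lambda>j. X j \<omega>) i) (proj_map W x)))) \<nu>'))"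
proof -
  have sub: "subspace_setup scl W"
    using assms(1,5) unfolding invariant_subspace_def
    by (intro subspace_setup.intro subspace_setup_axioms.intro) simp_all
  interpret invariant_measure scl W \<mu>
    by (intro invariant_measure.intro sub assms(2) invariant_measure_axioms.intro assms(3-5))
  obtain l where l: "lifted_walk scl W gm \<nu>' l \<nu>" by (rule lifted_walk_exists[OF assms(6,7,8)])
  \<comment> \<open>The given independence refers to \<open>GL_borel scl\<close>, which has the same
    measurable sets as \<open>\<mu>\<close>.\<close>
  have X: "prob_space.indep_vars M (\<lambda>_. \<mu>) X {1..}"
    by (rule prob_space.indep_vars_compose2[OF assms(9,10), of "\<lambda>_ x. x"]) (rule measurable_ident_sets[OF sets_\<mu>[symmetric]])
  have law: "distr M \<mu> (X i) = \<mu>" if "1 \<le> i" for i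
  proof -
    have "distr M \<mu> (X i) = distr M (GL_borel scl) (X i)" by (rule distr_cong) (simp_all add: sets_\<mu>)
    then show ?thesis by (simp only: assms(11)[OF that])
  qed
  show ?thesis
    unfolding proj_minus_space proj_minus_topology_eq qproj_topology_eq L.Y_def[symmetric] Q.Y_def[symmetric]
  proof (intro conjI ballI)
    fix x assume "x \<in> line scl ` (- W)"
    then obtain v where v: "v \<notin> W" and x: "x = line scl v" by blast
    show "weakly_converges L.T (average (\<lambda>i. act_conv scl W act (conv_power \<mu> i) (return L.Y x))) \<nu> \<longleftrightarrow>
        weakly_converges Q.T (average (\<lambda>i. act_conv scl W qact (conv_power \<mu> i) (return Q.Y (proj_map W x)))) \<nu>'"
      unfolding x proj_map_line by (rule cesaro_mean_iff[OF l v])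
    show "(AE \<omega> in M. weakly_converges L.T (average (\<lambda>i. return L.Y (act (walk (\<lambda>j. X j \<omega>) i) x))) \<nu>) \<longleftrightarrow>
        (AE \<omega> in M. weakly_converges Q.T (average (\<lambda>i. return Q.Y (qact (walk (\<lambda>j. X j \<omega>) i) (proj_map W x)))) \<nu>')"
      unfolding x proj_map_line by (rule empirical_measure_iff[OF l v assms(9) X]) (rule law)
  qed
qed

end
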